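(* Let $G$ be the closed shrinking-diamond chain with oriented edges $c$, $t_0$, $u_k,v_k,t_k$ ($k\ge1$) and $\lambda_k=2^{-k-2}$, and let $$\mathscr Z(G)=\{R\in\mathbf I_1(G):\partial R=0,\ \operatorname{set}(R)=G\}.$$ A current $R$ belongs to $\mathscr Z(G)$ if and only if it has a unique representation $$R=r\Big([\![c]\!]+[\![t_0]\!]+\sum_{k=1}^{\infty}[\![t_k]\!]\Big)+\sum_{k=1}^{\infty}\big(p_k[\![u_k]\!]+q_k[\![v_k]\!]\big),$$ where $$r\in\mathbb Z\setminus\{0\},\qquad p_k,q_k\in\mathbb Z\setminus\{0\},\qquad p_k+q_k=r$$ for every $k\ge1$, and $$\sum_{k=1}^{\infty}\lambda_k(|p_k|+|q_k|)<\infty.$$ For such a current, $$\mathbf M(R)=\frac34|r|+\sum_{k=1}^{\infty}\lambda_k(|p_k|+|q_k|).$$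
   Context: Construction of $G$. Set $\lambda_k=2^{-k-2}$ for $k\ge1$. Take vertices $o,a_1,b_1,a_2,b_2,\dots$. Join $o$ to $a_1$ by an edge $t_0$ of length $1/4$. For every $k\ge1$ join $a_k$ to $b_k$ by two distinct parallel edges $u_k,v_k$, each of length $\lambda_k$, and join $b_k$ to $a_{k+1}$ by an edge $t_k$ of length $\lambda_k$. This forward chain has a unique completion point $z=\lim_k a_k=\lim_k b_k$. Attach an edge $c$ of length $1/4$ from $z$ to $o$. $G$ is the resulting space with its path metric $d_G$. Orientations: $t_0:o\to a_1$; $u_k,v_k:a_k\to b_k$; $t_k:b_k\to a_{k+1}$; $c:z\to o$. Currents are metric currents in the sense of Ambrosio–Kirchheim; $\mathbf I_1(G)$ is the group of integral $1$-currents in $G$ (integer rectifiable of finite mass, with boundary integer rectifiable of finite mass), $\mathbf M$ is mass, $\|R\|$ the mass measure, $\partial R$ the boundary. For an oriented edge $e$ of length $\ell(e)$, $[\![e]\!]\in\mathbf I_1(G)$ is the push-forward of the standard integration current on $[0,\ell(e)]$ under the arclength parametrization of $e$ in its orientation. Infinite sums of edge currents are understood as convergent in mass. The characteristic set is $\operatorname{set}(R)=\{x\in G:\liminf_{r\downarrow0}\|R\|(B(x,r))/(2r)>0\}$. *)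

theory Defs
  imports "HOL-Analysis.Analysis"
begin

section \<open>Metric 1-currents in the sense of Ambrosio and Kirchheim\<close>

text \<open>
  A 1-current acts on pairs \<open>(f, \<pi>)\<close> with \<open>f\<close> bounded Lipschitz and \<open>\<pi>\<close> Lipschitz. Functionals are
  total HOL functions; currents are normalised to be \<open>0\<close> off the admissible pairs, so that HOL
  equality of functionals is equality of currents. 0-currents act on bounded Lipschitz functions
  and are normalised in the same way.
\<close>

type_synonym 'a functional1 = "('a \<Rightarrow> real) \<Rightarrow> ('a \<Rightarrow> real) \<Rightarrow> real"
type_synonym 'a functional0 = "('a \<Rightarrow> real) \<Rightarrow> real"

definition lip :: "('a::metric_space \<Rightarrow> 'b::metric_space) \<Rightarrow> bool" where
  "lip f \<longleftrightarrow> (\<exists>L. L-lipschitz_on UNIV f)"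

definition lip_bdd :: "('a::metric_space \<Rightarrow> real) \<Rightarrow> bool" where
  "lip_bdd f \<longleftrightarrow> lip f \<and> bounded (range f)"

definition mass_bound :: "'a::metric_space functional1 \<Rightarrow> 'a measure \<Rightarrow> bool" where
  "mass_bound T \<mu> \<longleftrightarrow>
     sets \<mu> = sets borel \<and> finite_measure \<mu> \<and>
     (\<forall>f \<pi> L. lip_bdd f \<longrightarrow> L-lipschitz_on UNIV \<pi> \<longrightarrow> \<bar>T f \<pi>\<bar> \<le> L * (\<integral>x. \<bar>f x\<bar> \<partial>\<mu>))"

text \<open>The mass measure is the least finite Borel measure satisfying the mass bound.\<close>

definition mass_measure :: "'a::metric_space functional1 \<Rightarrow> 'a measure" where
  "mass_measure T =
     (THE \<mu>. mass_bound T \<mu> \<and>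
        (\<forall>\<nu>. mass_bound T \<nu> \<longrightarrow> (\<forall>A\<in>sets borel. emeasure \<mu> A \<le> emeasure \<nu> A)))"

definition mass :: "'a::metric_space functional1 \<Rightarrow> ennreal" where
  "mass T = (if \<exists>\<mu>. mass_bound T \<mu> then emeasure (mass_measure T) UNIV else \<infinity>)"

text \<open>
  In order: normalisation, bilinearity, continuity under pointwise convergence with bounded
  Lipschitz constants, locality, and finite mass.
\<close>

definition current1 :: "'a::metric_space functional1 \<Rightarrow> bool" where
  "current1 T \<longleftrightarrow>
     (\<forall>f \<pi>. \<not> (lip_bdd f \<and> lip \<pi>) \<longrightarrow> T f \<pi> = 0) \<and>
     (\<forall>f g \<pi> a b. lip_bdd f \<longrightarrow> lip_bdd g \<longrightarrow> lip \<pi> \<longrightarrow>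
        T (\<lambda>x. a * f x + b * g x) \<pi> = a * T f \<pi> + b * T g \<pi>) \<and>
     (\<forall>f \<pi> \<rho> a b. lip_bdd f \<longrightarrow> lip \<pi> \<longrightarrow> lip \<rho> \<longrightarrow>
        T f (\<lambda>x. a * \<pi> x + b * \<rho> x) = a * T f \<pi> + b * T f \<rho>) \<and>
     (\<forall>f \<pi> \<rho> L. lip_bdd f \<longrightarrow> (\<forall>i::nat. L-lipschitz_on UNIV (\<rho> i)) \<longrightarrow> lip \<pi> \<longrightarrow>
        (\<forall>x. (\<lambda>i. \<rho> i x) \<longlonglongrightarrow> \<pi> x) \<longrightarrow> (\<lambda>i. T f (\<rho> i)) \<longlonglongrightarrow> T f \<pi>) \<and>
     (\<forall>f \<pi> U c. lip_bdd f \<longrightarrow> lip \<pi> \<longrightarrow> open U \<longrightarrow> {x. f x \<noteq> 0} \<subseteq> U \<longrightarrow>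
        (\<forall>x\<in>U. \<pi> x = c) \<longrightarrow> T f \<pi> = 0) \<and>
     (\<exists>\<mu>. mass_bound T \<mu>)"

definition boundary :: "'a::metric_space functional1 \<Rightarrow> 'a functional0" where
  "boundary T f = (if lip_bdd f then T (\<lambda>_. 1) f else 0)"

definition pushforward ::
    "('a::metric_space \<Rightarrow> 'b::metric_space) \<Rightarrow> 'a functional1 \<Rightarrow> 'b functional1" where
  "pushforward \<phi> T f \<pi> = (if lip_bdd f \<and> lip \<pi> then T (f \<circ> \<phi>) (\<pi> \<circ> \<phi>) else 0)"

text \<open>
  Value at a bounded Borel function \<open>g\<close> of the extension of \<open>T\<close> by density of the bounded Lipschitz
  functions in \<open>L\<^sup>1\<close> of the mass measure.
\<close>

definition borel_extension :: "'a::metric_space functional1 \<Rightarrow> 'a functional1" where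
  "borel_extension T g \<pi> =
     (THE l. \<exists>f. (\<forall>n::nat. lip_bdd (f n)) \<and>
        (\<lambda>n. \<integral>\<^sup>+x. ennreal \<bar>f n x - g x\<bar> \<partial>mass_measure T) \<longlonglongrightarrow> 0 \<and>
        (\<lambda>n. T (f n) \<pi>) \<longlonglongrightarrow> l)"

definition restrict_current :: "'a::metric_space functional1 \<Rightarrow> 'a set \<Rightarrow> 'a functional1" where
  "restrict_current T A f \<pi> =
     (if lip_bdd f \<and> lip \<pi> then borel_extension T (\<lambda>x. indicator A x * f x) \<pi> else 0)"

text \<open>
  The current \<open>\<lbrakk>\<theta>\<rbrakk>\<close> on the line. Lipschitz functions are differentiable almost everywhere, so the
  value of \<^const>\<open>deriv\<close> at other points is irrelevant.
\<close>

definition line_current :: "(real \<Rightarrow> real) \<Rightarrow> real functional1" where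
  "line_current \<theta> f \<pi> =
     (if lip_bdd f \<and> lip \<pi> then (\<integral>x. \<theta> x * f x * deriv \<pi> x \<partial>lebesgue) else 0)"

definition hausdorff1 :: "'a::metric_space set \<Rightarrow> ennreal" where
  "hausdorff1 A =
     (SUP \<delta>\<in>{0<..}. INF S\<in>{S :: nat \<Rightarrow> 'a set. A \<subseteq> (\<Union>i. S i) \<and>
        (\<forall>i. bounded (S i) \<and> diameter (S i) \<le> (\<delta>::real))}. \<Sum>i. ennreal (diameter (S i)))"

definition rectifiable1 :: "'a::metric_space set \<Rightarrow> bool" where
  "rectifiable1 S \<longleftrightarrow>
     (\<exists>(A :: nat \<Rightarrow> real set) (g :: nat \<Rightarrow> real \<Rightarrow> 'a).
        (\<forall>i. \<exists>L. L-lipschitz_on (A i) (g i)) \<and> hausdorff1 (S - (\<Union>i. g i ` A i)) = 0)"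

text \<open>Integer rectifiable currents: \<open>\<theta>\<close> below ranges over \<open>L\<^sup>1(\<real>, \<int>)\<close>.\<close>

definition int_rectifiable1 :: "'a::metric_space functional1 \<Rightarrow> bool" where
  "int_rectifiable1 T \<longleftrightarrow> current1 T \<and>
     (\<exists>S\<in>sets borel. rectifiable1 S \<and> emeasure (mass_measure T) (- S) = 0) \<and>
     (\<forall>B\<in>sets borel. hausdorff1 B = 0 \<longrightarrow> emeasure (mass_measure T) B = 0) \<and>
     (\<forall>(\<phi> :: 'a \<Rightarrow> real) A. lip \<phi> \<longrightarrow> open A \<longrightarrow>
        (\<exists>\<theta> :: real \<Rightarrow> int. integrable lebesgue (\<lambda>x. real_of_int (\<theta> x)) \<and>
           pushforward \<phi> (restrict_current T A) = line_current (\<lambda>x. real_of_int (\<theta> x))))"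

text \<open>
  An integer rectifiable 0-current of finite mass is a finite integer combination of point masses.
\<close>

definition int_rectifiable0 :: "'a::metric_space functional0 \<Rightarrow> bool" where
  "int_rectifiable0 S \<longleftrightarrow>
     (\<exists>F (\<theta> :: 'a \<Rightarrow> int). finite F \<and>
        S = (\<lambda>f. if lip_bdd f then (\<Sum>x\<in>F. real_of_int (\<theta> x) * f x) else 0))"

definition integral_currents1 :: "'a::metric_space functional1 set" where
  "integral_currents1 = {T. int_rectifiable1 T \<and> int_rectifiable0 (boundary T)}"

definition char_set :: "'a::metric_space functional1 \<Rightarrow> 'a set" where
  "char_set T =
     {x. Liminf (at_right 0) (\<lambda>r. emeasure (mass_measure T) (ball x r) / ennreal (2 * r)) > 0}"

text \<open>\<open>S\<close> is the sum, convergent in mass, of the currents \<open>X 1, X 2, \<dots>\<close>.\<close>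

definition sums_in_mass ::
    "(nat \<Rightarrow> 'a::metric_space functional1) \<Rightarrow> 'a functional1 \<Rightarrow> bool" where
  "sums_in_mass X S \<longleftrightarrow> current1 S \<and>
     (\<lambda>n. mass (\<lambda>f \<pi>. S f \<pi> - (\<Sum>k=1..n. X k f \<pi>))) \<longlonglongrightarrow> 0"


section \<open>The closed shrinking-diamond chain\<close>

definition lam :: "nat \<Rightarrow> real" where
  "lam k = 1 / 2 ^ (k + 2)"

datatype chain_vertex = Vo | Va nat | Vb nat | Vz
datatype chain_edge = Ec | Et nat | Eu nat | Ev nat

definition chain_edges :: "chain_edge set" where
  "chain_edges = {Ec} \<union> range Et \<union> Eu ` {1..} \<union> Ev ` {1..}"

fun edge_len :: "chain_edge \<Rightarrow> real" where
  "edge_len Ec = 1 / 4"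
| "edge_len (Et k) = (if k = 0 then 1 / 4 else lam k)"
| "edge_len (Eu k) = lam k"
| "edge_len (Ev k) = lam k"

fun edge_source :: "chain_edge \<Rightarrow> chain_vertex" where
  "edge_source Ec = Vz"
| "edge_source (Et k) = (if k = 0 then Vo else Vb k)"
| "edge_source (Eu k) = Va k"
| "edge_source (Ev k) = Va k"

fun edge_target :: "chain_edge \<Rightarrow> chain_vertex" where
  "edge_target Ec = Vo"
| "edge_target (Et k) = Va (k + 1)"
| "edge_target (Eu k) = Vb k"
| "edge_target (Ev k) = Vb k"

text \<open>\<open>(e, s)\<close> is the point at arclength \<open>s\<close> from the source of \<open>e\<close>.\<close>

definition edge_points :: "(chain_edge \<times> real) set" where
  "edge_points = (SIGMA e:chain_edges. {0..edge_len e})"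

definition at_vertex :: "chain_vertex \<Rightarrow> chain_edge \<times> real \<Rightarrow> bool" where
  "at_vertex v x \<longleftrightarrow> x \<in> edge_points \<and>
     (edge_source (fst x) = v \<and> snd x = 0 \<or> edge_target (fst x) = v \<and> snd x = edge_len (fst x))"

text \<open>
  \<open>walk x y l\<close>: a path of length \<open>l\<close> leads from \<open>x\<close> to \<open>y\<close>. The rule \<open>tail\<close> provides the infinite
  path \<open>a\<^sub>k, b\<^sub>k, a\<^sub>k\<^sub>+\<^sub>1, b\<^sub>k\<^sub>+\<^sub>1, \<dots>\<close> along the forward chain, which ends in the completion point \<open>z\<close>;
  this is what makes \<open>z\<close> the common limit of the vertices \<open>a\<^sub>k\<close> and \<open>b\<^sub>k\<close>.
\<close>

inductive walk :: "chain_edge \<times> real \<Rightarrow> chain_edge \<times> real \<Rightarrow> real \<Rightarrow> bool" where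
  along: "(e, s) \<in> edge_points \<Longrightarrow> (e, s') \<in> edge_points \<Longrightarrow> walk (e, s) (e, s') \<bar>s - s'\<bar>"
| glue: "at_vertex v x \<Longrightarrow> at_vertex v y \<Longrightarrow> walk x y 0"
| tail: "k \<ge> 1 \<Longrightarrow> at_vertex (Va k) x \<Longrightarrow> at_vertex Vz y \<Longrightarrow>
    walk x y (\<Sum>j. edge_len (Eu (k + j)) + edge_len (Et (k + j)))"
| reverse: "walk x y l \<Longrightarrow> walk y x l"
| join: "walk x y l \<Longrightarrow> walk y w m \<Longrightarrow> walk x w (l + m)"

definition path_dist :: "chain_edge \<times> real \<Rightarrow> chain_edge \<times> real \<Rightarrow> real" where
  "path_dist x y = Inf {l. walk x y l}"

lemma edge_len_nonneg: "edge_len e \<ge> 0"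
  by (cases e) (auto simp: lam_def)

lemma summable_lam_shift: "summable (\<lambda>j. lam (k + j))"
proof -
  have "summable (\<lambda>j. (1 / 2 ^ (k + 2)) * (1 / 2 :: real) ^ j)"
    by (intro summable_mult summable_geometric) auto
  then show ?thesis
    by (simp add: lam_def power_add power_divide mult_ac)
qed

lemma summable_tail:
  assumes "k \<ge> 1"
  shows "summable (\<lambda>j. edge_len (Eu (k + j)) + edge_len (Et (k + j)))"
  using assms by (auto intro!: summable_add summable_lam_shift)

lemma walk_nonneg: "walk x y l \<Longrightarrow> l \<ge> 0"
proof (induction rule: walk.induct)
  case (tail k x y)
  then show ?case
    by (intro suminf_nonneg summable_tail add_nonneg_nonneg edge_len_nonneg)
qed auto

lemma walk_refl: "x \<in> edge_points \<Longrightarrow> walk x x 0"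
  using walk.along[of "fst x" "snd x" "snd x"] by simp

lemma walk_edge_points: "walk x y l \<Longrightarrow> x \<in> edge_points \<and> y \<in> edge_points"
  by (induction rule: walk.induct) (auto simp: at_vertex_def)

lemma walk_to_source: "(e, s) \<in> edge_points \<Longrightarrow> walk (e, s) (e, 0) s"
  using walk.along[of e s 0] edge_len_nonneg[of e] by (auto simp: edge_points_def)

lemma walk_source_target: "e \<in> chain_edges \<Longrightarrow> walk (e, 0) (e, edge_len e) (edge_len e)"
  using walk.along[of e 0 "edge_len e"] edge_len_nonneg[of e] by (auto simp: edge_points_def)

lemma at_source: "e \<in> chain_edges \<Longrightarrow> at_vertex (edge_source e) (e, 0)"
  using edge_len_nonneg[of e] by (auto simp: at_vertex_def edge_points_def)

lemma at_target: "e \<in> chain_edges \<Longrightarrow> at_vertex (edge_target e) (e, edge_len e)"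
  using edge_len_nonneg[of e] by (auto simp: at_vertex_def edge_points_def)

lemma chain_edges_mem [simp]:
  "Ec \<in> chain_edges" "Et k \<in> chain_edges"
  "Eu k \<in> chain_edges \<longleftrightarrow> k \<ge> 1" "Ev k \<in> chain_edges \<longleftrightarrow> k \<ge> 1"
  by (auto simp: chain_edges_def)

lemma walk_Et_base: "\<exists>l. walk (Et k, 0) (Et 0, 0) l"
proof (induction k)
  case 0
  show ?case using walk_refl[of "(Et 0, 0)"] by (auto simp: edge_points_def)
next
  case (Suc k)
  have "walk (Et (Suc k), 0) (Eu (Suc k), edge_len (Eu (Suc k))) 0"
    using at_source[of "Et (Suc k)"] at_target[of "Eu (Suc k)"] by (intro walk.glue) auto
  moreover have "walk (Eu (Suc k), edge_len (Eu (Suc k))) (Eu (Suc k), 0) (edge_len (Eu (Suc k)))"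
    by (rule walk.reverse[OF walk_source_target]) simp
  moreover have "walk (Eu (Suc k), 0) (Et k, edge_len (Et k)) 0"
    using at_source[of "Eu (Suc k)"] at_target[of "Et k"] by (intro walk.glue) auto
  moreover have "walk (Et k, edge_len (Et k)) (Et k, 0) (edge_len (Et k))"
    by (rule walk.reverse[OF walk_source_target]) simp
  ultimately show ?case using Suc.IH by (meson walk.join)
qed

lemma walk_edge_base:
  assumes "e \<in> chain_edges"
  shows "\<exists>l. walk (e, 0) (Et 0, 0) l"
proof (cases e)
  case Ec
  have "walk (Ec, edge_len Ec) (Et 0, 0) 0"
    using at_target[of Ec] at_source[of "Et 0"] by (intro walk.glue) auto
  with walk_source_target[OF assms] Ec show ?thesis by (meson walk.join)
next
  case (Et k)
  then show ?thesis using walk_Et_base by simp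
next
  case (Eu k)
  have "walk (Eu k, edge_len (Eu k)) (Et k, 0) 0"
    using at_target[of "Eu k"] at_source[of "Et k"] Eu assms by (intro walk.glue) auto
  with walk_source_target[OF assms] Eu walk_Et_base show ?thesis by (meson walk.join)
next
  case (Ev k)
  have "walk (Ev k, edge_len (Ev k)) (Et k, 0) 0"
    using at_target[of "Ev k"] at_source[of "Et k"] Ev assms by (intro walk.glue) auto
  with walk_source_target[OF assms] Ev walk_Et_base show ?thesis by (meson walk.join)
qed

lemma walk_ex:
  assumes "x \<in> edge_points" "y \<in> edge_points"
  shows "\<exists>l. walk x y l"
proof -
  have "\<exists>l. walk z (Et 0, 0) l" if "z \<in> edge_points" for z
  proof -
    have "walk z (fst z, 0) (snd z)" using walk_to_source[of "fst z" "snd z"] that by simp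
    moreover have "fst z \<in> chain_edges" using that by (auto simp: edge_points_def)
    ultimately show ?thesis using walk_edge_base by (meson walk.join)
  qed
  then show ?thesis using assms by (meson walk.join walk.reverse)
qed

lemma path_dist_bdd: "bdd_below {l. walk x y l}"
  by (rule bdd_belowI[of _ 0]) (auto dest: walk_nonneg)

lemma path_dist_le: "walk x y l \<Longrightarrow> path_dist x y \<le> l"
  unfolding path_dist_def by (rule cInf_lower) (auto intro: path_dist_bdd)

lemma path_dist_nonneg:
  assumes "x \<in> edge_points" "y \<in> edge_points"
  shows "path_dist x y \<ge> 0"
  unfolding path_dist_def using walk_ex[OF assms] by (intro cInf_greatest) (auto dest: walk_nonneg)

lemma path_dist_refl: "x \<in> edge_points \<Longrightarrow> path_dist x x = 0"
  using path_dist_le[OF walk_refl] path_dist_nonneg by (meson order_antisym)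

lemma path_dist_sym: "path_dist x y = path_dist y x"
  unfolding path_dist_def by (rule arg_cong[of _ _ Inf]) (auto intro: walk.reverse)

lemma path_dist_triangle:
  assumes "x \<in> edge_points" "y \<in> edge_points" "w \<in> edge_points"
  shows "path_dist x w \<le> path_dist x y + path_dist y w"
proof (rule field_le_epsilon)
  fix e :: real assume "e > 0"
  have "\<exists>l. walk x y l \<and> l < path_dist x y + e / 2"
    using cInf_lessD[of "{l. walk x y l}" "path_dist x y + e / 2"] walk_ex[OF assms(1,2)] \<open>e > 0\<close>
    by (auto simp: path_dist_def)
  moreover have "\<exists>l. walk y w l \<and> l < path_dist y w + e / 2"
    using cInf_lessD[of "{l. walk y w l}" "path_dist y w + e / 2"] walk_ex[OF assms(2,3)] \<open>e > 0\<close>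
    by (auto simp: path_dist_def)
  ultimately obtain l m where "walk x y l" "l < path_dist x y + e / 2"
    "walk y w m" "m < path_dist y w + e / 2" by blast
  then show "path_dist x w \<le> path_dist x y + path_dist y w + e"
    using path_dist_le[OF walk.join[of x y l w m]] by linarith
qed

text \<open>The space \<open>G\<close>: the disjoint union of the closed edges modulo points at path distance \<open>0\<close>.\<close>

definition same_point :: "chain_edge \<times> real \<Rightarrow> chain_edge \<times> real \<Rightarrow> bool" where
  "same_point x y \<longleftrightarrow> x \<in> edge_points \<and> y \<in> edge_points \<and> path_dist x y = 0"

lemma part_equivp_same_point: "part_equivp same_point"
proof (rule part_equivpI)
  show "\<exists>x. same_point x x"
    by (rule exI[of _ "(Ec, 0)"]) (auto simp: same_point_def edge_points_def intro!: path_dist_refl)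
  show "symp same_point"
    by (auto simp: symp_def same_point_def path_dist_sym)
  show "transp same_point"
    unfolding transp_def same_point_def
    by (metis add.right_neutral order_antisym path_dist_nonneg path_dist_triangle)
qed

quotient_type diamond_chain = "chain_edge \<times> real" / partial: same_point
  by (rule part_equivp_same_point)

instantiation diamond_chain :: metric_space
begin

lift_definition dist_diamond_chain :: "diamond_chain \<Rightarrow> diamond_chain \<Rightarrow> real" is path_dist
proof -
  fix x x' y y' assume "same_point x x'" "same_point y y'"
  then show "path_dist x y = path_dist x' y'"
    unfolding same_point_def
    using path_dist_triangle[of x x' y] path_dist_triangle[of x' y' y]
      path_dist_triangle[of x' x y'] path_dist_triangle[of x y y']
      path_dist_sym[of x x'] path_dist_sym[of y y'] by linarith
qed

definition uniformity_diamond_chain :: "(diamond_chain \<times> diamond_chain) filter" where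
  "uniformity_diamond_chain = (INF e\<in>{0<..}. principal {(x, y). dist x y < e})"

definition open_diamond_chain :: "diamond_chain set \<Rightarrow> bool" where
  "open_diamond_chain U \<longleftrightarrow> (\<forall>x\<in>U. eventually (\<lambda>(x', y). x' = x \<longrightarrow> y \<in> U) uniformity)"

instance
proof
  fix x y w :: diamond_chain
  show "dist x y = 0 \<longleftrightarrow> x = y"
    by transfer (auto simp: same_point_def)
  show "dist x y \<le> dist x w + dist y w"
    by transfer (metis path_dist_sym path_dist_triangle same_point_def)
qed (simp_all add: uniformity_diamond_chain_def open_diamond_chain_def)

end

text \<open>Arclength parametrisation of an edge on \<open>[0, edge_len e]\<close>, extended to be constant outside.\<close>

definition edge_param :: "chain_edge \<Rightarrow> real \<Rightarrow> diamond_chain" where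
  "edge_param e s = abs_diamond_chain (e, max 0 (min (edge_len e) s))"

definition edge_current :: "chain_edge \<Rightarrow> diamond_chain functional1" where
  "edge_current e = pushforward (edge_param e) (line_current (indicator {0..edge_len e}))"

definition full_cycles :: "diamond_chain functional1 set" where
  "full_cycles = {R \<in> integral_currents1. boundary R = (\<lambda>_. 0) \<and> char_set R = UNIV}"

definition edge_expansion ::
    "diamond_chain functional1 \<Rightarrow> int \<Rightarrow> (nat \<Rightarrow> int) \<Rightarrow> (nat \<Rightarrow> int) \<Rightarrow> bool" where
  "edge_expansion R r p q \<longleftrightarrow>
     (\<exists>A B. sums_in_mass (\<lambda>k. edge_current (Et k)) A \<and>
        sums_in_mass (\<lambda>k f \<pi>. of_int (p k) * edge_current (Eu k) f \<pi>
                            + of_int (q k) * edge_current (Ev k) f \<pi>) B \<and>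
        R = (\<lambda>f \<pi>. of_int r * (edge_current Ec f \<pi> + edge_current (Et 0) f \<pi> + A f \<pi>) + B f \<pi>))"

definition admissible_coeffs :: "int \<Rightarrow> (nat \<Rightarrow> int) \<Rightarrow> (nat \<Rightarrow> int) \<Rightarrow> bool" where
  "admissible_coeffs r p q \<longleftrightarrow>
     r \<noteq> 0 \<and> (\<forall>k\<ge>1. p k \<noteq> 0 \<and> q k \<noteq> 0 \<and> p k + q k = r) \<and>
     (\<lambda>k. lam k * of_int (\<bar>p k\<bar> + \<bar>q k\<bar>)) summable_on {1..}"

end

theory Submission
  imports Defs
begin

text \<open>
  On an open edge, a cycle \<open>R\<close> is pushed forward by the arclength coordinate to an integer density on
  an interval. Testing \<open>\<partial>R = 0\<close> with tents supported in the edge makes this density constant, and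
  vertices carry no mass, so \<open>R\<close> is a mass-convergent integer combination of edge currents.
  Conversely, such combinations are integer rectifiable by the one-dimensional area formula, their
  mass is the weighted length, and their characteristic set is \<open>G\<close> exactly if no weight vanishes.
  Kirchhoff's law at the vertices then forces a common weight \<open>r\<close> on \<open>c\<close> and all \<open>t\<^sub>k\<close> and the relation
  \<open>p\<^sub>k + q\<^sub>k = r\<close>. It is also sufficient, because the flow through the chain telescopes to \<open>z\<close>.
\<close>

section \<open>Differentiation of Lipschitz functions\<close>

text \<open>Three features of the definitions shape the proof. Line currents contain
  \<open>deriv\<close> of functions that are merely Lipschitz, so differentiability almost
  everywhere and the fundamental theorem for such functions must be available. The mass measure is a
  \<open>THE\<close>, and rectifiability speaks of it before a current is known to be a chain, so a
  least mass bound has to exist for every current. The continuity axiom offers only pointwise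
  convergence with a common Lipschitz constant, under which derivatives need not converge;
  integration by parts moves the derivative to the fixed function. Test functions on
  \<open>G\<close> must be Lipschitz for a path metric that knows the infinite paths into
  \<open>z\<close>. Two families suffice: tents on one edge, and functions of the position on the
  circle of length \<open>1\<close> that arises when \<open>u_k\<close> and \<open>v_k\<close>,
  which have equal length, are identified. The latter also provide 1-Lipschitz coordinates on the
  edges, and these turn length into a sharp lower bound for mass. They see parallel edges only
  through the sum of their weights, the quantity in Kirchhoff's law.\<close>

lemma Vitali_intervals:
  fixes S U :: "real set"
  assumes "open U" "S \<subseteq> U"
    and Q: "\<And>x d. x \<in> S \<Longrightarrow> 0 < d \<Longrightarrow> \<exists>a b. a < x \<and> x < b \<and> b - a < d \<and> Q a b"
  obtains C where "countable C" "\<And>a b. (a, b) \<in> C \<Longrightarrow> Q a b \<and> a < b"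
    "disjoint_family_on (\<lambda>(a, b). {a<..<b}) C"
    "(\<Union>(a, b)\<in>C. {a<..<b}) \<subseteq> U" "negligible (S - (\<Union>(a, b)\<in>C. {a<..<b}))"
proof -
  define K where "K = {(a, b). a < b \<and> Q a b \<and> {a<..<b} \<subseteq> U}"
  \<comment> \<open>An interval is the ball about its midpoint. The covering theorem wants
    \<open>x\<close> inside a small ball, not at its centre, so intervals that merely straddle
    \<open>x\<close> are admissible.\<close>
  let ?a = "\<lambda>(a, b). (a + b) / 2 :: real" and ?r = "\<lambda>(a, b). (b - a) / 2 :: real"
  have ball: "ball (?a i) (?r i) = (case i of (a, b) \<Rightarrow> {a<..<b})" for i
    by (cases i) (auto simp: ball_eq_greaterThanLessThan field_simps)
  have "\<exists>i. i \<in> K \<and> x \<in> ball (?a i) (?r i) \<and> ?r i < d" if x: "x \<in> S" and d: "0 < d" for x d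
  proof -
    obtain e where e: "e > 0" "ball x e \<subseteq> U"
      using x assms(1,2) open_contains_ball by blast
    obtain a b where ab: "a < x" "x < b" "b - a < min d e" "Q a b"
      using Q[OF x, of "min d e"] d e by auto
    have "{a<..<b} \<subseteq> ball x e"
      using ab by (auto simp: dist_real_def)
    then have "(a, b) \<in> K" "x \<in> ball (?a (a, b)) (?r (a, b))" "?r (a, b) < d"
      using ab e unfolding ball by (auto simp: K_def)
    then show ?thesis by blast
  qed
  from Vitali_covering_theorem_balls[of S K ?a ?r, OF this] obtain C where
    C: "countable C" "C \<subseteq> K" "pairwise (\<lambda>i j. disjnt (ball (?a i) (?r i)) (ball (?a j) (?r j))) C"
     "negligible (S - (\<Union>i\<in>C. ball (?a i) (?r i)))" by blast
  show thesis
  proof (rule that[OF C(1)])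
    show "disjoint_family_on (\<lambda>(a, b). {a<..<b}) C"
      using C(3) unfolding ball by (auto simp: pairwise_def disjoint_family_on_def disjnt_def)
    show "negligible (S - (\<Union>(a, b)\<in>C. {a<..<b}))"
      using C(4) unfolding ball .
  qed (use C(2) in \<open>auto simp: K_def\<close>)
qed

text \<open>The selected intervals are disjoint, so an inequality valid on each of them can be
  summed. This turns slopes over short intervals into a comparison of \<open>\<nu>\<close> with
  length on an open set that covers almost all of \<open>S\<close>.\<close>

lemma Vitali_measure_le:
  fixes S U :: "real set"
  assumes \<nu>: "sets \<nu> = sets borel" and "open U" "S \<subseteq> U"
    and Q: "\<And>x d. x \<in> S \<Longrightarrow> 0 < d \<Longrightarrow> \<exists>a b. a < x \<and> x < b \<and> b - a < d \<and> Q a b"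
    and le: "\<And>a b. a < b \<Longrightarrow> Q a b \<Longrightarrow> ennreal s * emeasure \<nu> {a<..<b} \<le> ennreal t * emeasure lborel {a<..<b}"
  obtains W where "open W" "W \<subseteq> U" "negligible (S - W)" "ennreal s * emeasure \<nu> W \<le> ennreal t * emeasure lborel W"
proof -
  obtain C where C: "countable C" "\<And>a b. (a, b) \<in> C \<Longrightarrow> Q a b \<and> a < b"
    "disjoint_family_on (\<lambda>(a, b). {a<..<b}) C"
    "(\<Union>(a, b)\<in>C. {a<..<b}) \<subseteq> U" "negligible (S - (\<Union>(a, b)\<in>C. {a<..<b}))"
    using Vitali_intervals[OF assms(2,3) Q] by blast
  have "ennreal s * emeasure \<nu> (\<Union>(a, b)\<in>C. {a<..<b})
      = (\<integral>\<^sup>+i. ennreal s * emeasure \<nu> (case i of (a, b) \<Rightarrow> {a<..<b}) \<partial>count_space C)"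
    using C(1,3) by (subst emeasure_UN_countable) (auto simp: \<nu> nn_integral_cmult)
  also have "\<dots> \<le> (\<integral>\<^sup>+i. ennreal t * emeasure lborel (case i of (a, b) \<Rightarrow> {a<..<b}) \<partial>count_space C)"
    using C(2) le by (intro nn_integral_mono) (auto simp del: emeasure_lborel_Ioo)
  also have "\<dots> = ennreal t * emeasure lborel (\<Union>(a, b)\<in>C. {a<..<b})"
    using C(1,3) by (subst emeasure_UN_countable) (auto simp: nn_integral_cmult)
  finally show thesis
    using C(4,5) by (intro that[of "\<Union>(a, b)\<in>C. {a<..<b}"]) auto
qed

lemma lborel_outer_open:
  fixes E :: "real set"
  assumes "E \<in> sets borel" "emeasure lborel E < \<infinity>" "\<epsilon> > 0"
  obtains U where "open U" "E \<subseteq> U" "emeasure lborel U \<le> emeasure lborel E + ennreal \<epsilon>"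
proof -
  have "E \<in> sets lebesgue" using assms(1) by simp
  then obtain T where T: "open T" "E \<subseteq> T" "(T - E) \<in> lmeasurable" "emeasure lebesgue (T - E) < ennreal \<epsilon>"
    using sets_lebesgue_outer_open assms(3) by metis
  have "emeasure lborel T = emeasure lborel (E \<union> (T - E))"
    using T by (intro arg_cong2[of _ _ _ _ emeasure]) auto
  also have "\<dots> = emeasure lborel E + emeasure lborel (T - E)"
    using T assms by (intro plus_emeasure[symmetric]) auto
  also have "\<dots> \<le> emeasure lborel E + ennreal \<epsilon>"
    using T assms(1) by (intro add_left_mono) simp
  finally show thesis using T that by blast
qed

text \<open>
  The lower and upper derivates of a monotone continuous function are compared through two
  nested Vitali coverings; the Stieltjes measure turns sums of increments into measures.
\<close>

lemma mono_derivates_negligible: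
  fixes G :: "real \<Rightarrow> real"
  assumes mono: "\<And>x y. x \<le> y \<Longrightarrow> G x \<le> G y" and cont: "continuous_on UNIV G"
    and \<alpha>\<beta>: "0 \<le> \<alpha>" "\<alpha> < \<beta>"
  shows "negligible {x. (\<forall>d>0. \<exists>a b. a < x \<and> x < b \<and> b - a < d \<and> G b - G a < \<alpha> * (b - a))
                      \<and> (\<forall>d>0. \<exists>a b. a < x \<and> x < b \<and> b - a < d \<and> G b - G a > \<beta> * (b - a))}"
    (is "negligible ?E")
proof -
  \<comment> \<open>The points with arbitrarily short \<open>Q\<close>-intervals around them form a
    countable intersection of open sets. Hence the exceptional set is Borel, as the measure
    comparisons below require.\<close>
  define W where "W Q n = \<Union>{{a<..<b} | a b. b - a < 1 / real (Suc n) \<and> Q a b}" for Q :: "real \<Rightarrow> real \<Rightarrow> bool" and n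
  have W: "{x. \<forall>d>0. \<exists>a b. a < x \<and> x < b \<and> b - a < d \<and> Q a b} = (\<Inter>n. W Q n)" for Q
  proof safe
    fix x n assume *: "\<forall>d>0. \<exists>a b. a < x \<and> x < b \<and> b - a < d \<and> Q a b"
    obtain a b where "a < x" "x < b" "b - a < 1 / real (Suc n)" "Q a b"
      using *[rule_format, of "1 / real (Suc n)"] by auto
    then show "x \<in> W Q n"
      unfolding W_def by (intro UnionI[of "{a<..<b}"]) auto
  next
    fix x d :: real assume x: "x \<in> (\<Inter>n. W Q n)" and d: "0 < d"
    obtain n where "1 / real (Suc n) < d"
      using d reals_Archimedean by (auto simp: inverse_eq_divide)
    moreover have "x \<in> W Q n" using x by auto
    ultimately show "\<exists>a b. a < x \<and> x < b \<and> b - a < d \<and> Q a b"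
      by (fastforce simp: W_def)
  qed
  have oW: "open (W Q n)" for Q n unfolding W_def by (intro open_Union) auto
  have E_meas: "?E \<in> sets borel"
  proof -
    have "?E = (\<Inter>n. W (\<lambda>a b. G b - G a < \<alpha> * (b - a)) n) \<inter> (\<Inter>n. W (\<lambda>a b. G b - G a > \<beta> * (b - a)) n)"
      unfolding W[symmetric] by (rule Collect_conj_eq)
    also have "\<dots> \<in> sets borel" using oW by auto
    finally show ?thesis .
  qed
  let ?\<nu> = "interval_measure G"
  have Ioo: "emeasure ?\<nu> {a<..<b} = ennreal (G b - G a)" if "a < b" for a b
  proof -
    have rc: "\<And>a. continuous (at_right a) G"
      using cont continuous_on_eq_continuous_at continuous_at_imp_continuous_at_within by blast
    have "emeasure ?\<nu> {b} = ennreal (G b - G b)"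
      using emeasure_interval_measure_Icc[OF order_refl mono cont, of b] by simp
    moreover have "emeasure ?\<nu> {a<..b} = emeasure ?\<nu> {a<..<b} + emeasure ?\<nu> {b}"
      using that by (subst plus_emeasure) (auto intro!: arg_cong2[of _ _ _ _ emeasure])
    ultimately show ?thesis
      using emeasure_interval_measure_Ioc[of a b G] that mono rc by simp
  qed
  have bdd: "emeasure lborel (?E \<inter> {-real N..real N}) = 0" for N
  proof -
    define E where "E = ?E \<inter> {-real N..real N}"
    have E: "E \<in> sets borel" using E_meas by (auto simp: E_def)
    have fin: "emeasure lborel E < \<infinity>"
      using emeasure_mono[of E "{-real N..real N}" lborel] by (auto simp: E_def less_top[symmetric] top_unique)
    \<comment> \<open>With \<open>V'\<close> inside \<open>V\<close> inside \<open>U\<close>, the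
      chain is \<open>\<beta> |E| \<le> \<beta> |V'| \<le> \<nu> V' \<le> \<nu> V \<le> \<alpha> |V|
      \<le> \<alpha> |U|\<close>: steep intervals bound \<open>\<nu>\<close> from below on
      \<open>V'\<close>, flat ones bound it from above on \<open>V\<close>.\<close>
    have key: "ennreal \<beta> * emeasure lborel E \<le> ennreal \<alpha> * (emeasure lborel E + ennreal \<epsilon>)" if \<epsilon>: "\<epsilon> > 0" for \<epsilon>
    proof -
      obtain U where U: "open U" "E \<subseteq> U" "emeasure lborel U \<le> emeasure lborel E + ennreal \<epsilon>"
        using lborel_outer_open[OF E fin \<epsilon>] .
      obtain V where V: "open V" "V \<subseteq> U" "negligible (E - V)" "ennreal 1 * emeasure ?\<nu> V \<le> ennreal \<alpha> * emeasure lborel V"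
      proof (rule Vitali_measure_le[OF sets_interval_measure U(1,2), where s=1 and t=\<alpha> and Q="\<lambda>a b. G b - G a < \<alpha> * (b - a)"])
        show "ennreal 1 * emeasure ?\<nu> {a<..<b} \<le> ennreal \<alpha> * emeasure lborel {a<..<b}"
          if "a < b" "G b - G a < \<alpha> * (b - a)" for a b
          using that \<alpha>\<beta> mono[of a b] by (simp add: Ioo ennreal_mult[symmetric] ennreal_leI)
      qed (auto simp: E_def)
      obtain V' where V': "open V'" "V' \<subseteq> V" "negligible (E \<inter> V - V')" "ennreal \<beta> * emeasure lborel V' \<le> ennreal 1 * emeasure ?\<nu> V'"
      proof -
        obtain C where C: "countable C" "\<And>a b. (a, b) \<in> C \<Longrightarrow> G b - G a > \<beta> * (b - a) \<and> a < b"
          "disjoint_family_on (\<lambda>(a, b). {a<..<b}) C"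
          "(\<Union>(a, b)\<in>C. {a<..<b}) \<subseteq> V" "negligible (E \<inter> V - (\<Union>(a, b)\<in>C. {a<..<b}))"
          using Vitali_intervals[OF V(1), of "E \<inter> V" "\<lambda>a b. G b - G a > \<beta> * (b - a)"] by (auto simp: E_def)
        have "ennreal \<beta> * emeasure lborel (\<Union>(a, b)\<in>C. {a<..<b})
            = (\<integral>\<^sup>+i. ennreal \<beta> * emeasure lborel (case i of (a, b) \<Rightarrow> {a<..<b}) \<partial>count_space C)"
          using C(1,3) by (subst emeasure_UN_countable) (auto simp: nn_integral_cmult)
        also have "\<dots> \<le> (\<integral>\<^sup>+i. emeasure ?\<nu> (case i of (a, b) \<Rightarrow> {a<..<b}) \<partial>count_space C)"
          using C(2) \<alpha>\<beta> by (intro nn_integral_mono) (fastforce simp: Ioo ennreal_mult[symmetric] intro!: ennreal_leI)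
        also have "\<dots> = emeasure ?\<nu> (\<Union>(a, b)\<in>C. {a<..<b})"
          using C(1,3) by (subst emeasure_UN_countable) auto
        finally show thesis
          using C(4,5) by (intro that[of "\<Union>(a, b)\<in>C. {a<..<b}"]) auto
      qed
      have "negligible (E - V')"
        by (rule negligible_subset[OF negligible_Un[OF V(3) V'(3)]]) auto
      then have "E - V' \<in> null_sets lborel"
        using E V'(1) by (simp add: negligible_iff_null_sets null_sets_completion_iff)
      then have "emeasure lborel E \<le> emeasure lborel V'"
        using V'(1) E by (intro emeasure_mono_AE) (auto simp: AE_iff_null_sets[OF ] intro: AE_I'[of "E - V'"])
      then have "ennreal \<beta> * emeasure lborel E \<le> ennreal \<beta> * emeasure lborel V'"
        by (rule mult_left_mono) simp
      also have "\<dots> \<le> emeasure ?\<nu> V'" using V' by simp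
      also have "\<dots> \<le> emeasure ?\<nu> V" using V' V by (intro emeasure_mono) auto
      also have "\<dots> \<le> ennreal \<alpha> * emeasure lborel V" using V by simp
      also have "\<dots> \<le> ennreal \<alpha> * emeasure lborel U"
        using V U by (intro mult_left_mono emeasure_mono) auto
      also have "\<dots> \<le> ennreal \<alpha> * (emeasure lborel E + ennreal \<epsilon>)"
        using U by (intro mult_left_mono) auto
      finally show ?thesis .
    qed
    obtain m where m: "emeasure lborel E = ennreal m" "m \<ge> 0"
      using fin by (cases "emeasure lborel E") auto
    have bb: "\<beta> * m \<le> \<alpha> * m + \<alpha> * \<epsilon>" if "\<epsilon> > 0" for \<epsilon>
    proof -
      have "ennreal (\<beta> * m) = ennreal \<beta> * emeasure lborel E"
        using m \<alpha>\<beta> by (simp add: ennreal_mult)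
      also have "\<dots> \<le> ennreal \<alpha> * (ennreal m + ennreal \<epsilon>)" using key[OF that] m by simp
      also have "\<dots> = ennreal (\<alpha> * (m + \<epsilon>))" using m that \<alpha>\<beta> by (simp add: ennreal_mult)
      finally have "\<beta> * m \<le> \<alpha> * (m + \<epsilon>)" using m that \<alpha>\<beta> by (subst (asm) ennreal_le_iff) auto
      then show ?thesis by (simp add: distrib_left)
    qed
    have le: "\<beta> * m \<le> \<alpha> * m"
    proof (rule field_le_epsilon)
      fix e :: real assume "e > 0"
      \<comment> \<open>The slack is taken as \<open>e / (\<alpha> + 1)\<close> because
        \<open>\<alpha>\<close> may be \<open>0\<close>.\<close>
      have "\<alpha> / (\<alpha> + 1) \<le> 1" using \<alpha>\<beta> by simp
      from mult_left_mono[OF this, of e] \<open>e > 0\<close>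
      have "\<alpha> * (e / (\<alpha> + 1)) \<le> e" by (simp add: mult.commute)
      moreover have "\<beta> * m \<le> \<alpha> * m + \<alpha> * (e / (\<alpha> + 1))"
        using \<open>e > 0\<close> \<alpha>\<beta> by (intro bb) simp
      ultimately show "\<beta> * m \<le> \<alpha> * m + e" by simp
    qed
    have "m = 0"
    proof (rule ccontr)
      assume "m \<noteq> 0"
      then have "\<alpha> * m < \<beta> * m" using \<alpha>\<beta> m by simp
      with le show False by simp
    qed
    then show ?thesis using m by (simp add: E_def)
  qed
  have "?E = (\<Union>N. ?E \<inter> {-real N..real N})"
  proof -
    have "\<exists>N. - real N \<le> x \<and> x \<le> real N" for x :: real
      using real_arch_simple[of "\<bar>x\<bar>"] by (metis abs_le_iff minus_le_iff)
    then show ?thesis by auto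
  qed
  also have "negligible \<dots>"
    using bdd E_meas by (intro negligible_countable_Union)
      (auto simp: negligible_iff_null_sets null_sets_completion_iff intro!: null_setsI)
  finally show ?thesis .
qed

text \<open>Letting one end of a straddling interval tend to \<open>x\<close> turns its slope into a
  difference quotient at \<open>x\<close>, by continuity of \<open>G\<close>. Straddling intervals
  are what the covering arguments control.\<close>

lemma has_derivative_of_straddling_slopes:
  fixes G :: "real \<Rightarrow> real"
  assumes cont: "continuous_on UNIV G"
    and D: "\<And>e. e > 0 \<Longrightarrow> \<exists>d>0. \<forall>a b. a < x \<and> x < b \<and> b - a < d \<longrightarrow> \<bar>G b - G a - D * (b - a)\<bar> \<le> e * (b - a)"
  shows "(G has_real_derivative D) (at x)"
  unfolding has_field_derivative_def has_derivative_at_alt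
proof (intro conjI allI impI)
  show "bounded_linear ((*) D)" by (rule bounded_linear_mult_right)
next
  fix e :: real assume "e > 0"
  from D[OF this] obtain d where d: "d > 0"
    "\<And>a b. a < x \<Longrightarrow> x < b \<Longrightarrow> b - a < d \<Longrightarrow> \<bar>G b - G a - D * (b - a)\<bar> \<le> e * (b - a)" by blast
  have "\<bar>G y - G x - D * (y - x)\<bar> \<le> e * \<bar>y - x\<bar>" if y: "\<bar>y - x\<bar> < d" for y
  proof -
    have G: "(G \<longlongrightarrow> G x) (at x within S)" for S
      using cont by (auto simp: continuous_on_def intro: tendsto_within_subset)
    consider "y = x" | "x < y" | "y < x" by linarith
    then show ?thesis
    proof cases
      case 2
      have "((\<lambda>a. \<bar>G y - G a - D * (y - a)\<bar> - e * (y - a)) \<longlongrightarrow> \<bar>G y - G x - D * (y - x)\<bar> - e * (y - x)) (at_left x)"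
        by (intro tendsto_intros G)
      moreover have "\<forall>\<^sub>F a in at_left x. \<bar>G y - G a - D * (y - a)\<bar> - e * (y - a) \<le> 0"
        using eventually_at_left_real[of "y - d" x] 2 y by (auto elim!: eventually_mono dest!: d(2)[of _ y])
      ultimately have "\<bar>G y - G x - D * (y - x)\<bar> - e * (y - x) \<le> 0"
        by (rule tendsto_upperbound) simp
      then show ?thesis using 2 by simp
    next
      case 3
      have "((\<lambda>b. \<bar>G b - G y - D * (b - y)\<bar> - e * (b - y)) \<longlongrightarrow> \<bar>G x - G y - D * (x - y)\<bar> - e * (x - y)) (at_right x)"
        by (intro tendsto_intros G)
      moreover have "\<forall>\<^sub>F b in at_right x. \<bar>G b - G y - D * (b - y)\<bar> - e * (b - y) \<le> 0"
        using eventually_at_right_real[of x "y + d"] 3 y by (auto elim!: eventually_mono dest!: d(2)[of y])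
      ultimately have "\<bar>G x - G y - D * (x - y)\<bar> - e * (x - y) \<le> 0"
        by (rule tendsto_upperbound) simp
      moreover have "\<bar>G y - G x - D * (y - x)\<bar> = \<bar>G x - G y - D * (x - y)\<bar>" by (simp add: algebra_simps abs_if)
      ultimately show ?thesis using 3 by simp
    qed simp
  qed
  then show "\<exists>d>0. \<forall>y. norm (y - x) < d \<longrightarrow> norm (G y - G x - D * (y - x)) \<le> e * norm (y - x)"
    using d(1) by auto
qed

lemma lipschitz_real_bound:
  fixes F :: "real \<Rightarrow> real"
  assumes "L-lipschitz_on UNIV F"
  shows "\<bar>F x - F y\<bar> \<le> L * \<bar>x - y\<bar>"
  using lipschitz_onD[OF assms, of x y] by (simp add: dist_real_def)

text \<open>\<open>G = F + L x\<close> is increasing with slopes at most \<open>2 L\<close>. Where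
  it is not differentiable, its lower and upper derivates are separated by two rationals, so the
  point lies in one of countably many sets covered by
  \<open>mono_derivates_negligible\<close>.\<close>

theorem lipschitz_differentiable_negligible:
  fixes F :: "real \<Rightarrow> real"
  assumes L: "L-lipschitz_on UNIV F"
  shows "negligible {x. \<not> (\<exists>D. (F has_real_derivative D) (at x))}"
proof -
  define G where "G x = F x + L * x" for x
  have L0: "L \<ge> 0" using L by (rule lipschitz_on_nonneg)
  note lb = lipschitz_real_bound[OF L]
  have mono: "G x \<le> G y" if "x \<le> y" for x y
    using lb[of x y] that by (simp add: G_def algebra_simps)
  have up: "G y - G x \<le> 2 * L * (y - x)" if "x \<le> y" for x y
    using lb[of y x] that by (simp add: G_def algebra_simps)
  have cont: "continuous_on UNIV G"
    unfolding G_def by (intro continuous_intros lipschitz_on_continuous_on[OF L])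
  define N where "N \<alpha> \<beta> = {x. (\<forall>d>0. \<exists>a b. a < x \<and> x < b \<and> b - a < d \<and> G b - G a < \<alpha> * (b - a))
                      \<and> (\<forall>d>0. \<exists>a b. a < x \<and> x < b \<and> b - a < d \<and> G b - G a > \<beta> * (b - a))}" for \<alpha> \<beta>
  define I where "I = {(\<alpha>, \<beta>). \<alpha> \<in> \<rat> \<and> \<beta> \<in> \<rat> \<and> 0 \<le> \<alpha> \<and> \<alpha> < (\<beta>::real)}"
  have "countable I"
    by (rule countable_subset[of _ "\<rat> \<times> \<rat>"]) (auto simp: I_def countable_rat)
  moreover have "negligible (N \<alpha> \<beta>)" if "(\<alpha>, \<beta>) \<in> I" for \<alpha> \<beta>
    unfolding N_def using that by (intro mono_derivates_negligible mono cont) (auto simp: I_def)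
  ultimately have "negligible (\<Union>i\<in>I. N (fst i) (snd i))"
    by (intro negligible_countable_Union) auto
  moreover have "{x. \<not> (\<exists>D. (F has_real_derivative D) (at x))} \<subseteq> (\<Union>i\<in>I. N (fst i) (snd i))"
  proof
    fix x assume x: "x \<in> {x. \<not> (\<exists>D. (F has_real_derivative D) (at x))}"
    show "x \<in> (\<Union>i\<in>I. N (fst i) (snd i))"
    proof (rule ccontr)
      assume "x \<notin> (\<Union>i\<in>I. N (fst i) (snd i))"
      then have nN: "x \<notin> N \<alpha> \<beta>" if "(\<alpha>, \<beta>) \<in> I" for \<alpha> \<beta> using that by auto
      \<comment> \<open>\<open>A\<close> collects the numbers that bound all sufficiently short
        straddling slopes from below. Its supremum is the lower derivate and the candidate for the
        derivative.\<close>
      define A where "A = {\<alpha>. \<exists>d>0. \<forall>a b. a < x \<and> x < b \<and> b - a < d \<longrightarrow> G b - G a \<ge> \<alpha> * (b - a)}"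
      have A0: "0 \<in> A" using mono by (auto simp: A_def intro!: exI[of _ 1])
      have A_le: "\<alpha> \<le> 2 * L" if \<alpha>: "\<alpha> \<in> A" for \<alpha>
      proof -
        obtain d where d: "d > 0" "\<And>a b. a < x \<Longrightarrow> x < b \<Longrightarrow> b - a < d \<Longrightarrow> G b - G a \<ge> \<alpha> * (b - a)"
          using \<alpha> unfolding A_def by blast
        have "\<alpha> * (d / 2) \<le> G (x + d / 4) - G (x - d / 4)"
          using d(2)[of "x - d / 4" "x + d / 4"] d(1) by simp
        also have "\<dots> \<le> 2 * L * (d / 2)" using up[of "x - d / 4" "x + d / 4"] d(1) by simp
        finally show ?thesis using d(1) by simp
      qed
      have bdd: "bdd_above A" using A_le by (rule bdd_aboveI)
      define D where "D = Sup A"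
      have D0: "0 \<le> D" unfolding D_def using A0 bdd by (rule cSup_upper)
      have "(G has_real_derivative D) (at x)"
      proof (rule has_derivative_of_straddling_slopes[OF cont])
        fix e :: real assume e: "e > 0"
        obtain \<alpha> where \<alpha>: "\<alpha> \<in> A" "D - e < \<alpha>"
          using less_cSup_iff[of A "D - e"] A0 bdd e by (auto simp: D_def)
        obtain d1 where d1: "d1 > 0" "\<And>a b. a < x \<Longrightarrow> x < b \<Longrightarrow> b - a < d1 \<Longrightarrow> G b - G a \<ge> \<alpha> * (b - a)"
          using \<alpha> unfolding A_def by blast
        \<comment> \<open>Being above the supremum, \<open>\<alpha>'\<close> is not in
          \<open>A\<close>, so slopes below \<open>\<alpha>'\<close> occur at every scale. As
          \<open>x\<close> avoids \<open>N \<alpha>' \<beta>'\<close>, slopes above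
          \<open>\<beta>'\<close> do not, and \<open>\<beta>' < D + e\<close>.\<close>
        obtain \<alpha>' where \<alpha>': "\<alpha>' \<in> \<rat>" "D < \<alpha>'" "\<alpha>' < D + e" using Rats_dense_in_real[of D "D + e"] e by auto
        obtain \<beta>' where \<beta>': "\<beta>' \<in> \<rat>" "\<alpha>' < \<beta>'" "\<beta>' < D + e" using Rats_dense_in_real[of \<alpha>' "D + e"] \<alpha>' by auto
        have "\<alpha>' \<notin> A" using \<alpha>'(2) cSup_upper[OF _ bdd] by (force simp: D_def)
        then have "\<forall>d>0. \<exists>a b. a < x \<and> x < b \<and> b - a < d \<and> G b - G a < \<alpha>' * (b - a)"
          unfolding A_def by (force simp: not_le)
        moreover have "x \<notin> N \<alpha>' \<beta>'" using \<alpha>' \<beta>' D0 by (intro nN) (auto simp: I_def)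
        ultimately obtain d2 where d2: "d2 > 0" "\<And>a b. a < x \<Longrightarrow> x < b \<Longrightarrow> b - a < d2 \<Longrightarrow> G b - G a \<le> \<beta>' * (b - a)"
          unfolding N_def mem_Collect_eq not_less[symmetric] by blast
        have "\<bar>G b - G a - D * (b - a)\<bar> \<le> e * (b - a)" if ab: "a < x" "x < b" "b - a < min d1 d2" for a b
        proof -
          have "(D - e) * (b - a) \<le> G b - G a"
            using d1(2)[of a b] mult_right_mono[of "D - e" \<alpha> "b - a"] \<alpha>(2) ab by linarith
          moreover have "G b - G a \<le> (D + e) * (b - a)"
            using d2(2)[of a b] mult_right_mono[of \<beta>' "D + e" "b - a"] \<beta>'(3) ab by linarith
          ultimately show ?thesis by (simp add: algebra_simps abs_le_iff)
        qed
        then show "\<exists>d>0. \<forall>a b. a < x \<and> x < b \<and> b - a < d \<longrightarrow> \<bar>G b - G a - D * (b - a)\<bar> \<le> e * (b - a)"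
          using d1(1) d2(1) by (intro exI[of _ "min d1 d2"]) auto
      qed
      then have "((\<lambda>x. G x - L * x) has_real_derivative D - L) (at x)"
        by (auto intro!: derivative_eq_intros)
      then show False using x by (auto simp: G_def)
    qed
  qed
  ultimately show ?thesis by (rule negligible_subset)
qed

section \<open>Almost everywhere derivatives: bounds, measurability, fundamental theorem\<close>

lemma lipschitz_AE_deriv:
  fixes F :: "real \<Rightarrow> real"
  assumes L: "L-lipschitz_on UNIV F"
  shows "AE x in lebesgue. (F has_real_derivative deriv F x) (at x)"
proof -
  have "AE x in lebesgue. x \<notin> {x. \<not> (\<exists>D. (F has_real_derivative D) (at x))}"
    using lipschitz_differentiable_negligible[OF L] by (intro AE_not_in) (simp add: negligible_iff_null_sets)
  then show ?thesis by eventually_elim (auto dest: DERIV_imp_deriv)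
qed

lemma lipschitz_deriv_le:
  fixes F :: "real \<Rightarrow> real"
  assumes L: "L-lipschitz_on UNIV F" and D: "(F has_real_derivative D) (at x)"
  shows "\<bar>D\<bar> \<le> L"
proof -
  have "((\<lambda>y. \<bar>(F y - F x) / (y - x)\<bar>) \<longlongrightarrow> \<bar>D\<bar>) (at x)"
    using D by (intro tendsto_rabs) (simp add: has_field_derivative_iff)
  moreover have "\<forall>\<^sub>F y in at x. \<bar>(F y - F x) / (y - x)\<bar> \<le> L"
    using lipschitz_real_bound[OF L, of _ x] by (auto simp: eventually_at_filter abs_divide divide_le_eq)
  ultimately show ?thesis by (rule tendsto_upperbound) simp
qed

lemma lipschitz_AE_deriv_le:
  fixes F :: "real \<Rightarrow> real"
  assumes L: "L-lipschitz_on UNIV F"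
  shows "AE x in lebesgue. \<bar>deriv F x\<bar> \<le> L"
  using lipschitz_AE_deriv[OF L] by eventually_elim (rule lipschitz_deriv_le[OF L])

lemma borel_measurable_completion_cong_AE:
  fixes f g :: "'a \<Rightarrow> 'b::topological_space"
  assumes f: "f \<in> borel_measurable (completion M)" and ae: "AE x in completion M. f x = g x"
  shows "g \<in> borel_measurable (completion M)"
proof (rule measurableI)
  fix A :: "'b set" assume A: "A \<in> sets borel"
  show "g -` A \<inter> space (completion M) \<in> sets (completion M)"
  proof (rule completion.in_sets_AE)
    show "f -` A \<inter> space (completion M) \<in> sets (completion M)" using f A by (rule measurable_sets)
    show "AE x in completion M. x \<in> f -` A \<inter> space (completion M) \<longleftrightarrow> x \<in> g -` A \<inter> space (completion M)"
      using ae by eventually_elim auto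
  qed auto
qed auto

lemma deriv_quotient_tendsto:
  fixes F :: "real \<Rightarrow> real"
  assumes "(F has_real_derivative D) (at x)"
  shows "(\<lambda>n. (F (x + 1 / real (Suc n)) - F x) * real (Suc n)) \<longlonglongrightarrow> D"
proof -
  have "((\<lambda>h. (F (x + h) - F x) / h) \<longlongrightarrow> D) (at 0)" using assms by (simp add: DERIV_def)
  moreover have "filterlim (\<lambda>n. 1 / real (Suc n)) (at 0) sequentially"
    using lim_1_over_n[THEN filterlim_sequentially_Suc[THEN iffD2]] unfolding filterlim_at by auto
  ultimately have "(\<lambda>n. (F (x + 1 / real (Suc n)) - F x) / (1 / real (Suc n))) \<longlonglongrightarrow> D"
    by (rule filterlim_compose)
  then show ?thesis by simp
qed

text \<open>\<open>deriv\<close> has an arbitrary value where \<open>F\<close> is not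
  differentiable. Off a null set it is the limit of difference quotients, and Lebesgue measure is
  complete.\<close>

lemma lipschitz_deriv_measurable:
  fixes F :: "real \<Rightarrow> real"
  assumes L: "L-lipschitz_on UNIV F"
  shows "deriv F \<in> borel_measurable lebesgue"
proof -
  have [measurable]: "F \<in> borel_measurable borel"
    by (intro borel_measurable_continuous_onI lipschitz_on_continuous_on[OF L])
  define D where "D n x = (F (x + 1 / real (Suc n)) - F x) * real (Suc n)" for n x
  have [measurable]: "D n \<in> borel_measurable borel" for n unfolding D_def by measurable
  have "(\<lambda>x. lim (\<lambda>n. D n x)) \<in> borel_measurable borel" by measurable
  then have "(\<lambda>x. lim (\<lambda>n. D n x)) \<in> borel_measurable lebesgue" by (simp add: measurable_completion)
  moreover have "AE x in lebesgue. lim (\<lambda>n. D n x) = deriv F x"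
    using lipschitz_AE_deriv[OF L] by eventually_elim (simp add: D_def limI deriv_quotient_tendsto del: of_nat_Suc)
  ultimately show ?thesis by (rule borel_measurable_completion_cong_AE)
qed

lemma integrable_indicator_Icc: "integrable lebesgue (\<lambda>x. indicator {a..b::real} x * (c::real))"
  by (intro integrable_mult_left integrable_real_indicator) (auto simp: emeasure_lborel_Icc_eq)

text \<open>The difference quotients \<open>D n\<close> of \<open>F\<close> are continuous, and on
  \<open>[a, b]\<close> they are the derivatives of the difference quotients \<open>H n\<close> of a
  primitive \<open>G\<close> of \<open>F\<close>. The classical theorem applies to them. On the left
  the bound \<open>L\<close> allows passing to the limit, and on the right \<open>G' = F\<close>
  identifies it.\<close>

theorem lipschitz_FTC:
  fixes F :: "real \<Rightarrow> real"
  assumes L: "L-lipschitz_on UNIV F" and ab: "a \<le> b"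
  shows "(\<integral>x. indicator {a..b} x * deriv F x \<partial>lebesgue) = F b - F a"
proof -
  have cont: "continuous_on UNIV F" by (rule lipschitz_on_continuous_on[OF L])
  then have [measurable]: "F \<in> borel_measurable borel" by (rule borel_measurable_continuous_onI)
  define D where "D n x = (F (x + 1 / real (Suc n)) - F x) * real (Suc n)" for n x
  \<comment> \<open>The base point \<open>a - 1\<close> makes \<open>a\<close> an interior point,
    and the range up to \<open>b + 1\<close> accommodates shifts by
    \<open>1 / (n + 1) \<le> 1\<close>.\<close>
  define G where "G x = integral {a - 1..x} F" for x
  have G: "(G has_real_derivative F x) (at x)" if "a \<le> x" "x \<le> b + 1" for x
  proof -
    have "(G has_real_derivative F x) (at x within {a - 1..b + 2})"
      unfolding G_def using that by (intro integral_has_real_derivative continuous_on_subset[OF cont]) auto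
    then show ?thesis using that by (subst (asm) at_within_interior) auto
  qed
  define H where "H n x = (G (x + 1 / real (Suc n)) - G x) * real (Suc n)" for n x
  have H: "(H n has_real_derivative D n x) (at x)" if "a \<le> x" "x \<le> b" for n x
  proof -
    have "1 / real (Suc n) \<le> 1" by simp
    then have "(G has_real_derivative F (x + 1 / real (Suc n))) (at (x + 1 / real (Suc n)))"
      using that by (intro G) (simp_all add: add_increasing2 add_mono del: of_nat_Suc)
    then have "((\<lambda>x. G (x + 1 / real (Suc n))) has_real_derivative F (x + 1 / real (Suc n))) (at x)"
      by (simp add: DERIV_shift)
    then show ?thesis unfolding H_def D_def using that by (intro DERIV_cmult_right DERIV_diff G) auto
  qed
  have "(\<lambda>n. \<integral>x. indicator {a..b} x * D n x \<partial>lebesgue) \<longlonglongrightarrow> (\<integral>x. indicator {a..b} x * deriv F x \<partial>lebesgue)"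
  proof (rule integral_dominated_convergence[where w="\<lambda>x. indicator {a..b} x * L"])
    show "(\<lambda>x. indicator {a..b} x * deriv F x) \<in> borel_measurable lebesgue"
      using lipschitz_deriv_measurable[OF L] by (intro borel_measurable_times borel_measurable_indicator) auto
    show "(\<lambda>x. indicator {a..b} x * D n x) \<in> borel_measurable lebesgue" for n
      unfolding D_def by (intro measurable_completion) measurable
    show "integrable lebesgue (\<lambda>x. indicator {a..b} x * L)"
      by (rule integrable_indicator_Icc)
    show "AE x in lebesgue. (\<lambda>n. indicator {a..b} x * D n x) \<longlonglongrightarrow> indicator {a..b} x * deriv F x"
      using lipschitz_AE_deriv[OF L] by eventually_elim (auto simp: D_def intro!: tendsto_intros deriv_quotient_tendsto simp del: of_nat_Suc)
    show "AE x in lebesgue. norm (indicator {a..b} x * D n x) \<le> indicator {a..b} x * L" for n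
    proof (intro AE_I2)
      fix x
      have "\<bar>D n x\<bar> \<le> L" using lipschitz_real_bound[OF L, of "x + 1 / real (Suc n)" x] 
        unfolding D_def by (simp add: abs_mult le_divide_eq del: of_nat_Suc)
      then show "norm (indicator {a..b} x * D n x) \<le> indicator {a..b} x * L"
        by (auto simp: indicator_def)
    qed
  qed
  moreover have "(\<integral>x. indicator {a..b} x * D n x \<partial>lebesgue) = H n b - H n a" for n
  proof -
    have "has_bochner_integral lborel (\<lambda>x. D n x * indicator {a..b} x) (H n b - H n a)"
    proof (rule has_bochner_integral_FTC_Icc_real[OF ab])
      have "continuous_on UNIV (D n)"
        unfolding D_def by (intro continuous_intros cont continuous_on_compose2[OF cont]) auto
      then show "isCont (D n) x" for x by (simp add: continuous_on_eq_continuous_at)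
    qed (rule H)
    then have "integrable lborel (\<lambda>x. indicator {a..b} x * D n x)"
      "(LBINT x. indicator {a..b} x * D n x) = H n b - H n a"
      by (auto simp: has_bochner_integral_iff mult.commute)
    then show ?thesis by (subst integral_completion) auto
  qed
  moreover have "(\<lambda>n. H n b - H n a) \<longlonglongrightarrow> F b - F a"
    unfolding H_def using ab by (intro tendsto_diff deriv_quotient_tendsto G) auto
  ultimately show ?thesis using LIMSEQ_unique by simp
qed

section \<open>Integration against a Lipschitz function\<close>

text \<open>The Stieltjes integral of \<open>g\<close> with respect to \<open>\<sigma>\<close> over
  \<open>[a, b]\<close>.\<close>

definition lint :: "real \<Rightarrow> real \<Rightarrow> (real \<Rightarrow> real) \<Rightarrow> (real \<Rightarrow> real) \<Rightarrow> real" where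
  "lint a b g \<sigma> = (\<integral>x. indicator {a..b} x * (g x * deriv \<sigma> x) \<partial>lebesgue)"

lemma continuous_bounded_Icc:
  fixes g :: "real \<Rightarrow> real"
  assumes "continuous_on UNIV g"
  obtains B where "\<And>x. x \<in> {a..b} \<Longrightarrow> \<bar>g x\<bar> \<le> B"
proof -
  have "bounded (g ` {a..b})"
    using assms by (intro compact_imp_bounded compact_continuous_image compact_Icc) (auto intro: continuous_on_subset)
  then obtain B where "\<forall>x\<in>{a..b}. \<bar>g x\<bar> \<le> B" by (auto simp: bounded_iff)
  then show thesis using that by blast
qed

lemma lint_integrable:
  fixes g \<sigma> :: "real \<Rightarrow> real"
  assumes g: "g \<in> borel_measurable borel" and B: "\<And>x. x \<in> {a..b} \<Longrightarrow> \<bar>g x\<bar> \<le> B"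
    and L: "L-lipschitz_on UNIV \<sigma>"
  shows "integrable lebesgue (\<lambda>x. indicator {a..b} x * (g x * deriv \<sigma> x))"
proof (rule Bochner_Integration.integrable_bound)
  show "integrable lebesgue (\<lambda>x. indicator {a..b} x * (B * L))"
    by (rule integrable_indicator_Icc)
  show "(\<lambda>x. indicator {a..b} x * (g x * deriv \<sigma> x)) \<in> borel_measurable lebesgue"
    using g lipschitz_deriv_measurable[OF L]
    by (intro borel_measurable_times borel_measurable_indicator measurable_completion[of g]) auto
  show "AE x in lebesgue. norm (indicator {a..b} x * (g x * deriv \<sigma> x)) \<le> norm (indicator {a..b} x * (B * L))"
    using lipschitz_AE_deriv_le[OF L]
  proof eventually_elim
    case (elim x)
    show ?case
    proof (cases "x \<in> {a..b}")
      case True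
      have "\<bar>g x\<bar> * \<bar>deriv \<sigma> x\<bar> \<le> B * L"
        using B[OF True] elim by (intro mult_mono) auto
      then have "\<bar>g x * deriv \<sigma> x\<bar> \<le> \<bar>B * L\<bar>" by (simp only: abs_mult[of "g x"])
      then show ?thesis using True by simp
    qed simp
  qed
qed

lemma lint_integrable_cont:
  fixes g \<sigma> :: "real \<Rightarrow> real"
  assumes g: "continuous_on UNIV g" and L: "L-lipschitz_on UNIV \<sigma>"
  shows "integrable lebesgue (\<lambda>x. indicator {a..b} x * (g x * deriv \<sigma> x))"
proof -
  obtain B where "\<And>x. x \<in> {a..b} \<Longrightarrow> \<bar>g x\<bar> \<le> B" using continuous_bounded_Icc[OF g] by blast
  then show ?thesis using g L by (intro lint_integrable) (auto intro: borel_measurable_continuous_onI)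
qed

lemma lint_const:
  assumes "L-lipschitz_on UNIV \<sigma>" "a \<le> b"
  shows "lint a b (\<lambda>_. c) \<sigma> = c * (\<sigma> b - \<sigma> a)"
proof -
  have "lint a b (\<lambda>_. c) \<sigma> = (\<integral>x. c * (indicator {a..b} x * deriv \<sigma> x) \<partial>lebesgue)"
    unfolding lint_def by (intro Bochner_Integration.integral_cong) auto
  then show ?thesis using lipschitz_FTC[OF assms] by simp
qed

lemma lint_combine:
  assumes g: "g \<in> borel_measurable borel" and B: "\<And>x. x \<in> {a..b} \<Longrightarrow> \<bar>g x\<bar> \<le> B"
    and L: "L-lipschitz_on UNIV \<sigma>" and "a \<le> c" "c \<le> b"
  shows "lint a b g \<sigma> = lint a c g \<sigma> + lint c b g \<sigma>"
proof -
  have "integrable lebesgue (\<lambda>x. indicator {a..c} x * (g x * deriv \<sigma> x))"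
    "integrable lebesgue (\<lambda>x. indicator {c..b} x * (g x * deriv \<sigma> x))"
    using assms by (auto intro!: lint_integrable[OF g _ L, of _ _ B])
  then have "lint a c g \<sigma> + lint c b g \<sigma>
      = (\<integral>x. indicator {a..c} x * (g x * deriv \<sigma> x) + indicator {c..b} x * (g x * deriv \<sigma> x) \<partial>lebesgue)"
    unfolding lint_def by simp
  also have "\<dots> = lint a b g \<sigma>"
    unfolding lint_def
  proof (rule integral_cong_AE)
    have "AE x in lebesgue. x \<noteq> c" using AE_completion[OF AE_lborel_singleton[of c]] .
    then show "AE x in lebesgue. indicator {a..c} x * (g x * deriv \<sigma> x) + indicator {c..b} x * (g x * deriv \<sigma> x) = indicator {a..b} x * (g x * deriv \<sigma> x)"
      by eventually_elim (use assms(4,5) in \<open>auto simp: indicator_def\<close>)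
  qed (use g lipschitz_deriv_measurable[OF L] in \<open>auto intro!: borel_measurable_add borel_measurable_times borel_measurable_indicator measurable_completion[of g]\<close>)
  finally show ?thesis by simp
qed

lemma lint_combine_cont:
  assumes g: "continuous_on UNIV g" and L: "L-lipschitz_on UNIV \<sigma>" and "a \<le> c" "c \<le> b"
  shows "lint a b g \<sigma> = lint a c g \<sigma> + lint c b g \<sigma>"
proof -
  obtain B where "\<And>x. x \<in> {a..b} \<Longrightarrow> \<bar>g x\<bar> \<le> B" using continuous_bounded_Icc[OF g] by blast
  then show ?thesis using g L assms(3,4) by (intro lint_combine) (auto intro: borel_measurable_continuous_onI)
qed

lemma lint_bound:
  assumes g: "g \<in> borel_measurable borel" and B: "\<And>x. x \<in> {a..b} \<Longrightarrow> \<bar>g x\<bar> \<le> B"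
    and L: "L-lipschitz_on UNIV \<sigma>"
  shows "\<bar>lint a b g \<sigma>\<bar> \<le> L * (\<integral>x. indicator {a..b} x * \<bar>g x\<bar> \<partial>lebesgue)"
proof -
  have "\<bar>lint a b g \<sigma>\<bar> \<le> (\<integral>x. L * (indicator {a..b} x * \<bar>g x\<bar>) \<partial>lebesgue)"
    unfolding lint_def
  proof (rule order_trans[OF integral_abs_bound])
    show "(\<integral>x. \<bar>indicator {a..b} x * (g x * deriv \<sigma> x)\<bar> \<partial>lebesgue) \<le> (\<integral>x. L * (indicator {a..b} x * \<bar>g x\<bar>) \<partial>lebesgue)"
    proof (rule integral_mono_AE)
      show "integrable lebesgue (\<lambda>x. \<bar>indicator {a..b} x * (g x * deriv \<sigma> x)\<bar>)"
        by (intro integrable_abs lint_integrable[OF g B L])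
      have "integrable lebesgue (\<lambda>x. indicator {a..b} x * \<bar>g x\<bar>)"
      proof (rule Bochner_Integration.integrable_bound)
        show "integrable lebesgue (\<lambda>x. indicator {a..b} x * B)"
          by (rule integrable_indicator_Icc)
        show "(\<lambda>x. indicator {a..b} x * \<bar>g x\<bar>) \<in> borel_measurable lebesgue"
          using g by (intro borel_measurable_times borel_measurable_indicator borel_measurable_abs measurable_completion[of g]) auto
        show "AE x in lebesgue. norm (indicator {a..b} x * \<bar>g x\<bar>) \<le> norm (indicator {a..b} x * B)"
          using B by (intro AE_I2) (force simp: indicator_def)
      qed
      then show "integrable lebesgue (\<lambda>x. L * (indicator {a..b} x * \<bar>g x\<bar>))" by simp
      show "AE x in lebesgue. \<bar>indicator {a..b} x * (g x * deriv \<sigma> x)\<bar> \<le> L * (indicator {a..b} x * \<bar>g x\<bar>)"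
        using lipschitz_AE_deriv_le[OF L]
      proof eventually_elim
        case (elim x)
        have "\<bar>g x\<bar> * \<bar>deriv \<sigma> x\<bar> \<le> \<bar>g x\<bar> * L" using elim by (intro mult_left_mono) auto
        then show ?case by (auto simp: indicator_def abs_mult mult.commute)
      qed
    qed
  qed
  then show ?thesis by simp
qed

lemma lint_add_left:
  assumes "integrable lebesgue (\<lambda>x. indicator {a..b} x * (g x * deriv \<sigma> x))"
    "integrable lebesgue (\<lambda>x. indicator {a..b} x * (h x * deriv \<sigma> x))"
  shows "lint a b (\<lambda>x. c * g x + d * h x) \<sigma> = c * lint a b g \<sigma> + d * lint a b h \<sigma>"
proof -
  have "lint a b (\<lambda>x. c * g x + d * h x) \<sigma>
      = (\<integral>x. c * (indicator {a..b} x * (g x * deriv \<sigma> x)) + d * (indicator {a..b} x * (h x * deriv \<sigma> x)) \<partial>lebesgue)"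
    unfolding lint_def by (intro Bochner_Integration.integral_cong) (auto simp: algebra_simps)
  also have "\<dots> = c * lint a b g \<sigma> + d * lint a b h \<sigma>"
    using assms unfolding lint_def by simp
  finally show ?thesis .
qed

lemma lipschitz_lincomb:
  fixes \<sigma> \<rho> :: "'a::metric_space \<Rightarrow> real"
  assumes "L-lipschitz_on S \<sigma>" "M-lipschitz_on S \<rho>"
  shows "(\<bar>c\<bar> * L + \<bar>d\<bar> * M)-lipschitz_on S (\<lambda>x. c * \<sigma> x + d * \<rho> x)"
proof -
  have "(\<bar>c\<bar> * L)-lipschitz_on S (\<lambda>x. c * \<sigma> x)"
    if "L-lipschitz_on S \<sigma>" for c L and \<sigma> :: "'a \<Rightarrow> real"
    using lipschitz_on_cmult_real[OF that, of c] by simp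
  then show ?thesis using assms by (intro lipschitz_on_add) auto
qed

lemma lint_add_right:
  assumes g: "g \<in> borel_measurable borel" and B: "\<And>x. x \<in> {a..b} \<Longrightarrow> \<bar>g x\<bar> \<le> B"
    and L: "L-lipschitz_on UNIV \<sigma>" and M: "M-lipschitz_on UNIV \<rho>"
  shows "lint a b g (\<lambda>x. c * \<sigma> x + d * \<rho> x) = c * lint a b g \<sigma> + d * lint a b g \<rho>"
proof -
  have i: "integrable lebesgue (\<lambda>x. indicator {a..b} x * (g x * deriv \<tau> x))" if "N-lipschitz_on UNIV \<tau>" for N \<tau>
    using g B that by (rule lint_integrable)
  have "lint a b g (\<lambda>x. c * \<sigma> x + d * \<rho> x)
      = (\<integral>x. c * (indicator {a..b} x * (g x * deriv \<sigma> x)) + d * (indicator {a..b} x * (g x * deriv \<rho> x)) \<partial>lebesgue)"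
    unfolding lint_def
  proof (rule integral_cong_AE)
    show "AE x in lebesgue. indicator {a..b} x * (g x * deriv (\<lambda>x. c * \<sigma> x + d * \<rho> x) x)
        = c * (indicator {a..b} x * (g x * deriv \<sigma> x)) + d * (indicator {a..b} x * (g x * deriv \<rho> x))"
      using lipschitz_AE_deriv[OF L] lipschitz_AE_deriv[OF M]
    proof eventually_elim
      case (elim x)
      have "((\<lambda>x. c * \<sigma> x + d * \<rho> x) has_real_derivative c * deriv \<sigma> x + d * deriv \<rho> x) (at x)"
        using elim by (auto intro!: derivative_eq_intros)
      then have "deriv (\<lambda>x. c * \<sigma> x + d * \<rho> x) x = c * deriv \<sigma> x + d * deriv \<rho> x" by (rule DERIV_imp_deriv)
      then show ?case by (simp add: algebra_simps)
    qed
    show "(\<lambda>x. indicator {a..b} x * (g x * deriv (\<lambda>x. c * \<sigma> x + d * \<rho> x) x)) \<in> borel_measurable lebesgue"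
      by (rule borel_measurable_integrable[OF i[OF lipschitz_lincomb[OF L M]]])
    show "(\<lambda>x. c * (indicator {a..b} x * (g x * deriv \<sigma> x)) + d * (indicator {a..b} x * (g x * deriv \<rho> x))) \<in> borel_measurable lebesgue"
      using borel_measurable_integrable[OF i[OF L]] borel_measurable_integrable[OF i[OF M]] by auto
  qed
  also have "\<dots> = c * lint a b g \<sigma> + d * lint a b g \<rho>"
    using i[OF L] i[OF M] unfolding lint_def by simp
  finally show ?thesis .
qed

lemma lint_local:
  assumes L: "L-lipschitz_on UNIV \<sigma>" and U: "open U" and c: "\<And>x. x \<in> U \<Longrightarrow> \<sigma> x = c"
    and g: "\<And>x. g x \<noteq> 0 \<Longrightarrow> x \<in> U"
  shows "lint a b g \<sigma> = 0"
proof -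
  have "g x * deriv \<sigma> x = 0" for x
  proof (cases "g x = 0")
    case False
    then have x: "x \<in> U" using g by auto
    have "((\<lambda>_. c) has_real_derivative 0) (at x)" by simp
    then have "(\<sigma> has_real_derivative 0) (at x)"
      by (rule has_field_derivative_transform_within_open[OF _ U x]) (simp add: c)
    then show ?thesis by (simp add: DERIV_imp_deriv)
  qed simp
  then show ?thesis unfolding lint_def by (simp only: mult_zero_right Bochner_Integration.integral_zero)
qed

text \<open>The error of one Riemann cell: \<open>f\<close> varies by at most
  \<open>K (t - s)\<close> there, and \<open>\<sigma>\<close> has slope at most \<open>L\<close>.
  The free sample point \<open>u\<close> lets later proofs use either end of the cell.\<close>

lemma lint_cell:
  assumes K: "K-lipschitz_on UNIV f" and L: "L-lipschitz_on UNIV \<sigma>" and u: "s \<le> u" "u \<le> t"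
  shows "\<bar>lint s t f \<sigma> - f u * (\<sigma> t - \<sigma> s)\<bar> \<le> K * L * (t - s)\<^sup>2"
proof -
  have cf: "continuous_on UNIV f" by (rule lipschitz_on_continuous_on[OF K])
  have K0: "K \<ge> 0" "L \<ge> 0" using K L by (auto intro: lipschitz_on_nonneg)
  have "lint s t (\<lambda>x. 1 * f x + (- 1) * f u) \<sigma> = 1 * lint s t f \<sigma> + (- 1) * lint s t (\<lambda>_. f u) \<sigma>"
    by (intro lint_add_left lint_integrable_cont[OF _ L] cf) auto
  also have "lint s t (\<lambda>_. f u) \<sigma> = f u * (\<sigma> t - \<sigma> s)"
    using u by (intro lint_const[OF L]) auto
  finally have eq: "lint s t f \<sigma> - f u * (\<sigma> t - \<sigma> s) = lint s t (\<lambda>x. f x - f u) \<sigma>" by simp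
  have b: "\<bar>f x - f u\<bar> \<le> K * (t - s)" if "x \<in> {s..t}" for x
  proof -
    have "\<bar>x - u\<bar> \<le> t - s" using that u by auto
    from mult_left_mono[OF this K0(1)] show ?thesis using lipschitz_real_bound[OF K, of x u] by linarith
  qed
  have meas: "(\<lambda>x. f x - f u) \<in> borel_measurable borel"
    by (intro borel_measurable_continuous_onI continuous_intros cf)
  have "(\<integral>x. indicator {s..t} x * \<bar>f x - f u\<bar> \<partial>lebesgue) \<le> (\<integral>x. indicator {s..t} x * (K * (t - s)) \<partial>lebesgue)"
  proof (rule integral_mono')
    show "integrable lebesgue (\<lambda>x. indicator {s..t} x * (K * (t - s)))"
      by (rule integrable_indicator_Icc)
  qed (use b K0 u in \<open>auto simp: indicator_def\<close>)
  also have "(\<integral>x. indicator {s..t} x * (K * (t - s)) \<partial>lebesgue) = K * (t - s)\<^sup>2"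
    using u by (simp add: power2_eq_square)
  finally have "L * (\<integral>x. indicator {s..t} x * \<bar>f x - f u\<bar> \<partial>lebesgue) \<le> L * (K * (t - s)\<^sup>2)"
    using K0 by (intro mult_left_mono)
  moreover have "\<bar>lint s t (\<lambda>x. f x - f u) \<sigma>\<bar> \<le> L * (\<integral>x. indicator {s..t} x * \<bar>f x - f u\<bar> \<partial>lebesgue)"
    using b by (rule lint_bound[OF meas _ L])
  ultimately have "\<bar>lint s t f \<sigma> - f u * (\<sigma> t - \<sigma> s)\<bar> \<le> L * (K * (t - s)\<^sup>2)"
    using eq by simp
  then show ?thesis by (simp add: mult_ac)
qed

text \<open>Quadratic increments force the derivative to be \<open>0\<close>. Together with
  \<open>lint_cell\<close> this proves integral identities by comparing increments of both sides,
  with no limit of Riemann sums.\<close>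

lemma quadratic_increments_eq:
  fixes H :: "real \<Rightarrow> real"
  assumes H: "\<And>s t. a \<le> s \<Longrightarrow> s \<le> t \<Longrightarrow> t \<le> b \<Longrightarrow> \<bar>H t - H s\<bar> \<le> C * (t - s)\<^sup>2" and "a \<le> b"
  shows "H b = H a"
proof -
  have "(H has_field_derivative 0) (at x within {a..b})" if x: "x \<in> {a..b}" for x
    unfolding has_field_derivative_def has_derivative_within_alt
  proof (intro conjI allI impI)
    show "bounded_linear ((*) (0::real))" by (rule bounded_linear_mult_right)
  next
    fix e :: real assume e: "e > 0"
    define d where "d = e / (\<bar>C\<bar> + 1)"
    have d: "d > 0" using e by (simp add: d_def add_nonneg_pos)
    have "\<bar>H y - H x\<bar> \<le> e * \<bar>y - x\<bar>" if y: "y \<in> {a..b}" "\<bar>y - x\<bar> < d" for y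
    proof -
      have "\<bar>H y - H x\<bar> \<le> C * (y - x)\<^sup>2"
      proof (cases "x \<le> y")
        case True then show ?thesis using H[of x y] x y by simp
      next
        case False then show ?thesis using H[of y x] x y by (simp add: power2_commute[of y x] abs_minus_commute[of "H y" "H x"])
      qed
      also have "\<dots> \<le> (\<bar>C\<bar> + 1) * (y - x)\<^sup>2" by (intro mult_right_mono) auto
      also have "\<dots> = (\<bar>C\<bar> + 1) * (\<bar>y - x\<bar> * \<bar>y - x\<bar>)" by (simp add: power2_eq_square)
      also have "\<dots> \<le> (\<bar>C\<bar> + 1) * (d * \<bar>y - x\<bar>)"
        using y by (intro mult_left_mono mult_right_mono) auto
      also have "\<dots> = e * \<bar>y - x\<bar>" unfolding d_def by (simp add: add_nonneg_eq_0_iff)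
      finally show ?thesis .
    qed
    then show "\<exists>d>0. \<forall>y\<in>{a..b}. norm (y - x) < d \<longrightarrow> norm (H y - H x - 0 * (y - x)) \<le> e * norm (y - x)"
      using d by auto
  qed
  then have "\<exists>c. \<forall>x\<in>{a..b}. H x = c" by (intro has_field_derivative_zero_constant) auto
  then show ?thesis using assms(2) by auto
qed

lemma lint_by_parts:
  assumes K: "K-lipschitz_on UNIV f" and L: "L-lipschitz_on UNIV \<sigma>" and ab: "a \<le> b"
  shows "lint a b f \<sigma> = f b * \<sigma> b - f a * \<sigma> a - lint a b \<sigma> f"
proof -
  note cont = lipschitz_on_continuous_on[OF K] lipschitz_on_continuous_on[OF L]
  define H where "H t = lint a t f \<sigma> + lint a t \<sigma> f - f t * \<sigma> t" for t
  have "H b = H a"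
  proof (rule quadratic_increments_eq[OF _ ab])
    fix s t assume st: "a \<le> s" "s \<le> t" "t \<le> b"
    \<comment> \<open>The sample points \<open>s\<close> and \<open>t\<close> are chosen so that
      \<open>f s (\<sigma> t - \<sigma> s) + \<sigma> t (f t - f s)\<close> is exactly the increment
      of \<open>f \<sigma>\<close>.\<close>
    have "H t - H s = (lint s t f \<sigma> - f s * (\<sigma> t - \<sigma> s)) + (lint s t \<sigma> f - \<sigma> t * (f t - f s))"
      unfolding H_def using st lint_combine_cont[OF cont(1) L, of a s t] lint_combine_cont[OF cont(2) K, of a s t]
      by (simp add: algebra_simps)
    then show "\<bar>H t - H s\<bar> \<le> (2 * (K * L)) * (t - s)\<^sup>2"
      using lint_cell[OF K L, of s s t] lint_cell[OF L K, of s t t] st by (simp add: mult_ac)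
  qed
  moreover have "lint a a g \<rho> = 0" if "M-lipschitz_on UNIV \<rho>" "continuous_on UNIV g" for g \<rho> M
    using lint_combine_cont[OF that(2,1), of a a a] by simp
  ultimately show ?thesis using K L cont by (simp add: H_def)
qed

text \<open>The derivatives of the \<open>\<rho> i\<close> need not converge at any point.
  Integration by parts puts the derivative on the Lipschitz function \<open>f\<close>, and dominated
  convergence applies to what remains.\<close>

lemma lint_tendsto:
  assumes f: "lip f" and L: "\<And>i::nat. L-lipschitz_on UNIV (\<rho> i)" and \<sigma>: "lip \<sigma>"
    and lim: "\<And>x. x \<in> {a..b} \<Longrightarrow> (\<lambda>i. \<rho> i x) \<longlonglongrightarrow> \<sigma> x" and ab: "a \<le> b"
  shows "(\<lambda>i. lint a b f (\<rho> i)) \<longlonglongrightarrow> lint a b f \<sigma>"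
proof -
  obtain K where K: "K-lipschitz_on UNIV f" using f by (auto simp: lip_def)
  obtain M where M: "M-lipschitz_on UNIV \<sigma>" using \<sigma> by (auto simp: lip_def)
  \<comment> \<open>The values at \<open>a\<close> converge, hence are bounded, and the common
    constant \<open>L\<close> spreads the bound over \<open>[a, b]\<close>.\<close>
  have "(\<lambda>i. \<rho> i a) \<longlonglongrightarrow> \<sigma> a" using lim ab by simp
  then have "Bseq (\<lambda>i. \<rho> i a)" by (rule convergent_imp_Bseq[OF convergentI])
  then obtain B where B: "\<And>i. \<bar>\<rho> i a\<bar> \<le> B" unfolding Bseq_def real_norm_def by blast
  have L0: "L \<ge> 0" using L by (rule lipschitz_on_nonneg)
  have bd: "\<bar>\<rho> i x\<bar> \<le> B + L * (b - a)" if "x \<in> {a..b}" for i x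
    using lipschitz_real_bound[OF L[of i], of x a] B[of i] that L0 mult_left_mono[of "\<bar>x - a\<bar>" "b - a" L] by simp
  have "(\<lambda>i. lint a b (\<rho> i) f) \<longlonglongrightarrow> lint a b \<sigma> f"
    unfolding lint_def
  proof (rule integral_dominated_convergence[where w="\<lambda>x. indicator {a..b} x * ((B + L * (b - a)) * K)"])
    show "(\<lambda>x. indicator {a..b} x * (\<sigma> x * deriv f x)) \<in> borel_measurable lebesgue"
      using lint_integrable_cont[OF lipschitz_on_continuous_on[OF M] K] by (rule borel_measurable_integrable)
    show "(\<lambda>x. indicator {a..b} x * (\<rho> i x * deriv f x)) \<in> borel_measurable lebesgue" for i
      using lint_integrable_cont[OF lipschitz_on_continuous_on[OF L[of i]] K] by (rule borel_measurable_integrable)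
    show "integrable lebesgue (\<lambda>x. indicator {a..b} x * ((B + L * (b - a)) * K))"
      by (rule integrable_indicator_Icc)
    show "AE x in lebesgue. (\<lambda>i. indicator {a..b} x * (\<rho> i x * deriv f x)) \<longlonglongrightarrow> indicator {a..b} x * (\<sigma> x * deriv f x)"
      using lim by (intro AE_I2) (auto simp: indicator_def intro!: tendsto_intros)
    show "AE x in lebesgue. norm (indicator {a..b} x * (\<rho> i x * deriv f x)) \<le> indicator {a..b} x * ((B + L * (b - a)) * K)" for i
      using lipschitz_AE_deriv_le[OF K]
    proof eventually_elim
      case (elim x)
      show ?case
      proof (cases "x \<in> {a..b}")
        case True
        have "\<bar>\<rho> i x\<bar> * \<bar>deriv f x\<bar> \<le> (B + L * (b - a)) * K"
          using bd[OF True, of i] elim by (intro mult_mono) auto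
        then show ?thesis using True by (simp add: abs_mult)
      qed simp
    qed
  qed
  then have "(\<lambda>i. f b * \<rho> i b - f a * \<rho> i a - lint a b (\<rho> i) f) \<longlonglongrightarrow> f b * \<sigma> b - f a * \<sigma> a - lint a b \<sigma> f"
    using lim ab by (intro tendsto_intros) auto
  then show ?thesis by (simp add: lint_by_parts[OF K L ab] lint_by_parts[OF K M ab])
qed

text \<open>The degree over the line of a path from \<open>c\<close> to \<open>d\<close>:
  \<open>1\<close> between the ends if \<open>c < d\<close>, \<open>-1\<close> if
  \<open>d < c\<close>, and identically \<open>0\<close> if \<open>c = d\<close>.\<close>

definition oriented_indicator :: "real \<Rightarrow> real \<Rightarrow> real \<Rightarrow> real" where
  "oriented_indicator c d y = indicator {c..d} y - indicator {d..c} y"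

lemma oriented_indicator_integral:
  assumes f: "continuous_on UNIV f" and L: "L-lipschitz_on UNIV \<sigma>" and m: "m \<le> c" "m \<le> d"
  shows "(\<integral>y. oriented_indicator c d y * f y * deriv \<sigma> y \<partial>lebesgue) = lint m d f \<sigma> - lint m c f \<sigma>"
proof -
  note i = lint_integrable_cont[OF f L]
  have z: "lint x y f \<sigma> = 0" if "y \<le> x" for x y
  proof (cases "x = y")
    case True then show ?thesis using lint_combine_cont[OF f L, of x x x] by simp
  next
    case False then show ?thesis using that by (simp add: lint_def)
  qed
  have "(\<integral>y. oriented_indicator c d y * f y * deriv \<sigma> y \<partial>lebesgue)
    = (\<integral>y. indicator {c..d} y * (f y * deriv \<sigma> y) - indicator {d..c} y * (f y * deriv \<sigma> y) \<partial>lebesgue)"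
    unfolding oriented_indicator_def by (intro Bochner_Integration.integral_cong) (auto simp: algebra_simps)
  also have "\<dots> = lint c d f \<sigma> - lint d c f \<sigma>" unfolding lint_def using i by simp
  also have "\<dots> = lint m d f \<sigma> - lint m c f \<sigma>"
    using m lint_combine_cont[OF f L, of m c d] lint_combine_cont[OF f L, of m d c] z[of c d] z[of d c]
    by (cases "c \<le> d") auto
  finally show ?thesis .
qed

text \<open>As functions of the upper end, both sides have the same increments up to a multiple of
  \<open>(t - s)^2\<close>. This covers paths that turn back, whose overlaps cancel by orientation,
  and it avoids a chain rule at points where \<open>\<pi>\<close> is not differentiable.\<close>

theorem lint_substitution:
  assumes f: "lip f" and \<pi>: "lip \<pi>" and \<phi>: "lip \<phi>" and ab: "a \<le> b"
  shows "lint a b (f \<circ> \<phi>) (\<pi> \<circ> \<phi>) = (\<integral>y. oriented_indicator (\<phi> a) (\<phi> b) y * f y * deriv \<pi> y \<partial>lebesgue)"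
proof -
  obtain K where K: "K-lipschitz_on UNIV f" using f by (auto simp: lip_def)
  obtain L where L: "L-lipschitz_on UNIV \<pi>" using \<pi> by (auto simp: lip_def)
  obtain M where M: "M-lipschitz_on UNIV \<phi>" using \<phi> by (auto simp: lip_def)
  have K0: "K \<ge> 0" "L \<ge> 0" "M \<ge> 0" using K L M by (auto intro: lipschitz_on_nonneg)
  have KM: "(K * M)-lipschitz_on UNIV (f \<circ> \<phi>)" and LM: "(L * M)-lipschitz_on UNIV (\<pi> \<circ> \<phi>)"
    by (rule lipschitz_on_compose[OF M lipschitz_on_subset[OF K]]; simp)
       (rule lipschitz_on_compose[OF M lipschitz_on_subset[OF L]]; simp)
  note cf = lipschitz_on_continuous_on[OF K] and cfp = lipschitz_on_continuous_on[OF KM]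
  obtain m0 where m0: "\<And>x. x \<in> {a..b} \<Longrightarrow> \<bar>\<phi> x\<bar> \<le> m0"
    using continuous_bounded_Icc[OF lipschitz_on_continuous_on[OF M], of a b] by blast
  \<comment> \<open>A common lower bound of \<open>\<phi>\<close> on \<open>[a, b]\<close> serves as
    base point, so that signed integrals between values of \<open>\<phi>\<close> become differences
    of integrals from \<open>m\<close>.\<close>
  define m where "m = - m0"
  have m: "m \<le> \<phi> x" if "x \<in> {a..b}" for x using m0[OF that] unfolding m_def by linarith
  define H where "H t = lint a t (f \<circ> \<phi>) (\<pi> \<circ> \<phi>) - lint m (\<phi> t) f \<pi>" for t
  have "H b = H a"
  proof (rule quadratic_increments_eq[OF _ ab])
    fix s t assume st: "a \<le> s" "s \<le> t" "t \<le> b"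
    let ?E = "f (\<phi> s) * (\<pi> (\<phi> t) - \<pi> (\<phi> s))"
    have "\<bar>lint m (\<phi> t) f \<pi> - lint m (\<phi> s) f \<pi> - ?E\<bar> \<le> K * L * (\<phi> t - \<phi> s)\<^sup>2"
    \<comment> \<open>The sample point is \<open>\<phi> s\<close> in both cases: the left end of the
      cell in one, the right end in the other.\<close>
    proof (cases "\<phi> s \<le> \<phi> t")
      case True
      then show ?thesis
        using lint_combine_cont[OF cf L, of m "\<phi> s" "\<phi> t"] lint_cell[OF K L, of "\<phi> s" "\<phi> s" "\<phi> t"] m[of s] st by simp
    next
      case False
      then show ?thesis
        using lint_combine_cont[OF cf L, of m "\<phi> t" "\<phi> s"] lint_cell[OF K L, of "\<phi> t" "\<phi> s" "\<phi> s"] m[of t] st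
        by (simp add: power2_commute[of "\<phi> t"] right_diff_distrib abs_le_iff)
    qed
    also have "\<dots> \<le> K * L * (M\<^sup>2 * (t - s)\<^sup>2)"
    proof (rule mult_left_mono)
      have "\<bar>\<phi> t - \<phi> s\<bar>\<^sup>2 \<le> (M * \<bar>t - s\<bar>)\<^sup>2"
        using lipschitz_real_bound[OF M] by (intro power_mono) auto
      then show "(\<phi> t - \<phi> s)\<^sup>2 \<le> M\<^sup>2 * (t - s)\<^sup>2" by (simp add: power_mult_distrib)
    qed (use K0 in auto)
    finally have 1: "\<bar>lint m (\<phi> t) f \<pi> - lint m (\<phi> s) f \<pi> - ?E\<bar> \<le> K * L * (M\<^sup>2 * (t - s)\<^sup>2)" .
    have "\<bar>lint s t (f \<circ> \<phi>) (\<pi> \<circ> \<phi>) - ?E\<bar> \<le> K * M * (L * M) * (t - s)\<^sup>2"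
      using lint_cell[OF KM LM, of s s t] st by simp
    then have 2: "\<bar>lint s t (f \<circ> \<phi>) (\<pi> \<circ> \<phi>) - ?E\<bar> \<le> K * L * (M\<^sup>2 * (t - s)\<^sup>2)"
      by (simp add: power2_eq_square mult_ac)
    have "H t - H s = lint s t (f \<circ> \<phi>) (\<pi> \<circ> \<phi>) - (lint m (\<phi> t) f \<pi> - lint m (\<phi> s) f \<pi>)"
      unfolding H_def using lint_combine_cont[OF cfp LM, of a s t] st by simp
    then have "\<bar>H t - H s\<bar> \<le> 2 * (K * L * (M\<^sup>2 * (t - s)\<^sup>2))" using 1 2 by linarith
    then show "\<bar>H t - H s\<bar> \<le> (2 * (K * L * M\<^sup>2)) * (t - s)\<^sup>2" by (simp add: mult_ac)
  qed
  moreover have "lint a a (f \<circ> \<phi>) (\<pi> \<circ> \<phi>) = 0"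
    using lint_combine_cont[OF cfp LM, of a a a] by simp
  ultimately have "lint a b (f \<circ> \<phi>) (\<pi> \<circ> \<phi>) = lint m (\<phi> b) f \<pi> - lint m (\<phi> a) f \<pi>"
    by (simp add: H_def)
  also have "\<dots> = (\<integral>y. oriented_indicator (\<phi> a) (\<phi> b) y * f y * deriv \<pi> y \<partial>lebesgue)"
    using oriented_indicator_integral[OF cf L, of m "\<phi> a" "\<phi> b"] m ab by simp
  finally show ?thesis .
qed

section \<open>Metric currents and their mass measure\<close>

lemma lipI: "L-lipschitz_on UNIV f \<Longrightarrow> lip f"
  by (auto simp: lip_def)

lemma lipE:
  assumes "lip f"
  obtains L where "L \<ge> 0" "L-lipschitz_on UNIV f"
  using assms lipschitz_on_nonneg by (auto simp: lip_def)

lemma lip_continuous: "lip f \<Longrightarrow> continuous_on UNIV f"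
  by (auto simp: lip_def intro: lipschitz_on_continuous_on)

lemma lip_compose: "lip f \<Longrightarrow> lip g \<Longrightarrow> lip (g \<circ> f)"
  unfolding lip_def by (meson lipschitz_on_compose lipschitz_on_subset top_greatest)

lemma lip_const [simp]: "lip (\<lambda>_. c)"
  using lipI[OF lipschitz_on_constant[of UNIV c]] .

lemma lip_lincomb:
  fixes f g :: "'a::metric_space \<Rightarrow> real"
  assumes "lip f" "lip g"
  shows "lip (\<lambda>x. a * f x + b * g x)"
proof -
  obtain L where "L-lipschitz_on UNIV f" using assms(1) by (rule lipE) blast
  moreover obtain M where "M-lipschitz_on UNIV g" using assms(2) by (rule lipE) blast
  ultimately show ?thesis by (intro lipI) (rule lipschitz_lincomb)
qed

lemma lip_bdd_lip: "lip_bdd f \<Longrightarrow> lip f"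
  by (simp add: lip_bdd_def)

lemma lip_bddI: "lip f \<Longrightarrow> (\<And>x. \<bar>f x\<bar> \<le> B) \<Longrightarrow> lip_bdd f"
  by (auto simp: lip_bdd_def bounded_iff)

lemma lip_bddE:
  assumes "lip_bdd f"
  obtains B where "B \<ge> 0" "\<And>x. \<bar>f x\<bar> \<le> B"
proof -
  obtain B where "\<And>x. \<bar>f x\<bar> \<le> B"
    using assms unfolding lip_bdd_def bounded_iff by auto
  then show thesis by (meson abs_ge_zero order_trans that)
qed

lemma lip_bdd_measurable: "lip_bdd f \<Longrightarrow> f \<in> borel_measurable borel"
  by (intro borel_measurable_continuous_onI lip_continuous lip_bdd_lip)

lemma lip_bdd_const [simp]: "lip_bdd (\<lambda>_. c)"
  by (rule lip_bddI[of _ "\<bar>c\<bar>"]) auto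

lemma lip_bdd_lincomb:
  assumes "lip_bdd f" "lip_bdd g"
  shows "lip_bdd (\<lambda>x. a * f x + b * g x)"
proof -
  obtain B where "\<And>x. \<bar>f x\<bar> \<le> B" using assms(1) by (rule lip_bddE) blast
  moreover obtain C where "\<And>x. \<bar>g x\<bar> \<le> C" using assms(2) by (rule lip_bddE) blast
  ultimately have "\<bar>a * f x + b * g x\<bar> \<le> \<bar>a\<bar> * B + \<bar>b\<bar> * C" for x
    using abs_triangle_ineq[of "a * f x" "b * g x"] mult_left_mono[of "\<bar>f x\<bar>" B "\<bar>a\<bar>"] mult_left_mono[of "\<bar>g x\<bar>" C "\<bar>b\<bar>"]
    by (simp add: abs_mult)
  then show ?thesis
    by (rule lip_bddI[OF lip_lincomb[OF lip_bdd_lip[OF assms(1)] lip_bdd_lip[OF assms(2)]]])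
qed

lemma lip_bdd_diff: "lip_bdd f \<Longrightarrow> lip_bdd g \<Longrightarrow> lip_bdd (\<lambda>x. f x - g x)"
  using lip_bdd_lincomb[of f g 1 "-1"] by simp

lemma lip_bdd_add: "lip_bdd f \<Longrightarrow> lip_bdd g \<Longrightarrow> lip_bdd (\<lambda>x. f x + g x)"
  using lip_bdd_lincomb[of f g 1 1] by simp

lemma lip_bdd_sum: "(\<And>i. i \<in> I \<Longrightarrow> lip_bdd (f i)) \<Longrightarrow> lip_bdd (\<lambda>x. \<Sum>i\<in>I. f i x)"
  by (induction I rule: infinite_finite_induct) (auto intro: lip_bdd_add)

lemma lip_bdd_mult:
  assumes "lip_bdd f" "lip_bdd g"
  shows "lip_bdd (\<lambda>x. f x * g x)"
proof -
  obtain B where B: "B \<ge> 0" "\<And>x. \<bar>f x\<bar> \<le> B" using assms(1) by (rule lip_bddE) blast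
  obtain C where C: "C \<ge> 0" "\<And>x. \<bar>g x\<bar> \<le> C" using assms(2) by (rule lip_bddE) blast
  obtain K where K: "K \<ge> 0" "K-lipschitz_on UNIV f" using lip_bdd_lip[OF assms(1)] by (rule lipE) blast
  obtain L where L: "L \<ge> 0" "L-lipschitz_on UNIV g" using lip_bdd_lip[OF assms(2)] by (rule lipE) blast
  have "(B * L + C * K)-lipschitz_on UNIV (\<lambda>x. f x * g x)"
  proof (rule lipschitz_onI)
    fix x y
    have "f x * g x - f y * g y = f x * (g x - g y) + g y * (f x - f y)" by (simp add: algebra_simps)
    then have "\<bar>f x * g x - f y * g y\<bar> \<le> \<bar>f x\<bar> * \<bar>g x - g y\<bar> + \<bar>g y\<bar> * \<bar>f x - f y\<bar>"
      by (metis abs_mult abs_triangle_ineq)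
    also have "\<dots> \<le> B * (L * dist x y) + C * (K * dist x y)"
      using B C lipschitz_onD[OF K(2), of x y] lipschitz_onD[OF L(2), of x y]
      by (intro add_mono mult_mono) (auto simp: dist_real_def)
    finally show "dist (f x * g x) (f y * g y) \<le> (B * L + C * K) * dist x y"
      by (simp add: dist_real_def algebra_simps)
  qed (use B C K L in auto)
  moreover have "\<bar>f x * g x\<bar> \<le> B * C" for x
    unfolding abs_mult using B C by (intro mult_mono) auto
  ultimately show ?thesis by (rule lip_bddI[OF lipI])
qed

lemma lip_min_max:
  fixes f :: "'a::metric_space \<Rightarrow> real"
  assumes "lip f" shows "lip (\<lambda>x. min c (f x))" "lip (\<lambda>x. max c (f x))"
proof -
  obtain L where L: "L \<ge> 0" "L-lipschitz_on UNIV f" using assms by (rule lipE) blast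
  have "L-lipschitz_on UNIV (\<lambda>x. min c (f x))" "L-lipschitz_on UNIV (\<lambda>x. max c (f x))"
  proof (safe intro!: lipschitz_onI L(1))
    fix x y
    have "\<bar>f x - f y\<bar> \<le> L * dist x y" using lipschitz_onD[OF L(2), of x y] by (simp add: dist_real_def)
    then show "dist (min c (f x)) (min c (f y)) \<le> L * dist x y" "dist (max c (f x)) (max c (f y)) \<le> L * dist x y"
      by (auto simp: dist_real_def)
  qed
  then show "lip (\<lambda>x. min c (f x))" "lip (\<lambda>x. max c (f x))" by (auto intro: lipI)
qed

lemma lip_bdd_compose: "lip_bdd f \<Longrightarrow> lip \<phi> \<Longrightarrow> lip_bdd (f \<circ> \<phi>)"
  by (auto simp: lip_bdd_def intro: lip_compose bounded_subset)

text \<open>The case \<open>U = UNIV\<close> is separate because \<open>infdist\<close> to the empty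
  set is \<open>0\<close>. With growing \<open>n\<close> the cutoffs fill an open \<open>U\<close>
  from inside while each stays Lipschitz.\<close>

definition cutoff :: "'a::metric_space set \<Rightarrow> nat \<Rightarrow> 'a \<Rightarrow> real" where
  "cutoff U n x = (if U = UNIV then 1 else min 1 (real n * infdist x (- U)))"

lemma cutoff_range: "0 \<le> cutoff U n x" "cutoff U n x \<le> 1"
  by (auto simp: cutoff_def infdist_nonneg)

lemma cutoff_lip_bdd: "lip_bdd (cutoff U n)"
proof -
  have "1-lipschitz_on UNIV (\<lambda>x. infdist x (- U))"
    by (rule lipschitz_onI) (auto simp: dist_real_def infdist_triangle_abs)
  then have "lip (\<lambda>x. real n * infdist x (- U))"
    using lip_lincomb[OF lipI lip_const, of 1 "\<lambda>x. infdist x (- U)" "real n" 0] by simp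
  then have "lip (\<lambda>x. min 1 (real n * infdist x (- U)))" by (rule lip_min_max)
  then have "lip (cutoff U n)" by (cases "U = UNIV") (auto simp: cutoff_def[abs_def])
  then show ?thesis by (intro lip_bddI[of _ 1]) (auto simp: abs_of_nonneg cutoff_range)
qed

lemma cutoff_outside: "x \<notin> U \<Longrightarrow> cutoff U n x = 0"
  by (auto simp: cutoff_def)

lemma cutoff_tendsto:
  assumes "open U"
  shows "(\<lambda>n. cutoff U n x) \<longlonglongrightarrow> indicator U x"
proof (cases "x \<in> U \<and> U \<noteq> UNIV")
  case True
  then have d: "infdist x (- U) > 0"
    using assms by (intro infdist_pos_not_in_closed) (auto simp: closed_def)
  obtain N where "real N * infdist x (- U) > 1"
    using reals_Archimedean3[OF d] by auto
  then have "real n * infdist x (- U) \<ge> 1" if "n \<ge> N" for n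
  proof -
    have "real N * infdist x (- U) \<le> real n * infdist x (- U)" using that d by (intro mult_right_mono) auto
    then show ?thesis using \<open>real N * infdist x (- U) > 1\<close> by linarith
  qed
  then have "eventually (\<lambda>n. cutoff U n x = 1) sequentially"
    using True by (auto simp: cutoff_def eventually_sequentially intro!: exI[of _ N])
  then show ?thesis using True by (simp add: tendsto_eventually)
next
  case False
  then show ?thesis by (cases "x \<in> U") (auto simp: cutoff_outside, simp add: cutoff_def)
qed

section \<open>Finite Borel measures and approximation in L1\<close>

locale finite_borel = finite_measure \<mu> for \<mu> :: "'a::metric_space measure" +
  assumes sets_borel: "sets \<mu> = sets borel"
begin

lemma space_UNIV [simp]: "space \<mu> = UNIV"
  using sets_borel by (metis sets_eq_imp_space_eq space_borel)

lemma measurable_borel: "measurable \<mu> N = measurable borel N"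
  using sets_borel by (rule measurable_cong_sets) simp

lemma integrable_bounded:
  fixes g :: "'a \<Rightarrow> real"
  assumes "g \<in> borel_measurable borel" "\<And>x. \<bar>g x\<bar> \<le> B"
  shows "integrable \<mu> g"
  using assms by (intro integrable_const_bound[of _ B]) (auto simp: measurable_borel)

lemma integrable_lip_bdd: "lip_bdd f \<Longrightarrow> integrable \<mu> f"
  by (metis integrable_bounded lip_bddE lip_bdd_measurable)

lemma nn_integral_abs_eq:
  assumes "g \<in> borel_measurable borel" "\<And>x. \<bar>g x\<bar> \<le> B"
  shows "(\<integral>\<^sup>+x. ennreal \<bar>g x\<bar> \<partial>\<mu>) = ennreal (\<integral>x. \<bar>g x\<bar> \<partial>\<mu>)"
  using assms by (intro nn_integral_eq_integral integrable_bounded[of _ B]) auto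

lemma bounded_convergence:
  fixes g :: "nat \<Rightarrow> 'a \<Rightarrow> real"
  assumes "\<And>n. g n \<in> borel_measurable borel" "h \<in> borel_measurable borel"
    and "\<And>n x. \<bar>g n x\<bar> \<le> B" "\<And>x. (\<lambda>n. g n x) \<longlonglongrightarrow> h x"
  shows "(\<lambda>n. \<integral>x. g n x \<partial>\<mu>) \<longlonglongrightarrow> (\<integral>x. h x \<partial>\<mu>)"
  by (rule integral_dominated_convergence[where w="\<lambda>_. B"]) (use assms in \<open>auto simp: measurable_borel\<close>)

lemma cutoff_L1:
  assumes "open U"
  shows "(\<lambda>n. \<integral>x. \<bar>cutoff U n x - indicator U x\<bar> \<partial>\<mu>) \<longlonglongrightarrow> 0"
proof -
  have "(\<lambda>n. \<integral>x. \<bar>cutoff U n x - indicator U x\<bar> \<partial>\<mu>) \<longlonglongrightarrow> (\<integral>x. 0 \<partial>\<mu>)"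
  proof (rule bounded_convergence[where B=2])
    show "(\<lambda>x. \<bar>cutoff U n x - indicator U x\<bar>) \<in> borel_measurable borel" for n
      using assms by (intro borel_measurable_abs borel_measurable_diff lip_bdd_measurable cutoff_lip_bdd borel_measurable_indicator) auto
    show "(\<lambda>n. \<bar>cutoff U n x - indicator U x\<bar>) \<longlonglongrightarrow> 0" for x
      using cutoff_tendsto[OF assms, of x] by (intro tendsto_rabs_zero) (simp add: LIM_zero)
    show "\<bar>\<bar>cutoff U n x - indicator U x\<bar>\<bar> \<le> 2" for n x
      using cutoff_range[of U n x] by (auto simp: indicator_def)
  qed auto
  then show ?thesis by simp
qed

end

text \<open>The sets with such approximations include the open sets, through cutoffs, and are closed
  under complements and countable disjoint unions, so they are all Borel sets. One
  \<open>\<xi>\<close> serves two measures, because a test function will be split between two mass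
  bounds.\<close>

lemma lipschitz_dense_indicator:
  assumes \<mu>: "finite_borel \<mu>" and \<nu>: "finite_borel \<nu>" and B: "B \<in> sets borel" and e: "0 < e"
  shows "\<exists>\<xi>. lip_bdd \<xi> \<and> (\<forall>x. 0 \<le> \<xi> x \<and> \<xi> x \<le> 1) \<and>
     (\<integral>x. \<bar>\<xi> x - indicator B x\<bar> \<partial>\<mu>) < e \<and> (\<integral>x. \<bar>\<xi> x - indicator B x\<bar> \<partial>\<nu>) < e"
proof -
  let ?Q = "\<lambda>B e \<xi>. lip_bdd \<xi> \<and> (\<forall>x. 0 \<le> \<xi> x \<and> \<xi> x \<le> 1) \<and>
     (\<integral>x. \<bar>\<xi> x - indicator B x\<bar> \<partial>\<mu>) < e \<and> (\<integral>x. \<bar>\<xi> x - indicator B x\<bar> \<partial>\<nu>) < e"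
  have "B \<in> sigma_sets UNIV {S. open S}" using B by (simp add: borel_def)
  then have "\<forall>e>0. \<exists>\<xi>. ?Q B e \<xi>"
  proof (induction rule: sigma_sets_induct_disjoint[rotated 2, consumes 1])
    show "Int_stable {S. open S}" by (auto simp: Int_stable_def)
  next
    fix U :: "'a set" assume "U \<in> {S. open S}"
    then have U: "open U" by simp
    show "\<forall>e>0. \<exists>\<xi>. ?Q U e \<xi>"
    proof (intro allI impI)
      fix e :: real assume "e > 0"
      have "\<forall>\<^sub>F n in sequentially. (\<integral>x. \<bar>cutoff U n x - indicator U x\<bar> \<partial>\<mu>) < e \<and> (\<integral>x. \<bar>cutoff U n x - indicator U x\<bar> \<partial>\<nu>) < e"
        using finite_borel.cutoff_L1[OF \<mu> U] finite_borel.cutoff_L1[OF \<nu> U] \<open>e > 0\<close>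
        by (intro eventually_conj order_tendstoD(2)[where a=e]) auto
      then obtain n where "(\<integral>x. \<bar>cutoff U n x - indicator U x\<bar> \<partial>\<mu>) < e \<and> (\<integral>x. \<bar>cutoff U n x - indicator U x\<bar> \<partial>\<nu>) < e"
        by (auto simp: eventually_sequentially)
      then show "\<exists>\<xi>. ?Q U e \<xi>"
        by (intro exI[of _ "cutoff U n"]) (simp add: cutoff_lip_bdd cutoff_range)
    qed
  next
    show "\<forall>e>0. \<exists>\<xi>. ?Q {} e \<xi>"
      by (auto intro!: exI[of _ "\<lambda>_. 0"])
  next
    fix A :: "'a set" assume IH: "\<forall>e>0. \<exists>\<xi>. ?Q A e \<xi>"
    show "\<forall>e>0. \<exists>\<xi>. ?Q (UNIV - A) e \<xi>"
    proof (intro allI impI)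
      fix e :: real assume "e > 0"
      then obtain \<xi> where \<xi>: "?Q A e \<xi>" using IH by blast
      have "\<bar>(1 - \<xi> x) - indicator (UNIV - A) x\<bar> = \<bar>\<xi> x - indicator A x\<bar>" for x
        by (auto simp: indicator_def)
      then show "\<exists>\<xi>. ?Q (UNIV - A) e \<xi>"
        using \<xi> lip_bdd_diff[of "\<lambda>_. 1" \<xi>] by (intro exI[of _ "\<lambda>x. 1 - \<xi> x"]) simp
    qed
  next
    fix A :: "nat \<Rightarrow> 'a set"
    assume A: "disjoint_family A" "range A \<subseteq> sigma_sets UNIV {S. open S}" and IH: "\<And>i. \<forall>e>0. \<exists>\<xi>. ?Q (A i) e \<xi>"
    then have Am: "A i \<in> sets borel" for i by (auto simp: borel_def)
    show "\<forall>e>0. \<exists>\<xi>. ?Q (\<Union>i. A i) e \<xi>"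
    proof (intro allI impI)
      fix e :: real assume e: "e > 0"
      define C where "C n = (\<Union>i<n. A i)" for n
      have Cm: "C n \<in> sets borel" for n unfolding C_def using Am by auto
      have tail: "(\<lambda>n. measure M ((\<Union>i. A i) - C n)) \<longlonglongrightarrow> 0" if "finite_borel M" for M
      proof -
        interpret M: finite_borel M by fact
        have "(\<lambda>n. measure M ((\<Union>i. A i) - C n)) \<longlonglongrightarrow> measure M (\<Inter>n. (\<Union>i. A i) - C n)"
          using Am Cm by (intro M.finite_Lim_measure_decseq) (auto simp: M.sets_borel decseq_def C_def)
        moreover have "(\<Inter>n. (\<Union>i. A i) - C n) = {}" unfolding C_def by auto
        ultimately have "(\<lambda>n. measure M ((\<Union>i. A i) - C n)) \<longlonglongrightarrow> measure M {}" by (simp only:)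
        then show ?thesis by simp
      qed
      have "\<forall>\<^sub>F n in sequentially. measure \<mu> ((\<Union>i. A i) - C n) < e / 2 \<and> measure \<nu> ((\<Union>i. A i) - C n) < e / 2"
        using tail[OF \<mu>] tail[OF \<nu>] e by (intro eventually_conj order_tendstoD(2)[where a="e / 2"]) auto
      then obtain n where n: "measure \<mu> ((\<Union>i. A i) - C n) < e / 2" "measure \<nu> ((\<Union>i. A i) - C n) < e / 2"
        by (auto simp: eventually_sequentially)
      \<comment> \<open>The \<open>n\<close> pieces of a finite union share one half of
        \<open>e\<close>, and the tail of the union takes the other; \<open>n + 1\<close> avoids
        division by \<open>0\<close>.\<close>
      have "\<exists>\<xi>. ?Q (A i) (e / (2 * (real n + 1))) \<xi>" for i using IH[of i] e by simp
      then have "\<exists>\<xi>. \<forall>i. ?Q (A i) (e / (2 * (real n + 1))) (\<xi> i)" by (intro choice allI)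
      then obtain \<xi> where \<xi>': "\<forall>i. ?Q (A i) (e / (2 * (real n + 1))) (\<xi> i)" by (rule exE)
      then have \<xi>: "?Q (A i) (e / (2 * (real n + 1))) (\<xi> i)" for i by (rule spec)
      \<comment> \<open>Truncation at \<open>1\<close> keeps the values in \<open>[0, 1]\<close> and
        increases no distance to the indicator of \<open>C n\<close>, which is itself the truncated
        sum of the indicators.\<close>
      define \<psi> where "\<psi> x = min 1 (\<Sum>i<n. \<xi> i x)" for x
      have \<psi>01: "0 \<le> \<psi> x \<and> \<psi> x \<le> 1" for x using \<xi> by (auto simp: \<psi>_def intro: sum_nonneg)
      have "lip (\<lambda>x. \<Sum>i<n. \<xi> i x)" using \<xi> by (intro lip_bdd_lip lip_bdd_sum) auto
      then have "lip \<psi>" unfolding \<psi>_def[abs_def] by (rule lip_min_max)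
      then have \<psi>: "lip_bdd \<psi>" using \<psi>01 by (intro lip_bddI[of _ 1]) (auto simp: abs_of_nonneg)
      have pt: "\<bar>\<psi> x - indicator (\<Union>i. A i) x\<bar> \<le> (\<Sum>i<n. \<bar>\<xi> i x - indicator (A i) x\<bar>) + indicator ((\<Union>i. A i) - C n) x" for x
      proof -
        have "indicator (C n) x = (min 1 (\<Sum>i<n. indicator (A i) x) :: real)"
        proof (cases "x \<in> C n")
          case True
          then obtain j where j: "j < n" "x \<in> A j" by (auto simp: C_def)
          have "(1::real) = (\<Sum>i\<in>{j}. indicator (A i) x)" using j by simp
          also have "\<dots> \<le> (\<Sum>i<n. indicator (A i) x)" using j by (intro sum_mono2) auto
          finally show ?thesis using True by simp
        next
          case False
          then have "(\<Sum>i<n. indicator (A i) x) = (0::real)" by (intro sum.neutral) (auto simp: C_def)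
          then show ?thesis using False by simp
        qed
        then have "\<bar>\<psi> x - indicator (C n) x\<bar> \<le> \<bar>(\<Sum>i<n. \<xi> i x) - (\<Sum>i<n. indicator (A i) x)\<bar>"
          unfolding \<psi>_def by linarith
        also have "\<dots> \<le> (\<Sum>i<n. \<bar>\<xi> i x - indicator (A i) x\<bar>)"
          unfolding sum_subtractf[symmetric] by (rule sum_abs)
        finally have "\<bar>\<psi> x - indicator (C n) x\<bar> \<le> (\<Sum>i<n. \<bar>\<xi> i x - indicator (A i) x\<bar>)" .
        moreover have "indicator (\<Union>i. A i) x = (indicator (C n) x + indicator ((\<Union>i. A i) - C n) x :: real)"
          by (auto simp: indicator_def C_def)
        moreover have "(0::real) \<le> indicator ((\<Union>i. A i) - C n) x" by simp
        ultimately show ?thesis by linarith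
      qed
      have fin: "(\<integral>x. \<bar>\<psi> x - indicator (\<Union>i. A i) x\<bar> \<partial>M) < e"
        if M: "finite_borel M" and tl: "measure M ((\<Union>i. A i) - C n) < e / 2"
          and sm: "\<And>i. (\<integral>x. \<bar>\<xi> i x - indicator (A i) x\<bar> \<partial>M) < e / (2 * (real n + 1))" for M
      proof -
        interpret M: finite_borel M by fact
        have i1: "integrable M (\<lambda>x. \<bar>\<xi> i x - indicator (A i) x\<bar>)" for i
          using \<xi>[of i] Am by (intro integrable_abs Bochner_Integration.integrable_diff M.integrable_lip_bdd M.integrable_bounded[of "indicator (A i)" 1]) auto
        have i2: "integrable M (indicator ((\<Union>i. A i) - C n) :: _ \<Rightarrow> real)"
          using Am Cm by (intro M.integrable_bounded[of _ 1]) auto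
        have "(\<integral>x. \<bar>\<psi> x - indicator (\<Union>i. A i) x\<bar> \<partial>M)
            \<le> (\<integral>x. (\<Sum>i<n. \<bar>\<xi> i x - indicator (A i) x\<bar>) + indicator ((\<Union>i. A i) - C n) x \<partial>M)"
          using i1 i2 pt by (intro integral_mono') auto
        also have "\<dots> = (\<Sum>i<n. \<integral>x. \<bar>\<xi> i x - indicator (A i) x\<bar> \<partial>M) + measure M ((\<Union>i. A i) - C n)"
          using i1 i2 Am Cm by (subst Bochner_Integration.integral_add) (auto simp: M.sets_borel)
        also have "\<dots> \<le> (\<Sum>i<n. e / (2 * (real n + 1))) + measure M ((\<Union>i. A i) - C n)"
          using sm by (intro add_right_mono sum_mono less_imp_le)
        also have "(\<Sum>i<n. e / (2 * (real n + 1))) \<le> e / 2" using e by (simp add: field_simps)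
        finally show ?thesis using tl by simp
      qed
      show "\<exists>\<xi>. ?Q (\<Union>i. A i) e \<xi>"
        using \<psi> \<psi>01 fin[OF \<mu> n(1)] fin[OF \<nu> n(2)] \<xi> by (intro exI[of _ \<psi>]) auto
    qed
  qed auto
  then show ?thesis using e by blast
qed

section \<open>Mass bounds and the least one among them\<close>

lemma mass_bound_finite_borel: "mass_bound T \<mu> \<Longrightarrow> finite_borel \<mu>"
  by (auto simp: mass_bound_def finite_borel_def finite_borel_axioms_def)

lemma mass_boundD:
  "mass_bound T \<mu> \<Longrightarrow> lip_bdd f \<Longrightarrow> L-lipschitz_on UNIV \<pi> \<Longrightarrow> \<bar>T f \<pi>\<bar> \<le> L * (\<integral>x. \<bar>f x\<bar> \<partial>\<mu>)"
  by (auto simp: mass_bound_def)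

lemma current1_lincomb:
  "current1 T \<Longrightarrow> lip_bdd f \<Longrightarrow> lip_bdd g \<Longrightarrow> lip \<pi> \<Longrightarrow> T (\<lambda>x. a * f x + b * g x) \<pi> = a * T f \<pi> + b * T g \<pi>"
  by (simp add: current1_def)

lemma current1_diff:
  "current1 T \<Longrightarrow> lip_bdd f \<Longrightarrow> lip_bdd g \<Longrightarrow> lip \<pi> \<Longrightarrow> T (\<lambda>x. f x - g x) \<pi> = T f \<pi> - T g \<pi>"
  using current1_lincomb[of T f g \<pi> 1 "-1"] by simp

lemma current1_add:
  "current1 T \<Longrightarrow> lip_bdd f \<Longrightarrow> lip_bdd g \<Longrightarrow> lip \<pi> \<Longrightarrow> T (\<lambda>x. f x + g x) \<pi> = T f \<pi> + T g \<pi>"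
  using current1_lincomb[of T f g \<pi> 1 "1"] by simp

lemma (in finite_borel) integral_cutoff_le:
  assumes B: "B \<in> sets borel" and f: "lip_bdd f" and C: "\<And>x. \<bar>f x\<bar> \<le> C"
    and \<xi>: "lip_bdd \<xi>" "\<And>x. 0 \<le> \<xi> x"
  shows "(\<integral>x. \<bar>\<xi> x * f x\<bar> \<partial>\<mu>) \<le> (\<integral>x. indicator B x * \<bar>f x\<bar> \<partial>\<mu>) + C * (\<integral>x. \<bar>\<xi> x - indicator B x\<bar> \<partial>\<mu>)"
proof -
  have [measurable]: "f \<in> borel_measurable borel" "B \<in> sets borel"
    using f B by (auto intro: lip_bdd_measurable)
  have "\<bar>indicator B x * \<bar>f x\<bar>\<bar> \<le> C" for x using C[of x] by (auto simp: indicator_def)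
  then have i1: "integrable \<mu> (\<lambda>x. indicator B x * \<bar>f x\<bar>)" by (intro integrable_bounded[of _ C]) measurable
  have i2: "integrable \<mu> (\<lambda>x. \<bar>\<xi> x - indicator B x\<bar>)"
    using B by (intro integrable_abs Bochner_Integration.integrable_diff integrable_lip_bdd \<xi> integrable_bounded[of "indicator B" 1]) auto
  have "(\<integral>x. \<bar>\<xi> x * f x\<bar> \<partial>\<mu>) \<le> (\<integral>x. indicator B x * \<bar>f x\<bar> + C * \<bar>\<xi> x - indicator B x\<bar> \<partial>\<mu>)"
  proof (rule integral_mono)
    show "integrable \<mu> (\<lambda>x. \<bar>\<xi> x * f x\<bar>)" by (intro integrable_abs integrable_lip_bdd lip_bdd_mult \<xi> f)
    show "integrable \<mu> (\<lambda>x. indicator B x * \<bar>f x\<bar> + C * \<bar>\<xi> x - indicator B x\<bar>)" using i1 i2 by simp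
    show "\<bar>\<xi> x * f x\<bar> \<le> indicator B x * \<bar>f x\<bar> + C * \<bar>\<xi> x - indicator B x\<bar>" for x
    proof -
      have "\<xi> x * \<bar>f x\<bar> = indicator B x * \<bar>f x\<bar> + (\<xi> x - indicator B x) * \<bar>f x\<bar>" by (simp add: algebra_simps)
      also have "(\<xi> x - indicator B x) * \<bar>f x\<bar> \<le> \<bar>\<xi> x - indicator B x\<bar> * C"
        using C by (intro mult_mono) auto
      finally show ?thesis using \<xi>(2)[of x] by (simp add: abs_mult mult.commute)
    qed
  qed
  then show ?thesis using i1 i2 by simp
qed

text \<open>Splitting \<open>f\<close> along \<open>B\<close> is possible because indicators are \<open>L\<^sup>1\<close> limits of Lipschitz functions.\<close>

lemma mass_bound_mixture:
  assumes T: "current1 T" and \<mu>: "mass_bound T \<mu>" and \<nu>: "mass_bound T \<nu>" and B: "B \<in> sets borel"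
    and f: "lip_bdd f" and L: "L-lipschitz_on UNIV \<pi>"
  shows "\<bar>T f \<pi>\<bar> \<le> L * ((\<integral>x. indicator B x * \<bar>f x\<bar> \<partial>\<mu>) + (\<integral>x. indicator (- B) x * \<bar>f x\<bar> \<partial>\<nu>))"
proof -
  interpret \<mu>: finite_borel \<mu> using \<mu> by (rule mass_bound_finite_borel)
  interpret \<nu>: finite_borel \<nu> using \<nu> by (rule mass_bound_finite_borel)
  obtain C where C: "C \<ge> 0" "\<And>x. \<bar>f x\<bar> \<le> C" using f by (rule lip_bddE) blast
  have L0: "L \<ge> 0" using L by (rule lipschitz_on_nonneg)
  have fm [measurable]: "f \<in> borel_measurable borel" using f by (rule lip_bdd_measurable)
  have [measurable]: "B \<in> sets borel" by (rule B)
  let ?R = "L * ((\<integral>x. indicator B x * \<bar>f x\<bar> \<partial>\<mu>) + (\<integral>x. indicator (- B) x * \<bar>f x\<bar> \<partial>\<nu>))"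
  have "\<bar>T f \<pi>\<bar> \<le> ?R + 2 * (L * (C * e))" if e: "e > 0" for e
  proof -
    obtain \<xi> where \<xi>: "lip_bdd \<xi>" "\<And>x. 0 \<le> \<xi> x" "\<And>x. \<xi> x \<le> 1"
      and \<xi>e: "(\<integral>x. \<bar>\<xi> x - indicator B x\<bar> \<partial>\<mu>) < e" "(\<integral>x. \<bar>\<xi> x - indicator B x\<bar> \<partial>\<nu>) < e"
      using lipschitz_dense_indicator[OF \<mu>.finite_borel_axioms \<nu>.finite_borel_axioms B e] by blast
    have [measurable]: "\<xi> \<in> borel_measurable borel" using \<xi>(1) by (rule lip_bdd_measurable)
    have l1: "lip_bdd (\<lambda>x. \<xi> x * f x)" using \<xi>(1) f by (rule lip_bdd_mult)
    have l2: "lip_bdd (\<lambda>x. (1 - \<xi> x) * f x)"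
      using \<xi>(1) f by (intro lip_bdd_mult lip_bdd_diff) auto
    have "T f \<pi> = T (\<lambda>x. \<xi> x * f x + (1 - \<xi> x) * f x) \<pi>" by (simp add: algebra_simps)
    also have "\<dots> = T (\<lambda>x. \<xi> x * f x) \<pi> + T (\<lambda>x. (1 - \<xi> x) * f x) \<pi>"
      using current1_add[OF T l1 l2] lipI[OF L] by simp
    finally have "\<bar>T f \<pi>\<bar> \<le> L * (\<integral>x. \<bar>\<xi> x * f x\<bar> \<partial>\<mu>) + L * (\<integral>x. \<bar>(1 - \<xi> x) * f x\<bar> \<partial>\<nu>)"
      using mass_boundD[OF \<mu> l1 L] mass_boundD[OF \<nu> l2 L] by linarith
    moreover have "(\<integral>x. \<bar>\<xi> x * f x\<bar> \<partial>\<mu>) \<le> (\<integral>x. indicator B x * \<bar>f x\<bar> \<partial>\<mu>) + C * e"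
      using \<mu>.integral_cutoff_le[OF B f C(2) \<xi>(1,2)] mult_left_mono[OF less_imp_le[OF \<xi>e(1)] C(1)] by linarith
    moreover have "(\<integral>x. \<bar>(1 - \<xi> x) * f x\<bar> \<partial>\<nu>) \<le> (\<integral>x. indicator (- B) x * \<bar>f x\<bar> \<partial>\<nu>) + C * e"
    proof -
      have "\<bar>(1 - \<xi> x) - indicator (- B) x\<bar> = \<bar>\<xi> x - indicator B x\<bar>" for x by (auto simp: indicator_def)
      then have "(\<integral>x. \<bar>(1 - \<xi> x) * f x\<bar> \<partial>\<nu>) \<le> (\<integral>x. indicator (- B) x * \<bar>f x\<bar> \<partial>\<nu>) + C * (\<integral>x. \<bar>\<xi> x - indicator B x\<bar> \<partial>\<nu>)"
        using \<nu>.integral_cutoff_le[of "- B" f C "\<lambda>x. 1 - \<xi> x"] B f C(2) lip_bdd_diff[OF lip_bdd_const \<xi>(1)] \<xi>(3) by simp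
      then show ?thesis using mult_left_mono[OF less_imp_le[OF \<xi>e(2)] C(1)] by linarith
    qed
    ultimately have "\<bar>T f \<pi>\<bar> \<le> L * ((\<integral>x. indicator B x * \<bar>f x\<bar> \<partial>\<mu>) + C * e) + L * ((\<integral>x. indicator (- B) x * \<bar>f x\<bar> \<partial>\<nu>) + C * e)"
      using mult_left_mono[OF _ L0] by (smt (verit, best))
    then show ?thesis by (simp add: algebra_simps)
  qed
  note * = this
  show ?thesis
  proof (rule field_le_epsilon)
    fix e :: real assume e: "e > 0"
    \<comment> \<open>The error \<open>2 L C e\<close> is rescaled; the summand \<open>1\<close>
      covers the case \<open>L C = 0\<close>.\<close>
    have p: "2 * (L * C) + 1 > 0" using L0 C by (simp add: add_nonneg_pos)
    then have "e / (2 * (L * C) + 1) > 0" using e by simp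
    from *[OF this] have "\<bar>T f \<pi>\<bar> \<le> ?R + 2 * (L * C) / (2 * (L * C) + 1) * e" by simp
    also have "2 * (L * C) / (2 * (L * C) + 1) * e \<le> 1 * e"
      using e p by (intro mult_right_mono) auto
    finally show "\<bar>T f \<pi>\<bar> \<le> ?R + e" by simp
  qed
qed

text \<open>
  A bound dominated by a fixed bound \<open>\<mu>\<close> is described by its density \<open>h\<close>; these densities are closed
  under minima and decreasing limits, so a density of least integral exists.
\<close>

definition density_bound :: "'a::metric_space functional1 \<Rightarrow> 'a measure \<Rightarrow> ('a \<Rightarrow> real) \<Rightarrow> bool" where
  "density_bound T \<mu> h \<longleftrightarrow> h \<in> borel_measurable borel \<and> (\<forall>x. 0 \<le> h x \<and> h x \<le> 1) \<and>
     (\<forall>f \<pi> L. lip_bdd f \<longrightarrow> L-lipschitz_on UNIV \<pi> \<longrightarrow> \<bar>T f \<pi>\<bar> \<le> L * (\<integral>x. \<bar>f x\<bar> * h x \<partial>\<mu>))"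

context finite_borel begin

lemma finite_borel_density:
  assumes h: "h \<in> borel_measurable borel" "\<And>x. 0 \<le> h x" "\<And>x. h x \<le> (1::real)"
  shows "finite_borel (density \<mu> (\<lambda>x. ennreal (h x)))"
proof -
  have "emeasure (density \<mu> (\<lambda>x. ennreal (h x))) UNIV = (\<integral>\<^sup>+x. ennreal (h x) \<partial>\<mu>)"
    using h by (subst emeasure_density) (auto simp: measurable_borel sets_borel)
  also have "\<dots> \<le> (\<integral>\<^sup>+x. 1 \<partial>\<mu>)" using h by (intro nn_integral_mono) (auto simp: ennreal_le_1)
  also have "\<dots> < \<infinity>" using emeasure_finite[of UNIV] by (simp add: less_top[symmetric])
  finally have "emeasure (density \<mu> (\<lambda>x. ennreal (h x))) UNIV < \<infinity>" .
  then show ?thesis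
    by (intro finite_borel.intro finite_measureI finite_borel_axioms.intro) (simp_all add: sets_borel)
qed

lemma integral_density_borel:
  assumes h: "h \<in> borel_measurable borel" "\<And>x. 0 \<le> h x" and f: "f \<in> borel_measurable borel"
  shows "(\<integral>x. f x \<partial>density \<mu> (\<lambda>x. ennreal (h x))) = (\<integral>x. f x * h x \<partial>\<mu>)"
  using assms by (subst integral_density) (auto simp: measurable_borel mult.commute)

lemma mass_bound_density:
  assumes h: "density_bound T \<mu> h"
  shows "mass_bound T (density \<mu> (\<lambda>x. ennreal (h x)))"
proof -
  have 1: "h \<in> borel_measurable borel" "\<And>x. 0 \<le> h x" "\<And>x. h x \<le> (1::real)" using h by (auto simp: density_bound_def)
  interpret d: finite_borel "density \<mu> (\<lambda>x. ennreal (h x))" by (rule finite_borel_density[OF 1])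
  show ?thesis
    unfolding mass_bound_def
  proof (intro conjI allI impI)
    fix f \<pi> :: "'a \<Rightarrow> real" and L assume f: "lip_bdd f" and L: "L-lipschitz_on UNIV \<pi>"
    have "(\<integral>x. \<bar>f x\<bar> \<partial>density \<mu> (\<lambda>x. ennreal (h x))) = (\<integral>x. \<bar>f x\<bar> * h x \<partial>\<mu>)"
      using lip_bdd_measurable[OF f] by (intro integral_density_borel 1) measurable
    then show "\<bar>T f \<pi>\<bar> \<le> L * (\<integral>x. \<bar>f x\<bar> \<partial>density \<mu> (\<lambda>x. ennreal (h x)))"
      using h f L by (simp add: density_bound_def)
  qed (use d.sets_borel d.finite_measure_axioms in auto)
qed

text \<open>\<open>mass_bound_mixture\<close> permits one bound on \<open>B = {g \<le> h}\<close>
  and another on its complement. Taking the smaller density on each of the two sets gives the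
  minimum.\<close>

lemma density_bound_min:
  assumes T: "current1 T" and g: "density_bound T \<mu> g" and h: "density_bound T \<mu> h"
  shows "density_bound T \<mu> (\<lambda>x. min (g x) (h x))"
proof -
  have g1: "g \<in> borel_measurable borel" "\<And>x. 0 \<le> g x" "\<And>x. g x \<le> (1::real)" using g by (auto simp: density_bound_def)
  have h1: "h \<in> borel_measurable borel" "\<And>x. 0 \<le> h x" "\<And>x. h x \<le> (1::real)" using h by (auto simp: density_bound_def)
  note [measurable] = g1(1) h1(1)
  define B where "B = {x. g x \<le> h x}"
  have B: "B \<in> sets borel" unfolding B_def by measurable
  note [measurable] = B
  have "\<bar>T f \<pi>\<bar> \<le> L * (\<integral>x. \<bar>f x\<bar> * min (g x) (h x) \<partial>\<mu>)" if f: "lip_bdd f" and L: "L-lipschitz_on UNIV \<pi>" for f \<pi> L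
  proof -
    obtain C where C: "C \<ge> 0" "\<And>x. \<bar>f x\<bar> \<le> C" using f by (rule lip_bddE) blast
    note [measurable] = lip_bdd_measurable[OF f]
    have i: "integrable \<mu> (\<lambda>x. indicator A x * \<bar>f x\<bar> * u x)"
      if "A \<in> sets borel" "u \<in> borel_measurable borel" "\<And>x. 0 \<le> u x" "\<And>x. u x \<le> 1" for A u
    proof (rule integrable_bounded[where B="C * 1"])
      show "(\<lambda>x. indicator A x * \<bar>f x\<bar> * u x) \<in> borel_measurable borel" using that by measurable
      show "\<bar>indicator A x * \<bar>f x\<bar> * u x\<bar> \<le> C * 1" for x
        unfolding abs_mult using C that(3,4)[of x] by (intro mult_mono) (auto simp: indicator_def)
    qed
    have "\<bar>T f \<pi>\<bar> \<le> L * ((\<integral>x. indicator B x * \<bar>f x\<bar> \<partial>density \<mu> (\<lambda>x. ennreal (g x))) + (\<integral>x. indicator (- B) x * \<bar>f x\<bar> \<partial>density \<mu> (\<lambda>x. ennreal (h x))))"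
      by (rule mass_bound_mixture[OF T mass_bound_density[OF g] mass_bound_density[OF h] B f L])
    also have "(\<integral>x. indicator B x * \<bar>f x\<bar> \<partial>density \<mu> (\<lambda>x. ennreal (g x))) = (\<integral>x. indicator B x * \<bar>f x\<bar> * g x \<partial>\<mu>)"
      by (intro integral_density_borel g1) measurable
    also have "(\<integral>x. indicator (- B) x * \<bar>f x\<bar> \<partial>density \<mu> (\<lambda>x. ennreal (h x))) = (\<integral>x. indicator (- B) x * \<bar>f x\<bar> * h x \<partial>\<mu>)"
      by (intro integral_density_borel h1) measurable
    also have "(\<integral>x. indicator B x * \<bar>f x\<bar> * g x \<partial>\<mu>) + (\<integral>x. indicator (- B) x * \<bar>f x\<bar> * h x \<partial>\<mu>)
        = (\<integral>x. indicator B x * \<bar>f x\<bar> * g x + indicator (- B) x * \<bar>f x\<bar> * h x \<partial>\<mu>)"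
      using i[OF B g1] i[OF _ h1, of "- B"] B by (intro Bochner_Integration.integral_add[symmetric]) auto
    also have "\<dots> = (\<integral>x. \<bar>f x\<bar> * min (g x) (h x) \<partial>\<mu>)"
      by (intro Bochner_Integration.integral_cong) (auto simp: B_def indicator_def)
    finally show ?thesis .
  qed
  moreover have "(\<lambda>x. min (g x) (h x)) \<in> borel_measurable borel" by measurable
  ultimately show ?thesis using g1 h1 unfolding density_bound_def by (auto simp: min_le_iff_disj)
qed

lemma density_bound_limit:
  assumes h: "\<And>n. density_bound T \<mu> (h n)" and lim: "\<And>x. (\<lambda>n. h n x) \<longlonglongrightarrow> h' x"
  shows "density_bound T \<mu> h'"
proof -
  have h1: "h n \<in> borel_measurable borel" "\<And>x. 0 \<le> h n x" "\<And>x. h n x \<le> (1::real)" for n using h by (auto simp: density_bound_def)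
  have m: "h' \<in> borel_measurable borel" using h1(1) lim by (rule borel_measurable_LIMSEQ_real[rotated])
  have r: "0 \<le> h' x" "h' x \<le> 1" for x
    using LIMSEQ_le_const[OF lim] LIMSEQ_le_const2[OF lim] h1 by blast+
  have "\<bar>T f \<pi>\<bar> \<le> L * (\<integral>x. \<bar>f x\<bar> * h' x \<partial>\<mu>)" if f: "lip_bdd f" and L: "L-lipschitz_on UNIV \<pi>" for f \<pi> L
  proof -
    obtain C where C: "C \<ge> 0" "\<And>x. \<bar>f x\<bar> \<le> C" using f by (rule lip_bddE) blast
    note [measurable] = lip_bdd_measurable[OF f] h1(1) m
    have "(\<lambda>n. \<integral>x. \<bar>f x\<bar> * h n x \<partial>\<mu>) \<longlonglongrightarrow> (\<integral>x. \<bar>f x\<bar> * h' x \<partial>\<mu>)"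
    proof (rule bounded_convergence[where B="C * 1"])
      show "\<bar>\<bar>f x\<bar> * h n x\<bar> \<le> C * 1" for n x
        unfolding abs_mult using C h1(2,3)[of n x] by (intro mult_mono) auto
      show "(\<lambda>n. \<bar>f x\<bar> * h n x) \<longlonglongrightarrow> \<bar>f x\<bar> * h' x" for x by (intro tendsto_intros lim)
    qed measurable
    then have "(\<lambda>n. L * (\<integral>x. \<bar>f x\<bar> * h n x \<partial>\<mu>)) \<longlonglongrightarrow> L * (\<integral>x. \<bar>f x\<bar> * h' x \<partial>\<mu>)" by (intro tendsto_intros)
    then show ?thesis
      by (rule LIMSEQ_le_const) (use h f L in \<open>auto simp: density_bound_def\<close>)
  qed
  then show ?thesis using m r by (auto simp: density_bound_def)
qed

lemma density_bound_least_integral: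
  assumes T: "current1 T" and \<mu>: "mass_bound T \<mu>"
  shows "\<exists>h. density_bound T \<mu> h \<and> (\<forall>g. density_bound T \<mu> g \<longrightarrow> (\<integral>x. h x \<partial>\<mu>) \<le> (\<integral>x. g x \<partial>\<mu>))"
proof -
  define S where "S = {\<integral>x. g x \<partial>\<mu> | g. density_bound T \<mu> g}"
  have int: "integrable \<mu> g" if "density_bound T \<mu> g" for g
    using that by (intro integrable_bounded[of _ 1]) (auto simp: density_bound_def abs_le_iff intro: order_trans[of _ 0])
  have one: "density_bound T \<mu> (\<lambda>_. 1)" using \<mu> by (auto simp: density_bound_def mass_bound_def)
  have S: "S \<noteq> {}" unfolding S_def using one by blast
  have "0 \<le> s" if "s \<in> S" for s
    using that by (auto simp: S_def density_bound_def intro!: Bochner_Integration.integral_nonneg)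
  then have bdd: "bdd_below S" by (rule bdd_belowI)
  define m where "m = Inf S"
  have "\<exists>g. density_bound T \<mu> g \<and> (\<integral>x. g x \<partial>\<mu>) < m + 1 / real (Suc n)" for n
  proof -
    have "\<exists>s\<in>S. s < m + 1 / real (Suc n)"
      using cInf_less_iff[OF S bdd, of "m + 1 / real (Suc n)"] by (simp add: m_def del: of_nat_Suc)
    then show ?thesis by (auto simp: S_def)
  qed
  then have "\<exists>g. \<forall>n. density_bound T \<mu> (g n) \<and> (\<integral>x. g n x \<partial>\<mu>) < m + 1 / real (Suc n)" by (intro choice allI)
  then obtain g where g: "\<forall>n. density_bound T \<mu> (g n) \<and> (\<integral>x. g n x \<partial>\<mu>) < m + 1 / real (Suc n)" by (rule exE)
  \<comment> \<open>Running minima of a minimizing sequence are again bounds, and they decrease, so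
    they converge pointwise.\<close>
  define h where "h = rec_nat (g 0) (\<lambda>n u x. min (u x) (g (Suc n) x))"
  have h0: "h 0 = g 0" and hS: "h (Suc n) = (\<lambda>x. min (h n x) (g (Suc n) x))" for n by (simp_all add: h_def)
  have hb: "density_bound T \<mu> (h n)" for n
    by (induction n) (use g in \<open>auto simp: h0 hS intro: density_bound_min[OF T]\<close>)
  have hg: "h n x \<le> g n x" for n x by (cases n) (auto simp: h0 hS)
  have "decseq (\<lambda>n. h n x)" for x by (rule decseq_SucI) (simp add: hS)
  moreover have "0 \<le> h n x" for n x using hb by (auto simp: density_bound_def)
  ultimately have "\<exists>l. (\<lambda>n. h n x) \<longlonglongrightarrow> l" for x by (metis decseq_convergent)
  then have lim: "(\<lambda>n. h n x) \<longlonglongrightarrow> lim (\<lambda>n. h n x)" for x by (simp add: convergent_LIMSEQ_iff[symmetric] convergent_def)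
  define h' where "h' x = lim (\<lambda>n. h n x)" for x
  have h': "density_bound T \<mu> h'" by (rule density_bound_limit[where h=h]) (use hb lim in \<open>auto simp: h'_def\<close>)
  have "h' x \<le> h n x" for n x
    using decseq_ge[OF \<open>decseq (\<lambda>n. h n x)\<close> lim[of x]] by (simp add: h'_def)
  then have le: "h' x \<le> g n x" for n x using hg order_trans by blast
  have "(\<integral>x. h' x \<partial>\<mu>) \<le> m + 1 / real (Suc n)" for n
  proof -
    have "(\<integral>x. h' x \<partial>\<mu>) \<le> (\<integral>x. g n x \<partial>\<mu>)" using g le by (intro integral_mono int h') auto
    then show ?thesis using g[rule_format, of n] by linarith
  qed
  moreover have "(\<lambda>n. m + 1 / real (Suc n)) \<longlonglongrightarrow> m + 0"
    using lim_1_over_n[THEN filterlim_sequentially_Suc[THEN iffD2]] by (intro tendsto_intros) auto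
  ultimately have "(\<integral>x. h' x \<partial>\<mu>) \<le> m" by (intro LIMSEQ_le_const) auto
  moreover have "m \<le> (\<integral>x. g x \<partial>\<mu>)" if "density_bound T \<mu> g" for g
    unfolding m_def using that bdd by (intro cInf_lower) (auto simp: S_def)
  ultimately show ?thesis using h' by (meson order_trans)
qed

text \<open>\<open>\<nu>\<close> may be singular to \<open>\<mu>\<close>, but the infimum of the two
  measures has a density with respect to \<open>\<mu>\<close>. In a Hahn decomposition it is
  \<open>\<mu>\<close> on \<open>B\<close>, where \<open>\<mu> \<le> \<nu>\<close>, and
  \<open>\<nu>\<close> off \<open>B\<close>, where \<open>\<nu> \<le> \<mu>\<close>; by
  \<open>mass_bound_mixture\<close> it is a mass bound. Thus comparison with arbitrary bounds
  reduces to comparison with densities.\<close>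

lemma bound_density_below:
  assumes T: "current1 T" and \<mu>: "mass_bound T \<mu>" and \<nu>: "mass_bound T \<nu>"
  shows "\<exists>h. density_bound T \<mu> h \<and> (\<forall>A\<in>sets borel. emeasure (density \<mu> (\<lambda>x. ennreal (h x))) A \<le> emeasure \<nu> A)"
proof -
  interpret \<nu>: finite_borel \<nu> using \<nu> by (rule mass_bound_finite_borel)
  obtain B where B: "B \<in> sets borel" and B1: "\<And>X. X \<in> sets borel \<Longrightarrow> X \<subseteq> B \<Longrightarrow> emeasure \<mu> X \<le> emeasure \<nu> X"
    and B2: "\<And>X. X \<in> sets borel \<Longrightarrow> X \<inter> B = {} \<Longrightarrow> emeasure \<nu> X \<le> emeasure \<mu> X"
    using finite_unsigned_Hahn_decomposition[of \<nu> \<mu>] \<nu>.finite_measure_axioms finite_measure_axioms by (auto simp: sets_borel \<nu>.sets_borel)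
  note [measurable] = B
  define \<nu>' where "\<nu>' = density \<nu> (indicator (- B))"
  have \<nu>': "emeasure \<nu>' A = emeasure \<nu> (A - B)" if "A \<in> sets borel" for A
    unfolding \<nu>'_def using that B by (subst emeasure_density)
      (auto simp: \<nu>.sets_borel \<nu>.measurable_borel indicator_inter_arith[symmetric] Diff_eq Int_commute simp flip: nn_integral_indicator intro!: nn_integral_cong)
  have "absolutely_continuous \<mu> \<nu>'"
    unfolding absolutely_continuous_def
  proof
    fix N assume N: "N \<in> null_sets \<mu>"
    then have Nb: "N \<in> sets borel" and N0: "emeasure \<mu> N = 0" by (auto simp: sets_borel)
    have "emeasure \<nu> (N - B) \<le> emeasure \<mu> (N - B)" using Nb B by (intro B2) auto
    also have "\<dots> \<le> emeasure \<mu> N" using Nb B by (intro emeasure_mono) (auto simp: sets_borel)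
    finally show "N \<in> null_sets \<nu>'" using Nb N0 \<nu>'[OF Nb] by (auto simp: \<nu>'_def \<nu>.sets_borel)
  qed
  moreover have "sets \<nu>' = sets \<mu>" by (simp add: \<nu>'_def sets_borel \<nu>.sets_borel)
  ultimately obtain u where u: "u \<in> borel_measurable \<mu>" "density \<mu> u = \<nu>'"
    using Radon_Nikodym by blast
  then have um [measurable]: "u \<in> borel_measurable borel" by (simp add: measurable_borel)
  have u1: "AE x in \<mu>. u x \<le> 1"
  proof -
    \<comment> \<open>On \<open>{u > 1}\<close> the integral of \<open>u\<close> is at most that of
      \<open>1\<close>, so the nonnegative excess \<open>u - 1\<close> vanishes almost everywhere
      there. Finiteness of \<open>\<mu>\<close> makes the subtraction of \<open>ennreal\<close>
      integrals legitimate.\<close>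
    define A where "A = {x. u x > 1}"
    have A: "A \<in> sets borel" unfolding A_def by measurable
    have "(\<integral>\<^sup>+x. u x * indicator A x \<partial>\<mu>) = emeasure \<nu>' A" using u(1) A u(2) by (subst emeasure_density[symmetric]) (auto simp: sets_borel)
    also have "\<dots> \<le> emeasure \<mu> (A - B)" using A B by (simp add: \<nu>') (intro B2, auto)
    also have "\<dots> \<le> emeasure \<mu> A" using A B by (intro emeasure_mono) (auto simp: sets_borel)
    also have "\<dots> = (\<integral>\<^sup>+x. indicator A x \<partial>\<mu>)" using A by (simp add: sets_borel)
    finally have le: "(\<integral>\<^sup>+x. u x * indicator A x \<partial>\<mu>) \<le> (\<integral>\<^sup>+x. indicator A x \<partial>\<mu>)" .
    have fin: "(\<integral>\<^sup>+x. indicator A x \<partial>\<mu>) \<noteq> \<infinity>" using A by (simp add: sets_borel)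
    have "(\<integral>\<^sup>+x. (u x * indicator A x - indicator A x) \<partial>\<mu>) = (\<integral>\<^sup>+x. u x * indicator A x \<partial>\<mu>) - (\<integral>\<^sup>+x. indicator A x \<partial>\<mu>)"
      using A u(1) fin by (intro nn_integral_diff) (auto simp: sets_borel A_def indicator_def intro!: AE_I2 borel_measurable_times_ennreal)
    also have "\<dots> = 0"
    proof -
      have "(\<integral>\<^sup>+x. u x * indicator A x \<partial>\<mu>) < top"
        by (rule order_le_less_trans[OF le]) (use fin in \<open>simp add: less_top[symmetric]\<close>)
      with le show ?thesis by (simp add: diff_eq_0_iff_ennreal)
    qed
    finally have "AE x in \<mu>. u x * indicator A x - indicator A x = 0"
    proof (subst (asm) nn_integral_0_iff_AE)
      have [measurable]: "A \<in> sets borel" by (rule A)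
      show "(\<lambda>x. u x * indicator A x - indicator A x) \<in> borel_measurable \<mu>"
        unfolding measurable_borel by measurable
    qed
    then show ?thesis
    proof eventually_elim
      case (elim x)
      show ?case
      proof (rule ccontr)
        assume "\<not> u x \<le> 1"
        then have "x \<in> A" by (simp add: A_def)
        with elim have "u x - 1 = 0" by simp
        then show False using \<open>\<not> u x \<le> 1\<close> by (simp add: diff_eq_0_iff_ennreal)
      qed
    qed
  qed
  have uB: "AE x in \<mu>. x \<in> B \<longrightarrow> u x = 0"
  proof -
    have "(\<integral>\<^sup>+x. u x * indicator B x \<partial>\<mu>) = emeasure \<nu>' B" using u B by (subst emeasure_density[symmetric]) (auto simp: sets_borel)
    also have "\<dots> = 0" using B by (simp add: \<nu>')
    finally have "AE x in \<mu>. u x * indicator B x = 0"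
    proof (subst (asm) nn_integral_0_iff_AE)
      show "(\<lambda>x. u x * indicator B x) \<in> borel_measurable \<mu>"
        unfolding measurable_borel by measurable
    qed
    then show ?thesis by eventually_elim (auto simp: indicator_def split: if_splits)
  qed
  define h where "h x = (if x \<in> B then 1 else enn2real (min 1 (u x)))" for x
  have hm [measurable]: "h \<in> borel_measurable borel" unfolding h_def by measurable
  have h01: "0 \<le> h x" "h x \<le> 1" for x
    using enn2real_mono[of "min 1 (u x)" 1] by (auto simp: h_def)
  have hu: "AE x in \<mu>. ennreal (h x) = indicator B x + u x"
    using u1 uB
  proof eventually_elim
    case (elim x)
    then have "u x < top" by (metis ennreal_one_less_top order_le_less_trans)
    with elim show ?case by (auto simp: h_def indicator_def min_def)
  qed
  \<comment> \<open>Integration against \<open>h\<close> is integration against \<open>\<mu>\<close>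
    on \<open>B\<close> plus integration against \<open>\<nu>\<close> off \<open>B\<close>. It
    serves both the mass bound and the comparison with \<open>\<nu>\<close>.\<close>
  have dens: "(\<integral>\<^sup>+x. g x * ennreal (h x) \<partial>\<mu>) = (\<integral>\<^sup>+x. g x * indicator B x \<partial>\<mu>) + (\<integral>\<^sup>+x. g x * indicator (- B) x \<partial>\<nu>)"
    if g [measurable]: "g \<in> borel_measurable borel" for g
  proof -
    have "(\<integral>\<^sup>+x. g x * ennreal (h x) \<partial>\<mu>) = (\<integral>\<^sup>+x. g x * indicator B x + g x * u x \<partial>\<mu>)"
      using hu by (intro nn_integral_cong_AE) (auto simp: distrib_left)
    also have "\<dots> = (\<integral>\<^sup>+x. g x * indicator B x \<partial>\<mu>) + (\<integral>\<^sup>+x. u x * g x \<partial>\<mu>)"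
      by (subst nn_integral_add) (auto simp: measurable_borel mult.commute)
    also have "(\<integral>\<^sup>+x. u x * g x \<partial>\<mu>) = (\<integral>\<^sup>+x. g x \<partial>\<nu>')"
      unfolding u(2)[symmetric] by (subst nn_integral_density) (auto simp: measurable_borel)
    also have "\<dots> = (\<integral>\<^sup>+x. g x * indicator (- B) x \<partial>\<nu>)"
      unfolding \<nu>'_def by (subst nn_integral_density) (auto simp: \<nu>.measurable_borel mult.commute)
    finally show ?thesis .
  qed
  have "\<bar>T f \<pi>\<bar> \<le> L * (\<integral>x. \<bar>f x\<bar> * h x \<partial>\<mu>)" if f: "lip_bdd f" and L: "L-lipschitz_on UNIV \<pi>" for f \<pi> L
  proof -
    obtain C where C: "C \<ge> 0" "\<And>x. \<bar>f x\<bar> \<le> C" using f by (rule lip_bddE) blast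
    note [measurable] = lip_bdd_measurable[OF f]
    have eq: "ennreal (\<integral>x. g x \<partial>M) = (\<integral>\<^sup>+x. ennreal (g x) \<partial>M)" if "finite_borel M" "g \<in> borel_measurable borel" "\<And>x. 0 \<le> g x" "\<And>x. g x \<le> C" for M g
    proof -
      interpret M: finite_borel M by fact
      show ?thesis using that by (intro nn_integral_eq_integral[symmetric] M.integrable_bounded[of _ C]) (auto simp: abs_of_nonneg)
    qed
    have Cr: "0 \<le> indicator A x * \<bar>f x\<bar>" "indicator A x * \<bar>f x\<bar> \<le> C" for A x using C by (auto simp: indicator_def)
    have "ennreal (\<integral>x. \<bar>f x\<bar> * h x \<partial>\<mu>) = (\<integral>\<^sup>+x. ennreal \<bar>f x\<bar> * ennreal (h x) \<partial>\<mu>)"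
    proof (subst eq)
      show "\<bar>f x\<bar> * h x \<le> C" for x using mult_mono[OF C(2)[of x] h01(2)[of x]] C h01 by simp
    qed (auto simp: h01 ennreal_mult finite_borel_axioms)
    also have "\<dots> = (\<integral>\<^sup>+x. ennreal (indicator B x * \<bar>f x\<bar>) \<partial>\<mu>) + (\<integral>\<^sup>+x. ennreal (indicator (- B) x * \<bar>f x\<bar>) \<partial>\<nu>)"
      by (subst dens) (auto intro!: arg_cong2[of _ _ _ _ "(+)"] nn_integral_cong simp: indicator_def)
    also have "\<dots> = ennreal (\<integral>x. indicator B x * \<bar>f x\<bar> \<partial>\<mu>) + ennreal (\<integral>x. indicator (- B) x * \<bar>f x\<bar> \<partial>\<nu>)"
      using Cr by (simp add: eq[OF finite_borel_axioms] eq[OF \<nu>.finite_borel_axioms])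
    also have "\<dots> = ennreal ((\<integral>x. indicator B x * \<bar>f x\<bar> \<partial>\<mu>) + (\<integral>x. indicator (- B) x * \<bar>f x\<bar> \<partial>\<nu>))"
      by (intro ennreal_plus[symmetric] Bochner_Integration.integral_nonneg) auto
    finally have "(\<integral>x. \<bar>f x\<bar> * h x \<partial>\<mu>) = (\<integral>x. indicator B x * \<bar>f x\<bar> \<partial>\<mu>) + (\<integral>x. indicator (- B) x * \<bar>f x\<bar> \<partial>\<nu>)"
      using h01 by (subst (asm) ennreal_inj) (auto intro!: Bochner_Integration.integral_nonneg add_nonneg_nonneg)
    then show ?thesis using mass_bound_mixture[OF T \<mu> \<nu> B f L] by simp
  qed
  then have "density_bound T \<mu> h" using h01 by (auto simp: density_bound_def)
  moreover have "emeasure (density \<mu> (\<lambda>x. ennreal (h x))) A \<le> emeasure \<nu> A" if A [measurable]: "A \<in> sets borel" for A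
  proof -
    have "emeasure (density \<mu> (\<lambda>x. ennreal (h x))) A = (\<integral>\<^sup>+x. indicator A x * ennreal (h x) \<partial>\<mu>)"
      by (subst emeasure_density) (auto simp: measurable_borel sets_borel mult.commute)
    also have "\<dots> = (\<integral>\<^sup>+x. indicator A x * indicator B x \<partial>\<mu>) + (\<integral>\<^sup>+x. indicator A x * indicator (- B) x \<partial>\<nu>)"
      by (rule dens) measurable
    also have "\<dots> = emeasure \<mu> (A \<inter> B) + emeasure \<nu> (A \<inter> - B)"
      using A B by (simp add: indicator_inter_arith[symmetric] sets_borel \<nu>.sets_borel)
    also have "\<dots> \<le> emeasure \<nu> (A \<inter> B) + emeasure \<nu> (A \<inter> - B)" using A B by (intro add_right_mono B1) auto
    also have "\<dots> = emeasure \<nu> A" using A B by (subst plus_emeasure) (auto simp: \<nu>.sets_borel intro!: arg_cong2[of _ _ _ _ emeasure])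
    finally show ?thesis .
  qed
  ultimately show ?thesis by blast
qed

end

text \<open>Let \<open>h\<close> be the density of least integral. A bound \<open>\<nu>\<close>
  dominates one with a density \<open>g\<close>, and \<open>min h g\<close> is a bound whose
  integral cannot be smaller than that of \<open>h\<close>; hence \<open>h \<le> g\<close> almost
  everywhere.\<close>

theorem least_mass_bound_exists:
  assumes T: "current1 T"
  shows "\<exists>\<mu>. mass_bound T \<mu> \<and> (\<forall>\<nu>. mass_bound T \<nu> \<longrightarrow> (\<forall>A\<in>sets borel. emeasure \<mu> A \<le> emeasure \<nu> A))"
proof -
  obtain \<mu> where \<mu>: "mass_bound T \<mu>" using T by (auto simp: current1_def)
  interpret finite_borel \<mu> using \<mu> by (rule mass_bound_finite_borel)
  obtain h where h: "density_bound T \<mu> h" and least: "\<And>g. density_bound T \<mu> g \<Longrightarrow> (\<integral>x. h x \<partial>\<mu>) \<le> (\<integral>x. g x \<partial>\<mu>)"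
    using density_bound_least_integral[OF T \<mu>] by blast
  have int: "integrable \<mu> g" if "density_bound T \<mu> g" for g
    using that by (intro integrable_bounded[of _ 1]) (auto simp: density_bound_def abs_le_iff intro: order_trans[of _ 0])
  have "emeasure (density \<mu> (\<lambda>x. ennreal (h x))) A \<le> emeasure \<nu> A" if \<nu>: "mass_bound T \<nu>" and A: "A \<in> sets borel" for \<nu> A
  proof -
    obtain g where g: "density_bound T \<mu> g" and le: "\<And>A. A \<in> sets borel \<Longrightarrow> emeasure (density \<mu> (\<lambda>x. ennreal (g x))) A \<le> emeasure \<nu> A"
      using bound_density_below[OF T \<mu> \<nu>] by blast
    have m: "density_bound T \<mu> (\<lambda>x. min (h x) (g x))" using density_bound_min[OF T h g] .
    have "(\<integral>x. h x - min (h x) (g x) \<partial>\<mu>) = (\<integral>x. h x \<partial>\<mu>) - (\<integral>x. min (h x) (g x) \<partial>\<mu>)"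
      by (intro Bochner_Integration.integral_diff int h m)
    also have "\<dots> \<le> 0" using least[OF m] by simp
    finally have "(\<integral>x. h x - min (h x) (g x) \<partial>\<mu>) = 0"
      by (intro antisym Bochner_Integration.integral_nonneg) auto
    then have "AE x in \<mu>. h x - min (h x) (g x) = 0"
      by (subst (asm) integral_nonneg_eq_0_iff_AE[OF Bochner_Integration.integrable_diff[OF int[OF h] int[OF m]]]) auto
    then have "AE x in \<mu>. ennreal (h x) \<le> ennreal (g x)" by eventually_elim (auto simp: min_def split: if_splits intro: ennreal_leI)
    then have "emeasure (density \<mu> (\<lambda>x. ennreal (h x))) A \<le> emeasure (density \<mu> (\<lambda>x. ennreal (g x))) A"
      using A h g by (auto simp: emeasure_density density_bound_def measurable_borel sets_borel intro!: nn_integral_mono_AE mult_right_mono)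
    also have "\<dots> \<le> emeasure \<nu> A" by (rule le[OF A])
    finally show ?thesis .
  qed
  then show ?thesis using mass_bound_density[OF h] by blast
qed

text \<open>Two least bounds dominate each other on every Borel set, so the \<open>THE\<close> is
  well defined.\<close>

lemma mass_measure_eqI:
  assumes "mass_bound T \<mu>" "\<And>\<nu> A. mass_bound T \<nu> \<Longrightarrow> A \<in> sets borel \<Longrightarrow> emeasure \<mu> A \<le> emeasure \<nu> A"
  shows "mass_measure T = \<mu>"
  unfolding mass_measure_def
proof (rule the_equality)
  fix \<nu> assume \<nu>: "mass_bound T \<nu> \<and> (\<forall>\<nu>'. mass_bound T \<nu>' \<longrightarrow> (\<forall>A\<in>sets borel. emeasure \<nu> A \<le> emeasure \<nu>' A))"
  show "\<nu> = \<mu>"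
  proof (rule measure_eqI)
    show "sets \<nu> = sets \<mu>" using \<nu> assms(1) by (simp add: mass_bound_def)
    fix A assume "A \<in> sets \<nu>"
    then have "A \<in> sets borel" using \<nu> by (simp add: mass_bound_def)
    then show "emeasure \<nu> A = emeasure \<mu> A" using \<nu> assms by (auto intro: antisym)
  qed
qed (use assms in auto)

lemma mass_measure_bound:
  assumes "current1 T"
  shows "mass_bound T (mass_measure T)"
    and "\<And>\<nu> A. mass_bound T \<nu> \<Longrightarrow> A \<in> sets borel \<Longrightarrow> emeasure (mass_measure T) A \<le> emeasure \<nu> A"
proof -
  obtain \<mu> where \<mu>: "mass_bound T \<mu>" "\<And>\<nu> A. mass_bound T \<nu> \<Longrightarrow> A \<in> sets borel \<Longrightarrow> emeasure \<mu> A \<le> emeasure \<nu> A"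
    using least_mass_bound_exists[OF assms] by blast
  have "mass_measure T = \<mu>" using \<mu> by (rule mass_measure_eqI)
  then show "mass_bound T (mass_measure T)"
    "\<And>\<nu> A. mass_bound T \<nu> \<Longrightarrow> A \<in> sets borel \<Longrightarrow> emeasure (mass_measure T) A \<le> emeasure \<nu> A"
    using \<mu> by auto
qed

lemma mass_measure_finite_borel: "current1 T \<Longrightarrow> finite_borel (mass_measure T)"
  using mass_bound_finite_borel mass_measure_bound(1) by blast

text \<open>By the mass bound, the values of \<open>T\<close> on two approximations of
  \<open>g\<close> differ by at most \<open>L\<close> times the sum of their L1 distances to
  \<open>g\<close>. So approximating sequences give Cauchy sequences with a common limit, and the
  \<open>THE\<close> in \<open>borel_extension\<close> is justified.\<close>

lemma borel_extension_tendsto: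
  assumes T: "current1 T" and g: "g \<in> borel_measurable borel" "\<And>x. \<bar>g x\<bar> \<le> C"
    and f: "\<And>n. lip_bdd (f n)" and lim: "(\<lambda>n. \<integral>x. \<bar>f n x - g x\<bar> \<partial>mass_measure T) \<longlonglongrightarrow> 0" and \<pi>: "lip \<pi>"
  shows "(\<lambda>n. T (f n) \<pi>) \<longlonglongrightarrow> borel_extension T g \<pi>"
proof -
  let ?M = "mass_measure T"
  interpret M: finite_borel ?M using T by (rule mass_measure_finite_borel)
  obtain L where L: "L \<ge> 0" "L-lipschitz_on UNIV \<pi>" using \<pi> by (rule lipE)
  have gi: "integrable ?M g" using g by (rule M.integrable_bounded)
  have fi: "integrable ?M (\<lambda>x. \<bar>h x - g x\<bar>)" if "lip_bdd h" for h
    using that by (intro integrable_abs Bochner_Integration.integrable_diff[OF M.integrable_lip_bdd gi])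
  have diff: "\<bar>T h \<pi> - T k \<pi>\<bar> \<le> L * ((\<integral>x. \<bar>h x - g x\<bar> \<partial>?M) + (\<integral>x. \<bar>k x - g x\<bar> \<partial>?M))"
    if h: "lip_bdd h" and k: "lip_bdd k" for h k
  proof -
    have "\<bar>T h \<pi> - T k \<pi>\<bar> = \<bar>T (\<lambda>x. h x - k x) \<pi>\<bar>" using current1_diff[OF T h k \<pi>] by simp
    also have "\<dots> \<le> L * (\<integral>x. \<bar>h x - k x\<bar> \<partial>?M)"
      by (rule mass_boundD[OF mass_measure_bound(1)[OF T] lip_bdd_diff[OF h k] L(2)])
    also have "\<dots> \<le> L * (\<integral>x. \<bar>h x - g x\<bar> + \<bar>k x - g x\<bar> \<partial>?M)"
      by (intro mult_left_mono[OF integral_mono[OF integrable_abs[OF M.integrable_lip_bdd[OF lip_bdd_diff[OF h k]]]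
            Bochner_Integration.integrable_add[OF fi[OF h] fi[OF k]]]] L(1)) auto
    also have "(\<integral>x. \<bar>h x - g x\<bar> + \<bar>k x - g x\<bar> \<partial>?M) = (\<integral>x. \<bar>h x - g x\<bar> \<partial>?M) + (\<integral>x. \<bar>k x - g x\<bar> \<partial>?M)"
      by (rule Bochner_Integration.integral_add[OF fi[OF h] fi[OF k]])
    finally show ?thesis .
  qed
  have nn: "(\<integral>\<^sup>+x. ennreal \<bar>h x - g x\<bar> \<partial>?M) = ennreal (\<integral>x. \<bar>h x - g x\<bar> \<partial>?M)" if "lip_bdd h" for h
    using fi[OF that] by (intro nn_integral_eq_integral) auto
  have "Cauchy (\<lambda>n. T (f n) \<pi>)"
  proof (rule metric_CauchyI)
    fix e :: real assume e: "e > 0"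
    have "\<forall>\<^sub>F n in sequentially. (\<integral>x. \<bar>f n x - g x\<bar> \<partial>?M) < e / (L + 1) / 2"
      using lim e L(1) by (intro order_tendstoD(2)) auto
    then obtain N where N: "\<And>n. n \<ge> N \<Longrightarrow> (\<integral>x. \<bar>f n x - g x\<bar> \<partial>?M) < e / (L + 1) / 2"
      by (auto simp: eventually_sequentially)
    have "dist (T (f m) \<pi>) (T (f n) \<pi>) < e" if mn: "m \<ge> N" "n \<ge> N" for m n
    proof -
      let ?I = "(\<integral>x. \<bar>f m x - g x\<bar> \<partial>?M) + (\<integral>x. \<bar>f n x - g x\<bar> \<partial>?M)"
      have "?I < e / (L + 1)" using N[OF mn(1)] N[OF mn(2)] by linarith
      then have I: "(L + 1) * ?I < e" using L(1) by (simp add: field_simps)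
      have "0 \<le> ?I" by (intro add_nonneg_nonneg Bochner_Integration.integral_nonneg) auto
      then have "L * ?I \<le> (L + 1) * ?I" by (intro mult_right_mono) auto
      then show ?thesis using diff[OF f[of m] f[of n]] I by (simp add: dist_real_def)
    qed
    then show "\<exists>N. \<forall>m\<ge>N. \<forall>n\<ge>N. dist (T (f m) \<pi>) (T (f n) \<pi>) < e" by blast
  qed
  then obtain l where l: "(\<lambda>n. T (f n) \<pi>) \<longlonglongrightarrow> l" using Cauchy_convergent convergent_def by blast
  have "borel_extension T g \<pi> = l"
    unfolding borel_extension_def
  proof (rule the_equality)
    have "(\<lambda>n. \<integral>\<^sup>+x. ennreal \<bar>f n x - g x\<bar> \<partial>?M) \<longlonglongrightarrow> 0"
      unfolding nn[OF f] using lim by (metis ennreal_0 tendsto_ennrealI)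
    then show "\<exists>f. (\<forall>n. lip_bdd (f n)) \<and> (\<lambda>n. \<integral>\<^sup>+x. ennreal \<bar>f n x - g x\<bar> \<partial>?M) \<longlonglongrightarrow> 0 \<and> (\<lambda>n. T (f n) \<pi>) \<longlonglongrightarrow> l"
      using f l by blast
  next
    fix l' assume "\<exists>f. (\<forall>n. lip_bdd (f n)) \<and> (\<lambda>n. \<integral>\<^sup>+x. ennreal \<bar>f n x - g x\<bar> \<partial>?M) \<longlonglongrightarrow> 0 \<and> (\<lambda>n. T (f n) \<pi>) \<longlonglongrightarrow> l'"
    then obtain h where h: "\<And>n. lip_bdd (h n)" "(\<lambda>n. \<integral>\<^sup>+x. ennreal \<bar>h n x - g x\<bar> \<partial>?M) \<longlonglongrightarrow> 0" "(\<lambda>n. T (h n) \<pi>) \<longlonglongrightarrow> l'"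
      by blast
    have "(\<lambda>n. ennreal (\<integral>x. \<bar>h n x - g x\<bar> \<partial>?M)) \<longlonglongrightarrow> ennreal 0"
      using h(2) unfolding nn[OF h(1)] by simp
    then have "(\<lambda>n. \<integral>x. \<bar>h n x - g x\<bar> \<partial>?M) \<longlonglongrightarrow> 0"
      by (subst (asm) tendsto_ennreal_iff) (auto intro!: always_eventually Bochner_Integration.integral_nonneg)
    then have "(\<lambda>n. L * ((\<integral>x. \<bar>h n x - g x\<bar> \<partial>?M) + (\<integral>x. \<bar>f n x - g x\<bar> \<partial>?M))) \<longlonglongrightarrow> L * (0 + 0)"
      using lim by (intro tendsto_intros)
    then have "(\<lambda>n. L * ((\<integral>x. \<bar>h n x - g x\<bar> \<partial>?M) + (\<integral>x. \<bar>f n x - g x\<bar> \<partial>?M))) \<longlonglongrightarrow> 0" by simp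
    then have "(\<lambda>n. T (h n) \<pi> - T (f n) \<pi>) \<longlonglongrightarrow> 0"
      by (rule Lim_null_comparison[rotated]) (use diff[OF h(1) f] in \<open>simp add: always_eventually\<close>)
    moreover have "(\<lambda>n. T (h n) \<pi> - T (f n) \<pi>) \<longlonglongrightarrow> l' - l" using h(3) l by (rule tendsto_diff)
    ultimately show "l' = l" using LIMSEQ_unique by fastforce
  qed
  with l show ?thesis by simp
qed

lemma (in finite_borel) cutoff_mult_L1:
  assumes U: "open U" and f: "lip_bdd f"
  shows "(\<lambda>n. \<integral>x. \<bar>cutoff U n x * f x - indicator U x * f x\<bar> \<partial>\<mu>) \<longlonglongrightarrow> 0"
proof -
  obtain C where C: "C \<ge> 0" "\<And>x. \<bar>f x\<bar> \<le> C" using f by (rule lip_bddE) blast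
  have "(\<lambda>n. \<integral>x. \<bar>cutoff U n x * f x - indicator U x * f x\<bar> \<partial>\<mu>) \<longlonglongrightarrow> (\<integral>x. 0 \<partial>\<mu>)"
  proof (rule bounded_convergence[where B="1 * C"])
    show "(\<lambda>x. \<bar>cutoff U n x * f x - indicator U x * f x\<bar>) \<in> borel_measurable borel" for n
      using U f by (intro borel_measurable_abs borel_measurable_diff borel_measurable_times lip_bdd_measurable cutoff_lip_bdd borel_measurable_indicator) auto
    show "(\<lambda>n. \<bar>cutoff U n x * f x - indicator U x * f x\<bar>) \<longlonglongrightarrow> 0" for x
      using tendsto_mult_right[OF cutoff_tendsto[OF U, of x], of "f x"] by (intro tendsto_rabs_zero) (simp add: LIM_zero)
    show "\<bar>\<bar>cutoff U n x * f x - indicator U x * f x\<bar>\<bar> \<le> 1 * C" for n x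
    proof -
      have "\<bar>cutoff U n x - indicator U x\<bar> \<le> 1" using cutoff_range[of U n x] by (auto simp: indicator_def)
      from mult_mono[OF this C(2)[of x]] show ?thesis using C by (simp add: abs_mult left_diff_distrib[symmetric])
    qed
  qed auto
  then show ?thesis by simp
qed

text \<open>Products with cutoffs are a canonical approximating sequence, so restrictions to open
  sets can be handled as limits of values of \<open>T\<close> on Lipschitz functions.\<close>

lemma restrict_current_tendsto:
  assumes T: "current1 T" and U: "open U" and f: "lip_bdd f" and \<pi>: "lip \<pi>"
  shows "(\<lambda>n. T (\<lambda>x. cutoff U n x * f x) \<pi>) \<longlonglongrightarrow> restrict_current T U f \<pi>"
proof -
  interpret M: finite_borel "mass_measure T" using T by (rule mass_measure_finite_borel)
  obtain C where C: "C \<ge> 0" "\<And>x. \<bar>f x\<bar> \<le> C" using f by (rule lip_bddE) blast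
  have "(\<lambda>n. T (\<lambda>x. cutoff U n x * f x) \<pi>) \<longlonglongrightarrow> borel_extension T (\<lambda>x. indicator U x * f x) \<pi>"
  proof (rule borel_extension_tendsto[OF T])
    show "(\<lambda>x. indicator U x * f x) \<in> borel_measurable borel"
      using U by (intro borel_measurable_times lip_bdd_measurable f borel_measurable_indicator) auto
    show "\<bar>indicator U x * f x\<bar> \<le> C" for x using C by (auto simp: indicator_def)
  qed (intro lip_bdd_mult cutoff_lip_bdd f M.cutoff_mult_L1 U \<pi>)+
  then show ?thesis using f \<pi> by (simp add: restrict_current_def)
qed

section \<open>The area formula on the line\<close>

lemma AE_summable_of_integrals:
  fixes f :: "nat \<Rightarrow> 'a \<Rightarrow> real"
  assumes f: "\<And>n. integrable M (f n)" and s: "summable (\<lambda>n. \<integral>x. \<bar>f n x\<bar> \<partial>M)"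
  shows "AE x in M. summable (\<lambda>n. \<bar>f n x\<bar>)"
proof -
  have [measurable]: "f n \<in> borel_measurable M" for n using f by auto
  have "(\<integral>\<^sup>+x. (\<Sum>n. ennreal \<bar>f n x\<bar>) \<partial>M) = (\<Sum>n. \<integral>\<^sup>+x. ennreal \<bar>f n x\<bar> \<partial>M)"
    by (rule nn_integral_suminf) measurable
  also have "\<dots> = (\<Sum>n. ennreal (\<integral>x. \<bar>f n x\<bar> \<partial>M))"
    using f by (intro suminf_cong nn_integral_eq_integral) auto
  also have "\<dots> \<noteq> \<infinity>"
    using s by (subst suminf_ennreal2) (auto intro!: Bochner_Integration.integral_nonneg)
  finally have "AE x in M. (\<Sum>n. ennreal \<bar>f n x\<bar>) \<noteq> \<infinity>"
    by (intro nn_integral_PInf_AE) auto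
  then show ?thesis by eventually_elim (rule summable_suminf_not_top, auto)
qed

text \<open>At almost every point the integers are absolutely summable, so they vanish from some
  index on and their sum is an integer. Taking the floor changes the sum only on a null set and
  makes the density integer everywhere.\<close>

lemma int_valued_series:
  fixes \<theta> :: "nat \<Rightarrow> real \<Rightarrow> int"
  assumes i: "\<And>n. integrable lebesgue (\<lambda>x. real_of_int (\<theta> n x))"
    and s: "summable (\<lambda>n. \<integral>x. \<bar>real_of_int (\<theta> n x)\<bar> \<partial>lebesgue)"
  obtains \<Theta> :: "real \<Rightarrow> int" where "integrable lebesgue (\<lambda>x. real_of_int (\<Theta> x))"
    "(\<integral>x. \<bar>real_of_int (\<Theta> x)\<bar> \<partial>lebesgue) \<le> (\<Sum>n. \<integral>x. \<bar>real_of_int (\<theta> n x)\<bar> \<partial>lebesgue)"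
    "\<And>g C. g \<in> borel_measurable lebesgue \<Longrightarrow> AE x in lebesgue. \<bar>g x\<bar> \<le> C \<Longrightarrow>
       (\<lambda>n. \<integral>x. real_of_int (\<theta> n x) * g x \<partial>lebesgue) sums (\<integral>x. real_of_int (\<Theta> x) * g x \<partial>lebesgue)"
proof -
  let ?f = "\<lambda>n x. real_of_int (\<theta> n x)"
  have ae: "AE x in lebesgue. summable (\<lambda>n. \<bar>?f n x\<bar>)" by (rule AE_summable_of_integrals[OF i s])
  define S where "S x = (\<Sum>n. ?f n x)" for x
  have Si: "integrable lebesgue S" unfolding S_def
    by (rule integrable_suminf[OF i]) (use ae s in auto)
  define \<Theta> where "\<Theta> x = \<lfloor>S x\<rfloor>" for x
  have eq: "AE x in lebesgue. real_of_int (\<Theta> x) = S x"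
    using ae
  proof eventually_elim
    case (elim x)
    then have "(\<lambda>n. \<bar>?f n x\<bar>) \<longlonglongrightarrow> 0" by (rule summable_LIMSEQ_zero)
    then have "\<forall>\<^sub>F n in sequentially. \<bar>?f n x\<bar> < 1" by (rule order_tendstoD) simp
    then obtain N where N: "\<And>n. n \<ge> N \<Longrightarrow> \<bar>?f n x\<bar> < 1" by (auto simp: eventually_sequentially)
    have "?f n x = 0" if "n \<ge> N" for n
    proof -
      have "\<bar>\<theta> n x\<bar> < 1" using N[OF that] by linarith
      then show ?thesis by simp
    qed
    then have "S x = (\<Sum>n<N. ?f n x)" unfolding S_def by (intro suminf_finite) (auto simp: not_less)
    also have "\<dots> = real_of_int (\<Sum>n<N. \<theta> n x)" by simp
    finally show ?case by (simp only: \<Theta>_def floor_of_int)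
  qed
  have m: "(\<lambda>x. real_of_int (\<Theta> x)) \<in> borel_measurable lebesgue"
    using borel_measurable_integrable[OF Si] unfolding \<Theta>_def by measurable
  have Ti: "integrable lebesgue (\<lambda>x. real_of_int (\<Theta> x))"
    using integrable_cong_AE[OF m borel_measurable_integrable[OF Si] eq] Si by simp
  show thesis
  proof (rule that[OF Ti])
    have abs_ae: "AE x in lebesgue. summable (\<lambda>n. norm \<bar>?f n x\<bar>)" using ae by simp
    have abs_i: "integrable lebesgue (\<lambda>x. \<bar>?f n x\<bar>)" for n using i by simp
    have abs_s: "summable (\<lambda>n. \<integral>x. norm \<bar>?f n x\<bar> \<partial>lebesgue)" using s by simp
    have "(\<integral>x. \<bar>real_of_int (\<Theta> x)\<bar> \<partial>lebesgue) \<le> (\<integral>x. (\<Sum>n. \<bar>?f n x\<bar>) \<partial>lebesgue)"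
    proof (rule integral_mono_AE)
      show "integrable lebesgue (\<lambda>x. \<Sum>n. \<bar>?f n x\<bar>)" by (rule integrable_suminf[OF abs_i abs_ae abs_s])
      show "AE x in lebesgue. \<bar>real_of_int (\<Theta> x)\<bar> \<le> (\<Sum>n. \<bar>?f n x\<bar>)"
        using eq ae by eventually_elim (simp add: S_def summable_rabs)
    qed (use Ti in simp)
    also have "\<dots> = (\<Sum>n. \<integral>x. \<bar>?f n x\<bar> \<partial>lebesgue)" by (rule integral_suminf[OF abs_i abs_ae abs_s])
    finally show "(\<integral>x. \<bar>real_of_int (\<Theta> x)\<bar> \<partial>lebesgue) \<le> (\<Sum>n. \<integral>x. \<bar>?f n x\<bar> \<partial>lebesgue)" .
  next
    fix g :: "real \<Rightarrow> real" and C assume g: "g \<in> borel_measurable lebesgue" and C: "AE x in lebesgue. \<bar>g x\<bar> \<le> (C::real)"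
    have bi: "AE x in lebesgue. norm (?f n x * g x) \<le> norm (\<bar>?f n x\<bar> * C)" for n
      using C
    proof eventually_elim
      case (elim x)
      have "\<bar>?f n x\<bar> * \<bar>g x\<bar> \<le> \<bar>?f n x\<bar> * \<bar>C\<bar>" using elim by (intro mult_left_mono) auto
      then show ?case by (simp add: abs_mult)
    qed
    have gi: "integrable lebesgue (\<lambda>x. ?f n x * g x)" for n
      using i[of n] g by (intro Bochner_Integration.integrable_bound[OF _ _ bi]) auto
    have le: "(\<integral>x. norm (?f n x * g x) \<partial>lebesgue) \<le> \<bar>C\<bar> * (\<integral>x. \<bar>?f n x\<bar> \<partial>lebesgue)" for n
    proof -
      have "(\<integral>x. norm (?f n x * g x) \<partial>lebesgue) \<le> (\<integral>x. \<bar>C\<bar> * \<bar>?f n x\<bar> \<partial>lebesgue)"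
        using bi[of n] gi i by (intro integral_mono_AE integrable_norm) (auto simp: abs_mult mult.commute)
      then show ?thesis by simp
    qed
    have gs: "summable (\<lambda>n. \<integral>x. norm (?f n x * g x) \<partial>lebesgue)"
      by (rule summable_comparison_test'[OF summable_mult[OF s, of "\<bar>C\<bar>"], where N=0]) (use le in \<open>auto simp: abs_of_nonneg\<close>)
    have ga: "AE x in lebesgue. summable (\<lambda>n. norm (?f n x * g x))"
      using ae by eventually_elim (simp add: abs_mult summable_mult2)
    have "(\<lambda>n. \<integral>x. ?f n x * g x \<partial>lebesgue) sums (\<integral>x. (\<Sum>n. ?f n x * g x) \<partial>lebesgue)"
      by (rule sums_integral[OF gi ga gs])
    also have "(\<integral>x. (\<Sum>n. ?f n x * g x) \<partial>lebesgue) = (\<integral>x. real_of_int (\<Theta> x) * g x \<partial>lebesgue)"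
    proof (rule integral_cong_AE)
      show "AE x in lebesgue. (\<Sum>n. ?f n x * g x) = real_of_int (\<Theta> x) * g x"
        using eq ae by eventually_elim (simp add: S_def suminf_mult2[symmetric] summable_rabs_cancel)
      show "(\<lambda>x. \<Sum>n. ?f n x * g x) \<in> borel_measurable lebesgue"
        by (rule borel_measurable_integrable[OF integrable_suminf[OF gi ga gs]])
    qed (use m g in auto)
    finally show "(\<lambda>n. \<integral>x. ?f n x * g x \<partial>lebesgue) sums (\<integral>x. real_of_int (\<Theta> x) * g x \<partial>lebesgue)" .
  qed
qed

lemma open_connected_bounded_real:
  fixes K :: "real set"
  assumes "open K" "connected K" "K \<noteq> {}" "bounded K"
  shows "K = {Inf K<..<Sup K}"
proof
  have b: "bdd_below K" "bdd_above K" using assms(4) by (auto simp: bounded_imp_bdd_below bounded_imp_bdd_above)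
  show "K \<subseteq> {Inf K<..<Sup K}"
  proof
    fix x assume x: "x \<in> K"
    then obtain e where e: "e > 0" "ball x e \<subseteq> K" using assms(1) open_contains_ball by blast
    have "x - e / 2 \<in> K" "x + e / 2 \<in> K" using e by (auto intro!: subsetD[OF e(2)] simp: dist_real_def)
    then have "Inf K \<le> x - e / 2" "x + e / 2 \<le> Sup K" using b by (auto intro: cInf_lower cSup_upper)
    then show "x \<in> {Inf K<..<Sup K}" using e(1) by auto
  qed
  show "{Inf K<..<Sup K} \<subseteq> K"
  proof
    fix x assume x: "x \<in> {Inf K<..<Sup K}"
    obtain y where "y \<in> K" "y < x" using cInf_less_iff[OF assms(3) b(1), of x] x by auto
    moreover obtain z where "z \<in> K" "x < z" using less_cSup_iff[OF assms(3) b(2), of x] x by auto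
    ultimately show "x \<in> K" using assms(2) by (metis connected_iff_interval less_imp_le)
  qed
qed

text \<open>The intervals are the components of \<open>V\<close>. Indices without a component get
  the empty interval \<open>{a<..<a}\<close>, so that the family is indexed by all of
  \<open>nat\<close>.\<close>

lemma open_disjoint_intervals:
  fixes V :: "real set"
  assumes V: "open V" "V \<subseteq> {a<..<b}" and ab: "a \<le> b"
  obtains c d :: "nat \<Rightarrow> real" where "\<And>n. a \<le> c n" "\<And>n. c n \<le> d n" "\<And>n. d n \<le> b"
    "disjoint_family (\<lambda>n. {c n<..<d n})" "V = (\<Union>n. {c n<..<d n})"
proof -
  define \<K> where "\<K> = components V"
  have K: "K = {Inf K<..<Sup K}" "a \<le> Inf K" "Inf K \<le> Sup K" "Sup K \<le> b" "K \<subseteq> V" "K \<noteq> {}" if "K \<in> \<K>" for K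
  proof -
    have 1: "open K" "connected K" "K \<noteq> {}" "K \<subseteq> V"
      using that V(1) by (auto simp: \<K>_def open_components in_components_connected in_components_nonempty in_components_subset)
    have s: "K \<subseteq> {a<..<b}" using 1(4) V(2) by auto
    have bd: "bounded K" using bounded_subset[OF bounded_box[of a b]] s by simp
    then show "K = {Inf K<..<Sup K}" using 1 by (intro open_connected_bounded_real)
    obtain x where x: "x \<in> K" using 1 by auto
    show "a \<le> Inf K" using 1(3) s by (intro cInf_greatest) auto
    show "Sup K \<le> b" using 1(3) s by (intro cSup_least) auto
    have "Inf K \<le> x" using bd x by (intro cInf_lower bounded_imp_bdd_below)
    also have "x \<le> Sup K" using bd x by (intro cSup_upper bounded_imp_bdd_above)
    finally show "Inf K \<le> Sup K" .
    show "K \<subseteq> V" "K \<noteq> {}" by fact+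
  qed
  have disj: "A \<inter> B = {}" if "A \<in> \<K>" "B \<in> \<K>" "A \<noteq> B" for A B
    using that components_nonoverlap unfolding \<K>_def by blast
  have cnt: "countable \<K>"
    by (rule countable_disjoint_open_subsets)
      (use V(1) disj in \<open>auto simp: \<K>_def pairwise_def disjnt_def disjoint_def open_components\<close>)
  define J where "J n = (if n \<in> to_nat_on \<K> ` \<K> then from_nat_into \<K> n else {})" for n
  have J: "J n = {} \<or> J n \<in> \<K>" for n using cnt by (auto simp: J_def)
  have Jinj: "J m \<inter> J n = {}" if "m \<noteq> n" for m n
  proof (cases "m \<in> to_nat_on \<K> ` \<K> \<and> n \<in> to_nat_on \<K> ` \<K>")
    case True
    then obtain A B where AB: "A \<in> \<K>" "B \<in> \<K>" "m = to_nat_on \<K> A" "n = to_nat_on \<K> B" by auto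
    then have "A \<noteq> B" using that by auto
    then have "A \<inter> B = {}" using disj AB by blast
    then show ?thesis using AB cnt by (simp add: J_def)
  qed (auto simp: J_def)
  have JU: "(\<Union>n. J n) = V"
  proof -
    have "\<Union>\<K> = V" unfolding \<K>_def by (rule Union_components)
    moreover have "\<Union>\<K> = (\<Union>n. J n)"
    proof
      show "\<Union>\<K> \<subseteq> (\<Union>n. J n)"
      proof
        fix x assume "x \<in> \<Union>\<K>"
        then obtain A where A: "A \<in> \<K>" "x \<in> A" by auto
        then have "J (to_nat_on \<K> A) = A" using cnt by (simp add: J_def)
        then show "x \<in> (\<Union>n. J n)" using A by blast
      qed
      show "(\<Union>n. J n) \<subseteq> \<Union>\<K>" using J by blast
    qed
    ultimately show ?thesis by simp
  qed
  define c where "c n = (if J n = {} then a else Inf (J n))" for n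
  define d where "d n = (if J n = {} then a else Sup (J n))" for n
  have "{c n<..<d n} = J n" for n
    using J[of n] K(1)[of "J n"] by (auto simp: c_def d_def)
  moreover have "a \<le> c n" "c n \<le> d n" "d n \<le> b" for n
    using J[of n] K(2-4)[of "J n"] ab by (auto simp: c_def d_def)
  ultimately show thesis
    using JU Jinj by (intro that[of c d]) (auto simp: disjoint_family_on_def)
qed

text \<open>The integer form of \<open>oriented_indicator\<close>, since the densities of
  rectifiable currents take values in \<open>int\<close>.\<close>

definition int_indicator :: "real \<Rightarrow> real \<Rightarrow> real \<Rightarrow> int" where
  "int_indicator c d y = of_bool (y \<in> {c..d}) - of_bool (y \<in> {d..c})"

lemma int_indicator: "real_of_int (int_indicator c d y) = oriented_indicator c d y"
  by (simp add: int_indicator_def oriented_indicator_def indicator_def)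

lemma oriented_indicator_integrable:
  "integrable lebesgue (oriented_indicator c d)"
  "(\<integral>y. \<bar>oriented_indicator c d y\<bar> \<partial>lebesgue) = \<bar>d - c\<bar>"
proof -
  have "integrable lebesgue (\<lambda>y. indicator {c..d} y * (1::real) - indicator {d..c} y * 1)"
    by (intro Bochner_Integration.integrable_diff integrable_indicator_Icc)
  then show "integrable lebesgue (oriented_indicator c d)"
    by (simp add: oriented_indicator_def[abs_def])
  have "\<bar>oriented_indicator c d y\<bar> = (if c = d then 0 else indicator {min c d..max c d} y)" for y
    by (auto simp: oriented_indicator_def indicator_def)
  then show "(\<integral>y. \<bar>oriented_indicator c d y\<bar> \<partial>lebesgue) = \<bar>d - c\<bar>"
    by (cases "c = d") (auto simp: min_def max_def)
qed

lemma summable_disjoint_lengths: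
  fixes c d :: "nat \<Rightarrow> real"
  assumes cd: "\<And>n. a \<le> c n" "\<And>n. c n \<le> d n" "\<And>n. d n \<le> b" "disjoint_family (\<lambda>n. {c n<..<d n})"
    and ab: "a \<le> b"
  shows "summable (\<lambda>n. d n - c n)" "(\<Sum>n. d n - c n) \<le> b - a"
proof -
  have "(\<Sum>n. ennreal (d n - c n)) = (\<Sum>n. emeasure lborel {c n<..<d n})"
    using cd(2) by simp
  also have "\<dots> = emeasure lborel (\<Union>n. {c n<..<d n})"
    using cd(4) by (intro suminf_emeasure) auto
  also have "\<dots> \<le> emeasure lborel {a..b}"
  proof (rule emeasure_mono)
    show "(\<Union>n. {c n<..<d n}) \<subseteq> {a..b}"
    proof
      fix x assume "x \<in> (\<Union>n. {c n<..<d n})"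
      then obtain n where "c n < x" "x < d n" by auto
      then show "x \<in> {a..b}" using cd(1,3)[of n] by auto
    qed
  qed auto
  finally have le: "(\<Sum>n. ennreal (d n - c n)) \<le> ennreal (b - a)" using ab by simp
  then have "(\<Sum>n. ennreal (d n - c n)) \<noteq> top" by (metis ennreal_neq_top top.extremum_unique)
  then show s: "summable (\<lambda>n. d n - c n)" using cd(2) by (intro summable_suminf_not_top) auto
  have "(\<Sum>n. ennreal (d n - c n)) = ennreal (\<Sum>n. d n - c n)"
    using cd(2) by (intro suminf_ennreal2 s) auto
  with le show "(\<Sum>n. d n - c n) \<le> b - a" using ab by (simp add: ennreal_le_iff)
qed

lemma lint_indicator_Ioo:
  "lint a b (\<lambda>x. indicator {c<..<d} x * g x) \<sigma> = lint c d g \<sigma>" if "a \<le> c" "d \<le> b"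
    "g \<in> borel_measurable borel" "L-lipschitz_on UNIV \<sigma>"
  unfolding lint_def
proof (rule integral_cong_AE)
  have "AE x in lebesgue. x \<noteq> c" "AE x in lebesgue. x \<noteq> d"
    by (intro AE_completion AE_lborel_singleton)+
  then show "AE x in lebesgue. indicator {a..b} x * (indicator {c<..<d} x * g x * deriv \<sigma> x) = indicator {c..d} x * (g x * deriv \<sigma> x)"
    by eventually_elim (use that(1,2) in \<open>auto simp: indicator_def\<close>)
qed (use that(3) lipschitz_deriv_measurable[OF that(4)] in
    \<open>auto intro!: borel_measurable_times borel_measurable_indicator measurable_completion[of g]\<close>)

text \<open>Substitution on each component of \<open>V\<close> gives the oriented indicator of the interval between its end values.\<close>

lemma lint_open_degree:
  assumes V: "open V" "V \<subseteq> {a<..<b}" and ab: "a \<le> b" and M: "M-lipschitz_on UNIV \<phi>"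
  obtains \<Theta> :: "real \<Rightarrow> int" where "integrable lebesgue (\<lambda>y. real_of_int (\<Theta> y))"
    "(\<integral>y. \<bar>real_of_int (\<Theta> y)\<bar> \<partial>lebesgue) \<le> M * (b - a)"
    "\<And>f \<pi>. lip_bdd f \<Longrightarrow> lip \<pi> \<Longrightarrow> lint a b (\<lambda>x. indicator V x * f (\<phi> x)) (\<pi> \<circ> \<phi>) = (\<integral>y. real_of_int (\<Theta> y) * (f y * deriv \<pi> y) \<partial>lebesgue)"
proof -
  have M0: "M \<ge> 0" using M by (rule lipschitz_on_nonneg)
  obtain c d :: "nat \<Rightarrow> real" where cd: "\<And>n. a \<le> c n" "\<And>n. c n \<le> d n" "\<And>n. d n \<le> b"
    "disjoint_family (\<lambda>n. {c n<..<d n})" and Veq: "V = (\<Union>n. {c n<..<d n})"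
    using open_disjoint_intervals[OF V ab] by blast
  note sl = summable_disjoint_lengths[OF cd ab]
  define \<theta> where "\<theta> n = int_indicator (\<phi> (c n)) (\<phi> (d n))" for n
  have ti: "integrable lebesgue (\<lambda>y. real_of_int (\<theta> n y))" for n
    using oriented_indicator_integrable(1)[of "\<phi> (c n)" "\<phi> (d n)"] by (simp add: \<theta>_def int_indicator)
  \<comment> \<open>The values of \<open>\<phi>\<close> at the ends of a component differ by at most
    \<open>M\<close> times its length, and the lengths add up to at most \<open>b - a\<close>. So
    the degrees of the components are summable in L1.\<close>
  have tn: "(\<integral>y. \<bar>real_of_int (\<theta> n y)\<bar> \<partial>lebesgue) \<le> M * (d n - c n)" for n
    using lipschitz_real_bound[OF M, of "d n" "c n"] cd(2)[of n] by (simp add: \<theta>_def int_indicator oriented_indicator_integrable(2))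
  have ts: "summable (\<lambda>n. \<integral>y. \<bar>real_of_int (\<theta> n y)\<bar> \<partial>lebesgue)"
    by (rule summable_comparison_test'[OF summable_mult[OF sl(1), of M], where N=0]) (use tn in simp)
  obtain \<Theta> :: "real \<Rightarrow> int" where T: "integrable lebesgue (\<lambda>y. real_of_int (\<Theta> y))"
    "(\<integral>y. \<bar>real_of_int (\<Theta> y)\<bar> \<partial>lebesgue) \<le> (\<Sum>n. \<integral>y. \<bar>real_of_int (\<theta> n y)\<bar> \<partial>lebesgue)"
    "\<And>g C. g \<in> borel_measurable lebesgue \<Longrightarrow> AE x in lebesgue. \<bar>g x\<bar> \<le> C \<Longrightarrow>
       (\<lambda>n. \<integral>x. real_of_int (\<theta> n x) * g x \<partial>lebesgue) sums (\<integral>x. real_of_int (\<Theta> x) * g x \<partial>lebesgue)"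
    using int_valued_series[OF ti ts] by blast
  show thesis
  proof (rule that[OF T(1)])
    have "(\<Sum>n. \<integral>y. \<bar>real_of_int (\<theta> n y)\<bar> \<partial>lebesgue) \<le> (\<Sum>n. M * (d n - c n))"
      by (rule suminf_le[OF tn ts summable_mult[OF sl(1)]])
    also have "\<dots> = M * (\<Sum>n. d n - c n)" by (rule suminf_mult[OF sl(1)])
    also have "\<dots> \<le> M * (b - a)" using sl(2) M0 by (rule mult_left_mono)
    finally show "(\<integral>y. \<bar>real_of_int (\<Theta> y)\<bar> \<partial>lebesgue) \<le> M * (b - a)" using T(2) by simp
  next
    fix f \<pi> :: "real \<Rightarrow> real" assume f: "lip_bdd f" and \<pi>: "lip \<pi>"
    obtain C where C: "C \<ge> 0" "\<And>x. \<bar>f x\<bar> \<le> C" using f by (rule lip_bddE) blast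
    obtain L where L: "L \<ge> 0" "L-lipschitz_on UNIV \<pi>" using \<pi> by (rule lipE)
    have LM: "(L * M)-lipschitz_on UNIV (\<pi> \<circ> \<phi>)"
      by (rule lipschitz_on_compose[OF M lipschitz_on_subset[OF L(2)]]) simp
    have fm: "f \<in> borel_measurable borel" using f by (rule lip_bdd_measurable)
    have cfp: "continuous_on UNIV (\<lambda>x. f (\<phi> x))"
      using lip_continuous[OF lip_compose[OF lipI[OF M] lip_bdd_lip[OF f]]] by (simp add: comp_def)
    have gm: "(\<lambda>x. f (\<phi> x)) \<in> borel_measurable borel" using cfp by (rule borel_measurable_continuous_onI)
    define q where "q x = f (\<phi> x) * deriv (\<pi> \<circ> \<phi>) x" for x
    have qm: "q \<in> borel_measurable lebesgue"
      unfolding q_def using gm lipschitz_deriv_measurable[OF LM] by (intro borel_measurable_times measurable_completion[of "\<lambda>x. f (\<phi> x)"]) auto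
    have qb: "AE x in lebesgue. \<bar>q x\<bar> \<le> C * (L * M)"
      using lipschitz_AE_deriv_le[OF LM]
    proof eventually_elim
      case (elim x)
      then show ?case unfolding q_def abs_mult[of "f (\<phi> x)"] using C by (intro mult_mono) auto
    qed
    have sum_pieces: "(\<lambda>n. \<integral>x. indicator {c n<..<d n} x * q x \<partial>lebesgue) sums (\<integral>x. indicator V x * q x \<partial>lebesgue)"
    proof -
      have i: "integrable lebesgue (indicator {c n<..<d n} :: real \<Rightarrow> real)" for n
        using cd(2) by (intro integrable_real_indicator) auto
      have iq: "integrable lebesgue (\<lambda>x. indicator {c n<..<d n} x * q x)" for n
      proof (rule Bochner_Integration.integrable_bound)
        show "integrable lebesgue (\<lambda>x. indicator {c n<..<d n} x * (C * (L * M)))" using i by (rule integrable_mult_left)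
        show "AE x in lebesgue. norm (indicator {c n<..<d n} x * q x) \<le> norm (indicator {c n<..<d n} x * (C * (L * M)))"
          using qb by eventually_elim (auto simp: indicator_def)
      qed (use qm in \<open>auto intro!: borel_measurable_times borel_measurable_indicator\<close>)
      have bd: "(\<integral>x. norm (indicator {c n<..<d n} x * q x) \<partial>lebesgue) \<le> (C * (L * M)) * (d n - c n)" for n
      proof -
        have "(\<integral>x. norm (indicator {c n<..<d n} x * q x) \<partial>lebesgue) \<le> (\<integral>x. indicator {c n<..<d n} x * (C * (L * M)) \<partial>lebesgue)"
        proof (rule integral_mono_AE)
          show "AE x in lebesgue. norm (indicator {c n<..<d n} x * q x) \<le> indicator {c n<..<d n} x * (C * (L * M))"
            using qb by eventually_elim (auto simp: indicator_def)
        qed (use i iq in \<open>auto intro: integrable_mult_left\<close>)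
        then show ?thesis using cd(2)[of n] by (simp add: mult.commute)
      qed
      have sums1: "(\<lambda>n. \<integral>x. indicator {c n<..<d n} x * q x \<partial>lebesgue) sums (\<integral>x. (\<Sum>n. indicator {c n<..<d n} x * q x) \<partial>lebesgue)"
      proof (rule sums_integral[OF iq])
        show "AE x in lebesgue. summable (\<lambda>n. norm (indicator {c n<..<d n} x * q x))"
        proof (intro AE_I2)
          fix x
          have "\<exists>m. \<forall>n. n \<noteq> m \<longrightarrow> x \<notin> {c n<..<d n}"
            using cd(4) unfolding disjoint_family_on_def by blast
          then obtain m where "\<And>n. n \<noteq> m \<Longrightarrow> x \<notin> {c n<..<d n}" by blast
          then show "summable (\<lambda>n. norm (indicator {c n<..<d n} x * q x))"
            by (intro summable_finite[of "{m}"]) auto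
        qed
        show "summable (\<lambda>n. \<integral>x. norm (indicator {c n<..<d n} x * q x) \<partial>lebesgue)"
          by (rule summable_comparison_test'[OF summable_mult[OF sl(1), of "C * (L * M)"], where N=0]) (use bd in \<open>auto simp: abs_of_nonneg\<close>)
      qed
      have sum_eq: "(\<Sum>n. indicator {c n<..<d n} x * q x) = indicator V x * q x" for x
      proof (cases "x \<in> V")
        case True
        then obtain m where m: "x \<in> {c m<..<d m}" by (auto simp: Veq)
        have "n = m \<or> x \<notin> {c n<..<d n}" for n
          using cd(4) m unfolding disjoint_family_on_def by blast
        then have "(\<Sum>n. indicator {c n<..<d n} x * q x) = (\<Sum>n\<in>{m}. indicator {c n<..<d n} x * q x)"
          by (intro suminf_finite) (auto simp: indicator_def)
        also have "\<dots> = q x" using m by (subst sum.insert) auto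
        finally show ?thesis using True by simp
      next
        case False
        then show ?thesis by (simp add: Veq)
      qed
      show ?thesis using sums1 unfolding sum_eq .
    qed
    have piece: "(\<integral>x. indicator {c n<..<d n} x * q x \<partial>lebesgue) = (\<integral>y. real_of_int (\<theta> n y) * (f y * deriv \<pi> y) \<partial>lebesgue)" for n
    proof -
      have "(\<integral>x. indicator {c n<..<d n} x * q x \<partial>lebesgue) = lint (c n) (d n) (\<lambda>x. indicator {c n<..<d n} x * f (\<phi> x)) (\<pi> \<circ> \<phi>)"
        unfolding lint_def q_def by (intro Bochner_Integration.integral_cong) (auto simp: indicator_def)
      also have "\<dots> = lint (c n) (d n) (\<lambda>x. f (\<phi> x)) (\<pi> \<circ> \<phi>)"
        by (rule lint_indicator_Ioo[OF _ _ gm LM]) auto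
      also have "\<dots> = (\<integral>y. oriented_indicator (\<phi> (c n)) (\<phi> (d n)) y * f y * deriv \<pi> y \<partial>lebesgue)"
        using lint_substitution[OF lip_bdd_lip[OF f] \<pi> lipI[OF M] cd(2)] by (simp add: comp_def)
      finally show ?thesis by (simp add: \<theta>_def int_indicator mult.assoc)
    qed
    have "(\<lambda>n. \<integral>y. real_of_int (\<theta> n y) * (f y * deriv \<pi> y) \<partial>lebesgue) sums (\<integral>x. indicator V x * q x \<partial>lebesgue)"
      using sum_pieces unfolding piece .
    moreover have "(\<lambda>n. \<integral>y. real_of_int (\<theta> n y) * (f y * deriv \<pi> y) \<partial>lebesgue) sums (\<integral>y. real_of_int (\<Theta> y) * (f y * deriv \<pi> y) \<partial>lebesgue)"
    proof (rule T(3))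
      show "(\<lambda>y. f y * deriv \<pi> y) \<in> borel_measurable lebesgue"
        using fm lipschitz_deriv_measurable[OF L(2)] by (intro borel_measurable_times measurable_completion[of f]) auto
      show "AE y in lebesgue. \<bar>f y * deriv \<pi> y\<bar> \<le> C * L"
        using lipschitz_AE_deriv_le[OF L(2)]
      proof eventually_elim
        case (elim x)
        then show ?case unfolding abs_mult using C by (intro mult_mono) auto
      qed
    qed
    ultimately have "(\<integral>x. indicator V x * q x \<partial>lebesgue) = (\<integral>y. real_of_int (\<Theta> y) * (f y * deriv \<pi> y) \<partial>lebesgue)"
      by (rule sums_unique2)
    moreover have "lint a b (\<lambda>x. indicator V x * f (\<phi> x)) (\<pi> \<circ> \<phi>) = (\<integral>x. indicator V x * q x \<partial>lebesgue)"
      unfolding lint_def q_def using V(2) by (intro Bochner_Integration.integral_cong) (auto simp: indicator_def)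
    ultimately show "lint a b (\<lambda>x. indicator V x * f (\<phi> x)) (\<pi> \<circ> \<phi>) = (\<integral>y. real_of_int (\<Theta> y) * (f y * deriv \<pi> y) \<partial>lebesgue)"
      by simp
  qed
qed

section \<open>Chains of curves\<close>

text \<open>The curves live on the whole line, so that their composites with Lipschitz functions
  fall under the theory of \<open>lint\<close>; only parameters in \<open>[0, len n]\<close> are
  integrated over.\<close>

locale curves =
  fixes \<gamma> :: "nat \<Rightarrow> real \<Rightarrow> 'a::metric_space" and len :: "nat \<Rightarrow> real"
  assumes curve_lipschitz: "1-lipschitz_on UNIV (\<gamma> n)" and len_nonneg: "0 \<le> len n"
begin

definition finite_weight :: "(nat \<Rightarrow> real) \<Rightarrow> bool" where
  "finite_weight w \<longleftrightarrow> summable (\<lambda>n. \<bar>w n\<bar> * len n)"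

text \<open>Bounded Borel functions \<open>g\<close> are intended here as well, because restricting
  a chain to an open set multiplies by an indicator; \<open>chain\<close> is the normalised
  functional.\<close>

definition chain_ext :: "(nat \<Rightarrow> real) \<Rightarrow> 'a functional1" where
  "chain_ext w g \<pi> = (\<Sum>n. w n * lint 0 (len n) (g \<circ> \<gamma> n) (\<pi> \<circ> \<gamma> n))"

definition chain :: "(nat \<Rightarrow> real) \<Rightarrow> 'a functional1" where
  "chain w f \<pi> = (if lip_bdd f \<and> lip \<pi> then chain_ext w f \<pi> else 0)"

text \<open>The candidate for the mass measure. For finite weights it is a mass bound whatever the
  curves are; that it is the least one is shown with coordinates on disjoint arcs.\<close>

definition chain_measure :: "(nat \<Rightarrow> real) \<Rightarrow> 'a measure" where
  "chain_measure w = distr (density (count_space UNIV \<Otimes>\<^sub>M lborel) (\<lambda>(n, s). ennreal \<bar>w n\<bar> * indicator {0..len n} s)) borel (\<lambda>(n, s). \<gamma> n s)"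

lemma lip_curve: "lip (\<gamma> n)"
  using curve_lipschitz by (rule lipI)

lemma curve_measurable [measurable]: "\<gamma> n \<in> borel_measurable borel"
  by (intro borel_measurable_continuous_onI lip_continuous lip_curve)

lemma lipschitz_comp_curve: "L-lipschitz_on UNIV \<pi> \<Longrightarrow> L-lipschitz_on UNIV (\<pi> \<circ> \<gamma> n)"
  using lipschitz_on_compose[OF curve_lipschitz lipschitz_on_subset[of L UNIV \<pi>]] by simp

lemma comp_curve_measurable: "g \<in> borel_measurable borel \<Longrightarrow> g \<circ> \<gamma> n \<in> borel_measurable borel"
  by measurable

lemma sets_chain_measure [simp]: "sets (chain_measure w) = sets borel"
  by (simp add: chain_measure_def)

lemma nn_integral_chain_measure:
  assumes g [measurable]: "g \<in> borel_measurable borel"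
  shows "(\<integral>\<^sup>+x. g x \<partial>chain_measure w) = (\<Sum>n. ennreal \<bar>w n\<bar> * (\<integral>\<^sup>+s. indicator {0..len n} s * g (\<gamma> n s) \<partial>lborel))"
proof -
  let ?P = "count_space (UNIV :: nat set) \<Otimes>\<^sub>M (lborel :: real measure)"
  have pm: "f \<in> borel_measurable ?P" if "\<And>n. (\<lambda>s. f (n, s)) \<in> borel_measurable borel" for f :: "nat \<times> real \<Rightarrow> 'c::topological_space"
    by (rule measurable_pair_measure_countable1) (use that in auto)
  have gm: "(\<lambda>(n, s). \<gamma> n s) \<in> borel_measurable ?P" by (rule pm) simp
  have dm: "(\<lambda>(n, s). ennreal \<bar>w n\<bar> * indicator {0..len n} s) \<in> borel_measurable ?P" by (rule pm) simp
  have ggm: "(\<lambda>x. g (case x of (n, s) \<Rightarrow> \<gamma> n s)) \<in> borel_measurable ?P" by (rule pm) simp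
  have "(\<integral>\<^sup>+x. g x \<partial>chain_measure w) = (\<integral>\<^sup>+x. g (case x of (n, s) \<Rightarrow> \<gamma> n s) \<partial>density ?P (\<lambda>(n, s). ennreal \<bar>w n\<bar> * indicator {0..len n} s))"
    unfolding chain_measure_def using gm by (intro nn_integral_distr) auto
  also have "\<dots> = (\<integral>\<^sup>+x. (case x of (n, s) \<Rightarrow> ennreal \<bar>w n\<bar> * indicator {0..len n} s) * g (case x of (n, s) \<Rightarrow> \<gamma> n s) \<partial>?P)"
    by (rule nn_integral_density[OF dm ggm])
  also have "\<dots> = (\<integral>\<^sup>+n. \<integral>\<^sup>+s. (ennreal \<bar>w n\<bar> * indicator {0..len n} s) * g (\<gamma> n s) \<partial>lborel \<partial>count_space UNIV)"
    using borel_measurable_times_ennreal[OF dm ggm] by (subst lborel.nn_integral_fst[symmetric]) auto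
  also have "\<dots> = (\<Sum>n. \<integral>\<^sup>+s. ennreal \<bar>w n\<bar> * (indicator {0..len n} s * g (\<gamma> n s)) \<partial>lborel)"
    by (simp add: nn_integral_count_space_nat mult.assoc)
  also have "\<dots> = (\<Sum>n. ennreal \<bar>w n\<bar> * (\<integral>\<^sup>+s. indicator {0..len n} s * g (\<gamma> n s) \<partial>lborel))"
    by (subst nn_integral_cmult) auto
  finally show ?thesis .
qed

lemma emeasure_chain_measure:
  assumes B [measurable]: "B \<in> sets borel"
  shows "emeasure (chain_measure w) B = (\<Sum>n. ennreal \<bar>w n\<bar> * emeasure lborel ({0..len n} \<inter> \<gamma> n -` B))"
proof -
  have "emeasure (chain_measure w) B = (\<integral>\<^sup>+x. indicator B x \<partial>chain_measure w)" using B by simp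
  also have "\<dots> = (\<Sum>n. ennreal \<bar>w n\<bar> * (\<integral>\<^sup>+s. indicator {0..len n} s * indicator B (\<gamma> n s) \<partial>lborel))"
    by (rule nn_integral_chain_measure) measurable
  finally have eq: "emeasure (chain_measure w) B = (\<Sum>n. ennreal \<bar>w n\<bar> * (\<integral>\<^sup>+s. indicator {0..len n} s * indicator B (\<gamma> n s) \<partial>lborel))" .
  have piece: "(\<integral>\<^sup>+s. indicator {0..len n} s * indicator B (\<gamma> n s) \<partial>lborel) = emeasure lborel ({0..len n} \<inter> \<gamma> n -` B)" for n
  proof -
    have "\<gamma> n -` B \<in> sets borel" using measurable_sets[OF curve_measurable[of n] B] by simp
    then have "{0..len n} \<inter> \<gamma> n -` B \<in> sets lborel" by simp
    moreover have "(\<integral>\<^sup>+s. indicator {0..len n} s * indicator B (\<gamma> n s) \<partial>lborel) = (\<integral>\<^sup>+s. indicator ({0..len n} \<inter> \<gamma> n -` B) s \<partial>lborel)"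
      by (intro nn_integral_cong) (auto simp: indicator_def)
    ultimately show ?thesis by simp
  qed
  show ?thesis using eq unfolding piece .
qed

lemma emeasure_chain_measure_UNIV:
  assumes w: "finite_weight w"
  shows "emeasure (chain_measure w) UNIV = ennreal (\<Sum>n. \<bar>w n\<bar> * len n)"
proof -
  have "emeasure (chain_measure w) UNIV = (\<Sum>n. ennreal (\<bar>w n\<bar> * len n))"
    by (subst emeasure_chain_measure) (auto simp: len_nonneg ennreal_mult)
  also have "\<dots> = ennreal (\<Sum>n. \<bar>w n\<bar> * len n)"
    using w by (intro suminf_ennreal2) (auto simp: finite_weight_def len_nonneg)
  finally show ?thesis .
qed

lemma chain_measure_finite_borel: "finite_weight w \<Longrightarrow> finite_borel (chain_measure w)"
  by (intro finite_borel.intro finite_measureI finite_borel_axioms.intro)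
    (simp_all add: emeasure_chain_measure_UNIV sets_eq_imp_space_eq[OF sets_chain_measure])

lemma abs_arc_integral_le:
  assumes g: "g \<in> borel_measurable borel" "\<And>x. \<bar>g x\<bar> \<le> C"
  shows "integrable lebesgue (\<lambda>s. indicator {0..len n} s * \<bar>g (\<gamma> n s)\<bar>)"
    "(\<integral>s. indicator {0..len n} s * \<bar>g (\<gamma> n s)\<bar> \<partial>lebesgue) \<le> C * len n"
    "(\<integral>\<^sup>+s. indicator {0..len n} s * ennreal \<bar>g (\<gamma> n s)\<bar> \<partial>lborel) = ennreal (\<integral>s. indicator {0..len n} s * \<bar>g (\<gamma> n s)\<bar> \<partial>lebesgue)"
proof -
  have C: "0 \<le> C" using g(2)[of undefined] by simp
  have gm: "(\<lambda>s. indicator {0..len n} s * \<bar>g (\<gamma> n s)\<bar>) \<in> borel_measurable borel"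
    using comp_curve_measurable[OF g(1)] by (simp add: comp_def)
  show i: "integrable lebesgue (\<lambda>s. indicator {0..len n} s * \<bar>g (\<gamma> n s)\<bar>)"
  proof (rule Bochner_Integration.integrable_bound[OF integrable_indicator_Icc])
    show "(\<lambda>s. indicator {0..len n} s * \<bar>g (\<gamma> n s)\<bar>) \<in> borel_measurable lebesgue"
      using gm by (intro measurable_completion) simp
    show "AE s in lebesgue. norm (indicator {0..len n} s * \<bar>g (\<gamma> n s)\<bar>) \<le> norm (indicator {0..len n} s * C)"
      using g(2) C by (intro AE_I2) (auto simp: indicator_def)
  qed
  have "(\<integral>s. indicator {0..len n} s * \<bar>g (\<gamma> n s)\<bar> \<partial>lebesgue) \<le> (\<integral>s. indicator {0..len n} s * C \<partial>lebesgue)"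
    using g(2) i by (intro integral_mono integrable_indicator_Icc) (auto simp: indicator_def)
  then show "(\<integral>s. indicator {0..len n} s * \<bar>g (\<gamma> n s)\<bar> \<partial>lebesgue) \<le> C * len n"
    using len_nonneg[of n] by (simp add: mult.commute)
  have "(\<integral>\<^sup>+s. indicator {0..len n} s * ennreal \<bar>g (\<gamma> n s)\<bar> \<partial>lborel) = (\<integral>\<^sup>+s. ennreal (indicator {0..len n} s * \<bar>g (\<gamma> n s)\<bar>) \<partial>lborel)"
    by (intro nn_integral_cong) (auto simp: indicator_def)
  also have "\<dots> = (\<integral>\<^sup>+s. ennreal (indicator {0..len n} s * \<bar>g (\<gamma> n s)\<bar>) \<partial>lebesgue)"
    by (rule nn_integral_completion[symmetric])
  also have "\<dots> = ennreal (\<integral>s. indicator {0..len n} s * \<bar>g (\<gamma> n s)\<bar> \<partial>lebesgue)"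
    using i by (intro nn_integral_eq_integral) auto
  finally show "(\<integral>\<^sup>+s. indicator {0..len n} s * ennreal \<bar>g (\<gamma> n s)\<bar> \<partial>lborel) = ennreal (\<integral>s. indicator {0..len n} s * \<bar>g (\<gamma> n s)\<bar> \<partial>lebesgue)" .
qed

lemma integral_chain_measure:
  assumes w: "finite_weight w" and g: "g \<in> borel_measurable borel" "\<And>x. \<bar>g x\<bar> \<le> C"
  shows "(\<lambda>n. \<bar>w n\<bar> * (\<integral>s. indicator {0..len n} s * \<bar>g (\<gamma> n s)\<bar> \<partial>lebesgue)) sums (\<integral>x. \<bar>g x\<bar> \<partial>chain_measure w)"
proof -
  interpret \<mu>: finite_borel "chain_measure w" using w by (rule chain_measure_finite_borel)
  let ?a = "\<lambda>n. \<bar>w n\<bar> * (\<integral>s. indicator {0..len n} s * \<bar>g (\<gamma> n s)\<bar> \<partial>lebesgue)"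
  have nn: "0 \<le> ?a n" for n by (intro mult_nonneg_nonneg Bochner_Integration.integral_nonneg) auto
  have le: "?a n \<le> C * (\<bar>w n\<bar> * len n)" for n
    using mult_left_mono[OF abs_arc_integral_le(2)[OF g, of n], of "\<bar>w n\<bar>"] by (simp add: mult_ac)
  have s: "summable ?a"
    by (rule summable_comparison_test'[OF summable_mult[OF w[unfolded finite_weight_def], of C], where N=0])
       (use le nn in \<open>simp add: abs_of_nonneg\<close>)
  have "ennreal (\<integral>x. \<bar>g x\<bar> \<partial>chain_measure w) = (\<integral>\<^sup>+x. ennreal \<bar>g x\<bar> \<partial>chain_measure w)"
    by (rule \<mu>.nn_integral_abs_eq[OF g, symmetric])
  also have "\<dots> = (\<Sum>n. ennreal \<bar>w n\<bar> * (\<integral>\<^sup>+s. indicator {0..len n} s * ennreal \<bar>g (\<gamma> n s)\<bar> \<partial>lborel))"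
    using g(1) by (intro nn_integral_chain_measure) measurable
  also have "\<dots> = (\<Sum>n. ennreal (?a n))"
    unfolding abs_arc_integral_le(3)[OF g] by (simp add: ennreal_mult)
  also have "\<dots> = ennreal (\<Sum>n. ?a n)" by (rule suminf_ennreal2[OF nn s])
  finally have "(\<integral>x. \<bar>g x\<bar> \<partial>chain_measure w) = (\<Sum>n. ?a n)"
    using nn by (subst (asm) ennreal_inj) (auto intro!: suminf_nonneg s)
  then show ?thesis using s by (simp add: sums_iff)
qed

lemma chain_ext_term_le:
  assumes g: "g \<in> borel_measurable borel" "\<And>x. \<bar>g x\<bar> \<le> C" and L: "L-lipschitz_on UNIV \<pi>"
  shows "\<bar>w n * lint 0 (len n) (g \<circ> \<gamma> n) (\<pi> \<circ> \<gamma> n)\<bar> \<le> L * (\<bar>w n\<bar> * (\<integral>s. indicator {0..len n} s * \<bar>g (\<gamma> n s)\<bar> \<partial>lebesgue))"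
proof -
  have "\<bar>lint 0 (len n) (g \<circ> \<gamma> n) (\<pi> \<circ> \<gamma> n)\<bar> \<le> L * (\<integral>s. indicator {0..len n} s * \<bar>(g \<circ> \<gamma> n) s\<bar> \<partial>lebesgue)"
    using g by (intro lint_bound[OF comp_curve_measurable _ lipschitz_comp_curve[OF L], where B=C]) auto
  from mult_left_mono[OF this, of "\<bar>w n\<bar>"] show ?thesis by (simp add: abs_mult mult_ac)
qed

lemma chain_ext_bound:
  assumes w: "finite_weight w" and g: "g \<in> borel_measurable borel" "\<And>x. \<bar>g x\<bar> \<le> C" and L: "L-lipschitz_on UNIV \<pi>"
  shows "summable (\<lambda>n. \<bar>w n * lint 0 (len n) (g \<circ> \<gamma> n) (\<pi> \<circ> \<gamma> n)\<bar>)"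
    "\<bar>chain_ext w g \<pi>\<bar> \<le> L * (\<integral>x. \<bar>g x\<bar> \<partial>chain_measure w)"
proof -
  note s = sums_mult[OF integral_chain_measure[OF w g], of L]
  note le = chain_ext_term_le[OF g L]
  show 1: "summable (\<lambda>n. \<bar>w n * lint 0 (len n) (g \<circ> \<gamma> n) (\<pi> \<circ> \<gamma> n)\<bar>)"
    by (rule summable_comparison_test'[OF sums_summable[OF s], where N=0]) (use le in simp)
  have "\<bar>chain_ext w g \<pi>\<bar> \<le> (\<Sum>n. \<bar>w n * lint 0 (len n) (g \<circ> \<gamma> n) (\<pi> \<circ> \<gamma> n)\<bar>)"
    unfolding chain_ext_def by (rule summable_rabs[OF 1])
  also have "\<dots> \<le> (\<Sum>n. L * (\<bar>w n\<bar> * (\<integral>s. indicator {0..len n} s * \<bar>g (\<gamma> n s)\<bar> \<partial>lebesgue)))"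
    by (intro suminf_le le 1 sums_summable[OF s])
  also have "\<dots> = L * (\<integral>x. \<bar>g x\<bar> \<partial>chain_measure w)" using s by (rule sums_unique[symmetric])
  finally show "\<bar>chain_ext w g \<pi>\<bar> \<le> L * (\<integral>x. \<bar>g x\<bar> \<partial>chain_measure w)" .
qed

lemma chain_ext_sums:
  assumes w: "finite_weight w" and g: "g \<in> borel_measurable borel" "\<And>x. \<bar>g x\<bar> \<le> C" and \<pi>: "lip \<pi>"
  shows "(\<lambda>n. w n * lint 0 (len n) (g \<circ> \<gamma> n) (\<pi> \<circ> \<gamma> n)) sums chain_ext w g \<pi>"
proof -
  obtain L where L: "L-lipschitz_on UNIV \<pi>" using \<pi> by (rule lipE)
  show ?thesis
    using summable_rabs_cancel[OF chain_ext_bound(1)[OF w g L]] unfolding chain_ext_def by (rule summable_sums)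
qed

lemma lint_comp_integrable:
  assumes g: "g \<in> borel_measurable borel" "\<And>x. \<bar>g x\<bar> \<le> C" and \<pi>: "lip \<pi>"
  shows "integrable lebesgue (\<lambda>s. indicator {0..len n} s * ((g \<circ> \<gamma> n) s * deriv (\<pi> \<circ> \<gamma> n) s))"
proof -
  obtain L where L: "L-lipschitz_on UNIV \<pi>" using \<pi> by (rule lipE)
  show ?thesis using g by (intro lint_integrable[OF comp_curve_measurable _ lipschitz_comp_curve[OF L], where B=C]) auto
qed

lemma chain_ext_lincomb_left:
  assumes w: "finite_weight w" and g: "g \<in> borel_measurable borel" "\<And>x. \<bar>g x\<bar> \<le> C"
    and h: "h \<in> borel_measurable borel" "\<And>x. \<bar>h x\<bar> \<le> D" and \<pi>: "lip \<pi>"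
  shows "chain_ext w (\<lambda>x. a * g x + b * h x) \<pi> = a * chain_ext w g \<pi> + b * chain_ext w h \<pi>"
proof -
  have "(\<lambda>n. a * (w n * lint 0 (len n) (g \<circ> \<gamma> n) (\<pi> \<circ> \<gamma> n)) + b * (w n * lint 0 (len n) (h \<circ> \<gamma> n) (\<pi> \<circ> \<gamma> n)))
      sums (a * chain_ext w g \<pi> + b * chain_ext w h \<pi>)"
    by (intro sums_add sums_mult chain_ext_sums[OF w g \<pi>] chain_ext_sums[OF w h \<pi>])
  moreover have "a * (w n * lint 0 (len n) (g \<circ> \<gamma> n) (\<pi> \<circ> \<gamma> n)) + b * (w n * lint 0 (len n) (h \<circ> \<gamma> n) (\<pi> \<circ> \<gamma> n))
      = w n * lint 0 (len n) ((\<lambda>x. a * g x + b * h x) \<circ> \<gamma> n) (\<pi> \<circ> \<gamma> n)" for n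
    using lint_add_left[OF lint_comp_integrable[OF g \<pi>, of n] lint_comp_integrable[OF h \<pi>, of n], of a b]
    by (simp add: comp_def algebra_simps)
  ultimately show ?thesis unfolding chain_ext_def by (simp add: sums_iff)
qed

lemma chain_lincomb_weight:
  assumes w: "finite_weight w" and v: "finite_weight v"
  shows "finite_weight (\<lambda>n. a * w n + b * v n)"
    "chain (\<lambda>n. a * w n + b * v n) f \<pi> = a * chain w f \<pi> + b * chain v f \<pi>"
proof -
  have s: "summable (\<lambda>n. \<bar>a\<bar> * (\<bar>w n\<bar> * len n) + \<bar>b\<bar> * (\<bar>v n\<bar> * len n))"
    using w v unfolding finite_weight_def by (intro summable_add summable_mult)
  have "\<bar>a * w n + b * v n\<bar> * len n \<le> \<bar>a\<bar> * (\<bar>w n\<bar> * len n) + \<bar>b\<bar> * (\<bar>v n\<bar> * len n)" for n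
    using mult_right_mono[OF abs_triangle_ineq[of "a * w n" "b * v n"] len_nonneg[of n]]
    by (simp add: abs_mult distrib_right mult.assoc)
  then show "finite_weight (\<lambda>n. a * w n + b * v n)"
    unfolding finite_weight_def by (intro summable_comparison_test'[OF s, where N=0]) (simp add: abs_mult len_nonneg)
  show "chain (\<lambda>n. a * w n + b * v n) f \<pi> = a * chain w f \<pi> + b * chain v f \<pi>"
  proof (cases "lip_bdd f \<and> lip \<pi>")
    case True
    obtain C where C: "\<And>x. \<bar>f x\<bar> \<le> C" using conjunct1[OF True] by (rule lip_bddE) blast
    have fm: "f \<in> borel_measurable borel" using True by (simp add: lip_bdd_measurable)
    let ?l = "\<lambda>n. lint 0 (len n) (f \<circ> \<gamma> n) (\<pi> \<circ> \<gamma> n)"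
    have "(\<lambda>n. a * (w n * ?l n) + b * (v n * ?l n)) sums (a * chain_ext w f \<pi> + b * chain_ext v f \<pi>)"
      using True by (intro sums_add sums_mult chain_ext_sums[OF w fm C] chain_ext_sums[OF v fm C]) auto
    moreover have "a * (w n * ?l n) + b * (v n * ?l n) = (a * w n + b * v n) * ?l n" for n by (simp add: algebra_simps)
    ultimately show ?thesis using True by (simp add: chain_def chain_ext_def sums_iff)
  qed (auto simp: chain_def)
qed

lemma chain_mass_bound:
  assumes w: "finite_weight w"
  shows "mass_bound (chain w) (chain_measure w)"
  unfolding mass_bound_def
proof (intro conjI allI impI)
  interpret \<mu>: finite_borel "chain_measure w" using w by (rule chain_measure_finite_borel)
  show "finite_measure (chain_measure w)" by (rule \<mu>.finite_measure_axioms)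
  fix f \<pi> :: "'a \<Rightarrow> real" and L assume f: "lip_bdd f" and L: "L-lipschitz_on UNIV \<pi>"
  obtain C where C: "\<And>x. \<bar>f x\<bar> \<le> C" using f by (rule lip_bddE) blast
  show "\<bar>chain w f \<pi>\<bar> \<le> L * (\<integral>x. \<bar>f x\<bar> \<partial>chain_measure w)"
    using chain_ext_bound(2)[OF w lip_bdd_measurable[OF f] C L] f lipI[OF L] by (simp add: chain_def)
qed simp

lemma chain_current1:
  assumes w: "finite_weight w"
  shows "current1 (chain w)"
  unfolding current1_def
proof (intro conjI allI impI)
  fix f \<pi> :: "'a \<Rightarrow> real" assume "\<not> (lip_bdd f \<and> lip \<pi>)"
  then show "chain w f \<pi> = 0" by (auto simp: chain_def)
next
  fix f g \<pi> :: "'a \<Rightarrow> real" and a b assume f: "lip_bdd f" and g: "lip_bdd g" and \<pi>: "lip \<pi>"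
  obtain C where C: "\<And>x. \<bar>f x\<bar> \<le> C" using f by (rule lip_bddE) blast
  obtain D where D: "\<And>x. \<bar>g x\<bar> \<le> D" using g by (rule lip_bddE) blast
  show "chain w (\<lambda>x. a * f x + b * g x) \<pi> = a * chain w f \<pi> + b * chain w g \<pi>"
    using chain_ext_lincomb_left[OF w lip_bdd_measurable[OF f] C lip_bdd_measurable[OF g] D \<pi>] f g \<pi>
    by (simp add: chain_def lip_bdd_lincomb)
next
  fix f \<pi> \<rho> :: "'a \<Rightarrow> real" and a b assume f: "lip_bdd f" and \<pi>: "lip \<pi>" and \<rho>: "lip \<rho>"
  obtain C where C: "\<And>x. \<bar>f x\<bar> \<le> C" using f by (rule lip_bddE) blast
  have fm: "f \<in> borel_measurable borel" using f by (rule lip_bdd_measurable)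
  obtain L where L: "L-lipschitz_on UNIV \<pi>" using \<pi> by (rule lipE)
  obtain M where M: "M-lipschitz_on UNIV \<rho>" using \<rho> by (rule lipE)
  have "(\<lambda>n. a * (w n * lint 0 (len n) (f \<circ> \<gamma> n) (\<pi> \<circ> \<gamma> n)) + b * (w n * lint 0 (len n) (f \<circ> \<gamma> n) (\<rho> \<circ> \<gamma> n)))
      sums (a * chain_ext w f \<pi> + b * chain_ext w f \<rho>)"
    by (intro sums_add sums_mult chain_ext_sums[OF w fm C] \<pi> \<rho>)
  moreover have "a * (w n * lint 0 (len n) (f \<circ> \<gamma> n) (\<pi> \<circ> \<gamma> n)) + b * (w n * lint 0 (len n) (f \<circ> \<gamma> n) (\<rho> \<circ> \<gamma> n))
      = w n * lint 0 (len n) (f \<circ> \<gamma> n) ((\<lambda>x. a * \<pi> x + b * \<rho> x) \<circ> \<gamma> n)" for n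
    using lint_add_right[OF comp_curve_measurable[OF fm, of n] _ lipschitz_comp_curve[OF L, of n] lipschitz_comp_curve[OF M, of n], of 0 "len n" C a b] C
    by (simp add: comp_def algebra_simps)
  ultimately have "chain_ext w f (\<lambda>x. a * \<pi> x + b * \<rho> x) = a * chain_ext w f \<pi> + b * chain_ext w f \<rho>"
    unfolding chain_ext_def by (simp add: sums_iff)
  then show "chain w f (\<lambda>x. a * \<pi> x + b * \<rho> x) = a * chain w f \<pi> + b * chain w f \<rho>"
    using f \<pi> \<rho> by (simp add: chain_def lip_lincomb)
next
  fix f \<pi> :: "'a \<Rightarrow> real" and \<rho> :: "nat \<Rightarrow> 'a \<Rightarrow> real" and L
  assume f: "lip_bdd f" and \<rho>: "\<forall>i. L-lipschitz_on UNIV (\<rho> i)" and \<pi>: "lip \<pi>" and lim: "\<forall>x. (\<lambda>i. \<rho> i x) \<longlonglongrightarrow> \<pi> x"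
  obtain C where C: "\<And>x. \<bar>f x\<bar> \<le> C" using f by (rule lip_bddE) blast
  have fm: "f \<in> borel_measurable borel" using f by (rule lip_bdd_measurable)
  have L0: "L \<ge> 0" using \<rho> lipschitz_on_nonneg by blast
  have "(\<lambda>i. \<Sum>n. w n * lint 0 (len n) (f \<circ> \<gamma> n) (\<rho> i \<circ> \<gamma> n)) \<longlonglongrightarrow> (\<Sum>n. w n * lint 0 (len n) (f \<circ> \<gamma> n) (\<pi> \<circ> \<gamma> n))"
  \<comment> \<open>The limit passes through the series because the common Lipschitz constant
    \<open>L\<close> dominates the terms uniformly in \<open>i\<close>.\<close>
  proof (rule tannerys_theorem[THEN conjunct2, THEN conjunct2])
    show "((\<lambda>i. w n * lint 0 (len n) (f \<circ> \<gamma> n) (\<rho> i \<circ> \<gamma> n)) \<longlongrightarrow> w n * lint 0 (len n) (f \<circ> \<gamma> n) (\<pi> \<circ> \<gamma> n)) sequentially" for n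
    proof (intro tendsto_intros lint_tendsto)
      show "lip (f \<circ> \<gamma> n)" "lip (\<pi> \<circ> \<gamma> n)"
        using lip_compose[OF lip_curve] lip_bdd_lip[OF f] \<pi> by auto
      show "L-lipschitz_on UNIV (\<rho> i \<circ> \<gamma> n)" for i using \<rho> by (intro lipschitz_comp_curve) simp
      show "(\<lambda>i. (\<rho> i \<circ> \<gamma> n) x) \<longlonglongrightarrow> (\<pi> \<circ> \<gamma> n) x" for x using lim by simp
    qed (rule len_nonneg)
    show "summable (\<lambda>n. L * (\<bar>w n\<bar> * (\<integral>s. indicator {0..len n} s * \<bar>f (\<gamma> n s)\<bar> \<partial>lebesgue)))"
      by (intro summable_mult sums_summable[OF integral_chain_measure[OF w fm C]])
    show "\<forall>\<^sub>F (n, i) in at_top \<times>\<^sub>F sequentially. norm (w n * lint 0 (len n) (f \<circ> \<gamma> n) (\<rho> i \<circ> \<gamma> n)) \<le> L * (\<bar>w n\<bar> * (\<integral>s. indicator {0..len n} s * \<bar>f (\<gamma> n s)\<bar> \<partial>lebesgue))"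
      using chain_ext_term_le[OF fm C] \<rho> by (intro always_eventually) auto
  qed simp
  moreover have "lip (\<rho> i)" for i using \<rho> lipI by blast
  ultimately show "(\<lambda>i. chain w f (\<rho> i)) \<longlonglongrightarrow> chain w f \<pi>" using f \<pi> by (simp add: chain_def chain_ext_def)
next
  fix f \<pi> :: "'a \<Rightarrow> real" and U c
  assume f: "lip_bdd f" and \<pi>: "lip \<pi>" and U: "open U" and fU: "{x. f x \<noteq> 0} \<subseteq> U" and c: "\<forall>x\<in>U. \<pi> x = c"
  obtain L where L: "L-lipschitz_on UNIV \<pi>" using \<pi> by (rule lipE)
  have "lint 0 (len n) (f \<circ> \<gamma> n) (\<pi> \<circ> \<gamma> n) = 0" for n
  proof (rule lint_local[OF lipschitz_comp_curve[OF L]])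
    show "open (\<gamma> n -` U)" using U lip_continuous[OF lip_curve] by (rule open_vimage)
  qed (use fU c in auto)
  then show "chain w f \<pi> = 0" by (simp add: chain_def chain_ext_def)
next
  show "\<exists>\<mu>. mass_bound (chain w) \<mu>" using chain_mass_bound[OF w] by blast
qed

lemma chain_tendsto_ext:
  assumes w: "finite_weight w" and g: "g \<in> borel_measurable borel" "\<And>x. \<bar>g x\<bar> \<le> C" and \<pi>: "lip \<pi>"
    and f: "\<And>n. lip_bdd (f n)" "\<And>n x. \<bar>f n x\<bar> \<le> D" and lim: "(\<lambda>n. \<integral>x. \<bar>f n x - g x\<bar> \<partial>chain_measure w) \<longlonglongrightarrow> 0"
  shows "(\<lambda>n. chain w (f n) \<pi>) \<longlonglongrightarrow> chain_ext w g \<pi>"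
proof -
  obtain L where L: "L \<ge> 0" "L-lipschitz_on UNIV \<pi>" using \<pi> by (rule lipE)
  have fm: "f n \<in> borel_measurable borel" for n using f(1) by (rule lip_bdd_measurable)
  have bd: "\<bar>chain w (f n) \<pi> - chain_ext w g \<pi>\<bar> \<le> L * (\<integral>x. \<bar>f n x - g x\<bar> \<partial>chain_measure w)" for n
  proof -
    have "chain w (f n) \<pi> - chain_ext w g \<pi> = chain_ext w (\<lambda>x. f n x - g x) \<pi>"
      using chain_ext_lincomb_left[OF w fm[of n] f(2)[of n] g \<pi>, of 1 "-1"] f(1) \<pi> by (simp add: chain_def)
    also have "\<bar>\<dots>\<bar> \<le> L * (\<integral>x. \<bar>f n x - g x\<bar> \<partial>chain_measure w)"
    proof (rule chain_ext_bound(2)[OF w _ _ L(2)])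
      show "(\<lambda>x. f n x - g x) \<in> borel_measurable borel" using fm[of n] g(1) by measurable
      show "\<bar>f n x - g x\<bar> \<le> D + C" for x using f(2)[of n x] g(2)[of x] by linarith
    qed
    finally show ?thesis .
  qed
  have "(\<lambda>n. L * (\<integral>x. \<bar>f n x - g x\<bar> \<partial>chain_measure w)) \<longlonglongrightarrow> 0"
    using tendsto_mult_left[OF lim, of L] by simp
  then have "(\<lambda>n. chain w (f n) \<pi> - chain_ext w g \<pi>) \<longlonglongrightarrow> 0"
    by (rule Lim_null_comparison[rotated]) (use bd in \<open>simp add: always_eventually\<close>)
  then show ?thesis by (rule Lim_null[THEN iffD2])
qed

text \<open>The values on cutoff products converge to the restriction by
  \<open>restrict_current_tendsto\<close> and to the series by \<open>chain_tendsto_ext\<close>, so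
  the abstract extension of a chain is the explicit one.\<close>

lemma restrict_chain:
  assumes w: "finite_weight w" and U: "open U" and f: "lip_bdd f" and \<pi>: "lip \<pi>"
  shows "restrict_current (chain w) U f \<pi> = chain_ext w (\<lambda>x. indicator U x * f x) \<pi>"
proof -
  interpret \<mu>: finite_borel "chain_measure w" using w by (rule chain_measure_finite_borel)
  obtain C where C: "C \<ge> 0" "\<And>x. \<bar>f x\<bar> \<le> C" using f by (rule lip_bddE) blast
  have "(\<lambda>n. chain w (\<lambda>x. cutoff U n x * f x) \<pi>) \<longlonglongrightarrow> chain_ext w (\<lambda>x. indicator U x * f x) \<pi>"
  proof (rule chain_tendsto_ext[OF w _ _ \<pi> _ _ \<mu>.cutoff_mult_L1[OF U f]])
    show "(\<lambda>x. indicator U x * f x) \<in> borel_measurable borel"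
      using U by (intro borel_measurable_times lip_bdd_measurable f borel_measurable_indicator) auto
    show "\<bar>indicator U x * f x\<bar> \<le> C" for x using C by (auto simp: indicator_def)
    show "lip_bdd (\<lambda>x. cutoff U n x * f x)" for n by (intro lip_bdd_mult cutoff_lip_bdd f)
    show "\<bar>cutoff U n x * f x\<bar> \<le> 1 * C" for n x
      unfolding abs_mult using C cutoff_range[of U n x] by (intro mult_mono) auto
  qed
  then show ?thesis
    using restrict_current_tendsto[OF chain_current1[OF w] U f \<pi>] LIMSEQ_unique by blast
qed

end

lemma lint_cong_Ioo:
  assumes "\<And>x. x \<in> {a<..<b} \<Longrightarrow> g x = h x" "g \<in> borel_measurable borel" "h \<in> borel_measurable borel" "L-lipschitz_on UNIV \<sigma>"
  shows "lint a b g \<sigma> = lint a b h \<sigma>"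
  unfolding lint_def
proof (rule integral_cong_AE)
  have "AE x in lebesgue. x \<noteq> a" "AE x in lebesgue. x \<noteq> b"
    by (intro AE_completion AE_lborel_singleton)+
  then show "AE x in lebesgue. indicator {a..b} x * (g x * deriv \<sigma> x) = indicator {a..b} x * (h x * deriv \<sigma> x)"
    by eventually_elim (use assms(1) in \<open>auto simp: indicator_def\<close>)
qed (use assms lipschitz_deriv_measurable[OF assms(4)] in
    \<open>auto intro!: borel_measurable_times borel_measurable_indicator measurable_completion[of g] measurable_completion[of h]\<close>)

section \<open>Sets of one-dimensional Hausdorff measure zero\<close>

lemma hausdorff1_singleton: "hausdorff1 {x} = 0"
proof -
  have "(INF S\<in>{S :: nat \<Rightarrow> 'a set. {x} \<subseteq> (\<Union>i. S i) \<and> (\<forall>i. bounded (S i) \<and> diameter (S i) \<le> \<delta>)}. \<Sum>i. ennreal (diameter (S i))) \<le> 0"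
    if "\<delta> > 0" for \<delta> :: real
    by (rule INF_lower2[of "\<lambda>_. {x}"]) (use that in auto)
  then show ?thesis unfolding hausdorff1_def by (intro antisym SUP_least) auto
qed

lemma hausdorff1_empty: "hausdorff1 {} = 0"
proof -
  have "(INF S\<in>{S :: nat \<Rightarrow> 'a set. {} \<subseteq> (\<Union>i. S i) \<and> (\<forall>i. bounded (S i) \<and> diameter (S i) \<le> \<delta>)}. \<Sum>i. ennreal (diameter (S i))) \<le> 0"
    if "\<delta> > 0" for \<delta> :: real
    by (rule INF_lower2[of "\<lambda>_. {}"]) (use that in auto)
  then show ?thesis unfolding hausdorff1_def by (intro antisym SUP_least) auto
qed

lemma hausdorff1_zeroE:
  assumes "hausdorff1 B = 0" "0 < e"
  obtains S :: "nat \<Rightarrow> 'a::metric_space set" where "B \<subseteq> (\<Union>i. S i)" "\<And>i. bounded (S i)" "(\<Sum>i. ennreal (diameter (S i))) < e"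
proof -
  have "(INF S\<in>{S :: nat \<Rightarrow> 'a set. B \<subseteq> (\<Union>i. S i) \<and> (\<forall>i. bounded (S i) \<and> diameter (S i) \<le> 1)}. \<Sum>i. ennreal (diameter (S i))) \<le> hausdorff1 B"
    unfolding hausdorff1_def by (rule SUP_upper) simp
  also have "\<dots> < e" using assms by simp
  finally show thesis using that unfolding INF_less_iff by blast
qed

text \<open>\<open>h n\<close> is an arclength coordinate of the \<open>n\<close>-th curve, defined
  on the whole space and 1-Lipschitz. It calibrates chains: testing against it recovers the full
  length of pieces of the arc. Distinct curves meet only in end points, which carry no
  length.\<close>

locale charts = curves +
  fixes h :: "nat \<Rightarrow> 'a \<Rightarrow> real"
  assumes len_pos: "0 < len n"
    and h_lipschitz: "1-lipschitz_on UNIV (h n)"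
    and h_curve: "0 \<le> s \<Longrightarrow> s \<le> len n \<Longrightarrow> h n (\<gamma> n s) = s"
    and open_arc: "open (\<gamma> n ` {0<..<len n})"
    and arc_disjoint: "m \<noteq> n \<Longrightarrow> 0 \<le> s \<Longrightarrow> s \<le> len m \<Longrightarrow> \<gamma> m s \<notin> \<gamma> n ` {0<..<len n}"
    and arcs_cover: "\<exists>n s. 0 \<le> s \<and> s \<le> len n \<and> x = \<gamma> n s"
    and curve_clamped: "\<gamma> n s = \<gamma> n (max 0 (min (len n) s))"
begin

definition edge_arc :: "nat \<Rightarrow> 'a set" where
  "edge_arc n = \<gamma> n ` {0<..<len n}"

lemma edge_arc_borel [measurable]: "edge_arc n \<in> sets borel"
  using open_arc unfolding edge_arc_def by auto

lemma curve_in_arc_iff: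
  assumes "0 \<le> s" "s \<le> len m"
  shows "\<gamma> m s \<in> edge_arc n \<longleftrightarrow> m = n \<and> 0 < s \<and> s < len n"
proof (cases "m = n")
  case True
  have "\<gamma> n s \<in> edge_arc n \<longleftrightarrow> 0 < s \<and> s < len n"
  proof
    assume "\<gamma> n s \<in> edge_arc n"
    then obtain s' where s': "0 < s'" "s' < len n" "\<gamma> n s = \<gamma> n s'" by (auto simp: edge_arc_def)
    have "s = h n (\<gamma> n s)" using assms True by (intro h_curve[symmetric]) auto
    also have "\<dots> = h n (\<gamma> n s')" by (rule arg_cong[OF s'(3)])
    also have "\<dots> = s'" using s' by (intro h_curve) auto
    finally have "s = s'" .
    then show "0 < s \<and> s < len n" using s' by simp
  qed (auto simp: edge_arc_def)
  then show ?thesis using True by simp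
next
  case False
  then show ?thesis using arc_disjoint[OF False assms] by (auto simp: edge_arc_def)
qed

lemma disjoint_arcs: "disjoint_family edge_arc"
  unfolding disjoint_family_on_def
proof (intro ballI impI)
  fix m n :: nat assume "m \<noteq> n"
  then show "edge_arc m \<inter> edge_arc n = {}"
    using curve_in_arc_iff[of _ m n] unfolding edge_arc_def[of m] by auto
qed

lemma lint_coordinate:
  assumes g: "g \<in> borel_measurable borel"
  shows "lint 0 (len n) g (h n \<circ> \<gamma> n) = (\<integral>s. indicator {0..len n} s * g s \<partial>lebesgue)"
  unfolding lint_def
proof (rule integral_cong_AE)
  have "AE x in lebesgue. x \<noteq> 0" "AE x in lebesgue. x \<noteq> len n"
    by (intro AE_completion AE_lborel_singleton)+
  then show "AE x in lebesgue. indicator {0..len n} x * (g x * deriv (h n \<circ> \<gamma> n) x) = indicator {0..len n} x * g x"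
  proof eventually_elim
    case (elim x)
    show ?case
    proof (cases "x \<in> {0..len n}")
      case True
      then have x: "x \<in> {0<..<len n}" using elim by auto
      have "((\<lambda>s. s) has_real_derivative 1) (at x)" by simp
      then have "((h n \<circ> \<gamma> n) has_real_derivative 1) (at x)"
        by (rule has_field_derivative_transform_within_open[where S="{0<..<len n}"]) (use x h_curve in auto)
      then show ?thesis by (simp add: DERIV_imp_deriv)
    qed simp
  qed
qed (use g lipschitz_deriv_measurable[OF lipschitz_comp_curve[OF h_lipschitz], of n n] in
    \<open>auto intro!: borel_measurable_times borel_measurable_indicator measurable_completion[of g]\<close>)

text \<open>On its own arc \<open>h n\<close> has unit derivative along the curve, and the indicator
  removes all other arcs.\<close>

lemma chain_ext_coordinate:
  assumes B: "B \<in> sets borel"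
  shows "chain_ext w (indicator (B \<inter> edge_arc n)) (h n) = w n * measure lborel ({0..len n} \<inter> \<gamma> n -` (B \<inter> edge_arc n))"
proof -
  have S: "B \<inter> edge_arc n \<in> sets borel" using B by measurable
  have gm: "(indicator (B \<inter> edge_arc n) :: 'a \<Rightarrow> real) \<in> borel_measurable borel" using S by simp
  have "lint 0 (len m) (indicator (B \<inter> edge_arc n) \<circ> \<gamma> m) (h n \<circ> \<gamma> m) = 0" if "m \<noteq> n" for m
  proof -
    have "indicator {0..len m} x * ((indicator (B \<inter> edge_arc n) \<circ> \<gamma> m) x * deriv (h n \<circ> \<gamma> m) x) = 0" for x
      using curve_in_arc_iff[of x m n] that by (auto simp: indicator_def)
    then show ?thesis unfolding lint_def by (simp only: Bochner_Integration.integral_zero)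
  qed
  then have "chain_ext w (indicator (B \<inter> edge_arc n)) (h n) = (\<Sum>m\<in>{n}. w m * lint 0 (len m) (indicator (B \<inter> edge_arc n) \<circ> \<gamma> m) (h n \<circ> \<gamma> m))"
    unfolding chain_ext_def by (intro suminf_finite) auto
  also have "\<dots> = w n * (\<integral>s. indicator {0..len n} s * (indicator (B \<inter> edge_arc n) \<circ> \<gamma> n) s \<partial>lebesgue)"
    using comp_curve_measurable[OF gm, of n] by (simp add: lint_coordinate)
  also have "(\<integral>s. indicator {0..len n} s * (indicator (B \<inter> edge_arc n) \<circ> \<gamma> n) s \<partial>lebesgue) = (\<integral>s. (indicator ({0..len n} \<inter> \<gamma> n -` (B \<inter> edge_arc n)) s :: real) \<partial>lebesgue)"
    by (intro Bochner_Integration.integral_cong) (auto simp: indicator_def)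
  also have "\<dots> = measure lborel ({0..len n} \<inter> \<gamma> n -` (B \<inter> edge_arc n))"
    using measurable_sets[OF curve_measurable[of n] S] by simp
  finally show ?thesis .
qed

text \<open>On the open arc \<open>n\<close> every mass bound dominates \<open>|w n|\<close> times
  length, as testing with the 1-Lipschitz function \<open>h n\<close> shows. Summing over the
  disjoint open arcs loses nothing, because end points are null for arclength.\<close>

lemma chain_measure_least:
  assumes w: "finite_weight w" and \<nu>: "mass_bound (chain w) \<nu>" and B: "B \<in> sets borel"
  shows "emeasure (chain_measure w) B \<le> emeasure \<nu> B"
proof -
  interpret \<nu>: finite_borel \<nu> using \<nu> by (rule mass_bound_finite_borel)
  interpret \<mu>: finite_borel "chain_measure w" using w by (rule chain_measure_finite_borel)
  have term_le: "ennreal \<bar>w n\<bar> * emeasure lborel ({0..len n} \<inter> \<gamma> n -` B) \<le> emeasure \<nu> (B \<inter> edge_arc n)" for n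
  proof -
    define S where "S = B \<inter> edge_arc n"
    have S: "S \<in> sets borel" unfolding S_def using B by measurable
    have gm: "(indicator S :: 'a \<Rightarrow> real) \<in> borel_measurable borel" using S by simp
    \<comment> \<open>One sequence approximates the indicator for both measures: for
      \<open>chain_measure w\<close> to identify the limit of the values, for \<open>\<nu>\<close>
      to bound them.\<close>
    have "\<exists>\<xi>. lip_bdd \<xi> \<and> (\<forall>x. 0 \<le> \<xi> x \<and> \<xi> x \<le> 1) \<and>
     (\<integral>x. \<bar>\<xi> x - indicator S x\<bar> \<partial>chain_measure w) < 1 / real (Suc k) \<and> (\<integral>x. \<bar>\<xi> x - indicator S x\<bar> \<partial>\<nu>) < 1 / real (Suc k)" for k
      by (rule lipschitz_dense_indicator[OF \<mu>.finite_borel_axioms \<nu>.finite_borel_axioms S]) simp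
    then have "\<exists>\<xi>. \<forall>k. lip_bdd (\<xi> k) \<and> (\<forall>x. 0 \<le> \<xi> k x \<and> \<xi> k x \<le> 1) \<and>
     (\<integral>x. \<bar>\<xi> k x - indicator S x\<bar> \<partial>chain_measure w) < 1 / real (Suc k) \<and> (\<integral>x. \<bar>\<xi> k x - indicator S x\<bar> \<partial>\<nu>) < 1 / real (Suc k)"
      by (intro choice allI)
    then obtain \<xi> where \<xi>': "\<forall>k. lip_bdd (\<xi> k) \<and> (\<forall>x. 0 \<le> \<xi> k x \<and> \<xi> k x \<le> 1) \<and>
     (\<integral>x. \<bar>\<xi> k x - indicator S x\<bar> \<partial>chain_measure w) < 1 / real (Suc k) \<and> (\<integral>x. \<bar>\<xi> k x - indicator S x\<bar> \<partial>\<nu>) < 1 / real (Suc k)"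
      by (rule exE)
    have \<xi>: "lip_bdd (\<xi> k)" "\<And>x. 0 \<le> \<xi> k x" "\<And>x. \<xi> k x \<le> 1"
      "(\<integral>x. \<bar>\<xi> k x - indicator S x\<bar> \<partial>chain_measure w) < 1 / real (Suc k)" "(\<integral>x. \<bar>\<xi> k x - indicator S x\<bar> \<partial>\<nu>) < 1 / real (Suc k)" for k
      using \<xi>'[rule_format, of k] by auto
    have z: "(\<lambda>k. 1 / real (Suc k)) \<longlonglongrightarrow> 0"
      using lim_1_over_n[THEN filterlim_sequentially_Suc[THEN iffD2]] by simp
    have lim: "(\<lambda>k. \<integral>x. \<bar>\<xi> k x - indicator S x\<bar> \<partial>chain_measure w) \<longlonglongrightarrow> 0"
      by (rule tendsto_sandwich[OF _ _ tendsto_const z]) (use \<xi>(4) in \<open>auto intro!: always_eventually less_imp_le Bochner_Integration.integral_nonneg\<close>)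
    have conv: "(\<lambda>k. chain w (\<xi> k) (h n)) \<longlonglongrightarrow> chain_ext w (indicator S) (h n)"
      by (rule chain_tendsto_ext[OF w gm _ lipI[OF h_lipschitz] \<xi>(1) _ lim, where C=1 and D=1])
        (use \<xi>(2,3) in \<open>auto simp: abs_of_nonneg\<close>)
    have bd: "\<bar>chain w (\<xi> k) (h n)\<bar> \<le> measure \<nu> S + 1 / real (Suc k)" for k
    proof -
      have i1: "integrable \<nu> (indicator S :: 'a \<Rightarrow> real)" using gm by (intro \<nu>.integrable_bounded[of _ 1]) auto
      have i2: "integrable \<nu> (\<xi> k)" using \<xi>(1) by (rule \<nu>.integrable_lip_bdd)
      have "\<bar>chain w (\<xi> k) (h n)\<bar> \<le> 1 * (\<integral>x. \<bar>\<xi> k x\<bar> \<partial>\<nu>)"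
        by (rule mass_boundD[OF \<nu> \<xi>(1) h_lipschitz])
      also have "1 * (\<integral>x. \<bar>\<xi> k x\<bar> \<partial>\<nu>) \<le> (\<integral>x. indicator S x + \<bar>\<xi> k x - indicator S x\<bar> \<partial>\<nu>)"
        unfolding mult_1
      proof (rule integral_mono)
        show "\<bar>\<xi> k x\<bar> \<le> indicator S x + \<bar>\<xi> k x - indicator S x\<bar>" for x
          using \<xi>(2,3)[of k x] by (cases "x \<in> S") auto
      qed (use i1 i2 in \<open>auto intro!: integrable_abs Bochner_Integration.integrable_diff Bochner_Integration.integrable_add\<close>)
      also have "\<dots> = measure \<nu> S + (\<integral>x. \<bar>\<xi> k x - indicator S x\<bar> \<partial>\<nu>)"
        using i1 i2 S by (subst Bochner_Integration.integral_add) (auto simp: \<nu>.sets_borel)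
      finally show ?thesis using \<xi>(5)[of k] by linarith
    qed
    have "(\<lambda>k. measure \<nu> S + 1 / real (Suc k)) \<longlonglongrightarrow> measure \<nu> S + 0" by (intro tendsto_intros z)
    then have "\<bar>chain_ext w (indicator S) (h n)\<bar> \<le> measure \<nu> S"
      using tendsto_le[OF _ _ tendsto_rabs[OF conv]] bd by (simp add: always_eventually)
    then have le: "\<bar>w n\<bar> * measure lborel ({0..len n} \<inter> \<gamma> n -` S) \<le> measure \<nu> S"
      using chain_ext_coordinate[OF B, of w n] by (simp add: S_def abs_mult)
    have Sm: "{0..len n} \<inter> \<gamma> n -` S \<in> sets lborel" using measurable_sets[OF curve_measurable[of n] S] by simp
    have Bm: "{0..len n} \<inter> \<gamma> n -` B \<in> sets lborel" using measurable_sets[OF curve_measurable[of n] B] by simp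
    have "emeasure lborel ({0..len n} \<inter> \<gamma> n -` B) = emeasure lborel ({0..len n} \<inter> \<gamma> n -` S)"
    proof (rule emeasure_eq_AE[OF _ Bm Sm])
      show "AE x in lborel. x \<in> {0..len n} \<inter> \<gamma> n -` B \<longleftrightarrow> x \<in> {0..len n} \<inter> \<gamma> n -` S"
        using AE_lborel_singleton[of 0] AE_lborel_singleton[of "len n"]
      proof eventually_elim
        case (elim x)
        then show ?case using curve_in_arc_iff[of x n n] by (auto simp: S_def)
      qed
    qed
    also have "\<dots> = ennreal (measure lborel ({0..len n} \<inter> \<gamma> n -` S))"
    proof (rule emeasure_eq_ennreal_measure)
      have "emeasure lborel ({0..len n} \<inter> \<gamma> n -` S) \<le> emeasure lborel {0..len n}" by (intro emeasure_mono) auto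
      then show "emeasure lborel ({0..len n} \<inter> \<gamma> n -` S) \<noteq> top" by (auto simp: top_unique emeasure_lborel_Icc_eq)
    qed
    finally have "ennreal \<bar>w n\<bar> * emeasure lborel ({0..len n} \<inter> \<gamma> n -` B) = ennreal (\<bar>w n\<bar> * measure lborel ({0..len n} \<inter> \<gamma> n -` S))"
      by (simp add: ennreal_mult)
    also have "\<dots> \<le> ennreal (measure \<nu> S)" using le by (rule ennreal_leI)
    also have "\<dots> = emeasure \<nu> (B \<inter> edge_arc n)" by (simp add: \<nu>.emeasure_eq_measure S_def)
    finally show ?thesis .
  qed
  have "emeasure (chain_measure w) B \<le> (\<Sum>n. emeasure \<nu> (B \<inter> edge_arc n))"
    unfolding emeasure_chain_measure[OF B] by (intro suminf_le term_le) auto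
  also have "\<dots> = emeasure \<nu> (\<Union>n. B \<inter> edge_arc n)"
    using disjoint_arcs B by (intro suminf_emeasure) (auto simp: \<nu>.sets_borel disjoint_family_on_def)
  also have "\<dots> \<le> emeasure \<nu> B" using B by (intro emeasure_mono) (auto simp: \<nu>.sets_borel)
  finally show ?thesis .
qed

theorem mass_measure_chain:
  assumes w: "finite_weight w"
  shows "mass_measure (chain w) = chain_measure w"
  by (rule mass_measure_eqI[OF chain_mass_bound[OF w]]) (rule chain_measure_least[OF w])

lemma mass_chain:
  assumes w: "finite_weight w"
  shows "mass (chain w) = ennreal (\<Sum>n. \<bar>w n\<bar> * len n)"
proof -
  have "\<exists>\<mu>. mass_bound (chain w) \<mu>" using chain_mass_bound[OF w] by blast
  then show ?thesis
    by (simp add: mass_def mass_measure_chain[OF w] emeasure_chain_measure_UNIV[OF w])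
qed

text \<open>If the difference of two chains is the zero current, the null measure is a mass bound
  for it. By minimality its weighted length is \<open>0\<close>, and all lengths are
  positive.\<close>

lemma chain_inject:
  assumes w: "finite_weight w" and v: "finite_weight v" and eq: "chain w = chain v"
  shows "w = v"
proof
  fix n
  have f: "finite_weight (\<lambda>n. 1 * w n + (-1) * v n)" by (rule chain_lincomb_weight(1)[OF w v])
  have "chain (\<lambda>n. 1 * w n + (-1) * v n) f \<pi> = 0" for f \<pi>
    using chain_lincomb_weight(2)[OF w v, of 1 "-1" f \<pi>] eq by simp
  then have z: "chain (\<lambda>n. 1 * w n + (-1) * v n) = (\<lambda>f \<pi>. 0)" by auto
  have mb: "mass_bound (\<lambda>f \<pi>. 0 :: real) (null_measure (borel :: 'a measure))"
    by (auto simp: mass_bound_def intro!: finite_measureI)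
  have le0: "emeasure (chain_measure (\<lambda>n. 1 * w n + (-1) * v n)) UNIV \<le> emeasure (null_measure (borel :: 'a measure)) UNIV"
    by (rule chain_measure_least[OF f]) (simp_all only: z mb sets.top space_borel[symmetric])
  have "(\<Sum>n. \<bar>1 * w n + (-1) * v n\<bar> * len n) \<ge> 0"
    using f len_nonneg unfolding finite_weight_def by (intro suminf_nonneg) auto
  moreover have "ennreal (\<Sum>n. \<bar>1 * w n + (-1) * v n\<bar> * len n) = 0"
    using le0 emeasure_chain_measure_UNIV[OF f] by simp
  ultimately have "(\<Sum>n. \<bar>1 * w n + (-1) * v n\<bar> * len n) = 0" by simp
  then have "\<bar>1 * w n + (-1) * v n\<bar> * len n = 0"
    using f len_nonneg unfolding finite_weight_def by (subst (asm) suminf_eq_zero_iff) auto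
  then show "w n = v n" using len_pos[of n] by simp
qed

end

section \<open>Rectifiability and characteristic set of chains\<close>

context charts begin

lemma bij_cover: "UNIV - (\<Union>n. edge_arc n) \<subseteq> (\<Union>n. {\<gamma> n 0, \<gamma> n (len n)})"
proof
  fix x assume x: "x \<in> UNIV - (\<Union>n. edge_arc n)"
  obtain n s where s: "0 \<le> s" "s \<le> len n" "x = \<gamma> n s" using arcs_cover by blast
  have "\<not> (0 < s \<and> s < len n)" using x s curve_in_arc_iff[of s n n] by auto
  then have "s = 0 \<or> s = len n" using s by auto
  then show "x \<in> (\<Union>n. {\<gamma> n 0, \<gamma> n (len n)})" using s by auto
qed

lemma rectifiable_UNIV: "rectifiable1 (UNIV :: 'a set)"
proof -
  have "UNIV - (\<Union>n. \<gamma> n ` {0..len n}) = {}" using arcs_cover by fastforce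
  then have "hausdorff1 (UNIV - (\<Union>n. \<gamma> n ` {0..len n})) = 0" by (simp only: hausdorff1_empty)
  moreover have "\<exists>L. L-lipschitz_on {0..len n} (\<gamma> n)" for n
    using lipschitz_on_subset[OF curve_lipschitz] by blast
  ultimately show ?thesis
    unfolding rectifiable1_def by (intro exI[of _ "\<lambda>n. {0..len n}"] exI[of _ \<gamma>]) auto
qed

text \<open>\<open>h n\<close> does not increase distances, so a cover of \<open>B\<close> by sets
  of small total diameter yields a cover of the parameters of \<open>B\<close> by intervals of small
  total length.\<close>

lemma chain_measure_hausdorff_null:
  assumes B: "B \<in> sets borel" and null: "hausdorff1 B = 0"
  shows "emeasure (chain_measure w) B = 0"
proof -
  have "emeasure lborel ({0..len n} \<inter> \<gamma> n -` B) = 0" for n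
  proof -
    have bd: "emeasure lborel ({0..len n} \<inter> \<gamma> n -` B) \<le> 0 + ennreal e" if e: "e > 0" for e
    proof -
      obtain S :: "nat \<Rightarrow> 'a set" where S: "B \<subseteq> (\<Union>i. S i)" "\<And>i. bounded (S i)" "(\<Sum>i. ennreal (diameter (S i))) < ennreal (e / 2)"
        using hausdorff1_zeroE[OF null, of "ennreal (e / 2)"] e by auto
      \<comment> \<open>A set of diameter \<open>d\<close> is mapped into the ball of radius
        \<open>d\<close> about the coordinate of one of its points. That ball has length
        \<open>2 d\<close>, hence \<open>e / 2\<close> in the choice of the cover.\<close>
      define J where "J i = (if S i = {} then {} else cball (h n (SOME x. x \<in> S i)) (diameter (S i)))" for i
      have sub: "{0..len n} \<inter> \<gamma> n -` B \<subseteq> (\<Union>i. J i)"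
      proof
        fix s assume s: "s \<in> {0..len n} \<inter> \<gamma> n -` B"
        then obtain i where i: "\<gamma> n s \<in> S i" using S(1) by auto
        let ?x = "SOME x. x \<in> S i"
        have x: "?x \<in> S i" using i by (rule someI)
        have "dist (h n ?x) (h n (\<gamma> n s)) \<le> 1 * dist ?x (\<gamma> n s)"
          by (rule lipschitz_onD[OF h_lipschitz]) auto
        also have "\<dots> \<le> diameter (S i)" using diameter_bounded_bound[OF S(2) x i] by simp
        finally have "s \<in> J i" using i s h_curve[of s n] by (auto simp: J_def)
        then show "s \<in> (\<Union>i. J i)" by blast
      qed
      have J: "J i \<in> sets lborel" "emeasure lborel (J i) \<le> 2 * ennreal (diameter (S i))" for i
      proof -
        show "J i \<in> sets lborel" by (simp add: J_def)
        have "ennreal (2 * diameter (S i)) = 2 * ennreal (diameter (S i))"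
          using diameter_ge_0[OF S(2)[of i]] by (simp add: ennreal_mult)
        then show "emeasure lborel (J i) \<le> 2 * ennreal (diameter (S i))"
          using diameter_ge_0[OF S(2)[of i]] by (simp add: J_def cball_eq_atLeastAtMost)
      qed
      have "emeasure lborel ({0..len n} \<inter> \<gamma> n -` B) \<le> emeasure lborel (\<Union>i. J i)"
        using sub J by (intro emeasure_mono) auto
      also have "\<dots> \<le> (\<Sum>i. emeasure lborel (J i))" using J by (intro emeasure_subadditive_countably) auto
      also have "\<dots> \<le> (\<Sum>i. 2 * ennreal (diameter (S i)))" using J by (intro suminf_le) auto
      also have "\<dots> = 2 * (\<Sum>i. ennreal (diameter (S i)))" by simp
      also have "\<dots> \<le> 2 * ennreal (e / 2)" using S(3) by (intro mult_left_mono less_imp_le) auto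
      also have "\<dots> = ennreal (2 * (e / 2))" using e by (simp only: ennreal_mult ennreal_numeral)
      also have "\<dots> = 0 + ennreal e" by simp
      finally show ?thesis .
    qed
    have "emeasure lborel ({0..len n} \<inter> \<gamma> n -` B) \<le> 0"
      by (rule ennreal_le_epsilon) (rule bd)
    then show ?thesis by simp
  qed
  then show ?thesis unfolding emeasure_chain_measure[OF B] by simp
qed

text \<open>On one edge \<open>lint_open_degree\<close>, applied to
  \<open>\<phi> \<circ> \<gamma> n\<close>, gives an integer density with L1 norm at most the
  Lipschitz constant of \<open>\<phi>\<close> times the length. Weighted with the integers
  \<open>c n\<close> these norms are summable, and \<open>int_valued_series\<close> adds the
  densities up.\<close>

lemma chain_pushforward:
  fixes c :: "nat \<Rightarrow> int"
  assumes w: "finite_weight (\<lambda>n. real_of_int (c n))" and \<phi>: "lip \<phi>" and U: "open U"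
  shows "\<exists>\<Theta> :: real \<Rightarrow> int. integrable lebesgue (\<lambda>x. real_of_int (\<Theta> x)) \<and>
           pushforward \<phi> (restrict_current (chain (\<lambda>n. real_of_int (c n))) U) = line_current (\<lambda>x. real_of_int (\<Theta> x))"
proof -
  let ?w = "\<lambda>n. real_of_int (c n)"
  obtain M where M: "M \<ge> 0" "M-lipschitz_on UNIV \<phi>" using \<phi> by (rule lipE)
  define V where "V n = {0<..<len n} \<inter> \<gamma> n -` U" for n
  have V: "open (V n)" "V n \<subseteq> {0<..<len n}" for n
    unfolding V_def using U lip_continuous[OF lip_curve] by (auto intro!: open_Int open_vimage)
  let ?P = "\<lambda>n (T :: real \<Rightarrow> int). integrable lebesgue (\<lambda>y. real_of_int (T y)) \<and>
    (\<integral>y. \<bar>real_of_int (T y)\<bar> \<partial>lebesgue) \<le> M * (len n - 0) \<and>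
    (\<forall>f \<pi>. lip_bdd f \<longrightarrow> lip \<pi> \<longrightarrow> lint 0 (len n) (\<lambda>x. indicator (V n) x * f ((\<phi> \<circ> \<gamma> n) x)) (\<pi> \<circ> (\<phi> \<circ> \<gamma> n)) = (\<integral>y. real_of_int (T y) * (f y * deriv \<pi> y) \<partial>lebesgue))"
  have "\<exists>T. ?P n T" for n
    by (rule lint_open_degree[OF V[of n] len_nonneg lipschitz_comp_curve[OF M(2)], of n]) blast
  then have "\<exists>T. \<forall>n. ?P n (T n)" by (intro choice allI)
  then obtain T where T': "\<forall>n. ?P n (T n)" by (rule exE)
  have T: "integrable lebesgue (\<lambda>y. real_of_int (T n y))" "(\<integral>y. \<bar>real_of_int (T n y)\<bar> \<partial>lebesgue) \<le> M * len n"
    "lip_bdd f \<Longrightarrow> lip \<pi> \<Longrightarrow> lint 0 (len n) (\<lambda>x. indicator (V n) x * f ((\<phi> \<circ> \<gamma> n) x)) (\<pi> \<circ> (\<phi> \<circ> \<gamma> n)) = (\<integral>y. real_of_int (T n y) * (f y * deriv \<pi> y) \<partial>lebesgue)" for n f \<pi>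
    using T'[rule_format, of n] by auto
  define \<theta> where "\<theta> n y = c n * T n y" for n y
  have ti: "integrable lebesgue (\<lambda>y. real_of_int (\<theta> n y))" for n using T(1) by (simp add: \<theta>_def)
  have tn: "(\<integral>y. \<bar>real_of_int (\<theta> n y)\<bar> \<partial>lebesgue) \<le> M * (\<bar>?w n\<bar> * len n)" for n
    using mult_left_mono[OF T(2), of "\<bar>?w n\<bar>" n] by (simp add: \<theta>_def abs_mult mult_ac)
  have ts: "summable (\<lambda>n. \<integral>y. \<bar>real_of_int (\<theta> n y)\<bar> \<partial>lebesgue)"
    by (rule summable_comparison_test'[OF summable_mult[OF w[unfolded finite_weight_def], of M], where N=0]) (use tn in simp)
  obtain \<Theta> :: "real \<Rightarrow> int" where S: "integrable lebesgue (\<lambda>y. real_of_int (\<Theta> y))"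
    "\<And>g C. g \<in> borel_measurable lebesgue \<Longrightarrow> AE x in lebesgue. \<bar>g x\<bar> \<le> C \<Longrightarrow>
       (\<lambda>n. \<integral>x. real_of_int (\<theta> n x) * g x \<partial>lebesgue) sums (\<integral>x. real_of_int (\<Theta> x) * g x \<partial>lebesgue)"
    by (rule int_valued_series[OF ti ts]) blast
  have "pushforward \<phi> (restrict_current (chain ?w) U) f \<pi> = line_current (\<lambda>x. real_of_int (\<Theta> x)) f \<pi>" for f \<pi>
  proof (cases "lip_bdd f \<and> lip \<pi>")
    case True
    then have f: "lip_bdd f" and \<pi>: "lip \<pi>" by auto
    obtain C where C: "C \<ge> 0" "\<And>x. \<bar>f x\<bar> \<le> C" using f by (rule lip_bddE) blast
    obtain L where L: "L \<ge> 0" "L-lipschitz_on UNIV \<pi>" using \<pi> by (rule lipE)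
    have f\<phi>: "lip_bdd (f \<circ> \<phi>)" using f \<phi> by (rule lip_bdd_compose)
    have \<pi>\<phi>: "lip (\<pi> \<circ> \<phi>)" using \<phi> \<pi> by (rule lip_compose)
    obtain L' where L': "L'-lipschitz_on UNIV (\<pi> \<circ> \<phi>)" using \<pi>\<phi> by (rule lipE)
    define g where "g x = indicator U x * (f \<circ> \<phi>) x" for x
    have gm: "g \<in> borel_measurable borel" unfolding g_def[abs_def]
      using U by (intro borel_measurable_times lip_bdd_measurable f\<phi> borel_measurable_indicator) auto
    have gC: "\<bar>g x\<bar> \<le> C" for x using C by (auto simp: g_def indicator_def)
    have arcs: "lint 0 (len n) (g \<circ> \<gamma> n) ((\<pi> \<circ> \<phi>) \<circ> \<gamma> n) = (\<integral>y. real_of_int (T n y) * (f y * deriv \<pi> y) \<partial>lebesgue)" for n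
    proof -
      have "lint 0 (len n) (g \<circ> \<gamma> n) ((\<pi> \<circ> \<phi>) \<circ> \<gamma> n) = lint 0 (len n) (\<lambda>x. indicator (V n) x * f ((\<phi> \<circ> \<gamma> n) x)) ((\<pi> \<circ> \<phi>) \<circ> \<gamma> n)"
      proof (rule lint_cong_Ioo[OF _ comp_curve_measurable[OF gm] _ lipschitz_comp_curve[OF L']])
        have "(\<lambda>x. f ((\<phi> \<circ> \<gamma> n) x)) \<in> borel_measurable borel"
          using lip_bdd_measurable[OF lip_bdd_compose[OF f\<phi> lip_curve[of n]]] by (simp add: comp_def)
        then show "(\<lambda>x. indicator (V n) x * f ((\<phi> \<circ> \<gamma> n) x)) \<in> borel_measurable borel"
          using V(1)[of n] by (intro borel_measurable_times borel_measurable_indicator) auto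
      qed (auto simp: g_def V_def indicator_def)
      also have "\<dots> = (\<integral>y. real_of_int (T n y) * (f y * deriv \<pi> y) \<partial>lebesgue)"
        using T(3)[OF f \<pi>, of n] by (simp add: comp_assoc)
      finally show ?thesis .
    qed
    have "(\<lambda>n. ?w n * lint 0 (len n) (g \<circ> \<gamma> n) ((\<pi> \<circ> \<phi>) \<circ> \<gamma> n)) sums chain_ext ?w g (\<pi> \<circ> \<phi>)"
      by (rule chain_ext_sums[OF w gm gC \<pi>\<phi>])
    then have "(\<lambda>n. \<integral>y. real_of_int (\<theta> n y) * (f y * deriv \<pi> y) \<partial>lebesgue) sums chain_ext ?w g (\<pi> \<circ> \<phi>)"
      unfolding arcs by (simp add: \<theta>_def mult.assoc)
    moreover have "(\<lambda>n. \<integral>y. real_of_int (\<theta> n y) * (f y * deriv \<pi> y) \<partial>lebesgue) sums (\<integral>y. real_of_int (\<Theta> y) * (f y * deriv \<pi> y) \<partial>lebesgue)"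
    proof (rule S(2))
      show "(\<lambda>y. f y * deriv \<pi> y) \<in> borel_measurable lebesgue"
        using lip_bdd_measurable[OF f] lipschitz_deriv_measurable[OF L(2)] by (intro borel_measurable_times measurable_completion[of f]) auto
      show "AE y in lebesgue. \<bar>f y * deriv \<pi> y\<bar> \<le> C * L"
        using lipschitz_AE_deriv_le[OF L(2)]
      proof eventually_elim
        case (elim x)
        then show ?case unfolding abs_mult using C by (intro mult_mono) auto
      qed
    qed
    ultimately have "chain_ext ?w g (\<pi> \<circ> \<phi>) = (\<integral>y. real_of_int (\<Theta> y) * (f y * deriv \<pi> y) \<partial>lebesgue)"
      by (rule sums_unique2)
    moreover have "pushforward \<phi> (restrict_current (chain ?w) U) f \<pi> = chain_ext ?w g (\<pi> \<circ> \<phi>)"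
      using restrict_chain[OF w U f\<phi> \<pi>\<phi>] True by (simp add: pushforward_def g_def[abs_def])
    ultimately show ?thesis using True by (simp add: line_current_def mult.assoc)
  qed (auto simp: pushforward_def line_current_def)
  then have "pushforward \<phi> (restrict_current (chain ?w) U) = line_current (\<lambda>x. real_of_int (\<Theta> x))" by blast
  with S(1) show ?thesis by blast
qed

theorem chain_int_rectifiable:
  fixes c :: "nat \<Rightarrow> int"
  assumes w: "finite_weight (\<lambda>n. real_of_int (c n))"
  shows "int_rectifiable1 (chain (\<lambda>n. real_of_int (c n)))"
  unfolding int_rectifiable1_def
proof (intro conjI ballI allI impI)
  \<comment> \<open>The curves cover the space, so the space itself is a rectifiable
    carrier.\<close>
  show "\<exists>S\<in>sets borel. rectifiable1 S \<and> emeasure (mass_measure (chain (\<lambda>n. real_of_int (c n)))) (- S) = 0"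
    by (intro bexI[of _ UNIV] conjI rectifiable_UNIV) auto
qed (use chain_current1[OF w] chain_measure_hausdorff_null mass_measure_chain[OF w] chain_pushforward[OF w] in auto)

text \<open>A weight \<open>0\<close> leaves some ball about the midpoint of that edge without mass.
  If no weight vanishes, every point, vertices included, lies on a closed edge \<open>n\<close>,
  which puts a parameter interval of length \<open>r\<close> into each small ball of radius
  \<open>r\<close>; the lower density is at least \<open>|w n| / 2\<close>.\<close>

theorem chain_char_set:
  assumes w: "finite_weight w"
  shows "char_set (chain w) = UNIV \<longleftrightarrow> (\<forall>n. w n \<noteq> 0)"
proof safe
  fix n assume UNIV: "char_set (chain w) = UNIV" and w0: "w n = 0"
  let ?x = "\<gamma> n (len n / 2)"
  have "?x \<in> edge_arc n" using len_pos[of n] by (simp add: curve_in_arc_iff)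
  then obtain e where e: "e > 0" "ball ?x e \<subseteq> edge_arc n"
    using open_arc[of n] open_contains_ball unfolding edge_arc_def by blast
  have "emeasure (chain_measure w) (ball ?x r) = 0" if "0 < r" "r < e" for r
  proof -
    have sub: "ball ?x r \<subseteq> edge_arc n" using that e by auto
    have "ennreal \<bar>w m\<bar> * emeasure lborel ({0..len m} \<inter> \<gamma> m -` ball ?x r) = 0" for m
    proof (cases "m = n")
      case False
      then have "{0..len m} \<inter> \<gamma> m -` ball ?x r = {}"
        using sub curve_in_arc_iff[of _ m n] by auto
      then show ?thesis by (simp only: emeasure_empty mult_zero_right)
    qed (simp add: w0)
    then show ?thesis by (subst emeasure_chain_measure) (auto simp only: borel_open open_ball suminf_zero)
  qed
  then have "\<forall>\<^sub>F r in at_right 0. emeasure (chain_measure w) (ball ?x r) / ennreal (2 * r) \<le> 0"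
    using e(1) by (intro eventually_at_rightI[of 0 e]) (auto simp: ennreal_divide_eq_0_iff)
  then have "Liminf (at_right 0) (\<lambda>r. emeasure (chain_measure w) (ball ?x r) / ennreal (2 * r)) \<le> 0"
    by (intro order_trans[OF Liminf_le_Limsup Limsup_bounded]) auto
  moreover have "?x \<in> char_set (chain w)" using UNIV by simp
  ultimately show False by (simp add: char_set_def mass_measure_chain[OF w])
next
  fix x assume nz: "\<forall>n. w n \<noteq> 0"
  obtain n s where s: "0 \<le> s" "s \<le> len n" and x: "x = \<gamma> n s" using arcs_cover by blast
  have ge: "ennreal (\<bar>w n\<bar> / 2) \<le> emeasure (chain_measure w) (ball x r) / ennreal (2 * r)" if r: "0 < r" "r < len n / 2" for r
  proof -
    \<comment> \<open>The interval points from \<open>s\<close> towards the farther end of the edge,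
      so it stays in \<open>[0, len n]\<close> even when \<open>s\<close> is an end point.\<close>
    define J where "J = (if s \<le> len n / 2 then {s..<s + r} else {s - r<..s})"
    have J: "J \<subseteq> {0..len n}" "\<And>t. t \<in> J \<Longrightarrow> \<bar>s - t\<bar> < r" "J \<in> sets lborel" "emeasure lborel J = ennreal r"
      using s r by (auto simp: J_def split: if_splits)
    have "J \<subseteq> {0..len n} \<inter> \<gamma> n -` ball x r"
    proof
      fix t assume t: "t \<in> J"
      have "dist (\<gamma> n s) (\<gamma> n t) \<le> 1 * dist s t" by (rule lipschitz_onD[OF curve_lipschitz]) auto
      then show "t \<in> {0..len n} \<inter> \<gamma> n -` ball x r" using J(1) J(2)[OF t] t x by (auto simp: dist_real_def)
    qed
    moreover have "{0..len n} \<inter> \<gamma> n -` ball x r \<in> sets lborel"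
      using measurable_sets[OF curve_measurable[of n], of "ball x r"] by simp
    ultimately have le: "ennreal r \<le> emeasure lborel ({0..len n} \<inter> \<gamma> n -` ball x r)"
      unfolding J(4)[symmetric] by (intro emeasure_mono)
    have "ennreal \<bar>w n\<bar> * ennreal r \<le> ennreal \<bar>w n\<bar> * emeasure lborel ({0..len n} \<inter> \<gamma> n -` ball x r)"
      by (rule mult_left_mono[OF le]) simp
    also have "\<dots> = (\<Sum>m\<in>{n}. ennreal \<bar>w m\<bar> * emeasure lborel ({0..len m} \<inter> \<gamma> m -` ball x r))" by simp
    also have "\<dots> \<le> (\<Sum>m. ennreal \<bar>w m\<bar> * emeasure lborel ({0..len m} \<inter> \<gamma> m -` ball x r))"
      by (intro sum_le_suminf) auto
    also have "\<dots> = emeasure (chain_measure w) (ball x r)" by (subst emeasure_chain_measure) auto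
    finally have "ennreal (\<bar>w n\<bar> * r) / ennreal (2 * r) \<le> emeasure (chain_measure w) (ball x r) / ennreal (2 * r)"
      using r by (intro divide_right_mono_ennreal) (simp add: ennreal_mult)
    also have "ennreal (\<bar>w n\<bar> * r) / ennreal (2 * r) = ennreal (\<bar>w n\<bar> / 2)"
      using r by (subst divide_ennreal) auto
    finally show ?thesis .
  qed
  have "ennreal (\<bar>w n\<bar> / 2) \<le> Liminf (at_right 0) (\<lambda>r. emeasure (chain_measure w) (ball x r) / ennreal (2 * r))"
    by (rule Liminf_bounded) (use ge len_pos[of n] in \<open>auto intro!: eventually_at_rightI[of 0 "len n / 2"]\<close>)
  moreover have "0 < ennreal (\<bar>w n\<bar> / 2)" using nz by simp
  ultimately have "0 < Liminf (at_right 0) (\<lambda>r. emeasure (chain_measure w) (ball x r) / ennreal (2 * r))"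
    by (rule order_less_le_trans[rotated])
  then show "x \<in> char_set (chain w)" by (simp add: char_set_def mass_measure_chain[OF w])
qed simp

end

section \<open>Cycles are chains\<close>

lemma current1_off:
  assumes "current1 T" "\<not> (lip_bdd f \<and> lip \<pi>)"
  shows "T f \<pi> = 0"
  using assms(1)[unfolded current1_def, THEN conjunct1] assms(2) by blast

lemma current1_lincomb_right:
  "current1 T \<Longrightarrow> lip_bdd f \<Longrightarrow> lip \<pi> \<Longrightarrow> lip \<rho> \<Longrightarrow> T f (\<lambda>x. a * \<pi> x + b * \<rho> x) = a * T f \<pi> + b * T f \<rho>"
  by (simp add: current1_def)

lemma current1_local:
  assumes "current1 T" "lip_bdd f" "lip \<pi>" "open U" "{x. f x \<noteq> 0} \<subseteq> U" "\<forall>x\<in>U. \<pi> x = c"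
  shows "T f \<pi> = 0"
  using assms(1)[unfolded current1_def, THEN conjunct2, THEN conjunct2, THEN conjunct2, THEN conjunct2, THEN conjunct1] assms(2-)
  by blast

text \<open>Half-lines are a generator stable under intersection, and the total integral handles
  complements. So \<open>g\<close> has integral \<open>0\<close> over every Borel set, in particular
  over \<open>{g > 0}\<close> and \<open>{g < 0}\<close>.\<close>

lemma AE_zero_of_ray_integrals:
  fixes g :: "real \<Rightarrow> real"
  assumes g: "integrable lborel g" and ray: "\<And>t. (\<integral>x. indicator {..t} x * g x \<partial>lborel) = 0" and total: "(\<integral>x. g x \<partial>lborel) = 0"
  shows "AE x in lborel. g x = 0"
proof -
  have gm [measurable]: "g \<in> borel_measurable borel" using g by auto
  have gi: "integrable lborel (\<lambda>x. indicator A x * g x)" if "A \<in> sets borel" for A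
    using integrable_mult_indicator[OF _ g, of A] that by simp
  have zero: "(\<integral>x. indicator A x * g x \<partial>lborel) = 0" if "A \<in> sets borel" for A
  proof -
    have "A \<in> sigma_sets UNIV (range (\<lambda>t. {..t::real}))" using that by (simp add: borel_eq_atMost)
    then show ?thesis
    proof (induction rule: sigma_sets_induct_disjoint[rotated 2, consumes 1])
      show "Int_stable (range (\<lambda>t. {..t::real}))"
      proof (rule Int_stableI)
        fix a b :: "real set" assume "a \<in> range (\<lambda>t. {..t})" "b \<in> range (\<lambda>t. {..t})"
        then obtain s t where "a = {..s}" "b = {..t}" by auto
        then have "a \<inter> b = {..min s t}" by auto
        then show "a \<inter> b \<in> range (\<lambda>t. {..t})" by blast
      qed
    next
      fix A :: "real set" assume "A \<in> range (\<lambda>t. {..t})"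
      then show "(\<integral>x. indicator A x * g x \<partial>lborel) = 0" using ray by auto
    next
      fix A :: "real set" assume "A \<in> sigma_sets UNIV (range (\<lambda>t. {..t}))" and IH: "(\<integral>x. indicator A x * g x \<partial>lborel) = 0"
      then have A: "A \<in> sets borel" by (simp add: borel_eq_atMost)
      have "(\<integral>x. indicator (UNIV - A) x * g x \<partial>lborel) = (\<integral>x. g x - indicator A x * g x \<partial>lborel)"
        by (intro Bochner_Integration.integral_cong) (auto simp: indicator_def)
      then show "(\<integral>x. indicator (UNIV - A) x * g x \<partial>lborel) = 0" using g gi[OF A] IH total by simp
    next
      fix A :: "nat \<Rightarrow> real set" assume A: "disjoint_family A" "range A \<subseteq> sigma_sets UNIV (range (\<lambda>t. {..t}))"
        and IH: "\<And>i. (\<integral>x. indicator (A i) x * g x \<partial>lborel) = 0"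
      have Am: "A i \<in> sets borel" for i using A(2) by (auto simp: borel_eq_atMost)
      have "(\<lambda>n. \<integral>x. indicator (\<Union>i<n. A i) x * g x \<partial>lborel) \<longlonglongrightarrow> (\<integral>x. indicator (\<Union>i. A i) x * g x \<partial>lborel)"
      proof (rule integral_dominated_convergence[where w="\<lambda>x. \<bar>g x\<bar>"])
        show "AE x in lborel. (\<lambda>n. indicator (\<Union>i<n. A i) x * g x) \<longlonglongrightarrow> indicator (\<Union>i. A i) x * g x"
        proof (intro AE_I2)
          fix x
          have "\<forall>\<^sub>F n in sequentially. indicator (\<Union>i<n. A i) x * g x = indicator (\<Union>i. A i) x * g x"
          proof (cases "x \<in> (\<Union>i. A i)")
            case True
            then obtain i where "x \<in> A i" by auto
            then have "x \<in> (\<Union>i<n. A i)" if "n > i" for n using that by auto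
            then have "indicator (\<Union>i<n. A i) x * g x = indicator (\<Union>i. A i) x * g x" if "n \<ge> Suc i" for n
              using True that by simp
            then show ?thesis unfolding eventually_sequentially by blast
          qed simp
          then show "(\<lambda>n. indicator (\<Union>i<n. A i) x * g x) \<longlonglongrightarrow> indicator (\<Union>i. A i) x * g x"
            by (rule tendsto_eventually)
        qed
      qed (use Am g in \<open>auto simp: indicator_def\<close>)
      moreover have "(\<integral>x. indicator (\<Union>i<n. A i) x * g x \<partial>lborel) = 0" for n
      proof -
        have "indicator (\<Union>i<n. A i) x * g x = (\<Sum>i<n. indicator (A i) x * g x)" for x
          using A(1) by (subst indicator_UN_disjoint) (auto simp: sum_distrib_right disjoint_family_on_def)
        then have "(\<integral>x. indicator (\<Union>i<n. A i) x * g x \<partial>lborel) = (\<integral>x. (\<Sum>i<n. indicator (A i) x * g x) \<partial>lborel)" by (simp only:)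
        also have "\<dots> = (\<Sum>i<n. \<integral>x. indicator (A i) x * g x \<partial>lborel)"
          by (rule Bochner_Integration.integral_sum) (rule gi[OF Am])
        finally show ?thesis by (simp add: IH)
      qed
      ultimately show "(\<integral>x. indicator (\<Union>i. A i) x * g x \<partial>lborel) = 0" by (simp add: LIMSEQ_const_iff)
    qed auto
  qed
  have P: "AE x in lborel. \<not> g x > 0"
  proof -
    have A: "{x. g x > 0} \<in> sets borel" by measurable
    have "AE x in lborel. indicator {x. g x > 0} x * g x = 0"
      using zero[OF A] by (subst integral_nonneg_eq_0_iff_AE[symmetric, OF gi[OF A]]) (auto simp: indicator_def)
    then show ?thesis by eventually_elim (auto simp: indicator_def)
  qed
  have N: "AE x in lborel. \<not> g x < 0"
  proof -
    have A: "{x. g x < 0} \<in> sets borel" by measurable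
    have "integrable lborel (\<lambda>x. - (indicator {x. g x < 0} x * g x))" using gi[OF A] by simp
    moreover have "(\<integral>x. - (indicator {x. g x < 0} x * g x) \<partial>lborel) = 0" using zero[OF A] by simp
    ultimately have "AE x in lborel. - (indicator {x. g x < 0} x * g x) = 0"
      by (subst integral_nonneg_eq_0_iff_AE[symmetric]) (auto simp: indicator_def)
    then show ?thesis by eventually_elim (auto simp: indicator_def)
  qed
  show ?thesis using P N by eventually_elim auto
qed

text \<open>A Lebesgue measurable density is replaced by a Borel representative, to which the
  generator argument applies.\<close>

lemma AE_zero_of_ray_integrals_lebesgue:
  fixes g :: "real \<Rightarrow> real"
  assumes g: "integrable lebesgue g" and ray: "\<And>t. (\<integral>x. indicator {..t} x * g x \<partial>lebesgue) = 0" and total: "(\<integral>x. g x \<partial>lebesgue) = 0"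
  shows "AE x in lebesgue. g x = 0"
proof -
  obtain g' where g': "g' \<in> borel_measurable lborel" "AE x in lborel. g x = g' x"
    using completion_ex_borel_measurable_real[OF borel_measurable_integrable[OF g]] by blast
  have ae: "AE x in lebesgue. g x = g' x" using g'(2) by (rule AE_completion)
  have g'm: "g' \<in> borel_measurable lebesgue" using g'(1) by (rule measurable_completion)
  have "integrable lebesgue g'" using integrable_cong_AE[OF _ g'm ae] g by auto
  then have i: "integrable lborel g'" using g'(1) by (simp add: integrable_completion)
  have eq: "(\<integral>x. u x * g' x \<partial>lborel) = (\<integral>x. u x * g x \<partial>lebesgue)" if u: "u \<in> borel_measurable borel" for u :: "real \<Rightarrow> real"
  proof -
    have m: "(\<lambda>x. u x * g' x) \<in> borel_measurable lborel" using u g'(1) by measurable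
    have um: "u \<in> borel_measurable lebesgue" using u by (intro measurable_completion) simp
    have "(\<integral>x. u x * g' x \<partial>lborel) = (\<integral>x. u x * g' x \<partial>lebesgue)" using m by (rule integral_completion[symmetric])
    also have "\<dots> = (\<integral>x. u x * g x \<partial>lebesgue)"
      by (rule integral_cong_AE) (use um g'm borel_measurable_integrable[OF g] ae in auto)
    finally show ?thesis .
  qed
  have "AE x in lborel. g' x = 0"
  proof (rule AE_zero_of_ray_integrals[OF i])
    show "(\<integral>x. indicator {..t} x * g' x \<partial>lborel) = 0" for t using eq[of "indicator {..t}"] ray by simp
    show "(\<integral>x. g' x \<partial>lborel) = 0" using eq[of "\<lambda>_. 1"] total by simp
  qed
  then have "AE x in lebesgue. g' x = 0" by (rule AE_completion)
  with ae show ?thesis by eventually_elim simp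
qed

text \<open>The du Bois-Reymond lemma, with Lipschitz functions supported in \<open>[0, l]\<close>
  as test functions.\<close>

lemma constant_of_tent_integrals:
  fixes \<theta> :: "real \<Rightarrow> real"
  assumes \<theta>: "integrable lebesgue \<theta>" and l: "0 < l"
    and tent: "\<And>\<tau>. lip \<tau> \<Longrightarrow> (\<And>s. s \<le> 0 \<or> l \<le> s \<Longrightarrow> \<tau> s = 0) \<Longrightarrow> (\<integral>x. \<theta> x * deriv \<tau> x \<partial>lebesgue) = 0"
  obtains c where "AE x in lebesgue. x \<in> {0..l} \<longrightarrow> \<theta> x = c"
proof -
  define I where "I t = (\<integral>x. indicator {0..t} x * \<theta> x \<partial>lebesgue)" for t
  have \<theta>i: "integrable lebesgue (\<lambda>x. indicator {0..t} x * \<theta> x)" for t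
    using integrable_mult_indicator[OF _ \<theta>, of "{0..t}"] by simp
  have I: "I t = t / l * I l" if t: "0 \<le> t" "t \<le> l" for t
  proof -
    define k where "k s = max 0 (min l s)" for s
    \<comment> \<open>The tent with slope \<open>1 - t / l\<close> on \<open>(0, t)\<close> and
      \<open>- t / l\<close> on \<open>(t, l)\<close>; clamping by \<open>k\<close> makes it vanish
      outside. That its pairing with \<open>\<theta>\<close> is \<open>0\<close> says that the
      primitive of \<open>\<theta>\<close> is linear.\<close>
    define \<tau> where "\<tau> s = min t (k s) - t / l * k s" for s
    have "lip (\<lambda>s::real. s)" by (rule lipI[OF lipschitz_on_id])
    then have k: "lip k" unfolding k_def[abs_def] by (intro lip_min_max)
    have "lip (\<lambda>s. 1 * min t (k s) + (- (t / l)) * k s)" by (intro lip_lincomb lip_min_max k)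
    then have "lip \<tau>" by (simp add: \<tau>_def[abs_def])
    moreover have "\<tau> s = 0" if "s \<le> 0 \<or> l \<le> s" for s
      using that t l by (auto simp: \<tau>_def k_def)
    ultimately have "(\<integral>x. \<theta> x * deriv \<tau> x \<partial>lebesgue) = 0" by (rule tent)
    also have "(\<integral>x. \<theta> x * deriv \<tau> x \<partial>lebesgue) = (\<integral>x. indicator {0..t} x * \<theta> x - t / l * (indicator {0..l} x * \<theta> x) \<partial>lebesgue)"
    proof (rule integral_cong_AE)
      have "AE x in lebesgue. x \<noteq> 0" "AE x in lebesgue. x \<noteq> t" "AE x in lebesgue. x \<noteq> l"
        by (intro AE_completion AE_lborel_singleton)+
      then show "AE x in lebesgue. \<theta> x * deriv \<tau> x = indicator {0..t} x * \<theta> x - t / l * (indicator {0..l} x * \<theta> x)"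
      proof eventually_elim
        case (elim x)
        consider "x < 0" | "0 < x" "x < t" | "t < x" "x < l" "0 < x" | "l < x" using elim t by linarith
        then have "(\<tau> has_real_derivative (indicator {0..t} x - t / l * indicator {0..l} x)) (at x)"
        proof cases
          case 1
          have "((\<lambda>_. 0) has_real_derivative 0) (at x)" by simp
          then have "(\<tau> has_real_derivative 0) (at x)"
            by (rule has_field_derivative_transform_within_open[where S="{..<0}"]) (use 1 t l in \<open>auto simp: \<tau>_def k_def\<close>)
          then show ?thesis using 1 t by simp
        next
          case 2
          have "((\<lambda>s. s - t / l * s) has_real_derivative 1 - t / l) (at x)"
            using l by (auto intro!: derivative_eq_intros)
          then have "(\<tau> has_real_derivative 1 - t / l) (at x)"
            by (rule has_field_derivative_transform_within_open[where S="{0<..<t}"]) (use 2 t l in \<open>auto simp: \<tau>_def k_def\<close>)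
          then show ?thesis using 2 t l by simp
        next
          case 3
          have "((\<lambda>s. t - t / l * s) has_real_derivative - (t / l)) (at x)"
            using l by (auto intro!: derivative_eq_intros)
          then have "(\<tau> has_real_derivative - (t / l)) (at x)"
            by (rule has_field_derivative_transform_within_open[where S="{t<..<l} \<inter> {0<..}"]) (use 3 t l in \<open>auto simp: \<tau>_def k_def\<close>)
          then show ?thesis using 3 t l by simp
        next
          case 4
          have "((\<lambda>_. 0) has_real_derivative 0) (at x)" by simp
          then have "(\<tau> has_real_derivative 0) (at x)"
            by (rule has_field_derivative_transform_within_open[where S="{l<..}"]) (use 4 t l in \<open>auto simp: \<tau>_def k_def\<close>)
          then show ?thesis using 4 t l by simp
        qed
        then show ?case by (simp add: DERIV_imp_deriv algebra_simps)
      qed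
      obtain L where "L-lipschitz_on UNIV \<tau>" using \<open>lip \<tau>\<close> by (rule lipE)
      then show "(\<lambda>x. \<theta> x * deriv \<tau> x) \<in> borel_measurable lebesgue"
        using \<theta> by (intro borel_measurable_times lipschitz_deriv_measurable) auto
    qed (use \<theta>i[of t] \<theta>i[of l] in \<open>auto dest!: borel_measurable_integrable\<close>)
    also have "\<dots> = I t - t / l * I l" unfolding I_def using \<theta>i[of t] \<theta>i[of l] by simp
    finally show ?thesis by simp
  qed
  define c where "c = I l / l"
  define g where "g x = indicator {0..l} x * \<theta> x - indicator {0..l} x * c" for x
  have gi: "integrable lebesgue g"
    unfolding g_def[abs_def] by (intro Bochner_Integration.integrable_diff \<theta>i integrable_indicator_Icc)
  have "AE x in lebesgue. g x = 0"
  proof (rule AE_zero_of_ray_integrals_lebesgue[OF gi])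
    have ray: "(\<integral>x. indicator {..t} x * g x \<partial>lebesgue) = 0" for t
    proof (cases "t < 0")
      case True
      then have z: "indicator {..t} x * g x = 0" for x by (auto simp: g_def indicator_def)
      show ?thesis unfolding z by simp
    next
      case False
      define m where "m = min t l"
      have m: "0 \<le> m" "m \<le> l" using False l by (auto simp: m_def)
      have "indicator {..t} x * g x = indicator {0..m} x * \<theta> x - indicator {0..m} x * c" for x
        using False by (auto simp: g_def m_def indicator_def)
      then have "(\<integral>x. indicator {..t} x * g x \<partial>lebesgue) = I m - (\<integral>x. indicator {0..m} x * c \<partial>lebesgue)"
        using Bochner_Integration.integral_diff[OF \<theta>i[of m] integrable_indicator_Icc[of 0 m c]] by (simp add: I_def)
      also have "(\<integral>x. indicator {0..m} x * c \<partial>lebesgue) = m * c" using m by simp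
      finally show ?thesis using I[OF m] l by (simp add: c_def)
    qed
    show "(\<integral>x. indicator {..t} x * g x \<partial>lebesgue) = 0" for t by (rule ray)
    have eq: "indicator {..l} x * g x = g x" for x by (auto simp: g_def indicator_def)
    show "(\<integral>x. g x \<partial>lebesgue) = 0" using ray[of l] unfolding eq .
  qed
  then have "AE x in lebesgue. x \<in> {0..l} \<longrightarrow> \<theta> x = c"
    by eventually_elim (auto simp: g_def)
  then show thesis by (rule that)
qed

text \<open>A tent on one arc, extended by \<open>0\<close>, has to be Lipschitz across the ends of
  the arc for the metric of the whole space. On \<open>G\<close> this extension is the function
  \<open>edge_tent\<close>.\<close>

locale tent_charts = charts +
  assumes tent_lip: "lip (\<tau> :: real \<Rightarrow> real) \<Longrightarrow> (\<And>s. s \<le> 0 \<or> len n \<le> s \<Longrightarrow> \<tau> s = 0) \<Longrightarrow> lip (\<lambda>x. if x \<in> edge_arc n then \<tau> (h n x) else 0)"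
begin

lemma lip_h: "lip (h n)"
  using h_lipschitz by (rule lipI)

lemma h_retract: "x \<in> edge_arc n \<Longrightarrow> \<gamma> n (h n x) = x"
  unfolding edge_arc_def using h_curve by auto

text \<open>
  On the open arc every Lipschitz function factors through the coordinate \<open>h n\<close>, so the restriction
  of a current to the arc is determined by its push-forward under \<open>h n\<close>.
\<close>

lemma restrict_arc_eq:
  assumes T: "current1 T" and push: "pushforward (h n) (restrict_current T (edge_arc n)) = line_current \<theta>"
    and f: "lip_bdd f" and \<pi>: "lip \<pi>"
  shows "restrict_current T (edge_arc n) f \<pi> = (\<integral>x. \<theta> x * f (\<gamma> n x) * deriv (\<pi> \<circ> \<gamma> n) x \<partial>lebesgue)"
proof -
  let ?A = "edge_arc n"
  have A: "open ?A" unfolding edge_arc_def by (rule open_arc)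
  let ?F = "f \<circ> \<gamma> n \<circ> h n" and ?P = "\<pi> \<circ> \<gamma> n \<circ> h n"
  have f1: "lip_bdd (f \<circ> \<gamma> n)" using f lip_curve by (rule lip_bdd_compose)
  have \<pi>1: "lip (\<pi> \<circ> \<gamma> n)" using lip_curve \<pi> by (rule lip_compose)
  have F: "lip_bdd ?F" using f1 lip_h by (rule lip_bdd_compose)
  have P: "lip ?P" using lip_h \<pi>1 by (rule lip_compose)
  have "restrict_current T ?A ?F ?P = pushforward (h n) (restrict_current T ?A) (f \<circ> \<gamma> n) (\<pi> \<circ> \<gamma> n)"
    using f1 \<pi>1 by (simp add: pushforward_def)
  also have "\<dots> = (\<integral>x. \<theta> x * f (\<gamma> n x) * deriv (\<pi> \<circ> \<gamma> n) x \<partial>lebesgue)"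
    using f1 \<pi>1 by (simp add: push line_current_def)
  finally have 1: "restrict_current T ?A ?F ?P = (\<integral>x. \<theta> x * f (\<gamma> n x) * deriv (\<pi> \<circ> \<gamma> n) x \<partial>lebesgue)" .
  have "T (\<lambda>x. cutoff ?A k x * ?F x) ?P = T (\<lambda>x. cutoff ?A k x * f x) \<pi>" for k
  proof -
    have eq: "(\<lambda>x. cutoff ?A k x * ?F x) = (\<lambda>x. cutoff ?A k x * f x)"
    proof
      fix x show "cutoff ?A k x * ?F x = cutoff ?A k x * f x"
        by (cases "x \<in> ?A") (simp_all add: h_retract cutoff_outside)
    qed
    have l: "lip_bdd (\<lambda>x. cutoff ?A k x * f x)" by (intro lip_bdd_mult cutoff_lip_bdd f)
    \<comment> \<open>\<open>\<pi>\<close> and its factored version \<open>?P\<close> agree on the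
      open arc, outside of which the cutoff product vanishes, so locality makes them
      interchangeable.\<close>
    have "T (\<lambda>x. cutoff ?A k x * f x) (\<lambda>x. 1 * ?P x + (-1) * \<pi> x) = 1 * T (\<lambda>x. cutoff ?A k x * f x) ?P + (-1) * T (\<lambda>x. cutoff ?A k x * f x) \<pi>"
      by (rule current1_lincomb_right[OF T l P \<pi>])
    moreover have "T (\<lambda>x. cutoff ?A k x * f x) (\<lambda>x. 1 * ?P x + (-1) * \<pi> x) = 0"
    proof -
      have lp: "lip (\<lambda>x. 1 * ?P x + (-1) * \<pi> x)" by (intro lip_lincomb P \<pi>)
      have sub: "{x. cutoff ?A k x * f x \<noteq> 0} \<subseteq> ?A" using cutoff_outside by fastforce
      have const: "\<forall>x\<in>?A. 1 * ?P x + (-1) * \<pi> x = 0" by (simp add: h_retract)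
      show ?thesis by (rule current1_local[OF T l lp A sub const])
    qed
    ultimately show ?thesis unfolding eq by simp
  qed
  then have "(\<lambda>k. T (\<lambda>x. cutoff ?A k x * f x) \<pi>) \<longlonglongrightarrow> restrict_current T ?A ?F ?P"
    using restrict_current_tendsto[OF T A F P] by simp
  then have "restrict_current T ?A f \<pi> = restrict_current T ?A ?F ?P"
    using restrict_current_tendsto[OF T A f \<pi>] LIMSEQ_unique by blast
  with 1 show ?thesis by simp
qed

text \<open>What is left after \<open>N\<close> arcs is a set \<open>W N\<close>, and these sets
  decrease to a part of the countable set of end points. Since points are null, the error, which is
  controlled by the mass of \<open>W N\<close>, tends to \<open>0\<close>.\<close>

lemma current_sum_arcs:
  assumes T: "current1 T" and null: "\<And>x. emeasure (mass_measure T) {x} = 0"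
    and f: "lip_bdd f" and \<pi>: "lip \<pi>"
  shows "(\<lambda>n. restrict_current T (edge_arc n) f \<pi>) sums T f \<pi>"
proof -
  let ?M = "mass_measure T"
  interpret M: finite_borel ?M using T by (rule mass_measure_finite_borel)
  obtain C where C: "C \<ge> 0" "\<And>x. \<bar>f x\<bar> \<le> C" using f by (rule lip_bddE) blast
  obtain L where L: "L \<ge> 0" "L-lipschitz_on UNIV \<pi>" using \<pi> by (rule lipE)
  have A: "open (edge_arc n)" for n unfolding edge_arc_def by (rule open_arc)
  define W where "W N = UNIV - (\<Union>n<N. edge_arc n)" for N
  have Wm: "W N \<in> sets borel" for N unfolding W_def by measurable
  have step: "\<bar>T f \<pi> - (\<Sum>n<N. restrict_current T (edge_arc n) f \<pi>)\<bar> \<le> L * (C * measure ?M (W N))" for N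
  proof -
    define F where "F k x = (\<Sum>n<N. cutoff (edge_arc n) k x * f x)" for k x
    have Fl: "lip_bdd (F k)" for k unfolding F_def by (intro lip_bdd_sum lip_bdd_mult cutoff_lip_bdd f)
    have TF: "T (F k) \<pi> = (\<Sum>n<N. T (\<lambda>x. cutoff (edge_arc n) k x * f x) \<pi>)" for k
      unfolding F_def
    proof (induction N)
      case 0
      have "T (\<lambda>x. 0 * f x + 0 * f x) \<pi> = 0 * T f \<pi> + 0 * T f \<pi>" by (rule current1_lincomb[OF T f f \<pi>])
      then show ?case by simp
    next
      case (Suc N)
      have "T (\<lambda>x. (\<Sum>n<N. cutoff (edge_arc n) k x * f x) + cutoff (edge_arc N) k x * f x) \<pi> = T (\<lambda>x. \<Sum>n<N. cutoff (edge_arc n) k x * f x) \<pi> + T (\<lambda>x. cutoff (edge_arc N) k x * f x) \<pi>"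
        by (intro current1_add[OF T] lip_bdd_sum lip_bdd_mult cutoff_lip_bdd f \<pi>)
      then show ?case using Suc by simp
    qed
    have lim1: "(\<lambda>k. T (F k) \<pi>) \<longlonglongrightarrow> (\<Sum>n<N. restrict_current T (edge_arc n) f \<pi>)"
      unfolding TF by (intro tendsto_sum restrict_current_tendsto T A f \<pi>)
    have bd: "\<bar>T f \<pi> - T (F k) \<pi>\<bar> \<le> L * (\<integral>x. \<bar>f x - F k x\<bar> \<partial>?M)" for k
      using mass_boundD[OF mass_measure_bound(1)[OF T] lip_bdd_diff[OF f Fl] L(2), of k] current1_diff[OF T f Fl \<pi>] by simp
    have "(\<lambda>k. \<integral>x. \<bar>f x - F k x\<bar> \<partial>?M) \<longlonglongrightarrow> (\<integral>x. \<bar>f x - (\<Sum>n<N. indicator (edge_arc n) x * f x)\<bar> \<partial>?M)"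
    proof (rule M.bounded_convergence[where B="C + real N * C"])
      have [measurable]: "f \<in> borel_measurable borel" "F k \<in> borel_measurable borel" for k
        using f Fl by (auto intro: lip_bdd_measurable)
      show "(\<lambda>x. \<bar>f x - F k x\<bar>) \<in> borel_measurable borel" for k by measurable
      show "(\<lambda>x. \<bar>f x - (\<Sum>n<N. indicator (edge_arc n) x * f x)\<bar>) \<in> borel_measurable borel" by measurable
      show "(\<lambda>k. \<bar>f x - F k x\<bar>) \<longlonglongrightarrow> \<bar>f x - (\<Sum>n<N. indicator (edge_arc n) x * f x)\<bar>" for x
        unfolding F_def by (intro tendsto_intros cutoff_tendsto A)
      show "\<bar>\<bar>f x - F k x\<bar>\<bar> \<le> C + real N * C" for k x
      proof -
        have "\<bar>cutoff (edge_arc n) k x * f x\<bar> \<le> 1 * C" for n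
          unfolding abs_mult using C cutoff_range[of "edge_arc n" k x] by (intro mult_mono) auto
        then have "\<bar>F k x\<bar> \<le> (\<Sum>n<N. C)"
          unfolding F_def by (intro order_trans[OF sum_abs] sum_mono) simp
        then show ?thesis using C(2)[of x] by (simp add: abs_le_iff)
      qed
    qed
    then have lim2: "(\<lambda>k. L * (\<integral>x. \<bar>f x - F k x\<bar> \<partial>?M)) \<longlonglongrightarrow> L * (\<integral>x. \<bar>f x - (\<Sum>n<N. indicator (edge_arc n) x * f x)\<bar> \<partial>?M)"
      by (rule tendsto_mult_left)
    have "(\<lambda>k. \<bar>T f \<pi> - T (F k) \<pi>\<bar>) \<longlonglongrightarrow> \<bar>T f \<pi> - (\<Sum>n<N. restrict_current T (edge_arc n) f \<pi>)\<bar>"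
      by (intro tendsto_intros lim1)
    from tendsto_le[OF _ lim2 this] bd
    have "\<bar>T f \<pi> - (\<Sum>n<N. restrict_current T (edge_arc n) f \<pi>)\<bar> \<le> L * (\<integral>x. \<bar>f x - (\<Sum>n<N. indicator (edge_arc n) x * f x)\<bar> \<partial>?M)"
      by simp
    also have "\<dots> \<le> L * (\<integral>x. indicator (W N) x * C \<partial>?M)"
    proof (intro mult_left_mono L(1) integral_mono')
      show "integrable ?M (\<lambda>x. indicator (W N) x * C)"
        using Wm C by (intro M.integrable_bounded[of _ C]) (auto simp: indicator_def)
      show "\<bar>f x - (\<Sum>n<N. indicator (edge_arc n) x * f x)\<bar> \<le> indicator (W N) x * C" for x
      proof (cases "x \<in> W N")
        case True
        then have z: "(\<Sum>n<N. indicator (edge_arc n) x * f x) = 0" by (intro sum.neutral) (auto simp: W_def)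
        show ?thesis unfolding z using True C by simp
      next
        case False
        then obtain m where m: "m < N" "x \<in> edge_arc m" by (auto simp: W_def)
        then have "n = m \<or> x \<notin> edge_arc n" for n using disjoint_arcs by (auto simp: disjoint_family_on_def)
        then have "(\<Sum>n<N. indicator (edge_arc n) x * f x) = (\<Sum>n\<in>{m}. indicator (edge_arc n) x * f x)"
          using m by (intro sum.mono_neutral_right) (auto simp: indicator_def)
        also have "\<dots> = f x" using m by (subst sum.insert) auto
        finally show ?thesis using False by simp
      qed
    qed (use C in auto)
    also have "(\<integral>x. indicator (W N) x * C \<partial>?M) = C * measure ?M (W N)"
      using Wm by (simp add: M.sets_borel)
    finally show ?thesis .
  qed
  have "(\<lambda>N. measure ?M (W N)) \<longlonglongrightarrow> measure ?M (\<Inter>N. W N)"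
    using Wm by (intro M.finite_Lim_measure_decseq) (auto simp: M.sets_borel decseq_def W_def)
  moreover have "measure ?M (\<Inter>N. W N) = 0"
  proof -
    have "(\<Inter>N. W N) \<subseteq> UNIV - (\<Union>n. edge_arc n)" by (auto simp: W_def)
    also note bij_cover
    finally have sub: "(\<Inter>N. W N) \<subseteq> (\<Union>n. {\<gamma> n 0, \<gamma> n (len n)})" .
    have "{x} \<in> null_sets ?M" for x using null by (intro null_setsI) (auto simp: M.sets_borel)
    then have "(\<Union>n. {\<gamma> n 0} \<union> {\<gamma> n (len n)}) \<in> null_sets ?M"
      by (intro null_sets_UN null_sets.Un) auto
    then have "(\<Inter>N. W N) \<in> null_sets ?M"
      using sub Wm by (elim null_sets_subset) (auto simp: M.sets_borel)
    then show ?thesis by (simp add: measure_def null_setsD1)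
  qed
  ultimately have W0: "(\<lambda>N. measure ?M (W N)) \<longlonglongrightarrow> 0" by simp
  have "(\<lambda>N. L * (C * measure ?M (W N))) \<longlonglongrightarrow> L * (C * 0)" by (intro tendsto_intros W0)
  then have "(\<lambda>N. L * (C * measure ?M (W N))) \<longlonglongrightarrow> 0" by simp
  then have "(\<lambda>N. T f \<pi> - (\<Sum>n<N. restrict_current T (edge_arc n) f \<pi>)) \<longlonglongrightarrow> 0"
    by (rule Lim_null_comparison[rotated]) (use step in \<open>simp add: always_eventually\<close>)
  then have "(\<lambda>N. T f \<pi> - (T f \<pi> - (\<Sum>n<N. restrict_current T (edge_arc n) f \<pi>))) \<longlonglongrightarrow> T f \<pi> - 0"
    by (intro tendsto_intros)
  then show ?thesis by (simp add: sums_def)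
qed

theorem cycle_is_chain:
  assumes R: "int_rectifiable1 R" and cycle: "boundary R = (\<lambda>_. 0)"
  obtains c :: "nat \<Rightarrow> int" where "finite_weight (\<lambda>n. real_of_int (c n))" "R = chain (\<lambda>n. real_of_int (c n))"
proof -
  have T: "current1 R" using R by (simp add: int_rectifiable1_def)
  interpret M: finite_borel "mass_measure R" using T by (rule mass_measure_finite_borel)
  \<comment> \<open>Points have Hausdorff measure \<open>0\<close>, and rectifiability makes the
    mass measure vanish on Borel sets of Hausdorff measure \<open>0\<close>.\<close>
  have null: "emeasure (mass_measure R) {x} = 0" for x
    using R hausdorff1_singleton[of x] by (auto simp: int_rectifiable1_def)
  have A: "open (edge_arc n)" for n unfolding edge_arc_def by (rule open_arc)
  have "\<exists>\<theta> :: real \<Rightarrow> int. integrable lebesgue (\<lambda>x. real_of_int (\<theta> x)) \<and>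
       pushforward (h n) (restrict_current R (edge_arc n)) = line_current (\<lambda>x. real_of_int (\<theta> x))" for n
    using R lip_h[of n] A[of n] unfolding int_rectifiable1_def by blast
  then have "\<exists>\<theta> :: nat \<Rightarrow> real \<Rightarrow> int. \<forall>n. integrable lebesgue (\<lambda>x. real_of_int (\<theta> n x)) \<and>
       pushforward (h n) (restrict_current R (edge_arc n)) = line_current (\<lambda>x. real_of_int (\<theta> n x))"
    by (intro choice allI)
  then obtain \<theta> :: "nat \<Rightarrow> real \<Rightarrow> int" where \<theta>': "\<forall>n. integrable lebesgue (\<lambda>x. real_of_int (\<theta> n x)) \<and>
       pushforward (h n) (restrict_current R (edge_arc n)) = line_current (\<lambda>x. real_of_int (\<theta> n x))"
    by (rule exE)
  have \<theta>: "integrable lebesgue (\<lambda>x. real_of_int (\<theta> n x))"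
    "pushforward (h n) (restrict_current R (edge_arc n)) = line_current (\<lambda>x. real_of_int (\<theta> n x))" for n
    using \<theta>'[rule_format, of n] by auto
  note restr = restrict_arc_eq[OF T \<theta>(2)]
  have "\<exists>c. AE x in lebesgue. x \<in> {0..len n} \<longrightarrow> \<theta> n x = c" for n
  proof -
    obtain c where c: "AE x in lebesgue. x \<in> {0..len n} \<longrightarrow> real_of_int (\<theta> n x) = c"
    proof (rule constant_of_tent_integrals[OF \<theta>(1)[of n] len_pos[of n]])
      fix \<tau> :: "real \<Rightarrow> real" assume \<tau>: "lip \<tau>" "\<And>s. s \<le> 0 \<or> len n \<le> s \<Longrightarrow> \<tau> s = 0"
      define \<pi> where "\<pi> x = (if x \<in> edge_arc n then \<tau> (h n x) else 0)" for x
      have \<pi>: "lip \<pi>" unfolding \<pi>_def[abs_def] by (rule tent_lip[OF \<tau>(1)]) (rule \<tau>(2))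
      obtain B where B: "\<And>x. x \<in> {0..len n} \<Longrightarrow> \<bar>\<tau> x\<bar> \<le> B"
        using continuous_bounded_Icc[OF lip_continuous[OF \<tau>(1)]] by blast
      have "\<bar>\<pi> x\<bar> \<le> \<bar>B\<bar>" for x
      proof (cases "x \<in> edge_arc n")
        case True
        then obtain s where "0 < s" "s < len n" "x = \<gamma> n s" by (auto simp: edge_arc_def)
        then have "h n x \<in> {0..len n}" using h_curve[of s n] by simp
        then show ?thesis using B[of "h n x"] True by (simp add: \<pi>_def)
      qed (simp add: \<pi>_def)
      then have "lip_bdd \<pi>" by (rule lip_bddI[OF \<pi>])
      then have R0: "R (\<lambda>_. 1) \<pi> = 0" using fun_cong[OF cycle, of \<pi>] by (simp add: boundary_def)
      \<comment> \<open>Curves are constant beyond their ends and \<open>\<tau>\<close> vanishes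
        there, so the pullback to curve \<open>n\<close> is \<open>\<tau>\<close> on the whole line.
        On every other curve it is \<open>0\<close>, and the series over the arcs has a single
        term.\<close>
      have on: "\<pi> \<circ> \<gamma> n = \<tau>"
      proof
        fix s
        define s' where "s' = max 0 (min (len n) s)"
        have s': "0 \<le> s'" "s' \<le> len n" using len_nonneg[of n] by (auto simp: s'_def)
        have "(\<pi> \<circ> \<gamma> n) s = \<pi> (\<gamma> n s')" using curve_clamped[of n s] by (simp add: s'_def)
        also have "\<dots> = (if 0 < s' \<and> s' < len n then \<tau> s' else 0)"
          using s' by (simp add: \<pi>_def curve_in_arc_iff h_curve)
        also have "\<dots> = \<tau> s"
        proof (cases "0 < s \<and> s < len n")
          case True
          then have "s' = s" by (simp add: s'_def)
          then show ?thesis using True by simp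
        next
          case False
          then have "\<tau> s = 0" by (intro \<tau>(2)) auto
          moreover have "\<not> (0 < s' \<and> s' < len n)" using False by (auto simp: s'_def min_def max_def split: if_splits)
          ultimately show ?thesis by (simp only: if_False)
        qed
        finally show "(\<pi> \<circ> \<gamma> n) s = \<tau> s" .
      qed
      have off: "\<pi> \<circ> \<gamma> m = (\<lambda>_. 0)" if "m \<noteq> n" for m
      proof
        fix s
        define s' where "s' = max 0 (min (len m) s)"
        have s': "0 \<le> s'" "s' \<le> len m" using len_nonneg[of m] by (auto simp: s'_def)
        have "(\<pi> \<circ> \<gamma> m) s = \<pi> (\<gamma> m s')" using curve_clamped[of m s] by (simp add: s'_def)
        then show "(\<pi> \<circ> \<gamma> m) s = 0" using s' that by (simp add: \<pi>_def curve_in_arc_iff)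
      qed
      have "(\<lambda>m. restrict_current R (edge_arc m) (\<lambda>_. 1) \<pi>) sums R (\<lambda>_. 1) \<pi>"
        by (rule current_sum_arcs[OF T null lip_bdd_const \<pi>])
      moreover have "restrict_current R (edge_arc m) (\<lambda>_. 1) \<pi> = 0" if "m \<noteq> n" for m
        using restr[OF lip_bdd_const \<pi>, of m 1] off[OF that] by simp
      then have "(\<lambda>m. restrict_current R (edge_arc m) (\<lambda>_. 1) \<pi>) sums restrict_current R (edge_arc n) (\<lambda>_. 1) \<pi>"
        using sums_finite[of "{n}" "\<lambda>m. restrict_current R (edge_arc m) (\<lambda>_. 1) \<pi>"] by simp
      ultimately have "restrict_current R (edge_arc n) (\<lambda>_. 1) \<pi> = 0" using R0 sums_unique2 by fastforce
      then show "(\<integral>x. real_of_int (\<theta> n x) * deriv \<tau> x \<partial>lebesgue) = 0"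
        using restr[OF lip_bdd_const \<pi>, of n 1] by (simp add: on)
    qed blast
    \<comment> \<open>The tents give a real constant. The edge has positive length, so this constant
      is a value of \<open>\<theta> n\<close> and therefore an integer.\<close>
    have "\<exists>x\<in>{0..len n}. real_of_int (\<theta> n x) = c"
    proof (rule ccontr)
      assume no: "\<not> (\<exists>x\<in>{0..len n}. real_of_int (\<theta> n x) = c)"
      have "AE x in lebesgue. x \<notin> {0..len n}" using c by eventually_elim (use no in auto)
      then have "{0..len n} \<in> null_sets lebesgue" by (subst AE_iff_null_sets) auto
      then show False using len_pos[of n] by (simp add: null_sets_def)
    qed
    then obtain x where x: "real_of_int (\<theta> n x) = c" by blast
    have "AE y in lebesgue. y \<in> {0..len n} \<longrightarrow> \<theta> n y = \<theta> n x"
      using c by eventually_elim (simp add: x[symmetric])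
    then show ?thesis by (rule exI)
  qed
  then have "\<exists>c. \<forall>n. AE x in lebesgue. x \<in> {0..len n} \<longrightarrow> \<theta> n x = c n" by (intro choice allI)
  then obtain c where c': "\<forall>n. AE x in lebesgue. x \<in> {0..len n} \<longrightarrow> \<theta> n x = c n" by (rule exE)
  have c: "AE x in lebesgue. x \<in> {0..len n} \<longrightarrow> \<theta> n x = c n" for n using c' by (rule spec)
  have arc: "restrict_current R (edge_arc n) f \<pi> = real_of_int (c n) * lint 0 (len n) (f \<circ> \<gamma> n) (\<pi> \<circ> \<gamma> n)"
    if f: "lip_bdd f" and \<pi>: "lip \<pi>" for n f \<pi>
  proof -
    obtain C where C: "C \<ge> 0" "\<And>x. \<bar>f x\<bar> \<le> C" using f by (rule lip_bddE) blast
    obtain L where L: "L-lipschitz_on UNIV \<pi>" using \<pi> by (rule lipE)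
    note L\<gamma> = lipschitz_comp_curve[OF L, of n]
    have fm: "f \<circ> \<gamma> n \<in> borel_measurable borel" by (rule comp_curve_measurable[OF lip_bdd_measurable[OF f]])
    have fml: "(\<lambda>x. f (\<gamma> n x)) \<in> borel_measurable lebesgue" using fm by (intro measurable_completion) (simp add: comp_def)
    have "(\<integral>x. real_of_int (\<theta> n x) * f (\<gamma> n x) * deriv (\<pi> \<circ> \<gamma> n) x \<partial>lebesgue)
        = (\<integral>x. real_of_int (c n) * (indicator {0..len n} x * ((f \<circ> \<gamma> n) x * deriv (\<pi> \<circ> \<gamma> n) x)) \<partial>lebesgue)"
    proof (rule integral_cong_AE)
      show "AE x in lebesgue. real_of_int (\<theta> n x) * f (\<gamma> n x) * deriv (\<pi> \<circ> \<gamma> n) x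
        = real_of_int (c n) * (indicator {0..len n} x * ((f \<circ> \<gamma> n) x * deriv (\<pi> \<circ> \<gamma> n) x))"
        using c[of n]
      proof eventually_elim
        case (elim x)
        show ?case
        proof (cases "x \<in> {0..len n}")
          case True
          then show ?thesis using elim by simp
        next
          case False
          \<comment> \<open>Nothing is known about \<open>\<theta> n\<close> outside the edge, but
            there the clamped curve is locally constant and the derivative vanishes.\<close>
          define S where "S = (if x < 0 then {..<0} else {len n<..})"
          have S: "open S" "x \<in> S" using False by (auto simp: S_def)
          have "(\<pi> \<circ> \<gamma> n) x = (\<pi> \<circ> \<gamma> n) y" if y: "y \<in> S" for y
          proof -
            have clamp: "max 0 (min (len n) x) = max 0 (min (len n) y)"
              using y False len_nonneg[of n] by (auto simp: S_def split: if_splits)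
            have "\<gamma> n x = \<gamma> n (max 0 (min (len n) x))" by (rule curve_clamped)
            also have "\<dots> = \<gamma> n (max 0 (min (len n) y))" by (simp only: clamp)
            also have "\<dots> = \<gamma> n y" by (rule curve_clamped[symmetric])
            finally show ?thesis by simp
          qed
          note const = this
          have "((\<lambda>_. (\<pi> \<circ> \<gamma> n) x) has_real_derivative 0) (at x)" by simp
          then have "((\<pi> \<circ> \<gamma> n) has_real_derivative 0) (at x)"
            by (rule has_field_derivative_transform_within_open[OF _ S]) (rule const)
          then show ?thesis using False by (simp add: DERIV_imp_deriv)
        qed
      qed
      show "(\<lambda>x. real_of_int (\<theta> n x) * f (\<gamma> n x) * deriv (\<pi> \<circ> \<gamma> n) x) \<in> borel_measurable lebesgue"
        by (intro borel_measurable_times fml lipschitz_deriv_measurable[OF L\<gamma>] borel_measurable_integrable[OF \<theta>(1)])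
      show "(\<lambda>x. real_of_int (c n) * (indicator {0..len n} x * ((f \<circ> \<gamma> n) x * deriv (\<pi> \<circ> \<gamma> n) x))) \<in> borel_measurable lebesgue"
        using borel_measurable_integrable[OF lint_comp_integrable[OF lip_bdd_measurable[OF f] C(2) \<pi>, of n]] by simp
    qed
    then show ?thesis using restr[OF f \<pi>, of n] by (simp add: lint_def)
  qed
  \<comment> \<open>Testing with the 1-Lipschitz coordinate \<open>h n\<close> and cutoffs of the
    arc bounds the weighted length by the mass of the arc. The arcs are disjoint and the mass is
    finite, so the weighted lengths are summable.\<close>
  have "\<bar>real_of_int (c n)\<bar> * len n \<le> measure (mass_measure R) (edge_arc n)" for n
  proof -
    have "lint 0 (len n) ((\<lambda>_. 1) \<circ> \<gamma> n) (h n \<circ> \<gamma> n) = (\<integral>s. indicator {0..len n} s * ((\<lambda>_. 1) \<circ> \<gamma> n) s \<partial>lebesgue)"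
      by (rule lint_coordinate) (simp add: comp_def)
    also have "\<dots> = len n" using len_nonneg[of n] by simp
    finally have eq: "restrict_current R (edge_arc n) (\<lambda>_. 1) (h n) = real_of_int (c n) * len n"
      using arc[OF lip_bdd_const lip_h] by simp
    have lim1: "(\<lambda>k. \<bar>R (\<lambda>x. cutoff (edge_arc n) k x * 1) (h n)\<bar>) \<longlonglongrightarrow> \<bar>real_of_int (c n) * len n\<bar>"
      unfolding eq[symmetric] by (intro tendsto_rabs restrict_current_tendsto T A lip_bdd_const lip_h)
    have lim2: "(\<lambda>k. \<integral>x. \<bar>cutoff (edge_arc n) k x * 1\<bar> \<partial>mass_measure R) \<longlonglongrightarrow> (\<integral>x. indicator (edge_arc n) x \<partial>mass_measure R)"
    proof (rule M.bounded_convergence[where B=1])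
      show "(\<lambda>x. \<bar>cutoff (edge_arc n) k x * 1\<bar>) \<in> borel_measurable borel" for k
        using lip_bdd_measurable[OF cutoff_lip_bdd, of "edge_arc n" k] by simp
      show "(\<lambda>k. \<bar>cutoff (edge_arc n) k x * 1\<bar>) \<longlonglongrightarrow> indicator (edge_arc n) x" for x
        using tendsto_rabs[OF cutoff_tendsto[OF A[of n], of x]] by simp
      show "\<bar>\<bar>cutoff (edge_arc n) k x * 1\<bar>\<bar> \<le> 1" for k x using cutoff_range[of "edge_arc n" k x] by simp
    qed simp
    have "\<bar>R (\<lambda>x. cutoff (edge_arc n) k x * 1) (h n)\<bar> \<le> (\<integral>x. \<bar>cutoff (edge_arc n) k x * 1\<bar> \<partial>mass_measure R)" for k
      using mass_boundD[OF mass_measure_bound(1)[OF T] lip_bdd_mult[OF cutoff_lip_bdd[of "edge_arc n" k] lip_bdd_const[of 1]] h_lipschitz[of n]] by simp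
    then have "\<bar>real_of_int (c n) * len n\<bar> \<le> (\<integral>x. indicator (edge_arc n) x \<partial>mass_measure R)"
      using tendsto_le[OF _ lim2 lim1] by simp
    then show ?thesis using len_nonneg[of n] by (simp add: abs_mult M.sets_borel)
  qed
  note le = this
  have "summable (\<lambda>n. measure (mass_measure R) (edge_arc n))"
    by (rule sums_summable[OF M.finite_measure_UNION]) (use disjoint_arcs in \<open>auto simp: M.sets_borel\<close>)
  then have fw: "finite_weight (\<lambda>n. real_of_int (c n))"
    unfolding finite_weight_def by (rule summable_comparison_test'[where N=0]) (use le len_nonneg in \<open>simp add: abs_mult\<close>)
  have "R f \<pi> = chain (\<lambda>n. real_of_int (c n)) f \<pi>" for f \<pi>
  proof (cases "lip_bdd f \<and> lip \<pi>")
    case True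
    then have f: "lip_bdd f" and \<pi>: "lip \<pi>" by auto
    have "(\<lambda>n. real_of_int (c n) * lint 0 (len n) (f \<circ> \<gamma> n) (\<pi> \<circ> \<gamma> n)) sums R f \<pi>"
      using current_sum_arcs[OF T null f \<pi>] by (simp add: arc[OF f \<pi>])
    then show ?thesis using True by (simp add: chain_def chain_ext_def sums_iff)
  next
    case False
    then have "R f \<pi> = 0" by (rule current1_off[OF T])
    with False show ?thesis by (auto simp: chain_def)
  qed
  then have "R = chain (\<lambda>n. real_of_int (c n))" by blast
  with fw show thesis by (rule that)
qed

end

section \<open>The geometry of the diamond chain\<close>

lemma lam_pos: "0 < lam k"
  by (simp add: lam_def)

lemma lam_Suc: "lam (Suc k) = lam k / 2"
  by (simp add: lam_def)

lemma lam_le: "1 \<le> k \<Longrightarrow> lam k \<le> 1 / 8"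
  by (induction k rule: dec_induct) (auto simp: lam_Suc lam_def)

lemma edge_len_pos: "0 < edge_len e"
  by (cases e) (auto simp: lam_pos)

lemma edge_len_le: "e \<in> chain_edges \<Longrightarrow> edge_len e \<le> 1 / 4"
proof (cases e)
  case (Et k)
  then show ?thesis using lam_le[of k] by (cases "k = 0") auto
next
  case (Eu k)
  moreover assume "e \<in> chain_edges"
  ultimately show ?thesis using lam_le[of k] by auto
next
  case (Ev k)
  moreover assume "e \<in> chain_edges"
  ultimately show ?thesis using lam_le[of k] by auto
qed auto

text \<open>Layer \<open>k + j\<close> contributes \<open>2 lam (k + j)\<close>, a geometric series
  with ratio \<open>1 / 2\<close>. The sum is the length left along the forward chain from
  \<open>a_k\<close> to \<open>z\<close>.\<close>

lemma tail_length:
  assumes "1 \<le> k"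
  shows "(\<lambda>j. edge_len (Eu (k + j)) + edge_len (Et (k + j))) sums (4 * lam k)"
proof -
  have "(\<lambda>j. 2 * lam k * (1 / 2) ^ j) sums (2 * lam k * (1 / (1 - 1 / 2)))"
    by (intro sums_mult geometric_sums) simp
  moreover have "2 * lam k * (1 / 2) ^ j = edge_len (Eu (k + j)) + edge_len (Et (k + j))" for j
    using assms by (simp add: lam_def power_add power_divide)
  ultimately show ?thesis by simp
qed

text \<open>The limit condition on the vertex values \<open>\<eta>\<close> accounts for the rule \<open>tail\<close> of walks.\<close>

definition edge_compatible :: "(chain_edge \<Rightarrow> real \<Rightarrow> real) \<Rightarrow> (chain_vertex \<Rightarrow> real) \<Rightarrow> real \<Rightarrow> bool" where
  "edge_compatible H \<eta> L \<longleftrightarrow> 0 \<le> L \<and>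
     (\<forall>e\<in>chain_edges. H e 0 = \<eta> (edge_source e) \<and> H e (edge_len e) = \<eta> (edge_target e) \<and>
        (\<forall>s\<in>{0..edge_len e}. \<forall>s'\<in>{0..edge_len e}. \<bar>H e s - H e s'\<bar> \<le> L * \<bar>s - s'\<bar>)) \<and>
     (\<lambda>k. \<eta> (Va k)) \<longlonglongrightarrow> \<eta> Vz"

section \<open>Lipschitz functions on \<open>G\<close> assembled from functions on the edges\<close>

lemma edge_compatibleI:
  assumes "0 \<le> L"
    "\<And>e. e \<in> chain_edges \<Longrightarrow> H e 0 = \<eta> (edge_source e)" "\<And>e. e \<in> chain_edges \<Longrightarrow> H e (edge_len e) = \<eta> (edge_target e)"
    "\<And>e s s'. e \<in> chain_edges \<Longrightarrow> 0 \<le> s \<Longrightarrow> s \<le> edge_len e \<Longrightarrow> 0 \<le> s' \<Longrightarrow> s' \<le> edge_len e \<Longrightarrow> \<bar>H e s - H e s'\<bar> \<le> L * \<bar>s - s'\<bar>"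
    "(\<lambda>k. \<eta> (Va k)) \<longlonglongrightarrow> \<eta> Vz"
  shows "edge_compatible H \<eta> L"
  using assms by (simp add: edge_compatible_def)

lemma compatible_at_vertex:
  assumes "edge_compatible H \<eta> L" "at_vertex v x"
  shows "H (fst x) (snd x) = \<eta> v"
  using assms by (cases x) (auto simp: edge_compatible_def at_vertex_def edge_points_def)

text \<open>Along \<open>a_k, b_k, a_(k+1), ...\<close> the vertex values change by at most
  \<open>L\<close> times the length travelled, and the limit condition on \<open>\<eta>\<close>
  carries the estimate over to \<open>z\<close>.\<close>

lemma compatible_tail:
  assumes H: "edge_compatible H \<eta> L" and k: "1 \<le> k"
  shows "\<bar>\<eta> (Va k) - \<eta> Vz\<bar> \<le> L * (\<Sum>j. edge_len (Eu (k + j)) + edge_len (Et (k + j)))"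
proof -
  let ?d = "\<lambda>j. edge_len (Eu (k + j)) + edge_len (Et (k + j))"
  have edge: "\<bar>\<eta> (edge_source e) - \<eta> (edge_target e)\<bar> \<le> L * edge_len e" if "e \<in> chain_edges" for e
  proof -
    have v: "H e 0 = \<eta> (edge_source e)" "H e (edge_len e) = \<eta> (edge_target e)"
      and lp: "\<forall>s\<in>{0..edge_len e}. \<forall>s'\<in>{0..edge_len e}. \<bar>H e s - H e s'\<bar> \<le> L * \<bar>s - s'\<bar>"
      using H that by (simp_all add: edge_compatible_def)
    have "\<bar>H e 0 - H e (edge_len e)\<bar> \<le> L * \<bar>0 - edge_len e\<bar>"
      by (rule bspec[OF bspec[OF lp]]) (use edge_len_nonneg[of e] in auto)
    then show ?thesis using v edge_len_nonneg[of e] by simp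
  qed
  have fin: "\<bar>\<eta> (Va k) - \<eta> (Va (k + n))\<bar> \<le> L * (\<Sum>j<n. ?d j)" for n
  proof (induction n)
    case (Suc n)
    have "\<bar>\<eta> (Va (k + n)) - \<eta> (Vb (k + n))\<bar> \<le> L * edge_len (Eu (k + n))"
      using edge[of "Eu (k + n)"] k by simp
    moreover have "\<bar>\<eta> (Vb (k + n)) - \<eta> (Va (k + Suc n))\<bar> \<le> L * edge_len (Et (k + n))"
      using edge[of "Et (k + n)"] k by simp
    ultimately show ?case using Suc by (simp add: distrib_left)
  qed simp
  have "(\<lambda>n. \<bar>\<eta> (Va k) - \<eta> (Va (k + n))\<bar>) \<longlonglongrightarrow> \<bar>\<eta> (Va k) - \<eta> Vz\<bar>"
  proof -
    have "(\<lambda>n. \<eta> (Va (n + k))) \<longlonglongrightarrow> \<eta> Vz"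
      using H by (intro LIMSEQ_ignore_initial_segment) (simp add: edge_compatible_def)
    then show ?thesis by (intro tendsto_intros) (simp add: add.commute)
  qed
  moreover have "(\<lambda>n. L * (\<Sum>j<n. ?d j)) \<longlonglongrightarrow> L * (\<Sum>j. ?d j)"
    by (intro tendsto_intros summable_LIMSEQ summable_tail k)
  ultimately show ?thesis by (rule LIMSEQ_le) (use fin in auto)
qed

lemma compatible_walk:
  assumes H: "edge_compatible H \<eta> L" and w: "walk x y l"
  shows "\<bar>H (fst x) (snd x) - H (fst y) (snd y)\<bar> \<le> L * l"
  using w
proof (induction rule: walk.induct)
  case (along e s s')
  then show ?case using H by (auto simp: edge_compatible_def edge_points_def)
next
  case (glue v x y)
  then show ?case using compatible_at_vertex[OF H] by simp
next
  case (tail k x y)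
  then show ?case using compatible_at_vertex[OF H] compatible_tail[OF H, of k] by simp
next
  case (reverse x y l)
  then show ?case by (simp add: abs_minus_commute)
next
  case (join x y l w m)
  then show ?case by (simp add: distrib_left)
qed

text \<open>The estimate holds for every walk and passes to the infimum of the lengths. For
  \<open>L = 0\<close> one walk suffices, since division by \<open>L\<close> is impossible.\<close>

lemma compatible_path_dist:
  assumes H: "edge_compatible H \<eta> L" and x: "x \<in> edge_points" and y: "y \<in> edge_points"
  shows "\<bar>H (fst x) (snd x) - H (fst y) (snd y)\<bar> \<le> L * path_dist x y"
proof (cases "L = 0")
  case True
  then show ?thesis using walk_ex[OF x y] compatible_walk[OF H] by fastforce
next
  case False
  then have L: "L > 0" using H by (simp add: edge_compatible_def)
  have "\<bar>H (fst x) (snd x) - H (fst y) (snd y)\<bar> / L \<le> path_dist x y"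
    unfolding path_dist_def
  proof (rule cInf_greatest)
    show "{l. walk x y l} \<noteq> {}" using walk_ex[OF x y] by simp
    fix l assume "l \<in> {l. walk x y l}"
    then show "\<bar>H (fst x) (snd x) - H (fst y) (snd y)\<bar> / L \<le> l"
      using compatible_walk[OF H, of x y l] L by (simp add: divide_le_eq mult.commute)
  qed
  then show ?thesis using L by (simp add: divide_le_eq mult.commute)
qed

text \<open>The value at a chosen representative. For compatible \<open>H\<close> it does not depend
  on the choice, because representatives of one point have path distance \<open>0\<close>.\<close>

definition descend :: "(chain_edge \<Rightarrow> real \<Rightarrow> real) \<Rightarrow> diamond_chain \<Rightarrow> real" where
  "descend H x = H (fst (rep_diamond_chain x)) (snd (rep_diamond_chain x))"

lemma rep_edge_points: "rep_diamond_chain x \<in> edge_points"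
  using Quotient_rep_reflp[OF Quotient_diamond_chain, of x] by (simp add: same_point_def)

lemma rep_abs_same: "p \<in> edge_points \<Longrightarrow> same_point (rep_diamond_chain (abs_diamond_chain p)) p"
  by (rule rep_abs_rsp_left[OF Quotient3_diamond_chain]) (simp add: same_point_def path_dist_refl)

lemma dist_abs:
  assumes "p \<in> edge_points" "q \<in> edge_points"
  shows "dist (abs_diamond_chain p) (abs_diamond_chain q) = path_dist p q"
  using assms by (simp add: dist_diamond_chain.abs_eq same_point_def path_dist_refl)

lemma abs_eq_iff_dist:
  assumes "p \<in> edge_points" "q \<in> edge_points"
  shows "abs_diamond_chain p = abs_diamond_chain q \<longleftrightarrow> path_dist p q = 0"
  using dist_abs[OF assms] by (metis dist_eq_0_iff)

lemma descend_abs: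
  assumes H: "edge_compatible H \<eta> L" and p: "p \<in> edge_points"
  shows "descend H (abs_diamond_chain p) = H (fst p) (snd p)"
proof -
  let ?r = "rep_diamond_chain (abs_diamond_chain p)"
  have "path_dist ?r p = 0" using rep_abs_same[OF p] by (simp add: same_point_def)
  then have "\<bar>H (fst ?r) (snd ?r) - H (fst p) (snd p)\<bar> \<le> L * 0"
    using compatible_path_dist[OF H rep_edge_points p] by metis
  then show ?thesis by (simp add: descend_def)
qed

lemma descend_lipschitz:
  assumes H: "edge_compatible H \<eta> L"
  shows "L-lipschitz_on UNIV (descend H)"
proof (rule lipschitz_onI)
  fix x y
  have "dist x y = path_dist (rep_diamond_chain x) (rep_diamond_chain y)"
    by (simp add: dist_diamond_chain.rep_eq)
  then show "dist (descend H x) (descend H y) \<le> L * dist x y"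
    using compatible_path_dist[OF H rep_edge_points rep_edge_points, of x y] by (simp add: descend_def dist_real_def)
qed (use H in \<open>simp add: edge_compatible_def\<close>)

lemma edge_param_abs:
  "0 \<le> s \<Longrightarrow> s \<le> edge_len e \<Longrightarrow> edge_param e s = abs_diamond_chain (e, s)"
  by (simp add: edge_param_def)

lemma edge_points_iff: "(e, s) \<in> edge_points \<longleftrightarrow> e \<in> chain_edges \<and> 0 \<le> s \<and> s \<le> edge_len e"
  by (simp add: edge_points_def)

lemma descend_edge_param:
  assumes "edge_compatible H \<eta> L" "e \<in> chain_edges" "0 \<le> s" "s \<le> edge_len e"
  shows "descend H (edge_param e s) = H e s"
  using descend_abs[OF assms(1), of "(e, s)"] assms by (simp add: edge_param_abs edge_points_iff)

lemma edge_param_lipschitz: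
  assumes e: "e \<in> chain_edges"
  shows "1-lipschitz_on UNIV (edge_param e)"
proof (rule lipschitz_onI)
  fix s t :: real
  let ?c = "\<lambda>s. max 0 (min (edge_len e) s)"
  have c: "(e, ?c s) \<in> edge_points" for s using e edge_len_nonneg[of e] by (simp add: edge_points_iff)
  have "dist (edge_param e s) (edge_param e t) = path_dist (e, ?c s) (e, ?c t)"
    unfolding edge_param_def by (rule dist_abs[OF c c])
  also have "\<dots> \<le> \<bar>?c s - ?c t\<bar>" by (rule path_dist_le[OF walk.along[OF c c]])
  also have "\<dots> \<le> \<bar>s - t\<bar>" by (auto simp: max_def min_def)
  finally show "dist (edge_param e s) (edge_param e t) \<le> 1 * dist s t" by (simp add: dist_real_def)
qed simp

lemma edge_param_cover: "\<exists>e\<in>chain_edges. \<exists>s. 0 \<le> s \<and> s \<le> edge_len e \<and> x = edge_param e s"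
proof -
  obtain e s where es: "rep_diamond_chain x = (e, s)" by (cases "rep_diamond_chain x")
  then have "(e, s) \<in> edge_points" using rep_edge_points[of x] by simp
  moreover have "abs_diamond_chain (e, s) = x"
    using Quotient3_abs_rep[OF Quotient3_diamond_chain, of x] es by simp
  ultimately show ?thesis by (intro bexI[of _ e] exI[of _ s]) (auto simp: edge_param_abs edge_points_iff)
qed

lemma edge_param_clamped: "edge_param e s = edge_param e (max 0 (min (edge_len e) s))"
  using edge_len_nonneg[of e] by (simp add: edge_param_def)

lemma same_vertex_edge_param:
  assumes "at_vertex v (e, s)" "at_vertex v (e', s')"
  shows "edge_param e s = edge_param e' s'"
proof -
  have p: "(e, s) \<in> edge_points" "(e', s') \<in> edge_points" using assms by (auto simp: at_vertex_def)
  have "path_dist (e, s) (e', s') \<le> 0" by (rule path_dist_le[OF walk.glue[OF assms]])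
  then have "path_dist (e, s) (e', s') = 0" using path_dist_nonneg[OF p] by simp
  then show ?thesis using p abs_eq_iff_dist[OF p] by (simp add: edge_param_abs edge_points_iff)
qed

text \<open>Position along the circle of length \<open>1\<close> obtained by folding each pair \<open>u\<^sub>k, v\<^sub>k\<close>; it starts at \<open>o\<close>.\<close>

fun vertex_pos :: "chain_vertex \<Rightarrow> real" where
  "vertex_pos Vo = 0"
| "vertex_pos (Va k) = 3 / 4 - 4 * lam k"
| "vertex_pos (Vb k) = 3 / 4 - 3 * lam k"
| "vertex_pos Vz = 3 / 4"

lemma lam_tendsto: "lam \<longlonglongrightarrow> 0"
proof -
  have "(\<lambda>k. 1 / 4 * (1 / 2) ^ k) \<longlonglongrightarrow> (1 / 4 * 0 :: real)"
    by (intro tendsto_intros LIMSEQ_realpow_zero) auto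
  moreover have "1 / 4 * (1 / 2) ^ k = lam k" for k by (simp add: lam_def power_add power_divide)
  ultimately show ?thesis by simp
qed

text \<open>The edge \<open>c\<close> is an exception: along it the position runs from
  \<open>3 / 4\<close> to \<open>1\<close>, whereas its target \<open>o\<close> has position
  \<open>0\<close>. This is the origin of the condition \<open>g 0 = g 1\<close> on functions of the
  position.\<close>

lemma vertex_pos_edge:
  assumes "e \<in> chain_edges" "e \<noteq> Ec"
  shows "vertex_pos (edge_target e) = vertex_pos (edge_source e) + edge_len e"
  using assms by (cases e) (auto simp: lam_Suc, auto simp: lam_def)

text \<open>A function of the position that takes equal values at \<open>0\<close> and \<open>1\<close> is a function on \<open>G\<close>.\<close>

definition circle_fun :: "(real \<Rightarrow> real) \<Rightarrow> diamond_chain \<Rightarrow> real" where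
  "circle_fun g = descend (\<lambda>e s. g (vertex_pos (edge_source e) + s))"

lemma circle_compatible:
  assumes g: "L-lipschitz_on UNIV g" and per: "g 0 = g 1"
  shows "edge_compatible (\<lambda>e s. g (vertex_pos (edge_source e) + s)) (\<lambda>v. g (vertex_pos v)) L"
proof (rule edge_compatibleI)
  show "0 \<le> L" using g by (rule lipschitz_on_nonneg)
  fix e assume e: "e \<in> chain_edges"
  show "g (vertex_pos (edge_source e) + edge_len e) = g (vertex_pos (edge_target e))"
    using vertex_pos_edge[OF e] per by (cases "e = Ec") auto
  show "\<bar>g (vertex_pos (edge_source e) + s) - g (vertex_pos (edge_source e) + s')\<bar> \<le> L * \<bar>s - s'\<bar>" for s s'
    using lipschitz_real_bound[OF g, of "vertex_pos (edge_source e) + s" "vertex_pos (edge_source e) + s'"] by simp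
next
  have cont: "isCont g (3 / 4)" using lipschitz_on_continuous_on[OF g] by (simp add: continuous_on_eq_continuous_at)
  have "(\<lambda>k. 3 / 4 - 4 * lam k) \<longlonglongrightarrow> 3 / 4 - 4 * 0" by (intro tendsto_intros lam_tendsto)
  then have "(\<lambda>k. 3 / 4 - 4 * lam k) \<longlonglongrightarrow> 3 / 4" by simp
  from isCont_tendsto_compose[OF cont this]
  show "(\<lambda>k. g (vertex_pos (Va k))) \<longlonglongrightarrow> g (vertex_pos Vz)" by simp
qed simp

lemma circle_fun_lipschitz:
  "L-lipschitz_on UNIV g \<Longrightarrow> g 0 = g 1 \<Longrightarrow> L-lipschitz_on UNIV (circle_fun g)"
  unfolding circle_fun_def by (rule descend_lipschitz[OF circle_compatible])

lemma circle_fun_edge_param: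
  assumes "L-lipschitz_on UNIV g" "g 0 = g 1" "e \<in> chain_edges" "0 \<le> s" "s \<le> edge_len e"
  shows "circle_fun g (edge_param e s) = g (vertex_pos (edge_source e) + s)"
  unfolding circle_fun_def by (rule descend_edge_param[OF circle_compatible]) (use assms in auto)

lemma edge_position:
  assumes e: "e \<in> chain_edges"
  shows "0 \<le> vertex_pos (edge_source e)" "vertex_pos (edge_source e) + edge_len e \<le> 1"
proof -
  have "0 \<le> vertex_pos (edge_source e) \<and> vertex_pos (edge_source e) + edge_len e \<le> 1"
  proof (cases e)
    case (Et k)
    then show ?thesis using lam_le[of k] lam_pos[of k] by (cases "k = 0") auto
  next
    case (Eu k)
    then show ?thesis using e lam_le[of k] lam_pos[of k] by simp
  next
    case (Ev k)
    then show ?thesis using e lam_le[of k] lam_pos[of k] by simp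
  qed simp
  then show "0 \<le> vertex_pos (edge_source e)" "vertex_pos (edge_source e) + edge_len e \<le> 1" by auto
qed

text \<open>Distance on the circle from the source of \<open>e\<close>; a coordinate on \<open>e\<close> because \<open>e\<close> is short.\<close>

definition edge_coord :: "chain_edge \<Rightarrow> diamond_chain \<Rightarrow> real" where
  "edge_coord e = circle_fun (\<lambda>t. min \<bar>t - vertex_pos (edge_source e)\<bar> (1 - \<bar>t - vertex_pos (edge_source e)\<bar>))"

lemma edge_coord_aux:
  fixes p :: real
  shows "1-lipschitz_on UNIV (\<lambda>t. min \<bar>t - p\<bar> (1 - \<bar>t - p\<bar>))"
    and "0 \<le> p \<Longrightarrow> p \<le> 1 \<Longrightarrow> min \<bar>0 - p\<bar> (1 - \<bar>0 - p\<bar>) = min \<bar>1 - p\<bar> (1 - \<bar>1 - p\<bar>)"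
proof -
  show "1-lipschitz_on UNIV (\<lambda>t. min \<bar>t - p\<bar> (1 - \<bar>t - p\<bar>))"
  proof (rule lipschitz_onI)
    fix x y :: real
    have "\<bar>min a (1 - a) - min b (1 - b)\<bar> \<le> \<bar>a - b\<bar>" for a b :: real by (simp add: min_def abs_if)
    from this[of "\<bar>x - p\<bar>" "\<bar>y - p\<bar>"]
    show "dist (min \<bar>x - p\<bar> (1 - \<bar>x - p\<bar>)) (min \<bar>y - p\<bar> (1 - \<bar>y - p\<bar>)) \<le> 1 * dist x y"
      using abs_triangle_ineq3[of "x - p" "y - p"] by (simp add: dist_real_def)
  qed simp
qed (auto simp: abs_if min_def)

lemma edge_coord_lipschitz:
  assumes "e \<in> chain_edges"
  shows "1-lipschitz_on UNIV (edge_coord e)"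
  unfolding edge_coord_def using edge_position[OF assms] edge_len_nonneg[of e]
  by (intro circle_fun_lipschitz edge_coord_aux) auto

lemma edge_coord_edge_param:
  assumes e: "e \<in> chain_edges" and s: "0 \<le> s" "s \<le> edge_len e"
  shows "edge_coord e (edge_param e s) = s"
proof -
  have "edge_coord e (edge_param e s) = min \<bar>vertex_pos (edge_source e) + s - vertex_pos (edge_source e)\<bar> (1 - \<bar>vertex_pos (edge_source e) + s - vertex_pos (edge_source e)\<bar>)"
    unfolding edge_coord_def using edge_position[OF e] edge_len_nonneg[of e] e s
    by (intro circle_fun_edge_param[where L=1] edge_coord_aux) auto
  \<comment> \<open>An edge has length at most \<open>1 / 4\<close>, so the short way round the
    circle from its source is along the edge.\<close>
  then show ?thesis using s edge_len_le[OF e] by simp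
qed

section \<open>Functions supported in one edge\<close>

definition edge_tent :: "chain_edge \<Rightarrow> (real \<Rightarrow> real) \<Rightarrow> diamond_chain \<Rightarrow> real" where
  "edge_tent e \<tau> = descend (\<lambda>e' s. if e' = e then \<tau> s else 0)"

lemma edge_tent_compatible:
  assumes \<tau>: "L-lipschitz_on UNIV \<tau>" "\<tau> 0 = 0" "\<tau> (edge_len e) = 0"
  shows "edge_compatible (\<lambda>e' s. if e' = e then \<tau> s else 0) (\<lambda>_. 0) L"
  using \<tau> lipschitz_real_bound[OF \<tau>(1)] lipschitz_on_nonneg[OF \<tau>(1)] by (intro edge_compatibleI) auto

lemma edge_tent_edge_param:
  assumes "L-lipschitz_on UNIV \<tau>" "\<tau> 0 = 0" "\<tau> (edge_len e) = 0" "e' \<in> chain_edges" "0 \<le> s" "s \<le> edge_len e'"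
  shows "edge_tent e \<tau> (edge_param e' s) = (if e' = e then \<tau> s else 0)"
  unfolding edge_tent_def by (rule descend_edge_param[OF edge_tent_compatible]) (use assms in auto)

lemma edge_tent_lipschitz:
  "L-lipschitz_on UNIV \<tau> \<Longrightarrow> \<tau> 0 = 0 \<Longrightarrow> \<tau> (edge_len e) = 0 \<Longrightarrow> L-lipschitz_on UNIV (edge_tent e \<tau>)"
  unfolding edge_tent_def by (rule descend_lipschitz[OF edge_tent_compatible])

lemma bump_lipschitz: "1-lipschitz_on UNIV (\<lambda>s::real. max 0 (min s (l - s)))"
  by (rule lipschitz_onI) (auto simp: dist_real_def)

text \<open>Describing the open edge as the set where a Lipschitz function is positive shows both
  that it is open in the path metric and that it misses all other edges.\<close>

lemma open_edge_eq:
  assumes e: "e \<in> chain_edges"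
  shows "edge_param e ` {0<..<edge_len e} = {x. edge_tent e (\<lambda>s. max 0 (min s (edge_len e - s))) x > 0}"
proof -
  have b: "edge_tent e (\<lambda>s. max 0 (min s (edge_len e - s))) (edge_param e' s) = (if e' = e then max 0 (min s (edge_len e - s)) else 0)"
    if "e' \<in> chain_edges" "0 \<le> s" "s \<le> edge_len e'" for e' s
    using that edge_len_nonneg[of e] by (intro edge_tent_edge_param[OF bump_lipschitz]) auto
  show ?thesis
  proof (intro set_eqI iffI)
    fix x assume "x \<in> edge_param e ` {0<..<edge_len e}"
    then show "x \<in> {x. edge_tent e (\<lambda>s. max 0 (min s (edge_len e - s))) x > 0}"
      using b[OF e] by auto
  next
    fix x assume x: "x \<in> {x. edge_tent e (\<lambda>s. max 0 (min s (edge_len e - s))) x > 0}"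
    obtain e' s where es: "e' \<in> chain_edges" "0 \<le> s" "s \<le> edge_len e'" "x = edge_param e' s"
      using edge_param_cover by blast
    then have "(if e' = e then max 0 (min s (edge_len e - s)) else 0) > 0" using x b[OF es(1-3)] by simp
    then have "e' = e" "0 < s" "s < edge_len e" by (auto split: if_splits)
    then show "x \<in> edge_param e ` {0<..<edge_len e}" using es by auto
  qed
qed

lemma open_open_edge:
  assumes e: "e \<in> chain_edges"
  shows "open (edge_param e ` {0<..<edge_len e})"
proof -
  have "continuous_on UNIV (edge_tent e (\<lambda>s. max 0 (min s (edge_len e - s))))"
    using edge_len_nonneg[of e] by (intro lipschitz_on_continuous_on[OF edge_tent_lipschitz[OF bump_lipschitz]]) auto
  then show ?thesis unfolding open_edge_eq[OF e] by (intro open_Collect_less) auto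
qed

lemma open_edge_disjoint:
  assumes e: "e \<in> chain_edges" "e' \<in> chain_edges" "e' \<noteq> e" and s: "0 \<le> s" "s \<le> edge_len e'"
  shows "edge_param e' s \<notin> edge_param e ` {0<..<edge_len e}"
proof -
  have "edge_tent e (\<lambda>s. max 0 (min s (edge_len e - s))) (edge_param e' s) = 0"
    using e s edge_len_nonneg[of e] by (subst edge_tent_edge_param[OF bump_lipschitz]) auto
  then show ?thesis unfolding open_edge_eq[OF e(1)] by simp
qed

lemma edge_tent_eq:
  assumes e: "e \<in> chain_edges" and \<tau>: "L-lipschitz_on UNIV \<tau>" and z: "\<And>s. s \<le> 0 \<or> edge_len e \<le> s \<Longrightarrow> \<tau> s = 0"
  shows "edge_tent e \<tau> = (\<lambda>x. if x \<in> edge_param e ` {0<..<edge_len e} then \<tau> (edge_coord e x) else 0)"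
proof
  fix x
  obtain e' s where es: "e' \<in> chain_edges" "0 \<le> s" "s \<le> edge_len e'" "x = edge_param e' s"
    using edge_param_cover by blast
  have t: "edge_tent e \<tau> x = (if e' = e then \<tau> s else 0)"
    unfolding es(4) using z[of 0] z[of "edge_len e"] es by (intro edge_tent_edge_param[OF \<tau>]) auto
  show "edge_tent e \<tau> x = (if x \<in> edge_param e ` {0<..<edge_len e} then \<tau> (edge_coord e x) else 0)"
  proof (cases "e' = e")
    case False
    then show ?thesis using t open_edge_disjoint[OF e es(1) False es(2,3)] es(4) by simp
  next
    case True
    have co: "edge_coord e x = s" using es True edge_coord_edge_param[OF e] by simp
    show ?thesis
    proof (cases "x \<in> edge_param e ` {0<..<edge_len e}")
      case True
      then show ?thesis using t co \<open>e' = e\<close> by simp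
    next
      case False
      then have "s \<le> 0 \<or> edge_len e \<le> s" using es \<open>e' = e\<close> by force
      then show ?thesis using False t z[of s] \<open>e' = e\<close> by simp
    qed
  qed
qed

section \<open>Uniqueness of sums in mass\<close>

text \<open>Mass bounds of two currents add up to one of their difference; thus differences, and the
  remainders of series, are again currents.\<close>

definition sum_measure :: "'a measure \<Rightarrow> 'a measure \<Rightarrow> 'a measure" where
  "sum_measure M N = measure_of (space M) (sets M) (\<lambda>A. emeasure M A + emeasure N A)"

lemma sets_sum_measure [simp]: "sets (sum_measure M N) = sets M"
  by (simp add: sum_measure_def)

lemma space_sum_measure [simp]: "space (sum_measure M N) = space M"
  by (simp add: sum_measure_def)

lemma emeasure_sum_measure:
  assumes "sets N = sets M" "A \<in> sets M"
  shows "emeasure (sum_measure M N) A = emeasure M A + emeasure N A"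
proof (rule emeasure_measure_of[OF sum_measure_def])
  show "countably_additive (sets (sum_measure M N)) (\<lambda>A. emeasure M A + emeasure N A)"
  proof (rule countably_additiveI)
    fix A :: "nat \<Rightarrow> 'a set"
    assume A: "range A \<subseteq> sets (sum_measure M N)" "disjoint_family A"
    then have "(\<Sum>i. emeasure M (A i)) = emeasure M (\<Union>i. A i)" "(\<Sum>i. emeasure N (A i)) = emeasure N (\<Union>i. A i)"
      using assms(1) by (auto intro!: suminf_emeasure)
    then show "(\<Sum>i. emeasure M (A i) + emeasure N (A i)) = emeasure M (\<Union>i. A i) + emeasure N (\<Union>i. A i)"
      by (simp add: suminf_add[symmetric])
  qed
qed (use assms sets.space_closed in \<open>auto simp: positive_def\<close>)

lemma nn_integral_sum_measure:
  assumes N: "sets N = sets M" and f: "f \<in> borel_measurable M"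
  shows "(\<integral>\<^sup>+x. f x \<partial>sum_measure M N) = (\<integral>\<^sup>+x. f x \<partial>M) + (\<integral>\<^sup>+x. f x \<partial>N)"
  using f
proof (induction rule: borel_measurable_induct)
    case (cong f g)
    moreover have "space N = space M" using N by (rule sets_eq_imp_space_eq)
    ultimately have "integral\<^sup>N K f = integral\<^sup>N K g" if "K \<in> {M, N, sum_measure M N}" for K
      using that by (intro nn_integral_cong) auto
    then show ?case using cong by simp
  next
    case (set A)
    then show ?case using N by (simp add: emeasure_sum_measure)
  next
    case (mult u c)
    then have "u \<in> borel_measurable N" "u \<in> borel_measurable (sum_measure M N)"
      using N by (simp_all cong: measurable_cong_sets)
    with mult show ?case by (simp add: nn_integral_cmult distrib_left)
  next
    case (add u v)
    then have "u \<in> borel_measurable N" "u \<in> borel_measurable (sum_measure M N)"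
      "v \<in> borel_measurable N" "v \<in> borel_measurable (sum_measure M N)"
      using N by (simp_all cong: measurable_cong_sets)
    with add show ?case by (simp add: nn_integral_add add_ac)
  next
    case (seq U)
    have m: "U i \<in> borel_measurable N" "U i \<in> borel_measurable (sum_measure M N)" for i
      using N seq by (simp_all cong: measurable_cong_sets)
    have inc: "incseq (\<lambda>i. integral\<^sup>N K (U i))" for K
      using seq(3) by (auto simp: incseq_def le_fun_def intro!: nn_integral_mono)
    have "(\<integral>\<^sup>+x. (SUP i. U i) x \<partial>sum_measure M N) = (SUP i. integral\<^sup>N (sum_measure M N) (U i))"
      unfolding SUP_apply by (intro nn_integral_monotone_convergence_SUP seq m)
    also have "\<dots> = (SUP i. integral\<^sup>N M (U i) + integral\<^sup>N N (U i))" using seq by simp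
    also have "\<dots> = (SUP i. integral\<^sup>N M (U i)) + (SUP i. integral\<^sup>N N (U i))"
      by (intro ennreal_SUP_add inc)
    also have "(SUP i. integral\<^sup>N M (U i)) = (\<integral>\<^sup>+x. (SUP i. U i) x \<partial>M)"
      unfolding SUP_apply by (intro nn_integral_monotone_convergence_SUP[symmetric] seq)
    also have "(SUP i. integral\<^sup>N N (U i)) = (\<integral>\<^sup>+x. (SUP i. U i) x \<partial>N)"
      unfolding SUP_apply by (intro nn_integral_monotone_convergence_SUP[symmetric] seq m)
    finally show ?case .
qed

lemma mass_bound_diff:
  assumes \<mu>: "mass_bound S \<mu>" and \<nu>: "mass_bound T \<nu>"
  shows "mass_bound (\<lambda>f \<pi>. S f \<pi> - T f \<pi>) (sum_measure \<mu> \<nu>)"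
proof -
  interpret \<mu>: finite_borel \<mu> using \<mu> by (rule mass_bound_finite_borel)
  interpret \<nu>: finite_borel \<nu> using \<nu> by (rule mass_bound_finite_borel)
  have N: "sets \<nu> = sets \<mu>" by (simp add: \<mu>.sets_borel \<nu>.sets_borel)
  have "emeasure (sum_measure \<mu> \<nu>) UNIV = emeasure \<mu> UNIV + emeasure \<nu> UNIV"
    by (rule emeasure_sum_measure[OF N]) (simp add: \<mu>.sets_borel)
  then have fin: "finite_measure (sum_measure \<mu> \<nu>)"
    by (intro finite_measureI) (use \<mu>.emeasure_finite[of UNIV] \<nu>.emeasure_finite[of UNIV] in simp)
  interpret \<sigma>: finite_borel "sum_measure \<mu> \<nu>"
    using fin by (intro finite_borel.intro finite_borel_axioms.intro) (simp_all add: \<mu>.sets_borel)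
  show ?thesis
    unfolding mass_bound_def
  proof (intro conjI allI impI)
    fix f \<pi> :: "'a \<Rightarrow> real" and L assume f: "lip_bdd f" and L: "L-lipschitz_on UNIV \<pi>"
    obtain C where C: "\<And>x. \<bar>f x\<bar> \<le> C" using f by (rule lip_bddE) blast
    have fm: "f \<in> borel_measurable borel" using f by (rule lip_bdd_measurable)
    have "ennreal (\<integral>x. \<bar>f x\<bar> \<partial>sum_measure \<mu> \<nu>) = (\<integral>\<^sup>+x. ennreal \<bar>f x\<bar> \<partial>\<mu>) + (\<integral>\<^sup>+x. ennreal \<bar>f x\<bar> \<partial>\<nu>)"
      unfolding \<sigma>.nn_integral_abs_eq[OF fm C, symmetric]
      using fm by (intro nn_integral_sum_measure[OF N]) (simp add: \<mu>.measurable_borel)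
    also have "\<dots> = ennreal ((\<integral>x. \<bar>f x\<bar> \<partial>\<mu>) + (\<integral>x. \<bar>f x\<bar> \<partial>\<nu>))"
      unfolding \<mu>.nn_integral_abs_eq[OF fm C] \<nu>.nn_integral_abs_eq[OF fm C]
      by (intro ennreal_plus[symmetric] Bochner_Integration.integral_nonneg) auto
    finally have "(\<integral>x. \<bar>f x\<bar> \<partial>sum_measure \<mu> \<nu>) = (\<integral>x. \<bar>f x\<bar> \<partial>\<mu>) + (\<integral>x. \<bar>f x\<bar> \<partial>\<nu>)"
      by (subst (asm) ennreal_inj) (auto intro!: add_nonneg_nonneg Bochner_Integration.integral_nonneg)
    then show "\<bar>S f \<pi> - T f \<pi>\<bar> \<le> L * (\<integral>x. \<bar>f x\<bar> \<partial>sum_measure \<mu> \<nu>)"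
      using mass_boundD[OF \<mu> f L] mass_boundD[OF \<nu> f L] by (simp add: distrib_left)
  qed (simp_all add: fin \<mu>.sets_borel)
qed

lemma current1_tendsto:
  assumes "current1 T" "lip_bdd f" "\<And>i::nat. L-lipschitz_on UNIV (\<rho> i)" "lip \<pi>" "\<And>x. (\<lambda>i. \<rho> i x) \<longlonglongrightarrow> \<pi> x"
  shows "(\<lambda>i. T f (\<rho> i)) \<longlonglongrightarrow> T f \<pi>"
  using assms(1)[unfolded current1_def, THEN conjunct2, THEN conjunct2, THEN conjunct2, THEN conjunct1] assms(2-)
  by blast

lemma current1_diff_currents:
  assumes S: "current1 S" and T: "current1 T"
  shows "current1 (\<lambda>f \<pi>. S f \<pi> - T f \<pi>)"
  unfolding current1_def
proof (intro conjI allI impI)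
  fix f \<pi> :: "'a \<Rightarrow> real" assume "\<not> (lip_bdd f \<and> lip \<pi>)"
  then show "S f \<pi> - T f \<pi> = 0" using current1_off[OF S] current1_off[OF T] by simp
next
  fix f g \<pi> :: "'a \<Rightarrow> real" and a b assume "lip_bdd f" "lip_bdd g" "lip \<pi>"
  then show "S (\<lambda>x. a * f x + b * g x) \<pi> - T (\<lambda>x. a * f x + b * g x) \<pi> = a * (S f \<pi> - T f \<pi>) + b * (S g \<pi> - T g \<pi>)"
    by (simp add: current1_lincomb[OF S] current1_lincomb[OF T] algebra_simps)
next
  fix f \<pi> \<rho> :: "'a \<Rightarrow> real" and a b assume "lip_bdd f" "lip \<pi>" "lip \<rho>"
  then show "S f (\<lambda>x. a * \<pi> x + b * \<rho> x) - T f (\<lambda>x. a * \<pi> x + b * \<rho> x) = a * (S f \<pi> - T f \<pi>) + b * (S f \<rho> - T f \<rho>)"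
    by (simp add: current1_lincomb_right[OF S] current1_lincomb_right[OF T] algebra_simps)
next
  fix f \<pi> :: "'a \<Rightarrow> real" and \<rho> :: "nat \<Rightarrow> 'a \<Rightarrow> real" and L
  assume a: "lip_bdd f" "\<forall>i. L-lipschitz_on UNIV (\<rho> i)" "lip \<pi>" "\<forall>x. (\<lambda>i. \<rho> i x) \<longlonglongrightarrow> \<pi> x"
  show "(\<lambda>i. S f (\<rho> i) - T f (\<rho> i)) \<longlonglongrightarrow> S f \<pi> - T f \<pi>"
    using a by (intro tendsto_diff current1_tendsto[OF S, where L=L] current1_tendsto[OF T, where L=L]) auto
next
  fix f \<pi> :: "'a \<Rightarrow> real" and U c
  assume a: "lip_bdd f" "lip \<pi>" "open U" "{x. f x \<noteq> 0} \<subseteq> U" "\<forall>x\<in>U. \<pi> x = c"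
  show "S f \<pi> - T f \<pi> = 0" using current1_local[OF S a] current1_local[OF T a] by simp
next
  show "\<exists>\<mu>. mass_bound (\<lambda>f \<pi>. S f \<pi> - T f \<pi>) \<mu>"
    using mass_bound_diff[OF mass_measure_bound(1)[OF S] mass_measure_bound(1)[OF T]] by blast
qed

lemma current1_diff_sum:
  fixes X :: "nat \<Rightarrow> 'a::metric_space functional1"
  assumes S: "current1 S" and X: "\<And>k. 1 \<le> k \<Longrightarrow> current1 (X k)"
  shows "current1 (\<lambda>f \<pi>. S f \<pi> - (\<Sum>k=1..n. X k f \<pi>))"
proof (induction n)
  case (Suc n)
  have "current1 (\<lambda>f \<pi>. (S f \<pi> - (\<Sum>k=1..n. X k f \<pi>)) - X (Suc n) f \<pi>)"
    by (intro current1_diff_currents Suc X) simp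
  then show ?case by (simp add: algebra_simps)
qed (simp add: S)

lemma mass_estimate:
  assumes T: "current1 T" and f: "lip_bdd f" "\<And>x. \<bar>f x\<bar> \<le> C" and L: "L-lipschitz_on UNIV \<pi>"
  shows "ennreal \<bar>T f \<pi>\<bar> \<le> ennreal (L * C) * mass T"
proof -
  let ?M = "mass_measure T"
  interpret M: finite_borel ?M using T by (rule mass_measure_finite_borel)
  have L0: "0 \<le> L" using L by (rule lipschitz_on_nonneg)
  have C0: "0 \<le> C" using f(2)[of undefined] by simp
  have "(\<integral>x. \<bar>f x\<bar> \<partial>?M) \<le> (\<integral>x. C \<partial>?M)"
    using f by (intro integral_mono M.integrable_lip_bdd integrable_abs) auto
  then have "L * (\<integral>x. \<bar>f x\<bar> \<partial>?M) \<le> L * (measure ?M UNIV * C)"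
    using L0 by (intro mult_left_mono) simp_all
  then have "\<bar>T f \<pi>\<bar> \<le> (L * C) * measure ?M UNIV"
    using mass_boundD[OF mass_measure_bound(1)[OF T] f(1) L] by (simp add: mult_ac)
  then have "ennreal \<bar>T f \<pi>\<bar> \<le> ennreal ((L * C) * measure ?M UNIV)" by (rule ennreal_leI)
  also have "\<dots> = ennreal (L * C) * emeasure ?M UNIV"
    using L0 C0 by (simp add: ennreal_mult M.emeasure_eq_measure)
  also have "emeasure ?M UNIV = mass T"
    using mass_measure_bound(1)[OF T] by (auto simp: mass_def)
  finally show ?thesis .
qed

text \<open>By \<open>mass_estimate\<close> convergence in mass implies convergence of every value,
  and limits of values are unique.\<close>

lemma sums_in_mass_unique:
  assumes S: "sums_in_mass X S" and T: "sums_in_mass X T" and X: "\<And>k. 1 \<le> k \<Longrightarrow> current1 (X k)"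
  shows "S = T"
proof (intro ext)
  fix f \<pi>
  have cS: "current1 S" and cT: "current1 T" using S T by (auto simp: sums_in_mass_def)
  show "S f \<pi> = T f \<pi>"
  proof (cases "lip_bdd f \<and> lip \<pi>")
    case False
    then show ?thesis using current1_off[OF cS False] current1_off[OF cT False] by simp
  next
    case True
    obtain C where C: "\<And>x. \<bar>f x\<bar> \<le> C" using conjunct1[OF True] by (rule lip_bddE) blast
    obtain L where L: "L-lipschitz_on UNIV \<pi>" using conjunct2[OF True] by (rule lipE)
    let ?K = "ennreal (L * C)"
    define DS where "DS n = (\<lambda>f \<pi>. S f \<pi> - (\<Sum>k=1..n. X k f \<pi>))" for n
    define DT where "DT n = (\<lambda>f \<pi>. T f \<pi> - (\<Sum>k=1..n. X k f \<pi>))" for n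
    have mS: "(\<lambda>n. mass (DS n)) \<longlonglongrightarrow> 0" and mT: "(\<lambda>n. mass (DT n)) \<longlonglongrightarrow> 0"
      using S T by (auto simp: sums_in_mass_def DS_def DT_def)
    have "(\<lambda>n. ?K * mass (DS n) + ?K * mass (DT n)) \<longlonglongrightarrow> ?K * 0 + ?K * 0"
      by (intro tendsto_add ennreal_tendsto_cmult mS mT) auto
    then have lim: "(\<lambda>n. ?K * mass (DS n) + ?K * mass (DT n)) \<longlonglongrightarrow> 0" by simp
    have "ennreal \<bar>S f \<pi> - T f \<pi>\<bar> \<le> ?K * mass (DS n) + ?K * mass (DT n)" for n
    proof -
      have "\<bar>S f \<pi> - T f \<pi>\<bar> \<le> \<bar>DS n f \<pi>\<bar> + \<bar>DT n f \<pi>\<bar>" by (simp add: DS_def DT_def)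
      then have "ennreal \<bar>S f \<pi> - T f \<pi>\<bar> \<le> ennreal \<bar>DS n f \<pi>\<bar> + ennreal \<bar>DT n f \<pi>\<bar>"
        by (simp add: ennreal_plus[symmetric] ennreal_leI del: ennreal_plus)
      also have "\<dots> \<le> ?K * mass (DS n) + ?K * mass (DT n)"
        unfolding DS_def DT_def using True
        by (intro add_mono mass_estimate current1_diff_sum cS cT X C L) auto
      finally show ?thesis .
    qed
    then have "ennreal \<bar>S f \<pi> - T f \<pi>\<bar> \<le> 0"
      by (intro LIMSEQ_le_const[OF lim]) auto
    then show ?thesis by simp
  qed
qed

section \<open>Weights on the edges of the diamond chain\<close>

lemma nonneg_summable_on_mono:
  fixes f g :: "'a \<Rightarrow> real"
  assumes g: "g summable_on A" and fg: "\<And>x. x \<in> A \<Longrightarrow> 0 \<le> f x" "\<And>x. x \<in> A \<Longrightarrow> f x \<le> g x"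
  shows "f summable_on A"
proof (rule nonneg_bdd_above_summable_on)
  show "bdd_above (sum f ` {F. F \<subseteq> A \<and> finite F})"
  proof (rule bdd_aboveI2)
    fix F assume F: "F \<in> {F. F \<subseteq> A \<and> finite F}"
    have "sum f F \<le> sum g F" using F fg by (intro sum_mono) auto
    also have "\<dots> \<le> infsum g A" using F g fg by (intro finite_sum_le_infsum) (auto intro: order_trans)
    finally show "sum f F \<le> infsum g A" .
  qed
qed (use fg in auto)

lemma nonneg_summable_on_imp_summable:
  fixes f :: "nat \<Rightarrow> real"
  assumes "f summable_on UNIV" "\<And>n. 0 \<le> f n"
  shows "summable f"
  by (rule summableI_nonneg_bounded[where x="infsum f UNIV"]) (use assms in \<open>auto intro!: finite_sum_le_infsum\<close>)

text \<open>The locales of curves are indexed by \<open>nat\<close>, whereas the expansion runs over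
  layers \<open>k \<ge> 1\<close>; this enumeration mediates between the two.\<close>

definition edge_enum :: "nat \<Rightarrow> chain_edge" where
  "edge_enum = from_nat_into chain_edges"

lemma edge_enum_bij: "bij_betw edge_enum UNIV chain_edges"
proof -
  have "countable chain_edges" by (auto simp: chain_edges_def)
  moreover have "infinite (range Et)" by (intro range_inj_infinite injI) simp
  then have "infinite chain_edges"
    using finite_subset[of "range Et" chain_edges] by (auto simp: chain_edges_def)
  ultimately show ?thesis unfolding edge_enum_def by (rule bij_betw_from_nat_into)
qed

lemma edge_enum_mem [simp]: "edge_enum n \<in> chain_edges"
  using edge_enum_bij by (auto simp: bij_betw_def)

lemma edge_enum_eq_iff [simp]: "edge_enum m = edge_enum n \<longleftrightarrow> m = n"
  using edge_enum_bij by (auto simp: bij_betw_def inj_eq)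

lemma edge_enum_surj: "e \<in> chain_edges \<Longrightarrow> \<exists>n. edge_enum n = e"
  using edge_enum_bij unfolding bij_betw_def by (metis rangeE)

lemma chain_edges_layers: "chain_edges = {Ec, Et 0} \<union> (Et ` {1..} \<union> (Eu ` {1..} \<union> Ev ` {1..}))"
proof -
  have "range Et = {Et 0} \<union> Et ` {1..}"
  proof -
    have "k = 0 \<or> k \<in> {1..}" for k :: nat by auto
    then show ?thesis by blast
  qed
  then show ?thesis unfolding chain_edges_def by blast
qed

lemma has_sum_layers:
  fixes g :: "chain_edge \<Rightarrow> real"
  assumes "((\<lambda>k. g (Et k)) has_sum a) {1..}" "((\<lambda>k. g (Eu k)) has_sum b) {1..}" "((\<lambda>k. g (Ev k)) has_sum c) {1..}"
  shows "(g has_sum (g Ec + g (Et 0) + (a + (b + c)))) chain_edges"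
proof -
  have "(g has_sum (sum g {Ec, Et 0})) {Ec, Et 0}" by (rule has_sum_finite) simp
  moreover have "(g has_sum a) (Et ` {1..})" "(g has_sum b) (Eu ` {1..})" "(g has_sum c) (Ev ` {1..})"
    using assms by (auto simp: has_sum_reindex inj_on_def comp_def)
  ultimately have "(g has_sum (sum g {Ec, Et 0} + (a + (b + c)))) chain_edges"
    unfolding chain_edges_layers by (intro has_sum_Un_disjoint) auto
  then show ?thesis by simp
qed

text \<open>Absolute summability permits regrouping the enumerated series into \<open>c\<close>,
  \<open>t_0\<close> and the layers \<open>k \<ge> 1\<close>.\<close>

lemma edge_enum_sums:
  fixes g :: "chain_edge \<Rightarrow> real"
  assumes s: "summable (\<lambda>n. \<bar>g (edge_enum n)\<bar>)"
  shows "(\<lambda>k. g (Et k)) summable_on {1..}" "(\<lambda>k. g (Eu k)) summable_on {1..}" "(\<lambda>k. g (Ev k)) summable_on {1..}"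
    "(\<lambda>n. g (edge_enum n)) sums (g Ec + g (Et 0) + (\<Sum>\<^sub>\<infinity>k\<in>{1..}. g (Et k) + g (Eu k) + g (Ev k)))"
proof -
  have s': "summable (\<lambda>n. norm (g (edge_enum n)))" using s by simp
  have "(\<lambda>n. g (edge_enum n)) summable_on UNIV" by (rule norm_summable_imp_summable_on[OF s'])
  then have G: "g summable_on chain_edges" using summable_on_reindex_bij_betw[OF edge_enum_bij, of g] by simp
  have sub: "g summable_on A" if "A \<subseteq> chain_edges" for A by (rule summable_on_subset_banach[OF G that])
  show T: "(\<lambda>k. g (Et k)) summable_on {1..}" proof -
    have "g summable_on Et ` {1..}" by (rule sub) (auto simp: chain_edges_def)
    then show ?thesis by (simp add: summable_on_reindex inj_on_def comp_def)
  qed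
  show U: "(\<lambda>k. g (Eu k)) summable_on {1..}" proof -
    have "g summable_on Eu ` {1..}" by (rule sub) (auto simp: chain_edges_def)
    then show ?thesis by (simp add: summable_on_reindex inj_on_def comp_def)
  qed
  show V: "(\<lambda>k. g (Ev k)) summable_on {1..}" proof -
    have "g summable_on Ev ` {1..}" by (rule sub) (auto simp: chain_edges_def)
    then show ?thesis by (simp add: summable_on_reindex inj_on_def comp_def)
  qed
  let ?S = "g Ec + g (Et 0) + (infsum (\<lambda>k. g (Et k)) {1..} + (infsum (\<lambda>k. g (Eu k)) {1..} + infsum (\<lambda>k. g (Ev k)) {1..}))"
  have "infsum g chain_edges = ?S"
    by (intro infsumI has_sum_layers has_sum_infsum T U V)
  moreover have "(\<lambda>n. g (edge_enum n)) sums infsum g chain_edges"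
  proof -
    have "(\<lambda>n. g (edge_enum n)) sums (\<Sum>n. g (edge_enum n))" by (rule summable_sums[OF summable_norm_cancel[OF s']])
    moreover from norm_summable_imp_has_sum[OF s' this]
    have "infsum (\<lambda>n. g (edge_enum n)) UNIV = (\<Sum>n. g (edge_enum n))" by (rule infsumI)
    ultimately show ?thesis using infsum_reindex_bij_betw[OF edge_enum_bij, of g] by simp
  qed
  moreover have "(\<Sum>\<^sub>\<infinity>k\<in>{1..}. g (Et k) + g (Eu k) + g (Ev k)) = infsum (\<lambda>k. g (Et k)) {1..} + infsum (\<lambda>k. g (Eu k)) {1..} + infsum (\<lambda>k. g (Ev k)) {1..}"
    using T U V by (simp add: infsum_add summable_on_add)
  ultimately show "(\<lambda>n. g (edge_enum n)) sums (g Ec + g (Et 0) + (\<Sum>\<^sub>\<infinity>k\<in>{1..}. g (Et k) + g (Eu k) + g (Ev k)))"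
    by (simp add: add.assoc)
qed

lemma edge_enum_summable:
  fixes g :: "chain_edge \<Rightarrow> real"
  assumes nn: "\<And>e. 0 \<le> g e" and s: "(\<lambda>k. g (Et k) + g (Eu k) + g (Ev k)) summable_on {1..}"
  shows "summable (\<lambda>n. g (edge_enum n))"
proof -
  have "(\<lambda>k. g (Et k)) summable_on {1..}" "(\<lambda>k. g (Eu k)) summable_on {1..}" "(\<lambda>k. g (Ev k)) summable_on {1..}"
    by (rule nonneg_summable_on_mono[OF s]; use nn in \<open>simp add: add_nonneg_nonneg\<close>)+
  then have "(g has_sum (g Ec + g (Et 0) + (infsum (\<lambda>k. g (Et k)) {1..} + (infsum (\<lambda>k. g (Eu k)) {1..} + infsum (\<lambda>k. g (Ev k)) {1..})))) chain_edges"
    by (intro has_sum_layers has_sum_infsum)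
  then have "g summable_on chain_edges" by (auto simp: summable_on_def)
  then have "(\<lambda>n. g (edge_enum n)) summable_on UNIV" using summable_on_reindex_bij_betw[OF edge_enum_bij, of g] by simp
  then show ?thesis by (rule nonneg_summable_on_imp_summable) (rule nn)
qed

lemma charts_diamond:
  "charts (\<lambda>n. edge_param (edge_enum n)) (\<lambda>n. edge_len (edge_enum n)) (\<lambda>n. edge_coord (edge_enum n))"
proof unfold_locales
  show "\<exists>n s. 0 \<le> s \<and> s \<le> edge_len (edge_enum n) \<and> x = edge_param (edge_enum n) s" for x
    using edge_param_cover[of x] edge_enum_surj by metis
  show "edge_param (edge_enum m) s \<notin> edge_param (edge_enum n) ` {0<..<edge_len (edge_enum n)}"
    if "m \<noteq> n" "0 \<le> s" "s \<le> edge_len (edge_enum m)" for m n s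
    using that by (intro open_edge_disjoint) auto
  show "edge_param (edge_enum n) s = edge_param (edge_enum n) (max 0 (min (edge_len (edge_enum n)) s))" for n s
    by (rule edge_param_clamped)
qed (simp_all add: edge_param_lipschitz edge_len_nonneg edge_len_pos edge_coord_lipschitz edge_coord_edge_param open_open_edge)

interpretation G: charts "\<lambda>n. edge_param (edge_enum n)" "\<lambda>n. edge_len (edge_enum n)" "\<lambda>n. edge_coord (edge_enum n)"
  by (rule charts_diamond)

interpretation G: tent_charts "\<lambda>n. edge_param (edge_enum n)" "\<lambda>n. edge_len (edge_enum n)" "\<lambda>n. edge_coord (edge_enum n)"
proof unfold_locales
  fix \<tau> :: "real \<Rightarrow> real" and n
  assume \<tau>: "lip \<tau>" "\<And>s. s \<le> 0 \<or> edge_len (edge_enum n) \<le> s \<Longrightarrow> \<tau> s = 0"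
  obtain L where L: "L-lipschitz_on UNIV \<tau>" using \<tau>(1) by (rule lipE)
  have "lip (edge_tent (edge_enum n) \<tau>)"
    using \<tau>(2)[of 0] \<tau>(2)[of "edge_len (edge_enum n)"] by (intro lipI[OF edge_tent_lipschitz[OF L]]) auto
  moreover have "edge_tent (edge_enum n) \<tau> = (\<lambda>x. if x \<in> G.edge_arc n then \<tau> (edge_coord (edge_enum n) x) else 0)"
    unfolding G.edge_arc_def using L \<tau>(2) by (intro edge_tent_eq) auto
  ultimately show "lip (\<lambda>x. if x \<in> G.edge_arc n then \<tau> (edge_coord (edge_enum n) x) else 0)" by simp
qed

section \<open>Chains with weights on the edges of \<open>G\<close>\<close>

definition graph_chain :: "(chain_edge \<Rightarrow> real) \<Rightarrow> diamond_chain functional1" where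
  "graph_chain w = G.chain (\<lambda>n. w (edge_enum n))"

definition finite_mass_weight :: "(chain_edge \<Rightarrow> real) \<Rightarrow> bool" where
  "finite_mass_weight w \<longleftrightarrow> G.finite_weight (\<lambda>n. w (edge_enum n))"

lemma graph_chain_current1: "finite_mass_weight w \<Longrightarrow> current1 (graph_chain w)"
  unfolding finite_mass_weight_def graph_chain_def by (rule G.chain_current1)

lemma graph_chain_mass:
  "finite_mass_weight w \<Longrightarrow> mass (graph_chain w) = ennreal (\<Sum>n. \<bar>w (edge_enum n)\<bar> * edge_len (edge_enum n))"
  unfolding finite_mass_weight_def graph_chain_def by (rule G.mass_chain)

lemma graph_chain_lincomb:
  assumes "finite_mass_weight w" "finite_mass_weight v"
  shows "finite_mass_weight (\<lambda>e. a * w e + b * v e)"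
    "graph_chain (\<lambda>e. a * w e + b * v e) f \<pi> = a * graph_chain w f \<pi> + b * graph_chain v f \<pi>"
  using assms unfolding finite_mass_weight_def graph_chain_def by (auto intro: G.chain_lincomb_weight)

lemma graph_chain_cong:
  assumes "\<And>e. e \<in> chain_edges \<Longrightarrow> w e = v e"
  shows "graph_chain w = graph_chain v" "finite_mass_weight w \<longleftrightarrow> finite_mass_weight v"
  using assms by (simp_all add: graph_chain_def finite_mass_weight_def)

lemma graph_chain_inject:
  assumes "finite_mass_weight w" "finite_mass_weight v" "graph_chain w = graph_chain v" "e \<in> chain_edges"
  shows "w e = v e"
proof -
  have "(\<lambda>n. w (edge_enum n)) = (\<lambda>n. v (edge_enum n))"
    using assms(1-3) unfolding finite_mass_weight_def graph_chain_def by (rule G.chain_inject)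
  moreover obtain n where "edge_enum n = e" using edge_enum_surj[OF assms(4)] by blast
  ultimately show ?thesis by metis
qed

lemma graph_chain_single:
  assumes e: "e \<in> chain_edges"
  shows "finite_mass_weight (\<lambda>e'. of_bool (e' = e))" "graph_chain (\<lambda>e'. of_bool (e' = e)) = edge_current e"
proof -
  obtain n where n: "edge_enum n = e" using edge_enum_surj[OF e] by blast
  have off: "of_bool (edge_enum m = e) = (0::real)" if "m \<noteq> n" for m using that n by auto
  show "finite_mass_weight (\<lambda>e'. of_bool (e' = e))"
    unfolding finite_mass_weight_def G.finite_weight_def
    by (rule summable_finite[of "{n}"]) (use off in auto)
  show "graph_chain (\<lambda>e'. of_bool (e' = e)) = edge_current e"
  proof (intro ext)
    fix f \<pi>
    show "graph_chain (\<lambda>e'. of_bool (e' = e)) f \<pi> = edge_current e f \<pi>"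
    proof (cases "lip_bdd f \<and> lip \<pi>")
      case True
      have "lip (edge_param e)" using edge_param_lipschitz[OF e] by (rule lipI)
      then have 1: "lip_bdd (f \<circ> edge_param e)" "lip (\<pi> \<circ> edge_param e)"
        using True by (auto intro: lip_bdd_compose lip_compose)
      have "graph_chain (\<lambda>e'. of_bool (e' = e)) f \<pi> = (\<Sum>m\<in>{n}. of_bool (edge_enum m = e) * lint 0 (edge_len (edge_enum m)) (f \<circ> edge_param (edge_enum m)) (\<pi> \<circ> edge_param (edge_enum m)))"
        using True unfolding graph_chain_def G.chain_def G.chain_ext_def
        by (subst suminf_finite[of "{n}"]) (use off in auto)
      also have "\<dots> = lint 0 (edge_len e) (f \<circ> edge_param e) (\<pi> \<circ> edge_param e)" using n by simp
      also have "\<dots> = edge_current e f \<pi>"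
        using True 1 by (simp add: edge_current_def pushforward_def line_current_def lint_def mult.assoc)
      finally show ?thesis .
    next
      case False
      then show ?thesis by (auto simp: graph_chain_def G.chain_def edge_current_def pushforward_def)
    qed
  qed
qed

text \<open>Partial sums of an expansion run over layers, so a remainder is the chain of the weights
  on the layers above \<open>n\<close>.\<close>

fun layer :: "chain_edge \<Rightarrow> nat" where
  "layer Ec = 0" | "layer (Et k) = k" | "layer (Eu k) = k" | "layer (Ev k) = k"

lemma tail_weight_finite:
  assumes "finite_mass_weight w"
  shows "finite_mass_weight (\<lambda>e. if n < layer e then w e else 0)"
  unfolding finite_mass_weight_def G.finite_weight_def
  by (rule summable_comparison_test'[OF assms[unfolded finite_mass_weight_def G.finite_weight_def], where N=0])
    (auto simp: edge_len_nonneg)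

text \<open>The only edges of layer \<open>0\<close> are \<open>c\<close> and \<open>t_0\<close>. As
  they have weight \<open>0\<close>, the remainder for \<open>n = 0\<close> is the whole chain, and
  each further step removes three edges.\<close>

lemma graph_chain_tail:
  assumes w: "finite_mass_weight w" and w0: "w Ec = 0" "w (Et 0) = 0"
  shows "graph_chain (\<lambda>e. if n < layer e then w e else 0) f \<pi> =
    graph_chain w f \<pi> - (\<Sum>k=1..n. w (Et k) * edge_current (Et k) f \<pi> + w (Eu k) * edge_current (Eu k) f \<pi> + w (Ev k) * edge_current (Ev k) f \<pi>)"
proof (induction n)
  case 0
  have "graph_chain (\<lambda>e. if 0 < layer e then w e else 0) = graph_chain w"
  proof (rule graph_chain_cong(1))
    show "(if 0 < layer e then w e else 0) = w e" if "e \<in> chain_edges" for e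
      using that w0 by (cases e) auto
  qed
  then show ?case by simp
next
  case (Suc n)
  let ?t = "\<lambda>n e. if n < layer e then w e else 0"
  let ?d = "\<lambda>e e'. of_bool (e' = e) :: real"
  let ?a = "Et (Suc n)" and ?b = "Eu (Suc n)" and ?c = "Ev (Suc n)"
  have e: "?a \<in> chain_edges" "?b \<in> chain_edges" "?c \<in> chain_edges" by auto
  note fin = graph_chain_single(1)
  define v1 where "v1 e' = 1 * ?t n e' + (- w ?a) * ?d ?a e'" for e'
  define v2 where "v2 e' = 1 * v1 e' + (- w ?b) * ?d ?b e'" for e'
  define v3 where "v3 e' = 1 * v2 e' + (- w ?c) * ?d ?c e'" for e'
  have f1: "finite_mass_weight v1" unfolding v1_def by (rule graph_chain_lincomb(1)[OF tail_weight_finite[OF w] fin[OF e(1)]])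
  have f2: "finite_mass_weight v2" unfolding v2_def by (rule graph_chain_lincomb(1)[OF f1 fin[OF e(2)]])
  have g1: "graph_chain v1 f \<pi> = graph_chain (?t n) f \<pi> - w ?a * edge_current ?a f \<pi>"
    unfolding v1_def graph_chain_lincomb(2)[OF tail_weight_finite[OF w] fin[OF e(1)]] graph_chain_single(2)[OF e(1)] by simp
  have g2: "graph_chain v2 f \<pi> = graph_chain v1 f \<pi> - w ?b * edge_current ?b f \<pi>"
    unfolding v2_def graph_chain_lincomb(2)[OF f1 fin[OF e(2)]] graph_chain_single(2)[OF e(2)] by simp
  have g3: "graph_chain v3 f \<pi> = graph_chain v2 f \<pi> - w ?c * edge_current ?c f \<pi>"
    unfolding v3_def graph_chain_lincomb(2)[OF f2 fin[OF e(3)]] graph_chain_single(2)[OF e(3)] by simp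
  have "?t (Suc n) = v3"
  proof
    fix e' show "?t (Suc n) e' = v3 e'"
      by (cases e') (auto simp: v1_def v2_def v3_def less_Suc_eq not_less_eq)
  qed
  then have "graph_chain (?t (Suc n)) f \<pi> = graph_chain (?t n) f \<pi> - (w ?a * edge_current ?a f \<pi> + w ?b * edge_current ?b f \<pi> + w ?c * edge_current ?c f \<pi>)"
    using g1 g2 g3 by simp
  then show ?case using Suc by simp
qed

text \<open>The mass of a remainder is an explicit series. Each of its terms is eventually
  \<open>0\<close>, and all are dominated by the full weighted lengths, so Tannery's theorem gives
  the limit \<open>0\<close>.\<close>

lemma graph_chain_sums_in_mass:
  assumes w: "finite_mass_weight w" and w0: "w Ec = 0" "w (Et 0) = 0"
    and X: "\<And>k f \<pi>. 1 \<le> k \<Longrightarrow> X k f \<pi> = w (Et k) * edge_current (Et k) f \<pi> + w (Eu k) * edge_current (Eu k) f \<pi> + w (Ev k) * edge_current (Ev k) f \<pi>"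
  shows "sums_in_mass X (graph_chain w)"
  unfolding sums_in_mass_def
proof
  show "current1 (graph_chain w)" by (rule graph_chain_current1[OF w])
  let ?t = "\<lambda>n e. if n < layer e then w e else 0"
  have "mass (\<lambda>f \<pi>. graph_chain w f \<pi> - (\<Sum>k=1..n. X k f \<pi>)) = ennreal (\<Sum>m. \<bar>?t n (edge_enum m)\<bar> * edge_len (edge_enum m))" for n
  proof -
    have "(\<lambda>f \<pi>. graph_chain w f \<pi> - (\<Sum>k=1..n. X k f \<pi>)) = graph_chain (?t n)"
      by (intro ext) (simp add: graph_chain_tail[OF w w0] X)
    then show ?thesis using graph_chain_mass[OF tail_weight_finite[OF w], of n] by simp
  qed
  moreover have "(\<lambda>n. \<Sum>m. \<bar>?t n (edge_enum m)\<bar> * edge_len (edge_enum m)) \<longlonglongrightarrow> (\<Sum>m. 0 :: real)"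
  proof (rule tannerys_theorem[THEN conjunct2, THEN conjunct2])
    show "((\<lambda>n. \<bar>?t n (edge_enum m)\<bar> * edge_len (edge_enum m)) \<longlongrightarrow> 0) sequentially" for m
    proof (rule tendsto_eventually)
      show "\<forall>\<^sub>F n in sequentially. \<bar>?t n (edge_enum m)\<bar> * edge_len (edge_enum m) = 0"
        unfolding eventually_sequentially by (intro exI[of _ "layer (edge_enum m)"]) auto
    qed
    show "summable (\<lambda>m. \<bar>w (edge_enum m)\<bar> * edge_len (edge_enum m))"
      using w by (simp add: finite_mass_weight_def G.finite_weight_def)
    show "\<forall>\<^sub>F (m, n) in at_top \<times>\<^sub>F sequentially. norm (\<bar>?t n (edge_enum m)\<bar> * edge_len (edge_enum m)) \<le> \<bar>w (edge_enum m)\<bar> * edge_len (edge_enum m)"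
      by (intro always_eventually) (auto simp: edge_len_nonneg)
  qed simp
  then have "(\<lambda>n. ennreal (\<Sum>m. \<bar>?t n (edge_enum m)\<bar> * edge_len (edge_enum m))) \<longlonglongrightarrow> ennreal 0"
    by (intro tendsto_ennrealI) simp
  ultimately show "(\<lambda>n. mass (\<lambda>f \<pi>. graph_chain w f \<pi> - (\<Sum>k=1..n. X k f \<pi>))) \<longlonglongrightarrow> 0" by simp
qed

section \<open>The chain belonging to given coefficients, and its mass\<close>

fun cycle_weight :: "int \<Rightarrow> (nat \<Rightarrow> int) \<Rightarrow> (nat \<Rightarrow> int) \<Rightarrow> chain_edge \<Rightarrow> int" where
  "cycle_weight r p q Ec = r"
| "cycle_weight r p q (Et k) = r"
| "cycle_weight r p q (Eu k) = p k"
| "cycle_weight r p q (Ev k) = q k"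

lemma range_Suc: "range Suc = {1..}"
proof
  show "{1..} \<subseteq> range Suc"
  proof
    fix n :: nat
    assume "n \<in> {1..}"
    then have "n = Suc (n - 1)" by simp
    then show "n \<in> range Suc" by (rule range_eqI)
  qed
qed auto

text \<open>This \<open>1 / 4\<close> is the total length of the \<open>t_k\<close> with
  \<open>k \<ge> 1\<close>; with \<open>c\<close> and \<open>t_0\<close> it makes up the factor
  \<open>3 / 4\<close> in the mass.\<close>

lemma lam_has_sum: "(lam has_sum 1 / 4) {1..}"
proof -
  have "(\<lambda>k. 1 / 8 * (1 / 2) ^ k) sums (1 / 8 * (1 / (1 - 1 / 2)) :: real)"
    by (intro sums_mult geometric_sums) simp
  then have s: "(\<lambda>k. lam (Suc k)) sums (1 / 4)" by (simp add: lam_def power_add power_divide)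
  then have "summable (\<lambda>k. norm (lam (Suc k)))" using lam_pos by (simp add: abs_of_pos sums_iff)
  from norm_summable_imp_has_sum[OF this s] have "((lam \<circ> Suc) has_sum 1 / 4) UNIV" by (simp add: comp_def)
  then have "(lam has_sum 1 / 4) (Suc ` UNIV)" by (subst has_sum_reindex) auto
  then show ?thesis by (simp only: range_Suc)
qed

lemma cycle_weight_mass:
  assumes s: "(\<lambda>k. lam k * of_int (\<bar>p k\<bar> + \<bar>q k\<bar>)) summable_on {1..}"
  shows "finite_mass_weight (\<lambda>e. real_of_int (cycle_weight r p q e))"
    "mass (graph_chain (\<lambda>e. real_of_int (cycle_weight r p q e))) = ennreal (3 / 4 * of_int \<bar>r\<bar> + (\<Sum>\<^sub>\<infinity>k\<in>{1..}. lam k * of_int (\<bar>p k\<bar> + \<bar>q k\<bar>)))"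
proof -
  let ?g = "\<lambda>e. \<bar>real_of_int (cycle_weight r p q e)\<bar> * edge_len e"
  let ?h = "\<lambda>k. real_of_int \<bar>r\<bar> * lam k + lam k * of_int (\<bar>p k\<bar> + \<bar>q k\<bar>)"
  have eq: "?g (Et k) + ?g (Eu k) + ?g (Ev k) = ?h k" if "k \<in> {1..}" for k
    using that by (simp add: algebra_simps)
  have rs: "(\<lambda>k. real_of_int \<bar>r\<bar> * lam k) summable_on {1..}"
    using lam_has_sum by (intro summable_on_cmult_right) (auto simp: summable_on_def)
  have "?h summable_on {1..}" by (intro summable_on_add rs s)
  then have "(\<lambda>k. ?g (Et k) + ?g (Eu k) + ?g (Ev k)) summable_on {1..}"
    using summable_on_cong[of "{1..}" "\<lambda>k. ?g (Et k) + ?g (Eu k) + ?g (Ev k)" ?h] eq by blast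
  then have sm: "summable (\<lambda>n. ?g (edge_enum n))"
    by (intro edge_enum_summable) (auto simp: edge_len_nonneg)
  then show fin: "finite_mass_weight (\<lambda>e. real_of_int (cycle_weight r p q e))"
    by (simp add: finite_mass_weight_def G.finite_weight_def)
  have "summable (\<lambda>n. \<bar>?g (edge_enum n)\<bar>)" using sm by (simp add: abs_mult edge_len_nonneg)
  from edge_enum_sums(4)[OF this]
  have "(\<Sum>n. ?g (edge_enum n)) = ?g Ec + ?g (Et 0) + (\<Sum>\<^sub>\<infinity>k\<in>{1..}. ?g (Et k) + ?g (Eu k) + ?g (Ev k))"
    by (rule sums_unique[symmetric])
  also have "(\<Sum>\<^sub>\<infinity>k\<in>{1..}. ?g (Et k) + ?g (Eu k) + ?g (Ev k)) = (\<Sum>\<^sub>\<infinity>k\<in>{1..}. ?h k)"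
    by (rule infsum_cong) (rule eq)
  also have "\<dots> = (\<Sum>\<^sub>\<infinity>k\<in>{1..}. real_of_int \<bar>r\<bar> * lam k) + (\<Sum>\<^sub>\<infinity>k\<in>{1..}. lam k * of_int (\<bar>p k\<bar> + \<bar>q k\<bar>))"
    by (rule infsum_add[OF rs s])
  also have "(\<Sum>\<^sub>\<infinity>k\<in>{1..}. real_of_int \<bar>r\<bar> * lam k) = real_of_int \<bar>r\<bar> * (1 / 4)"
    by (intro infsumI has_sum_cmult_right lam_has_sum)
  also have "?g Ec + ?g (Et 0) + (real_of_int \<bar>r\<bar> * (1 / 4) + (\<Sum>\<^sub>\<infinity>k\<in>{1..}. lam k * of_int (\<bar>p k\<bar> + \<bar>q k\<bar>)))
      = 3 / 4 * of_int \<bar>r\<bar> + (\<Sum>\<^sub>\<infinity>k\<in>{1..}. lam k * of_int (\<bar>p k\<bar> + \<bar>q k\<bar>))" by simp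
  finally have "(\<Sum>n. ?g (edge_enum n)) = 3 / 4 * of_int \<bar>r\<bar> + (\<Sum>\<^sub>\<infinity>k\<in>{1..}. lam k * of_int (\<bar>p k\<bar> + \<bar>q k\<bar>))" .
  then show "mass (graph_chain (\<lambda>e. real_of_int (cycle_weight r p q e))) = ennreal (3 / 4 * of_int \<bar>r\<bar> + (\<Sum>\<^sub>\<infinity>k\<in>{1..}. lam k * of_int (\<bar>p k\<bar> + \<bar>q k\<bar>)))"
    using graph_chain_mass[OF fin] by simp
qed

lemma edge_current_current1: "e \<in> chain_edges \<Longrightarrow> current1 (edge_current e)"
  using graph_chain_current1 graph_chain_single by metis

text \<open>Sums in mass are unique, so the existentially quantified \<open>A\<close> and
  \<open>B\<close> can only be the chains with the evident weights, and the expansion is the chain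
  of \<open>cycle_weight\<close>.\<close>

lemma edge_expansion_iff:
  assumes adm: "admissible_coeffs r p q"
  shows "edge_expansion R r p q \<longleftrightarrow> R = graph_chain (\<lambda>e. real_of_int (cycle_weight r p q e))"
proof -
  have s: "(\<lambda>k. lam k * of_int (\<bar>p k\<bar> + \<bar>q k\<bar>)) summable_on {1..}" using adm by (simp add: admissible_coeffs_def)
  \<comment> \<open>The edge \<open>t_0\<close> is written separately in the expansion, so the
    weight of \<open>A\<close> vanishes on it.\<close>
  let ?wA = "\<lambda>e. if \<exists>k\<ge>1. e = Et k then 1 else 0 :: real"
  let ?wB = "\<lambda>e. case e of Eu k \<Rightarrow> real_of_int (p k) | Ev k \<Rightarrow> real_of_int (q k) | _ \<Rightarrow> 0"
  let ?X = "\<lambda>k f \<pi>. of_int (p k) * edge_current (Eu k) f \<pi> + of_int (q k) * edge_current (Ev k) f \<pi>"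
  let ?R = "graph_chain (\<lambda>e. real_of_int (cycle_weight r p q e))"
  note fin = graph_chain_single(1)
  have fR: "finite_mass_weight (\<lambda>e. real_of_int (cycle_weight r p q e))" by (rule cycle_weight_mass(1)[OF s])
  have fA: "finite_mass_weight ?wA"
    unfolding finite_mass_weight_def G.finite_weight_def
  proof (rule edge_enum_summable)
    have "lam summable_on {1..}" using lam_has_sum by (auto simp: summable_on_def)
    then show "(\<lambda>k. \<bar>?wA (Et k)\<bar> * edge_len (Et k) + \<bar>?wA (Eu k)\<bar> * edge_len (Eu k) + \<bar>?wA (Ev k)\<bar> * edge_len (Ev k)) summable_on {1..}"
      by (rule summable_on_cong[THEN iffD1, rotated]) auto
  qed (simp add: edge_len_nonneg)
  have fB: "finite_mass_weight ?wB"
    unfolding finite_mass_weight_def G.finite_weight_def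
  proof (rule edge_enum_summable)
    show "(\<lambda>k. \<bar>?wB (Et k)\<bar> * edge_len (Et k) + \<bar>?wB (Eu k)\<bar> * edge_len (Eu k) + \<bar>?wB (Ev k)\<bar> * edge_len (Ev k)) summable_on {1..}"
      using s by (rule summable_on_cong[THEN iffD1, rotated]) (auto simp: algebra_simps)
  qed (simp add: edge_len_nonneg)
  have A: "sums_in_mass (\<lambda>k. edge_current (Et k)) (graph_chain ?wA)"
    by (rule graph_chain_sums_in_mass[OF fA]) auto
  have B: "sums_in_mass ?X (graph_chain ?wB)"
    by (rule graph_chain_sums_in_mass[OF fB]) auto
  have XA: "current1 (edge_current (Et k))" for k by (rule edge_current_current1) simp
  have XB: "current1 (?X k)" if "1 \<le> k" for k
  proof -
    have e: "Eu k \<in> chain_edges" "Ev k \<in> chain_edges" using that by auto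
    have "?X k = graph_chain (\<lambda>e. of_int (p k) * of_bool (e = Eu k) + of_int (q k) * of_bool (e = Ev k))"
      unfolding graph_chain_single(2)[OF e(1), symmetric] graph_chain_single(2)[OF e(2), symmetric]
      by (intro ext) (rule graph_chain_lincomb(2)[OF fin[OF e(1)] fin[OF e(2)], symmetric])
    then show ?thesis using graph_chain_current1[OF graph_chain_lincomb(1)[OF fin[OF e(1)] fin[OF e(2)]]] by simp
  qed
  have R: "?R = (\<lambda>f \<pi>. of_int r * (edge_current Ec f \<pi> + edge_current (Et 0) f \<pi> + graph_chain ?wA f \<pi>) + graph_chain ?wB f \<pi>)"
  proof (intro ext)
    fix f \<pi>
    have e: "Ec \<in> chain_edges" "Et 0 \<in> chain_edges" by auto
    define v1 :: "chain_edge \<Rightarrow> real" where "v1 e = 1 * of_bool (e = Ec) + 1 * of_bool (e = Et 0)" for e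
    define v2 :: "chain_edge \<Rightarrow> real" where "v2 e = 1 * v1 e + 1 * ?wA e" for e
    define v3 :: "chain_edge \<Rightarrow> real" where "v3 e = of_int r * v2 e + 1 * ?wB e" for e
    have f1: "finite_mass_weight v1" unfolding v1_def by (rule graph_chain_lincomb(1)[OF fin[OF e(1)] fin[OF e(2)]])
    have f2: "finite_mass_weight v2" unfolding v2_def by (rule graph_chain_lincomb(1)[OF f1 fA])
    have g1: "graph_chain v1 f \<pi> = edge_current Ec f \<pi> + edge_current (Et 0) f \<pi>"
      unfolding v1_def graph_chain_lincomb(2)[OF fin[OF e(1)] fin[OF e(2)]] graph_chain_single(2)[OF e(1)] graph_chain_single(2)[OF e(2)] by simp
    have g2: "graph_chain v2 f \<pi> = graph_chain v1 f \<pi> + graph_chain ?wA f \<pi>"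
      unfolding v2_def graph_chain_lincomb(2)[OF f1 fA] by simp
    have g3: "graph_chain v3 f \<pi> = of_int r * graph_chain v2 f \<pi> + graph_chain ?wB f \<pi>"
      unfolding v3_def graph_chain_lincomb(2)[OF f2 fB] by simp
    have "real_of_int (cycle_weight r p q e) = v3 e" if "e \<in> chain_edges" for e
    proof (cases e)
      case (Et k)
      then show ?thesis by (cases "k = 0") (auto simp: v1_def v2_def v3_def)
    qed (auto simp: v1_def v2_def v3_def)
    then have "?R = graph_chain v3" by (rule graph_chain_cong(1))
    then show "?R f \<pi> = of_int r * (edge_current Ec f \<pi> + edge_current (Et 0) f \<pi> + graph_chain ?wA f \<pi>) + graph_chain ?wB f \<pi>"
      using g1 g2 g3 by simp
  qed
  show ?thesis
  proof
    assume "edge_expansion R r p q"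
    then obtain A' B' where A': "sums_in_mass (\<lambda>k. edge_current (Et k)) A'" and B': "sums_in_mass ?X B'"
      and R': "R = (\<lambda>f \<pi>. of_int r * (edge_current Ec f \<pi> + edge_current (Et 0) f \<pi> + A' f \<pi>) + B' f \<pi>)"
      unfolding edge_expansion_def by blast
    have "A' = graph_chain ?wA" by (rule sums_in_mass_unique[OF A' A XA])
    moreover have "B' = graph_chain ?wB" by (rule sums_in_mass_unique[OF B' B XB])
    ultimately show "R = ?R" using R R' by simp
  next
    assume "R = ?R"
    then show "edge_expansion R r p q" unfolding edge_expansion_def using A B R by blast
  qed
qed

section \<open>Conservation at the vertices\<close>

text \<open>One chosen edge end for each vertex. \<open>Va 0\<close> and \<open>Vb 0\<close> are not
  vertices of the graph, which is why \<open>vertex_point_eq\<close> restricts the index.\<close>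

fun vertex_point :: "chain_vertex \<Rightarrow> diamond_chain" where
  "vertex_point Vo = edge_param (Et 0) 0"
| "vertex_point (Va k) = edge_param (Eu k) 0"
| "vertex_point (Vb k) = edge_param (Et k) 0"
| "vertex_point Vz = edge_param Ec 0"

lemma vertex_point_eq:
  assumes "at_vertex v (e, s)" "\<And>k. v = Va k \<Longrightarrow> 1 \<le> k" "\<And>k. v = Vb k \<Longrightarrow> 1 \<le> k"
  shows "edge_param e s = vertex_point v"
proof (cases v)
  case Vo
  then show ?thesis using same_vertex_edge_param[OF assms(1), of "Et 0" 0] at_source[of "Et 0"] by simp
next
  case (Va k)
  then show ?thesis using same_vertex_edge_param[OF assms(1), of "Eu k" 0] at_source[of "Eu k"] assms(2) by simp
next
  case (Vb k)
  then show ?thesis using same_vertex_edge_param[OF assms(1), of "Et k" 0] at_source[of "Et k"] assms(3)[of k] by simp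
next
  case Vz
  then show ?thesis using same_vertex_edge_param[OF assms(1), of Ec 0] at_source[of Ec] by simp
qed

lemma edge_param_ends:
  assumes e: "e \<in> chain_edges"
  shows "edge_param e 0 = vertex_point (edge_source e)" "edge_param e (edge_len e) = vertex_point (edge_target e)"
  using e at_source[OF e] at_target[OF e] by (auto intro!: vertex_point_eq simp: chain_edges_def split: if_splits)

text \<open>The rule \<open>tail\<close> gives a walk of length \<open>4 lam k\<close> from
  \<open>a_k\<close> to \<open>z\<close>.\<close>

lemma vertex_point_tendsto: "(\<lambda>k. vertex_point (Va k)) \<longlonglongrightarrow> vertex_point Vz"
proof -
  have "dist (vertex_point (Va k)) (vertex_point Vz) \<le> 4 * lam k" if k: "1 \<le> k" for k
  proof -
    have a: "at_vertex (Va k) (Eu k, 0)" "at_vertex Vz (Ec, 0)" using at_source[of "Eu k"] at_source[of Ec] k by auto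
    have p: "(Eu k, 0) \<in> edge_points" "(Ec, 0) \<in> edge_points" using a by (auto simp: at_vertex_def)
    have "dist (vertex_point (Va k)) (vertex_point Vz) = path_dist (Eu k, 0) (Ec, 0)"
      using dist_abs[OF p] edge_len_nonneg[of "Eu k"] edge_len_nonneg[of Ec] by (simp add: edge_param_abs)
    also have "\<dots> \<le> (\<Sum>j. edge_len (Eu (k + j)) + edge_len (Et (k + j)))"
      by (rule path_dist_le[OF walk.tail[OF k a]])
    also have "\<dots> = 4 * lam k" using tail_length[OF k] by (rule sums_unique[symmetric])
    finally show ?thesis .
  qed
  then have "\<forall>\<^sub>F k in sequentially. norm (dist (vertex_point (Va k)) (vertex_point Vz)) \<le> 4 * lam k"
    unfolding eventually_sequentially by (intro exI[of _ 1]) auto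
  moreover have "(\<lambda>k. 4 * lam k) \<longlonglongrightarrow> 0" using tendsto_mult_left[OF lam_tendsto, of 4] by simp
  ultimately have "(\<lambda>k. dist (vertex_point (Va k)) (vertex_point Vz)) \<longlonglongrightarrow> 0" by (rule Lim_null_comparison)
  then show ?thesis by (rule tendsto_dist_iff[THEN iffD2])
qed

text \<open>By the fundamental theorem each edge contributes the difference of \<open>f\<close> at
  its ends, and absolute convergence allows grouping by layers.\<close>

lemma boundary_graph_chain:
  assumes w: "finite_mass_weight w" and f: "lip_bdd f"
  defines "g \<equiv> \<lambda>e. w e * (f (vertex_point (edge_target e)) - f (vertex_point (edge_source e)))"
  shows "summable (\<lambda>n. \<bar>g (edge_enum n)\<bar>)"
    "boundary (graph_chain w) f = g Ec + g (Et 0) + (\<Sum>\<^sub>\<infinity>k\<in>{1..}. g (Et k) + g (Eu k) + g (Ev k))"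
proof -
  obtain L where L: "L-lipschitz_on UNIV f" using lip_bdd_lip[OF f] by (rule lipE)
  have term_eq: "w e * lint 0 (edge_len e) ((\<lambda>_. 1) \<circ> edge_param e) (f \<circ> edge_param e) = g e" if e: "e \<in> chain_edges" for e
  proof -
    have "(L * 1)-lipschitz_on UNIV (f \<circ> edge_param e)"
      by (rule lipschitz_on_compose[OF edge_param_lipschitz[OF e] lipschitz_on_subset[OF L]]) simp
    from lint_const[OF this edge_len_nonneg[of e], where c=1] show ?thesis
      by (simp add: comp_def g_def edge_param_ends[OF e])
  qed
  have fw: "G.finite_weight (\<lambda>n. w (edge_enum n))" using w by (simp add: finite_mass_weight_def)
  have "summable (\<lambda>n. \<bar>w (edge_enum n) * lint 0 (edge_len (edge_enum n)) ((\<lambda>_. 1) \<circ> edge_param (edge_enum n)) (f \<circ> edge_param (edge_enum n))\<bar>)"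
    by (rule G.chain_ext_bound(1)[OF fw _ _ L, where C=1]) auto
  then show s: "summable (\<lambda>n. \<bar>g (edge_enum n)\<bar>)" by (simp only: term_eq edge_enum_mem)
  have "boundary (graph_chain w) f = (\<Sum>n. g (edge_enum n))"
    using f by (simp add: boundary_def graph_chain_def G.chain_def G.chain_ext_def lip_bdd_lip term_eq[unfolded comp_def] comp_def)
  also have "\<dots> = g Ec + g (Et 0) + (\<Sum>\<^sub>\<infinity>k\<in>{1..}. g (Et k) + g (Eu k) + g (Ev k))"
    using edge_enum_sums(4)[OF s] by (rule sums_unique[symmetric])
  finally show "boundary (graph_chain w) f = g Ec + g (Et 0) + (\<Sum>\<^sub>\<infinity>k\<in>{1..}. g (Et k) + g (Eu k) + g (Ev k))" .
qed

lemma cycle_boundary: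
  assumes adm: "admissible_coeffs r p q"
  shows "boundary (graph_chain (\<lambda>e. real_of_int (cycle_weight r p q e))) = (\<lambda>_. 0)"
proof
  fix f :: "diamond_chain \<Rightarrow> real"
  let ?w = "\<lambda>e. real_of_int (cycle_weight r p q e)"
  show "boundary (graph_chain ?w) f = 0"
  proof (cases "lip_bdd f")
    case f: True
    have w: "finite_mass_weight ?w" using adm by (intro cycle_weight_mass(1)) (simp add: admissible_coeffs_def)
    define F where "F v = f (vertex_point v)" for v
    let ?g = "\<lambda>e. ?w e * (F (edge_target e) - F (edge_source e))"
    let ?h = "\<lambda>k. real_of_int r * (F (Va (Suc k)) - F (Va k))"
    note s = boundary_graph_chain(1)[OF w f, folded F_def]
    \<comment> \<open>\<open>p k + q k = r\<close> merges the two parallel edges, so layer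
      \<open>k\<close> contributes \<open>r\<close> times the increment of \<open>F\<close> from
      \<open>a_k\<close> to \<open>a_(k+1)\<close>.\<close>
    have eq: "?g (Et k) + ?g (Eu k) + ?g (Ev k) = ?h k" if k: "k \<in> {1..}" for k
    proof -
      have "real_of_int (p k) + real_of_int (q k) = real_of_int r"
        using adm k by (simp add: admissible_coeffs_def flip: of_int_add)
      moreover have "?g (Et k) + ?g (Eu k) + ?g (Ev k) = real_of_int r * (F (Va (Suc k)) - F (Vb k)) + (real_of_int (p k) + real_of_int (q k)) * (F (Vb k) - F (Va k))"
        using k by (simp add: algebra_simps)
      ultimately show ?thesis by (simp add: algebra_simps)
    qed
    have "(\<lambda>k. ?g (Et k) + ?g (Eu k) + ?g (Ev k)) summable_on {1..}"
      using edge_enum_sums(1-3)[OF s] by (intro summable_on_add)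
    then have hs: "?h summable_on {1..}"
      using summable_on_cong[of "{1..}" "\<lambda>k. ?g (Et k) + ?g (Eu k) + ?g (Ev k)" ?h] eq by blast
    have "(\<Sum>\<^sub>\<infinity>k\<in>{1..}. ?g (Et k) + ?g (Eu k) + ?g (Ev k)) = infsum ?h {1..}" by (rule infsum_cong) (rule eq)
    also have "\<dots> = real_of_int r * (F Vz - F (Va 1))"
    proof -
      have cont: "isCont f (vertex_point Vz)"
        using lip_continuous[OF lip_bdd_lip[OF f]] by (simp add: continuous_on_eq_continuous_at)
      have "(\<lambda>k. F (Va k)) \<longlonglongrightarrow> F Vz" unfolding F_def by (rule isCont_tendsto_compose[OF cont vertex_point_tendsto])
      then have "(\<lambda>k. real_of_int r * F (Va (Suc k))) \<longlonglongrightarrow> real_of_int r * F Vz"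
        by (intro tendsto_intros filterlim_sequentially_Suc[THEN iffD2])
      from telescope_sums[OF this]
      have tel: "(\<lambda>k. ?h (Suc k)) sums (real_of_int r * (F Vz - F (Va 1)))" by (simp add: algebra_simps)
      have img: "Suc ` UNIV = {1..}" by (rule range_Suc)
      \<comment> \<open>\<open>infsum\<close> is an unconditional sum, so convergence of the
        telescoping partial sums is supplemented by absolute summability, inherited from the edge
        series.\<close>
      have "(\<lambda>k. \<bar>?h k\<bar>) summable_on {1..}"
        using hs summable_on_iff_abs_summable_on_real[of ?h "{1..}"] by simp
      then have "((\<lambda>k. \<bar>?h k\<bar>) \<circ> Suc) summable_on UNIV"
        unfolding img[symmetric] by (subst summable_on_reindex[symmetric]) auto
      then have "summable ((\<lambda>k. \<bar>?h k\<bar>) \<circ> Suc)" by (rule nonneg_summable_on_imp_summable) simp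
      then have "summable (\<lambda>k. norm (?h (Suc k)))" by (simp add: comp_def)
      from norm_summable_imp_has_sum[OF this tel]
      have "((?h \<circ> Suc) has_sum (real_of_int r * (F Vz - F (Va 1)))) UNIV" by (simp add: comp_def)
      then have "(?h has_sum (real_of_int r * (F Vz - F (Va 1)))) {1..}"
        unfolding img[symmetric] by (subst has_sum_reindex) auto
      then show ?thesis by (rule infsumI)
    qed
    finally have S: "(\<Sum>\<^sub>\<infinity>k\<in>{1..}. ?g (Et k) + ?g (Eu k) + ?g (Ev k)) = real_of_int r * (F Vz - F (Va 1))" .
    have "boundary (graph_chain ?w) f = ?g Ec + ?g (Et 0) + (\<Sum>\<^sub>\<infinity>k\<in>{1..}. ?g (Et k) + ?g (Eu k) + ?g (Ev k))"
      by (rule boundary_graph_chain(2)[OF w f, folded F_def])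
    also have "\<dots> = real_of_int r * (F Vo - F Vz) + real_of_int r * (F (Va 1) - F Vo) + real_of_int r * (F Vz - F (Va 1))"
      unfolding S by simp
    also have "\<dots> = 0" by (simp add: algebra_simps)
    finally show ?thesis .
  qed (simp add: boundary_def)
qed

lemma cycle_in_full_cycles:
  assumes adm: "admissible_coeffs r p q"
  shows "graph_chain (\<lambda>e. real_of_int (cycle_weight r p q e)) \<in> full_cycles"
proof -
  let ?c = "\<lambda>n. cycle_weight r p q (edge_enum n)"
  let ?R = "graph_chain (\<lambda>e. real_of_int (cycle_weight r p q e))"
  have w: "finite_mass_weight (\<lambda>e. real_of_int (cycle_weight r p q e))"
    using adm by (intro cycle_weight_mass(1)) (simp add: admissible_coeffs_def)
  note fw = w[unfolded finite_mass_weight_def]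
  have b: "boundary ?R = (\<lambda>_. 0)" by (rule cycle_boundary[OF adm])
  have "int_rectifiable1 ?R" unfolding graph_chain_def by (rule G.chain_int_rectifiable[OF fw])
  moreover have "int_rectifiable0 (boundary ?R)" unfolding b int_rectifiable0_def by (intro exI[of _ "{}"] exI[of _ "\<lambda>_. 0"]) auto
  moreover have "char_set ?R = UNIV"
    unfolding graph_chain_def G.chain_char_set[OF fw]
  proof
    fix n
    show "real_of_int (?c n) \<noteq> 0"
      using adm edge_enum_mem[of n] by (cases "edge_enum n") (auto simp: admissible_coeffs_def chain_edges_def simp del: edge_enum_mem)
  qed
  ultimately show ?thesis using b by (simp add: full_cycles_def integral_currents1_def)
qed

text \<open>Parallel edges occupy the same positions, so a circle function sees only the sum of
  their weights. The arguments of \<open>g\<close> in layer \<open>k\<close> are the positions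
  \<open>3 / 4 - 4 lam k\<close>, \<open>3 / 4 - 3 lam k\<close>, \<open>3 / 4 - 2 lam k\<close> of
  \<open>a_k\<close>, \<open>b_k\<close>, \<open>a_(k+1)\<close>.\<close>

lemma circle_conservation:
  assumes w: "finite_mass_weight w" and b: "boundary (graph_chain w) = (\<lambda>_. 0)"
    and g: "L-lipschitz_on UNIV g" "\<And>t. \<bar>g t\<bar> \<le> B" "g 0 = g 1"
  shows "w Ec * (g 1 - g (3 / 4)) + w (Et 0) * (g (1 / 4) - g 0) +
    (\<Sum>\<^sub>\<infinity>k\<in>{1..}. w (Et k) * (g (3 / 4 - 2 * lam k) - g (3 / 4 - 3 * lam k))
      + (w (Eu k) + w (Ev k)) * (g (3 / 4 - 3 * lam k) - g (3 / 4 - 4 * lam k))) = 0"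
proof -
  let ?f = "circle_fun g"
  have "lip ?f" by (rule lipI[OF circle_fun_lipschitz[OF g(1) g(3)]])
  moreover have "\<bar>?f x\<bar> \<le> B" for x
  proof -
    obtain e s where "e \<in> chain_edges" "0 \<le> s" "s \<le> edge_len e" "x = edge_param e s" using edge_param_cover by blast
    then show ?thesis using circle_fun_edge_param[OF g(1,3)] g(2) by simp
  qed
  ultimately have f: "lip_bdd ?f" by (rule lip_bddI)
  have ends: "?f (vertex_point (edge_source e)) = g (vertex_pos (edge_source e))"
    "?f (vertex_point (edge_target e)) = g (vertex_pos (edge_source e) + edge_len e)" if e: "e \<in> chain_edges" for e
    using circle_fun_edge_param[OF g(1,3) e, of 0] circle_fun_edge_param[OF g(1,3) e, of "edge_len e"]
    by (simp_all add: edge_len_nonneg edge_param_ends[OF e])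
  define G where "G e = w e * (?f (vertex_point (edge_target e)) - ?f (vertex_point (edge_source e)))" for e
  have G: "G e = w e * (g (vertex_pos (edge_source e) + edge_len e) - g (vertex_pos (edge_source e)))" if "e \<in> chain_edges" for e
    unfolding G_def ends[OF that] ..
  have "G Ec + G (Et 0) + (\<Sum>\<^sub>\<infinity>k\<in>{1..}. G (Et k) + G (Eu k) + G (Ev k)) = 0"
    using boundary_graph_chain(2)[OF w f] b by (simp only: G_def)
  moreover have "(\<Sum>\<^sub>\<infinity>k\<in>{1..}. G (Et k) + G (Eu k) + G (Ev k)) =
    (\<Sum>\<^sub>\<infinity>k\<in>{1..}. w (Et k) * (g (3 / 4 - 2 * lam k) - g (3 / 4 - 3 * lam k))
      + (w (Eu k) + w (Ev k)) * (g (3 / 4 - 3 * lam k) - g (3 / 4 - 4 * lam k)))"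
  proof (rule infsum_cong)
    fix k :: nat
    assume k: "k \<in> {1..}"
    have a: "3 / 4 - 3 * lam k + lam k = 3 / 4 - 2 * lam k" "3 / 4 - 4 * lam k + lam k = 3 / 4 - 3 * lam k" by auto
    have e: "Et k \<in> chain_edges" "Eu k \<in> chain_edges" "Ev k \<in> chain_edges" using k by auto
    show "G (Et k) + G (Eu k) + G (Ev k) = w (Et k) * (g (3 / 4 - 2 * lam k) - g (3 / 4 - 3 * lam k))
      + (w (Eu k) + w (Ev k)) * (g (3 / 4 - 3 * lam k) - g (3 / 4 - 4 * lam k))"
      unfolding G[OF e(1)] G[OF e(2)] G[OF e(3)] using k a by (simp add: distrib_right)
  qed
  ultimately show ?thesis using G[of Ec] G[of "Et 0"] by simp
qed

text \<open>This separates layers by position: for \<open>1 \<le> j < k\<close> layer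
  \<open>j\<close> ends at \<open>3 / 4 - 2 lam j\<close>, no later than layer \<open>k\<close>
  begins at \<open>3 / 4 - 4 lam k\<close>.\<close>

lemma lam_double_le:
  assumes "j < k"
  shows "2 * lam k \<le> lam j"
  using assms
proof (induction k rule: less_induct)
  case (less k)
  show ?case
  proof (cases "j = k - 1")
    case True
    then have "k = Suc j" using less.prems by simp
    then show ?thesis by (simp add: lam_Suc)
  next
    case False
    then have "2 * lam (k - 1) \<le> lam j" "k = Suc (k - 1)" using less.prems by (auto intro: less.IH)
    then show ?thesis using lam_Suc[of "k - 1"] lam_pos[of "k - 1"] by simp
  qed
qed

text \<open>
  Testing the boundary with trapezoids on the circle, rising along \<open>t\<^sub>0\<close> and falling along \<open>u\<^sub>k\<close>, \<open>v\<^sub>k\<close>,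
  along \<open>t\<^sub>k\<close>, or along \<open>c\<close>, compares the flux through \<open>t\<^sub>0\<close> with the flux through the other layer.
\<close>

definition trapezoid :: "real \<Rightarrow> real \<Rightarrow> real \<Rightarrow> real" where
  "trapezoid m b t = max 0 (min m (min t (b - t)))"

lemma trapezoid_lipschitz: "1-lipschitz_on UNIV (trapezoid m b)"
  by (rule lipschitz_onI) (auto simp: trapezoid_def dist_real_def max_def min_def)

lemma cycle_weights:
  assumes w: "finite_mass_weight w" and b: "boundary (graph_chain w) = (\<lambda>_. 0)"
  shows "w Ec = w (Et 0)" "1 \<le> k \<Longrightarrow> w (Et k) = w (Et 0)" "1 \<le> k \<Longrightarrow> w (Eu k) + w (Ev k) = w (Et 0)"
proof -
  let ?h = "\<lambda>g k. w (Et k) * (g (3 / 4 - 2 * lam k) - g (3 / 4 - 3 * lam k))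
      + (w (Eu k) + w (Ev k)) * (g (3 / 4 - 3 * lam k) - g (3 / 4 - 4 * lam k))"
  have flux: "w Ec * (trapezoid m c 1 - trapezoid m c (3 / 4)) + w (Et 0) * (trapezoid m c (1 / 4) - trapezoid m c 0)
    + infsum (?h (trapezoid m c)) {1..} = 0" if "0 \<le> m" "c \<le> 1" for m c
  proof (rule circle_conservation[OF w b trapezoid_lipschitz])
    show "\<bar>trapezoid m c t\<bar> \<le> m" for t using that by (simp add: trapezoid_def)
    show "trapezoid m c 0 = trapezoid m c 1" using that by (simp add: trapezoid_def)
  qed
  have l: "0 < lam j \<and> lam j \<le> 1 / 8" if "1 \<le> j" for j using lam_pos lam_le[OF that] by simp
  show "w Ec = w (Et 0)"
  proof -
    \<comment> \<open>Rising on the positions \<open>[0, 1 / 4]\<close> of \<open>t_0\<close> and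
      falling on the positions \<open>[3 / 4, 1]\<close> of \<open>c\<close>, this trapezoid is
      constant on all layers.\<close>
    have "infsum (?h (trapezoid (1 / 4) 1)) {1..} = 0"
    proof (rule infsum_0)
      fix j :: nat assume "j \<in> {1..}"
      then have "0 < lam j" "lam j \<le> 1 / 8" using l[of j] by auto
      then have "trapezoid (1 / 4) 1 (3 / 4 - 2 * lam j) = 1 / 4" "trapezoid (1 / 4) 1 (3 / 4 - 3 * lam j) = 1 / 4"
        "trapezoid (1 / 4) 1 (3 / 4 - 4 * lam j) = 1 / 4" by (auto simp: trapezoid_def)
      then show "?h (trapezoid (1 / 4) 1) j = 0" by (simp only: diff_self mult_zero_right add_0)
    qed
    then show ?thesis using flux[of "1 / 4" 1] by (simp add: trapezoid_def)
  qed
  assume k: "1 \<le> k"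
  have lk: "0 < lam k" "lam k \<le> 1 / 8" using l[OF k] by auto
  \<comment> \<open>The falling side \<open>[c - lam k, c]\<close> lies within layer
    \<open>k\<close>: earlier layers see the constant \<open>lam k\<close>, later ones the constant
    \<open>0\<close>.\<close>
  have single: "infsum (?h (trapezoid (lam k) c)) {1..} = ?h (trapezoid (lam k) c) k"
    if c: "3 / 4 - 3 * lam k \<le> c" "c \<le> 3 / 4 - 2 * lam k" for c
  proof -
    have "?h (trapezoid (lam k) c) j = 0" if j: "j \<in> {1..}" "j \<noteq> k" for j
    proof (cases "j < k")
      case True
      then have "2 * lam k \<le> lam j" "lam j \<le> 1 / 8" using lam_double_le l[of j] j by auto
      then have "trapezoid (lam k) c (3 / 4 - 2 * lam j) = lam k" "trapezoid (lam k) c (3 / 4 - 3 * lam j) = lam k"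
        "trapezoid (lam k) c (3 / 4 - 4 * lam j) = lam k" using lk c by (auto simp: trapezoid_def)
      then show ?thesis by simp
    next
      case False
      then have "2 * lam j \<le> lam k" "0 < lam j" using lam_double_le[of k j] l[of j] j by auto
      then have "trapezoid (lam k) c (3 / 4 - 2 * lam j) = 0" "trapezoid (lam k) c (3 / 4 - 3 * lam j) = 0"
        "trapezoid (lam k) c (3 / 4 - 4 * lam j) = 0" using lk c by (auto simp: trapezoid_def)
      then show ?thesis by simp
    qed
    then have "infsum (?h (trapezoid (lam k) c)) {1..} = infsum (?h (trapezoid (lam k) c)) {k}"
      using k by (intro infsum_cong_neutral) auto
    then show ?thesis by simp
  qed
  have outer: "trapezoid (lam k) c 1 = 0" "trapezoid (lam k) c (3 / 4) = 0" "trapezoid (lam k) c 0 = 0"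
    "trapezoid (lam k) c (1 / 4) = lam k" "c \<le> 1" "0 \<le> lam k" if "3 / 4 - 3 * lam k \<le> c" "c \<le> 3 / 4 - 2 * lam k" for c
    using that lk by (auto simp: trapezoid_def)
  show "w (Eu k) + w (Ev k) = w (Et 0)"
  proof -
    \<comment> \<open>The falling side is then exactly the common range of positions of
      \<open>u_k\<close> and \<open>v_k\<close>.\<close>
    define c where "c = 3 / 4 - 3 * lam k"
    have c: "3 / 4 - 3 * lam k \<le> c" "c \<le> 3 / 4 - 2 * lam k" using lk by (auto simp: c_def)
    have "trapezoid (lam k) c (3 / 4 - 2 * lam k) = 0" "trapezoid (lam k) c (3 / 4 - 3 * lam k) = 0"
      "trapezoid (lam k) c (3 / 4 - 4 * lam k) = lam k" using lk by (auto simp: trapezoid_def c_def)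
    then have "lam k * w (Et 0) = lam k * (w (Eu k) + w (Ev k))"
      using flux[of "lam k" c] outer[OF c] single[OF c] by (simp add: algebra_simps)
    then show ?thesis using lk by simp
  qed
  show "w (Et k) = w (Et 0)"
  proof -
    \<comment> \<open>The falling side is then the range of positions of \<open>t_k\<close>.\<close>
    define c where "c = 3 / 4 - 2 * lam k"
    have c: "3 / 4 - 3 * lam k \<le> c" "c \<le> 3 / 4 - 2 * lam k" using lk by (auto simp: c_def)
    have "trapezoid (lam k) c (3 / 4 - 2 * lam k) = 0" "trapezoid (lam k) c (3 / 4 - 3 * lam k) = lam k"
      "trapezoid (lam k) c (3 / 4 - 4 * lam k) = lam k" using lk by (auto simp: trapezoid_def c_def)
    then have "lam k * w (Et 0) = lam k * w (Et k)"
      using flux[of "lam k" c] outer[OF c] single[OF c] by (simp add: algebra_simps)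
    then show ?thesis using lk by simp
  qed
qed

section \<open>From cycles to coefficients, and uniqueness\<close>

lemma full_cycle_expansion:
  assumes R: "R \<in> full_cycles"
  obtains r p q where "p \<in> extensional {1..}" "q \<in> extensional {1..}" "admissible_coeffs r p q"
    "R = graph_chain (\<lambda>e. real_of_int (cycle_weight r p q e))"
proof -
  have R': "int_rectifiable1 R" "boundary R = (\<lambda>_. 0)" "char_set R = UNIV"
    using R by (auto simp: full_cycles_def integral_currents1_def)
  obtain c :: "nat \<Rightarrow> int" where c: "G.finite_weight (\<lambda>n. real_of_int (c n))" "R = G.chain (\<lambda>n. real_of_int (c n))"
    using R'(1,2) by (rule G.cycle_is_chain)
  have c0: "c n \<noteq> 0" for n using G.chain_char_set[OF c(1)] R'(3) c(2) by simp
  define w where "w e = c (inv edge_enum e)" for e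
  have "inj edge_enum" by (rule injI) simp
  then have wn: "w (edge_enum n) = c n" for n by (simp add: w_def)
  have fw: "finite_mass_weight (\<lambda>e. real_of_int (w e))" using c(1) by (simp add: finite_mass_weight_def wn)
  have Rw: "R = graph_chain (\<lambda>e. real_of_int (w e))" using c(2) by (simp add: graph_chain_def wn)
  have w0: "w e \<noteq> 0" if "e \<in> chain_edges" for e using edge_enum_surj[OF that] c0 wn by metis
  note cw = cycle_weights[OF fw R'(2)[unfolded Rw]]
  \<comment> \<open>\<open>restrict\<close> fixes the value at index \<open>0\<close>, which belongs
    to no edge and would otherwise be arbitrary.\<close>
  define r p q where "r = w (Et 0)" and "p = restrict (\<lambda>k. w (Eu k)) {1..}" and "q = restrict (\<lambda>k. w (Ev k)) {1..}"
  have pq: "p k = w (Eu k)" "q k = w (Ev k)" if "1 \<le> k" for k using that by (auto simp: p_def q_def)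
  have eq: "w e = cycle_weight r p q e" if e: "e \<in> chain_edges" for e
  proof (cases e)
    case Ec
    then show ?thesis using cw(1) by (simp add: r_def)
  next
    case (Et k)
    then show ?thesis using cw(2)[of k] by (cases "k = 0") (auto simp: r_def)
  qed (use e pq in auto)
  have "summable (\<lambda>n. \<bar>\<bar>real_of_int (w (edge_enum n))\<bar> * edge_len (edge_enum n)\<bar>)"
    using fw by (simp add: finite_mass_weight_def G.finite_weight_def edge_len_nonneg)
  from edge_enum_sums(2,3)[OF this]
  have "(\<lambda>k. \<bar>real_of_int (w (Eu k))\<bar> * lam k + \<bar>real_of_int (w (Ev k))\<bar> * lam k) summable_on {1..}"
    by (intro summable_on_add) auto
  then have "(\<lambda>k. lam k * of_int (\<bar>p k\<bar> + \<bar>q k\<bar>)) summable_on {1..}"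
    by (rule summable_on_cong[THEN iffD1, rotated]) (auto simp: pq algebra_simps)
  moreover have "p k + q k = r" if "1 \<le> k" for k
    using cw(3)[OF that] by (simp add: pq[OF that] r_def flip: of_int_add)
  ultimately have "admissible_coeffs r p q"
    using w0 by (auto simp: admissible_coeffs_def pq r_def)
  moreover have "R = graph_chain (\<lambda>e. real_of_int (cycle_weight r p q e))"
    unfolding Rw by (rule graph_chain_cong(1)) (simp add: eq)
  moreover have "p \<in> extensional {1..}" "q \<in> extensional {1..}" by (auto simp: p_def q_def)
  ultimately show ?thesis using that by blast
qed

lemma cycle_weight_unique:
  assumes "admissible_coeffs r p q" "admissible_coeffs r' p' q'"
    and ext: "p \<in> extensional {1..}" "q \<in> extensional {1..}" "p' \<in> extensional {1..}" "q' \<in> extensional {1..}"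
    and eq: "graph_chain (\<lambda>e. real_of_int (cycle_weight r p q e)) = graph_chain (\<lambda>e. real_of_int (cycle_weight r' p' q' e))"
  shows "r = r'" "p = p'" "q = q'"
proof -
  have "finite_mass_weight (\<lambda>e. real_of_int (cycle_weight r p q e))" "finite_mass_weight (\<lambda>e. real_of_int (cycle_weight r' p' q' e))"
    using assms(1,2) by (auto intro!: cycle_weight_mass(1) simp: admissible_coeffs_def)
  from graph_chain_inject[OF this eq]
  have e: "cycle_weight r p q e = cycle_weight r' p' q' e" if "e \<in> chain_edges" for e using that by simp
  show "r = r'" using e[of Ec] by simp
  show "p = p'" by (rule extensionalityI[OF ext(1,3)]) (use e[of "Eu _"] in auto)
  show "q = q'" by (rule extensionalityI[OF ext(2,4)]) (use e[of "Ev _"] in auto)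
qed

text \<open>\<open>extensional {1..}\<close> normalises \<open>p\<close> and \<open>q\<close> at
  index \<open>0\<close>, so that uniqueness concerns the coefficients with
  \<open>k \<ge> 1\<close>. The mass formula is asserted for every admissible expansion, whatever
  the values at \<open>0\<close>.\<close>

theorem theorem6p3:
  fixes R :: "diamond_chain functional1"
  shows "(R \<in> full_cycles \<longleftrightarrow>
           (\<exists>!(r, p, q). p \<in> extensional {1..} \<and> q \<in> extensional {1..} \<and>
              admissible_coeffs r p q \<and> edge_expansion R r p q))
       \<and> (\<forall>r p q. admissible_coeffs r p q \<and> edge_expansion R r p q \<longrightarrow>
            mass R = ennreal (3 / 4 * of_int \<bar>r\<bar>
              + (\<Sum>\<^sub>\<infinity>k\<in>{1..}. lam k * of_int (\<bar>p k\<bar> + \<bar>q k\<bar>))))"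
proof (intro conjI iffI allI impI)
  assume "R \<in> full_cycles"
  then obtain r p q where *: "p \<in> extensional {1..}" "q \<in> extensional {1..}" "admissible_coeffs r p q"
    "R = graph_chain (\<lambda>e. real_of_int (cycle_weight r p q e))" by (rule full_cycle_expansion)
  show "\<exists>!(r, p, q). p \<in> extensional {1..} \<and> q \<in> extensional {1..} \<and> admissible_coeffs r p q \<and> edge_expansion R r p q"
  proof (rule ex1I[of _ "(r, p, q)"])
    show "case (r, p, q) of (r, p, q) \<Rightarrow> p \<in> extensional {1..} \<and> q \<in> extensional {1..} \<and> admissible_coeffs r p q \<and> edge_expansion R r p q"
      using * by (simp add: edge_expansion_iff)
  next
    fix x
    assume x: "case x of (r, p, q) \<Rightarrow> p \<in> extensional {1..} \<and> q \<in> extensional {1..} \<and> admissible_coeffs r p q \<and> edge_expansion R r p q"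
    obtain r' p' q' where x': "x = (r', p', q')" by (cases x)
    with x have "p' \<in> extensional {1..}" "q' \<in> extensional {1..}" "admissible_coeffs r' p' q'"
      "R = graph_chain (\<lambda>e. real_of_int (cycle_weight r' p' q' e))" by (auto simp: edge_expansion_iff)
    with * x' show "x = (r, p, q)" using cycle_weight_unique[of r' p' q' r p q] by simp
  qed
next
  assume "\<exists>!(r, p, q). p \<in> extensional {1..} \<and> q \<in> extensional {1..} \<and> admissible_coeffs r p q \<and> edge_expansion R r p q"
  then obtain r p q where "admissible_coeffs r p q" "edge_expansion R r p q" by auto
  then show "R \<in> full_cycles" using cycle_in_full_cycles by (simp add: edge_expansion_iff)
next
  fix r p q
  assume "admissible_coeffs r p q \<and> edge_expansion R r p q"
  then have "R = graph_chain (\<lambda>e. real_of_int (cycle_weight r p q e))"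
    "(\<lambda>k. lam k * of_int (\<bar>p k\<bar> + \<bar>q k\<bar>)) summable_on {1..}"
    using edge_expansion_iff by (blast, simp add: admissible_coeffs_def)
  then show "mass R = ennreal (3 / 4 * of_int \<bar>r\<bar> + (\<Sum>\<^sub>\<infinity>k\<in>{1..}. lam k * of_int (\<bar>p k\<bar> + \<bar>q k\<bar>)))"
    by (simp only: cycle_weight_mass(2))
qed

end
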